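(* Let $(F,[\cdot,\cdot],\theta)$ be a Lie algebroid over a finitely generated commutative associative unital algebra $R$, and let $\widehat R=J_\infty R$ be the jet algebra of $R$. There is a Lie conformal algebroid $(\widehat F,\partial,[\cdot_\lambda\cdot]^{\widehat{}},\widehat\theta)$ over the differential algebra $\widehat R$, called the current LCAd of $F$, defined as follows. As a left $\widehat R[\partial]$-module, $\widehat F=\widehat R[\partial]\otimes_RF$. The $\lambda$-bracket on $\widehat F$ is uniquely defined by $$[1\otimes_Ru\,{}_\lambda\,1\otimes_Rv]^{\widehat{}}=1\otimes_R[u,v]\qquad(u,v\in F)$$ and extended to $\widehat F$ by the total formula $$[a(\partial)u_\lambda b(\partial)v]=\big(\big|_{x=\partial}a^*(\lambda)\big)b(\lambda+x+y)\big(\big|_{y=\partial}[u_{\lambda+x}v]\big)+\big(\big|_{x=\partial}a^*(\lambda)\big)\widehat\theta(u)_{\lambda+x}(b(y))\big(\big|_{y=\partial}v\big)-b(\lambda+x+y)\big(\big|_{y=\partial}\widehat\theta(v)^*_{\lambda+x}(a(x))\big)\big(\big|_{x=\partial}u\big)$$ for $u,v\in\widehat F$, $a(\partial),b(\partial)\in\widehat R[\partial]$. The anchor map on $\widehat F$ is uniquely defined by $$\widehat\theta(1\otimes_Ru)_\lambda=\widehat{\theta(u)}_\lambda\qquad(u\in F),$$ where, for $D\in\mathrm{Der}(R)$, $\widehat D\in\mathrm{CDer}(J_\infty R)$ is the unique conformal derivation extending $D$, and extended to $\widehat F$ to be a homomorphism of left $\widehat R[\partial]$-modules $\widehat F\to\mathrm{CDer}(\widehat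 R)$. Furthermore, the quotient Lie algebroid of the current LCAd $\widehat F$ is canonically isomorphic to the Lie algebroid $F$.
   Context: Everything is over a field $\mathbb F$ of characteristic $0$. A differential algebra $A$ is a commutative associative unital algebra with a derivation $\partial$; $A[\partial]$ is the associative algebra of differential operators $a(\partial)=\sum_i a_i\partial^i$ (product = composition), with symbol $a(x)=\sum_ia_ix^i$ and adjoint symbol $a^*(\lambda)=\sum_i(-\lambda-\partial)^i(a_i)\in A[\lambda]$. Substitution convention: in an expression containing a factor $\big(\big|_{x=\partial}f\big)$, expand the whole expression in powers of the commuting indeterminate $x$ and replace each $x^n$ by $\partial^n$ acting only on what is inside that parenthesis (on coefficients, if $f$ is a polynomial); same for $y$. E.g. $a(\lambda+x)\big(\big|_{x=\partial}b\big)c=c\sum_ia_i(\lambda+\partial)^i(b)$. For $\phi_\lambda$ linear, $\phi_\lambda(a(x))=\sum_i\phi_\lambda(a_i)x^i$, and $\phi_{\lambda+x}(a(x))=\sum_i\phi_{\lambda+x}(a_i)x^i$. $\mathrm{CDer}(A)$ is the space of linear maps $\phi_\lambda:A\to A[\lambda]$ with $\phi_\lambda(\partial a)=(\partial+\lambda)\phi_\lambda(a)$ and $\phi_\lambda(ab)=\phi_\lambda(a)b+a\phi_\lambda(b)$; it is a left $A[\partial]$-module by $(a(\partial)\phi)_\lambda=\big(\big|_{x=\partial}a^*(\lambda)\big)\phi_{\lambda+x}$. For $\phi\in\mathrm{CDer}(A)$ put $\phi^*_\lambda(a)=\big(\big|_{x=\partial}\phi_{-\lambda-x}(a)\big)$.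 A Lie conformal algebra (LCA) is an $\mathbb F[\partial]$-module $E$ with a bilinear $\lambda$-bracket $[\cdot_\lambda\cdot]:E\otimes E\to E[\lambda]$ with: $[\partial u_\lambda v]=-\lambda[u_\lambda v]$, $[u_\lambda\partial v]=(\partial+\lambda)[u_\lambda v]$; $[v_\lambda u]=-\big(\big|_{x=\partial}[u_{-\lambda-x}v]\big)$; $[u_\lambda[v_\mu w]]-[v_\mu[u_\lambda w]]=[[u_\lambda v]_{\lambda+\mu}w]$. A Lie conformal algebroid (LCAd) over $A$ is a left $A[\partial]$-module $E$ with a left $A[\partial]$-module homomorphism $\theta:E\to\mathrm{CDer}(A)$ (anchor) and an LCA $\lambda$-bracket such that (i) $[u_\lambda a(\partial)v]=a(\lambda+x)\big(\big|_{x=\partial}[u_\lambda v]\big)+\theta(u)_\lambda(a(x))\big(\big|_{x=\partial}v\big)$, and (ii) $\theta([u_\lambda v])_\mu(a)=\theta(u)_\lambda(\theta(v)_{\mu-\lambda}(a))-\theta(v)_{\mu-\lambda}(\theta(u)_\lambda(a))$. A Lie algebroid (LAd) over $R$ is an $R$-module $F$ with a Lie bracket $[\cdot,\cdot]$ and a Lie algebra homomorphism $\theta:F\to\mathrm{Der}(R)$ (anchor) commuting with the action of $R$, such that $[u,av]=a[u,v]+\theta(u)(a)v$ for $a\in R$, $u,v\in F$. The jet algebra $J_\infty R$ is the differential algebra with an (injective) algebra homomorphism $\iota:R\to J_\infty R$ universal among algebra homomorphisms from $R$ to differential algebras: each algebra homomorphism $f:R\to A$ to a differential algebra factors as $f=\tilde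 f\circ\iota$ for a unique differential algebra homomorphism $\tilde f$. For every $D\in\mathrm{Der}(R)$ there is a unique $\widehat D\in\mathrm{CDer}(J_\infty R)$ with $\widehat D_\lambda\circ\iota=\iota\circ D$. In $\widehat R[\partial]\otimes_RF$ the algebra $\widehat R[\partial]$ is a right $R$-module via right composition with $\iota(r)$. Quotient LAd of an LCAd $E$ over $A$: it is $\bar E=E/A\partial E$, a LAd over $\bar A=A/A\partial A$ ($A\partial A$ the ideal generated by $\partial A$), with bracket $[\bar u,\bar v]=\overline{[u_\lambda v]}\big|_{\lambda=0}$ and anchor $\bar\theta(\bar u)(\bar a)=\overline{\theta(u)_\lambda(a)}\big|_{\lambda=0}$. *)

theory Defs
  imports
    "HOL-Computational_Algebra.Polynomial"
    "HOL-Algebra.Free_Abelian_Groups"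
    "HOL-Algebra.QuotRing"
    "HOL-Algebra.Subrings"
    "HOL-Algebra.UnivPoly"
begin

section \<open>Differential algebras\<close>

text \<open>
  The ground field is a ring record \<open>K\<close>; an associative commutative unital algebra over it is a
  module record \<open>A\<close> satisfying the library locale \<^locale>\<open>algebra\<close>.
\<close>

definition char_zero :: "('k, 'm) ring_scheme \<Rightarrow> bool" where
  "char_zero K \<longleftrightarrow> (\<forall>n::nat. n > 0 \<longrightarrow> add_pow K n \<one>\<^bsub>K\<^esub> \<noteq> \<zero>\<^bsub>K\<^esub>)"

definition finitely_generated_algebra :: "'k ring \<Rightarrow> ('k, 'a) module \<Rightarrow> bool" where
  "finitely_generated_algebra K A \<longleftrightarrow>
     (\<exists>S. finite S \<and> S \<subseteq> carrier A \<and>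
        (\<forall>B. subcring B A \<and> (\<forall>c\<in>carrier K. \<forall>b\<in>B. c \<odot>\<^bsub>A\<^esub> b \<in> B) \<and> S \<subseteq> B
             \<longrightarrow> B = carrier A))"

definition algebra_hom :: "'k ring \<Rightarrow> ('k, 'a) module \<Rightarrow> ('k, 'b) module \<Rightarrow> ('a \<Rightarrow> 'b) set" where
  "algebra_hom K A B =
     {h \<in> ring_hom A B. \<forall>c\<in>carrier K. \<forall>a\<in>carrier A. h (c \<odot>\<^bsub>A\<^esub> a) = c \<odot>\<^bsub>B\<^esub> h a}"

definition Der :: "'k ring \<Rightarrow> ('k, 'a) module \<Rightarrow> ('a \<Rightarrow> 'a) set" where
  "Der K A =
     {D \<in> carrier A \<rightarrow> carrier A.
        (\<forall>a\<in>carrier A. \<forall>b\<in>carrier A. D (a \<oplus>\<^bsub>A\<^esub> b) = D a \<oplus>\<^bsub>A\<^esub> D b) \<and>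
        (\<forall>c\<in>carrier K. \<forall>a\<in>carrier A. D (c \<odot>\<^bsub>A\<^esub> a) = c \<odot>\<^bsub>A\<^esub> D a) \<and>
        (\<forall>a\<in>carrier A. \<forall>b\<in>carrier A.
           D (a \<otimes>\<^bsub>A\<^esub> b) = D a \<otimes>\<^bsub>A\<^esub> b \<oplus>\<^bsub>A\<^esub> a \<otimes>\<^bsub>A\<^esub> D b)}"

definition differential_algebra :: "'k ring \<Rightarrow> ('k, 'a) module \<Rightarrow> ('a \<Rightarrow> 'a) \<Rightarrow> bool" where
  "differential_algebra K A d \<longleftrightarrow> algebra K A \<and> d \<in> Der K A"

definition differential_algebra_hom ::
  "'k ring \<Rightarrow> ('k, 'a) module \<Rightarrow> ('a \<Rightarrow> 'a) \<Rightarrow> ('k, 'b) module \<Rightarrow> ('b \<Rightarrow> 'b) \<Rightarrow> ('a \<Rightarrow> 'b) set" where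
  "differential_algebra_hom K A d B d' =
     {h \<in> algebra_hom K A B. \<forall>a\<in>carrier A. h (d a) = d' (h a)}"

text \<open>
  HOL cannot quantify over all types inside a definition, so the universal property is
  tested on the differential algebras whose carrier lies in the type of \<open>J\<close>. For a ground field of
  characteristic zero this is no restriction: see \<open>jet_algebra_universal\<close> below.
\<close>

definition jet_algebra ::
  "'k ring \<Rightarrow> ('k, 'r) module \<Rightarrow> ('k, 'j) module \<Rightarrow> ('j \<Rightarrow> 'j) \<Rightarrow> ('r \<Rightarrow> 'j) \<Rightarrow> bool" where
  "jet_algebra K R J d \<iota> \<longleftrightarrow>
     differential_algebra K J d \<and> \<iota> \<in> algebra_hom K R J \<and> inj_on \<iota> (carrier R) \<and>
     (\<forall>(B :: ('k, 'j) module) d' f.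
        differential_algebra K B d' \<and> f \<in> algebra_hom K R B \<longrightarrow>
        (\<exists>!h. h \<in> differential_algebra_hom K J d B d' \<and> h \<in> extensional (carrier J) \<and>
              (\<forall>r\<in>carrier R. f r = h (\<iota> r))))"


subsection \<open>The universal property for all types\<close>

definition transport_algebra ::
  "('k, 'b) module \<Rightarrow> 'b set \<Rightarrow> ('b \<Rightarrow> 'c) \<Rightarrow> ('k, 'c) module" where
  "transport_algebra B S e = (let g = inv_into S e in \<lparr>
     carrier = e ` S, mult = (\<lambda>x y. e (g x \<otimes>\<^bsub>B\<^esub> g y)), one = e \<one>\<^bsub>B\<^esub>, zero = e \<zero>\<^bsub>B\<^esub>,
     add = (\<lambda>x y. e (g x \<oplus>\<^bsub>B\<^esub> g y)), smult = (\<lambda>c x. e (c \<odot>\<^bsub>B\<^esub> g x))\<rparr>)"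

lemma transport_differential_algebra:
  assumes B: "differential_algebra K B d"
    and S: "S \<subseteq> carrier B" "\<one>\<^bsub>B\<^esub> \<in> S"
      "\<forall>a\<in>S. \<forall>b\<in>S. a \<oplus>\<^bsub>B\<^esub> b \<in> S" "\<forall>a\<in>S. \<forall>b\<in>S. a \<otimes>\<^bsub>B\<^esub> b \<in> S"
      "\<forall>c\<in>carrier K. \<forall>a\<in>S. c \<odot>\<^bsub>B\<^esub> a \<in> S" "\<forall>a\<in>S. d a \<in> S"
    and e: "inj_on e S"
  shows "differential_algebra K (transport_algebra B S e) (\<lambda>x. e (d (inv_into S e x)))"
    and "inv_into S e \<in> differential_algebra_hom K (transport_algebra B S e)
           (\<lambda>x. e (d (inv_into S e x))) B d"
    and "h \<in> algebra_hom K A B \<Longrightarrow> h ` carrier A \<subseteq> S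
          \<Longrightarrow> (\<lambda>a. e (h a)) \<in> algebra_hom K A (transport_algebra B S e)"
proof -
  interpret algebra K B using B by (simp add: differential_algebra_def)
  note S = S(1,2) S(3-6)[rule_format]
  have d: "d \<in> Der K B" using B by (simp add: differential_algebra_def)
  have Sc: "a \<in> S \<Longrightarrow> a \<in> carrier B" for a using S by auto
  have g: "a \<in> S \<Longrightarrow> inv_into S e (e a) = a" for a using e by simp
  have neg: "\<ominus>\<^bsub>B\<^esub> a \<in> S" if "a \<in> S" for a
  proof -
    have "(\<ominus>\<^bsub>K\<^esub> \<one>\<^bsub>K\<^esub>) \<odot>\<^bsub>B\<^esub> a = \<ominus>\<^bsub>B\<^esub> a"
      using that Sc smult_l_minus[of "\<one>\<^bsub>K\<^esub>" a] by simp
    then show ?thesis using S(5)[of "\<ominus>\<^bsub>K\<^esub> \<one>\<^bsub>K\<^esub>" a] that by simp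
  qed
  have zero: "\<zero>\<^bsub>B\<^esub> \<in> S"
    using S(3)[OF S(2) neg[OF S(2)]] Sc[OF S(2)] by (simp add: M.r_neg)
  let ?B = "transport_algebra B S e"
  have ab: "abelian_group ?B"
  proof (rule abelian_groupI, goal_cases)
    case (6 x)
    then obtain a where "a \<in> S" "x = e a" by (auto simp: transport_algebra_def Let_def)
    then show ?case using neg[of a] Sc
      by (auto simp: transport_algebra_def Let_def g M.l_neg intro!: bexI[of _ "\<ominus>\<^bsub>B\<^esub> a"])
  qed (auto simp: transport_algebra_def Let_def g S zero Sc M.a_assoc M.a_comm M.a_lcomm)
  have cr: "cring ?B"
  proof (rule cringI[OF ab])
    show "comm_monoid ?B"
      by (rule comm_monoidI)
         (auto simp: transport_algebra_def Let_def g S zero Sc m_assoc m_comm m_lcomm)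
  qed (auto simp: transport_algebra_def Let_def g S zero Sc l_distr)
  have alg: "algebra K ?B"
    by (rule algebraI[OF R.is_cring cr])
       (auto simp: transport_algebra_def Let_def g S zero Sc smult_l_distr smult_r_distr smult_assoc1 smult_assoc2)
  show "differential_algebra K ?B (\<lambda>x. e (d (inv_into S e x)))"
    unfolding differential_algebra_def using alg d
    by (auto simp: Der_def transport_algebra_def Let_def g S zero Sc)
  show "inv_into S e \<in> differential_algebra_hom K ?B (\<lambda>x. e (d (inv_into S e x))) B d"
    by (auto simp: differential_algebra_hom_def algebra_hom_def ring_hom_def
         transport_algebra_def Let_def g S zero Sc)
  show "h \<in> algebra_hom K A B \<Longrightarrow> h ` carrier A \<subseteq> S
          \<Longrightarrow> (\<lambda>a. e (h a)) \<in> algebra_hom K A ?B"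
    by (auto simp: algebra_hom_def ring_hom_def image_subset_iff
         transport_algebra_def Let_def g S zero Sc)
qed


lemma differential_algebra_homD:
  assumes "h \<in> differential_algebra_hom K A d B d'"
  shows "a \<in> carrier A \<Longrightarrow> h a \<in> carrier B"
    and "a \<in> carrier A \<Longrightarrow> b \<in> carrier A \<Longrightarrow> h (a \<oplus>\<^bsub>A\<^esub> b) = h a \<oplus>\<^bsub>B\<^esub> h b"
    and "a \<in> carrier A \<Longrightarrow> b \<in> carrier A \<Longrightarrow> h (a \<otimes>\<^bsub>A\<^esub> b) = h a \<otimes>\<^bsub>B\<^esub> h b"
    and "h \<one>\<^bsub>A\<^esub> = \<one>\<^bsub>B\<^esub>"
    and "c \<in> carrier K \<Longrightarrow> a \<in> carrier A \<Longrightarrow> h (c \<odot>\<^bsub>A\<^esub> a) = c \<odot>\<^bsub>B\<^esub> h a"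
    and "a \<in> carrier A \<Longrightarrow> h (d a) = d' (h a)"
  using assms by (auto simp: differential_algebra_hom_def algebra_hom_def ring_hom_def)

lemma differential_algebra_homI:
  assumes "\<And>a. a \<in> carrier A \<Longrightarrow> h a \<in> carrier B"
    and "\<And>a b. a \<in> carrier A \<Longrightarrow> b \<in> carrier A \<Longrightarrow> h (a \<oplus>\<^bsub>A\<^esub> b) = h a \<oplus>\<^bsub>B\<^esub> h b"
    and "\<And>a b. a \<in> carrier A \<Longrightarrow> b \<in> carrier A \<Longrightarrow> h (a \<otimes>\<^bsub>A\<^esub> b) = h a \<otimes>\<^bsub>B\<^esub> h b"
    and "h \<one>\<^bsub>A\<^esub> = \<one>\<^bsub>B\<^esub>"
    and "\<And>c a. c \<in> carrier K \<Longrightarrow> a \<in> carrier A \<Longrightarrow> h (c \<odot>\<^bsub>A\<^esub> a) = c \<odot>\<^bsub>B\<^esub> h a"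
    and "\<And>a. a \<in> carrier A \<Longrightarrow> h (d a) = d' (h a)"
  shows "h \<in> differential_algebra_hom K A d B d'"
  using assms by (auto simp: differential_algebra_hom_def algebra_hom_def ring_hom_def)

lemma finite_algebra_trivial:
  assumes K: "field K" "char_zero K" and R: "algebra K R" and fin: "finite (carrier R)"
  shows "\<one>\<^bsub>R\<^esub> = \<zero>\<^bsub>R\<^esub>"
proof -
  interpret algebra K R by fact
  interpret K: field K by fact
  let ?k = "\<lambda>n::nat. add_pow K n \<one>\<^bsub>K\<^esub>"
  have kc: "?k n \<in> carrier K" for n by simp
  have "\<not> inj (\<lambda>n. ?k n \<odot>\<^bsub>R\<^esub> \<one>\<^bsub>R\<^esub>)"
  proof
    assume "inj (\<lambda>n. ?k n \<odot>\<^bsub>R\<^esub> \<one>\<^bsub>R\<^esub>)"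
    moreover have "finite (range (\<lambda>n. ?k n \<odot>\<^bsub>R\<^esub> \<one>\<^bsub>R\<^esub>))"
      by (rule finite_subset[OF _ fin]) auto
    ultimately show False using finite_imageD infinite_UNIV_nat by blast
  qed
  then obtain m n where mn: "m < n" "?k m \<odot>\<^bsub>R\<^esub> \<one>\<^bsub>R\<^esub> = ?k n \<odot>\<^bsub>R\<^esub> \<one>\<^bsub>R\<^esub>"
    unfolding inj_def by (metis linorder_neqE_nat)
  define p where "p = n - m"
  have p: "p > 0" "n = m + p" using mn by (auto simp: p_def)
  have "?k n = ?k m \<oplus>\<^bsub>K\<^esub> ?k p"
    unfolding p(2) using R.add.nat_pow_mult[of "\<one>\<^bsub>K\<^esub>" m p] by simp
  then have "?k m \<odot>\<^bsub>R\<^esub> \<one>\<^bsub>R\<^esub> \<oplus>\<^bsub>R\<^esub> ?k p \<odot>\<^bsub>R\<^esub> \<one>\<^bsub>R\<^esub> = ?k m \<odot>\<^bsub>R\<^esub> \<one>\<^bsub>R\<^esub>"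
    using mn kc by (simp add: smult_l_distr)
  then have z: "?k p \<odot>\<^bsub>R\<^esub> \<one>\<^bsub>R\<^esub> = \<zero>\<^bsub>R\<^esub>" by (simp add: M.add.l_cancel_one)
  have "?k p \<noteq> \<zero>\<^bsub>K\<^esub>" using K(2) p by (simp add: char_zero_def)
  then have u: "?k p \<in> Units K" using K.field_Units kc by auto
  have "\<one>\<^bsub>R\<^esub> = (inv\<^bsub>K\<^esub> ?k p \<otimes>\<^bsub>K\<^esub> ?k p) \<odot>\<^bsub>R\<^esub> \<one>\<^bsub>R\<^esub>" using u by simp
  also have "\<dots> = inv\<^bsub>K\<^esub> ?k p \<odot>\<^bsub>R\<^esub> (?k p \<odot>\<^bsub>R\<^esub> \<one>\<^bsub>R\<^esub>)" using u kc smult_assoc1[of "inv\<^bsub>K\<^esub> ?k p" "?k p" "\<one>\<^bsub>R\<^esub>"] R.Units_inv_closed[OF u] by simp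
  also have "\<dots> = \<zero>\<^bsub>R\<^esub>" using u by (simp add: z)
  finally show ?thesis .
qed

text \<open>A jet algebra has the universal property with respect to differential algebras of any type.\<close>

theorem jet_algebra_universal:
  fixes J :: "('k, 'j) module" and B :: "('k, 'b) module"
  assumes K: "field K" "char_zero K" and R: "algebra K R" and jet: "jet_algebra K R J d \<iota>"
    and B: "differential_algebra K B d'" and f: "f \<in> algebra_hom K R B"
  shows "\<exists>!h. h \<in> differential_algebra_hom K J d B d' \<and> h \<in> extensional (carrier J) \<and>
              (\<forall>r\<in>carrier R. f r = h (\<iota> r))"
proof -
  interpret R: algebra K R by fact
  interpret B: algebra K B using B by (simp add: differential_algebra_def)
  interpret J: algebra K J using jet by (simp add: jet_algebra_def differential_algebra_def)
  have J: "differential_algebra K J d" and \<iota>: "\<iota> \<in> algebra_hom K R J" "inj_on \<iota> (carrier R)"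
    using jet by (auto simp: jet_algebra_def)
  have d: "d' \<in> Der K B" "d \<in> Der K J" using B J by (auto simp: differential_algebra_def)
  have \<iota>c: "r \<in> carrier R \<Longrightarrow> \<iota> r \<in> carrier J" for r
    using \<iota>(1) by (auto simp: algebra_hom_def ring_hom_def)
  have univ: "\<exists>!h. h \<in> differential_algebra_hom K J d C d'' \<and> h \<in> extensional (carrier J) \<and>
              (\<forall>r\<in>carrier R. g r = h (\<iota> r))"
    if "differential_algebra K C d''" "g \<in> algebra_hom K R C" for C :: "('k, 'j) module" and d'' g
    using jet[unfolded jet_algebra_def, THEN conjunct2, THEN conjunct2, THEN conjunct2,
        rule_format, OF conjI[OF that]] .

  define T where "T = rec_nat (f ` carrier R) (\<lambda>_ X. X \<union> (\<lambda>(a, b). a \<oplus>\<^bsub>B\<^esub> b) ` (X \<times> X)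
      \<union> (\<lambda>(a, b). a \<otimes>\<^bsub>B\<^esub> b) ` (X \<times> X) \<union> d' ` X)"
  have T0: "T 0 = f ` carrier R" by (simp add: T_def)
  have TS: "T (Suc n) = T n \<union> (\<lambda>(a, b). a \<oplus>\<^bsub>B\<^esub> b) ` (T n \<times> T n)
      \<union> (\<lambda>(a, b). a \<otimes>\<^bsub>B\<^esub> b) ` (T n \<times> T n) \<union> d' ` T n" for n by (simp add: T_def)
  define S where "S = (\<Union>n. T n)"
  have Tmono: "T m \<subseteq> T n" if "m \<le> n" for m n
    using lift_Suc_mono_le[of T, OF _ that] unfolding TS by blast
  have Tc: "T n \<subseteq> carrier B" for n
  proof (induction n)
    case 0 show ?case using f unfolding T0 by (auto simp: algebra_hom_def ring_hom_def)
  next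
    case (Suc n)
    have 1: "a \<in> carrier B" if "a \<in> T n" for a using Suc that by blast
    have 2: "d' a \<in> carrier B" if "a \<in> T n" for a using 1[OF that] d(1) by (auto simp: Der_def)
    show ?case unfolding TS by (auto simp: 1 2)
  qed
  have Sc: "S \<subseteq> carrier B" using Tc by (auto simp: S_def)
  have two: "\<exists>n. a \<in> T n \<and> b \<in> T n" if "a \<in> S" "b \<in> S" for a b
  proof -
    obtain m n where "a \<in> T m" "b \<in> T n" using \<open>a \<in> S\<close> \<open>b \<in> S\<close> by (auto simp: S_def)
    then have "a \<in> T (max m n)" "b \<in> T (max m n)" using Tmono[of m "max m n"] Tmono[of n "max m n"] by auto
    then show ?thesis by blast
  qed
  have fS: "f r \<in> S" if "r \<in> carrier R" for r using that T0 by (auto simp: S_def)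
  have Sadd: "a \<oplus>\<^bsub>B\<^esub> b \<in> S" if ab: "a \<in> S" "b \<in> S" for a b
  proof -
    obtain n where "a \<in> T n" "b \<in> T n" using two[OF ab] by auto
    then have "a \<oplus>\<^bsub>B\<^esub> b \<in> T (Suc n)" by (auto simp: TS image_iff)
    then show ?thesis by (auto simp: S_def)
  qed
  have Smul: "a \<otimes>\<^bsub>B\<^esub> b \<in> S" if ab: "a \<in> S" "b \<in> S" for a b
  proof -
    obtain n where "a \<in> T n" "b \<in> T n" using two[OF ab] by auto
    then have "a \<otimes>\<^bsub>B\<^esub> b \<in> T (Suc n)" by (auto simp: TS image_iff)
    then show ?thesis by (auto simp: S_def)
  qed
  have Sd: "d' a \<in> S" if a: "a \<in> S" for a
  proof -
    obtain n where "a \<in> T n" using two[OF a a] by auto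
    then have "d' a \<in> T (Suc n)" by (auto simp: TS)
    then show ?thesis by (auto simp: S_def)
  qed
  have f1: "f \<one>\<^bsub>R\<^esub> = \<one>\<^bsub>B\<^esub>" using f by (auto simp: algebra_hom_def ring_hom_def)
  have S1: "\<one>\<^bsub>B\<^esub> \<in> S" using fS[of "\<one>\<^bsub>R\<^esub>"] f1 by simp
  have Ssm: "c \<odot>\<^bsub>B\<^esub> a \<in> S" if c: "c \<in> carrier K" and a: "a \<in> S" for c a
  proof -
    have ac: "a \<in> carrier B" using a Sc by auto
    have "f (c \<odot>\<^bsub>R\<^esub> \<one>\<^bsub>R\<^esub>) = c \<odot>\<^bsub>B\<^esub> \<one>\<^bsub>B\<^esub>" using f c f1 by (auto simp: algebra_hom_def)
    then have "f (c \<odot>\<^bsub>R\<^esub> \<one>\<^bsub>R\<^esub>) \<otimes>\<^bsub>B\<^esub> a = c \<odot>\<^bsub>B\<^esub> a"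
      using c ac by (simp add: B.smult_assoc2)
    moreover have "f (c \<odot>\<^bsub>R\<^esub> \<one>\<^bsub>R\<^esub>) \<in> S" using c by (intro fS) simp
    ultimately show ?thesis using Smul[of "f (c \<odot>\<^bsub>R\<^esub> \<one>\<^bsub>R\<^esub>)" a] a by simp
  qed

  have "\<exists>e :: 'b \<Rightarrow> 'j. inj_on e S"
  proof (cases "finite (carrier R)")
    case True
    have "\<one>\<^bsub>R\<^esub> = \<zero>\<^bsub>R\<^esub>" by (rule finite_algebra_trivial[OF K R True])
    moreover have "f \<zero>\<^bsub>R\<^esub> = \<zero>\<^bsub>B\<^esub>"
    proof -
      have "f (\<zero>\<^bsub>K\<^esub> \<odot>\<^bsub>R\<^esub> \<zero>\<^bsub>R\<^esub>) = \<zero>\<^bsub>K\<^esub> \<odot>\<^bsub>B\<^esub> f \<zero>\<^bsub>R\<^esub>"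
        using f R.R.zero_closed R.M.zero_closed unfolding algebra_hom_def by blast
      moreover have "f \<zero>\<^bsub>R\<^esub> \<in> carrier B" using f by (auto simp: algebra_hom_def ring_hom_def)
      ultimately show ?thesis by simp
    qed
    ultimately have "\<one>\<^bsub>B\<^esub> = \<zero>\<^bsub>B\<^esub>" using f1 by simp
    then have "a = \<zero>\<^bsub>B\<^esub>" if "a \<in> carrier B" for a using that B.l_null[of a] B.l_one[of a] by simp
    then have "inj_on (\<lambda>_. undefined :: 'j) S" using Sc by (auto simp: inj_on_def)
    then show ?thesis by blast
  next
    case False
    have "|T n| \<le>o |carrier R|" for n
    proof (induction n)
      case 0 show ?case by (simp add: T0)
    next
      case (Suc n)
      have "|T n \<times> T n| \<le>o |carrier R|" by (rule card_of_Times_ordLeq_infinite[OF False Suc Suc])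
      then have "|g ` (T n \<times> T n)| \<le>o |carrier R|" for g :: "'b \<times> 'b \<Rightarrow> 'b"
        by (rule ordLeq_transitive[OF card_of_image])
      moreover have "|d' ` T n| \<le>o |carrier R|" by (rule ordLeq_transitive[OF card_of_image Suc])
      ultimately show ?case
        unfolding TS using False Suc by (intro card_of_Un_ordLeq_infinite) auto
    qed
    moreover have "|UNIV :: nat set| \<le>o |carrier R|" using False infinite_iff_card_of_nat by blast
    ultimately have "|S| \<le>o |carrier R|"
      unfolding S_def by (intro card_of_UNION_ordLeq_infinite[OF False]) auto
    then obtain e1 where e1: "inj_on e1 S" "e1 ` S \<subseteq> carrier R"
      using card_of_ordLeq[of S "carrier R"] by auto
    then have "inj_on (\<iota> \<circ> e1) S" using \<iota>(2) by (auto intro: comp_inj_on inj_on_subset)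
    then show ?thesis by blast
  qed
  then obtain e :: "'b \<Rightarrow> 'j" where e: "inj_on e S" by blast
  have clos: "\<forall>a\<in>S. \<forall>b\<in>S. a \<oplus>\<^bsub>B\<^esub> b \<in> S" "\<forall>a\<in>S. \<forall>b\<in>S. a \<otimes>\<^bsub>B\<^esub> b \<in> S"
      "\<forall>c\<in>carrier K. \<forall>a\<in>S. c \<odot>\<^bsub>B\<^esub> a \<in> S" "\<forall>a\<in>S. d' a \<in> S"
    using Sadd Smul Ssm Sd by blast+
  note tr = transport_differential_algebra[OF B Sc S1 clos e]
  let ?C = "transport_algebra B S e" and ?dC = "\<lambda>x. e (d' (inv_into S e x))"
  have "(\<lambda>a. e (f a)) \<in> algebra_hom K R ?C" by (rule tr(3)[OF f]) (auto simp: fS)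
  from univ[OF tr(1) this] obtain h where h: "h \<in> differential_algebra_hom K J d ?C ?dC"
    and hf: "\<And>r. r \<in> carrier R \<Longrightarrow> e (f r) = h (\<iota> r)" by blast
  have dJ: "a \<in> carrier J \<Longrightarrow> d a \<in> carrier J" for a using d(2) by (auto simp: Der_def)
  note hD = differential_algebra_homD[OF h] and vD = differential_algebra_homD[OF tr(2)]
  define H where "H = restrict (\<lambda>a. inv_into S e (h a)) (carrier J)"
  have Hhom: "H \<in> differential_algebra_hom K J d B d'"
    unfolding H_def by (rule differential_algebra_homI) (simp_all add: hD vD dJ)
  have Hf: "f r = H (\<iota> r)" if "r \<in> carrier R" for r
    using that hf[OF that] \<iota>c[OF that] inv_into_f_f[OF e fS[OF that]] by (simp add: H_def)
  show ?thesis
  proof (rule ex1I[of _ H], goal_cases)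
    case 1 show ?case using Hhom Hf by (auto simp: H_def)
  next
    case (2 g)
    define S' where "S' = {a \<in> carrier J. g a = H a}"
    have gh: "g \<in> differential_algebra_hom K J d B d'" using 2 by simp
    have clos': "S' \<subseteq> carrier J" "\<one>\<^bsub>J\<^esub> \<in> S'"
      "\<forall>a\<in>S'. \<forall>b\<in>S'. a \<oplus>\<^bsub>J\<^esub> b \<in> S'" "\<forall>a\<in>S'. \<forall>b\<in>S'. a \<otimes>\<^bsub>J\<^esub> b \<in> S'"
      "\<forall>c\<in>carrier K. \<forall>a\<in>S'. c \<odot>\<^bsub>J\<^esub> a \<in> S'" "\<forall>a\<in>S'. d a \<in> S'"
      by (auto simp: S'_def dJ differential_algebra_homD[OF gh] differential_algebra_homD[OF Hhom])
    note tr' = transport_differential_algebra[OF J clos' inj_on_id]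
    let ?D = "transport_algebra J S' id" and ?dD = "\<lambda>x. id (d (inv_into S' id x))"
    have "(\<lambda>a. id (\<iota> a)) \<in> algebra_hom K R ?D"
      using 2 Hf \<iota>c by (intro tr'(3)[OF \<iota>(1)]) (auto simp: S'_def)
    from univ[OF tr'(1) this] obtain k where k: "k \<in> differential_algebra_hom K J d ?D ?dD"
      and k\<iota>: "\<And>r. r \<in> carrier R \<Longrightarrow> \<iota> r = k (\<iota> r)" by auto
    have kS: "k a \<in> S'" if "a \<in> carrier J" for a
      using k that by (auto simp: differential_algebra_hom_def algebra_hom_def ring_hom_def
        transport_algebra_def Let_def)
    have inv: "inv_into S' id a = a" if "a \<in> S'" for a using inv_into_f_f[of id S' a] that by simp
    note kD = differential_algebra_homD[OF k] and wD = differential_algebra_homD[OF tr'(2)]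
    have kk: "restrict k (carrier J) \<in> differential_algebra_hom K J d J d"
    proof -
      have "restrict (\<lambda>a. inv_into S' id (k a)) (carrier J) \<in> differential_algebra_hom K J d J d"
        by (rule differential_algebra_homI) (simp_all add: kD wD dJ del: id_apply)
      moreover have "restrict (\<lambda>a. inv_into S' id (k a)) (carrier J) = restrict k (carrier J)"
        using kS inv by (intro restrict_ext) blast
      ultimately show ?thesis by simp
    qed
    have ii: "restrict id (carrier J) \<in> differential_algebra_hom K J d J d"
      by (rule differential_algebra_homI) (simp_all add: dJ)
    have uniq: "p = q" if "p \<in> differential_algebra_hom K J d J d" "p \<in> extensional (carrier J)"
      "\<forall>r\<in>carrier R. \<iota> r = p (\<iota> r)" "q \<in> differential_algebra_hom K J d J d"
      "q \<in> extensional (carrier J)" "\<forall>r\<in>carrier R. \<iota> r = q (\<iota> r)" for p q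
      using univ[OF J \<iota>(1)] that by blast
    have "restrict k (carrier J) = restrict id (carrier J)"
      by (rule uniq[OF kk _ _ ii]) (simp_all add: \<iota>c k\<iota>[symmetric])
    then have "k a = a" if "a \<in> carrier J" for a using that by (metis id_apply restrict_apply')
    then have "g a = H a" if "a \<in> carrier J" for a using kS[OF that] that by (simp add: S'_def)
    then show ?case using 2 by (intro extensionalityI[of _ "carrier J"]) (auto simp: H_def)
  qed
qed


section \<open>Differential operators and their modules\<close>

text \<open>
  Polynomials with coefficients in \<open>M\<close>, in particular the elements of \<open>M[\<lambda>]\<close> and the
  differential operators \<open>\<Sum>\<^sub>i a\<^sub>i \<partial>\<^sup>i\<close>, are the coefficient sequences in \<^term>\<open>up M\<close>.
\<close>

definition supp :: "('m, 's) ring_scheme \<Rightarrow> (nat \<Rightarrow> 'm) \<Rightarrow> nat set" where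
  "supp M p = {n. p n \<noteq> \<zero>\<^bsub>M\<^esub>}"

definition cpoly :: "('m, 's) ring_scheme \<Rightarrow> 'm \<Rightarrow> nat \<Rightarrow> 'm" where
  "cpoly M u = (\<lambda>n. if n = 0 then u else \<zero>\<^bsub>M\<^esub>)"

definition polysum :: "('m, 's) ring_scheme \<Rightarrow> 'i set \<Rightarrow> ('i \<Rightarrow> nat \<Rightarrow> 'm) \<Rightarrow> nat \<Rightarrow> 'm" where
  "polysum M I f = (\<lambda>k. \<Oplus>\<^bsub>M\<^esub>i\<in>I. f i k)"

text \<open>
  The product is determined by
  \<open>a \<partial>\<^sup>i \<circ> b \<partial>\<^sup>j = \<Sum>\<^sub>m (i choose m) a \<partial>\<^sup>m(b) \<partial>\<^bsup>i-m+j\<^esup>\<close>; below \<open>m = i + j - n\<close>.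
\<close>

definition diffop_ring :: "('a, 's) ring_scheme \<Rightarrow> ('a \<Rightarrow> 'a) \<Rightarrow> (nat \<Rightarrow> 'a) ring" where
  "diffop_ring A d = \<lparr>
     carrier = up A,
     mult = (\<lambda>P Q n. finsum A
               (\<lambda>(i, j). add_pow A (i choose (i + j - n)) (P i \<otimes>\<^bsub>A\<^esub> (d ^^ (i + j - n)) (Q j)))
               {(i, j). i \<in> supp A P \<and> j \<le> n \<and> n \<le> i + j}),
     one = cpoly A \<one>\<^bsub>A\<^esub>,
     zero = (\<lambda>_. \<zero>\<^bsub>A\<^esub>),
     add = (\<lambda>P Q n. P n \<oplus>\<^bsub>A\<^esub> Q n)\<rparr>"

definition del_op :: "('a, 's) ring_scheme \<Rightarrow> nat \<Rightarrow> 'a" where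
  "del_op A = (\<lambda>n. if n = 1 then \<one>\<^bsub>A\<^esub> else \<zero>\<^bsub>A\<^esub>)"

text \<open>The library locale \<^locale>\<open>module\<close> is restricted to commutative rings.\<close>

locale left_module = R?: ring R + M?: abelian_group M
    for R :: "('a, 's) ring_scheme" (structure) and M :: "('a, 'e, 't) module_scheme" (structure) +
  assumes smult_closed:
      "\<lbrakk>a \<in> carrier R; x \<in> carrier M\<rbrakk> \<Longrightarrow> a \<odot>\<^bsub>M\<^esub> x \<in> carrier M"
    and smult_l_distr:
      "\<lbrakk>a \<in> carrier R; b \<in> carrier R; x \<in> carrier M\<rbrakk>
        \<Longrightarrow> (a \<oplus> b) \<odot>\<^bsub>M\<^esub> x = a \<odot>\<^bsub>M\<^esub> x \<oplus>\<^bsub>M\<^esub> b \<odot>\<^bsub>M\<^esub> x"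
    and smult_r_distr:
      "\<lbrakk>a \<in> carrier R; x \<in> carrier M; y \<in> carrier M\<rbrakk>
        \<Longrightarrow> a \<odot>\<^bsub>M\<^esub> (x \<oplus>\<^bsub>M\<^esub> y) = a \<odot>\<^bsub>M\<^esub> x \<oplus>\<^bsub>M\<^esub> a \<odot>\<^bsub>M\<^esub> y"
    and smult_assoc:
      "\<lbrakk>a \<in> carrier R; b \<in> carrier R; x \<in> carrier M\<rbrakk>
        \<Longrightarrow> (a \<otimes> b) \<odot>\<^bsub>M\<^esub> x = a \<odot>\<^bsub>M\<^esub> (b \<odot>\<^bsub>M\<^esub> x)"
    and smult_one:
      "x \<in> carrier M \<Longrightarrow> \<one> \<odot>\<^bsub>M\<^esub> x = x"

definition restrict_scalars :: "('b \<Rightarrow> 'a) \<Rightarrow> ('a, 'e) module \<Rightarrow> ('b, 'e) module" where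
  "restrict_scalars h M = \<lparr>
     carrier = carrier M, mult = mult M, one = one M, zero = zero M, add = add M,
     smult = (\<lambda>c u. h c \<odot>\<^bsub>M\<^esub> u)\<rparr>"

text \<open>A left \<open>A[\<partial>]\<close>-module \<open>E\<close> as a module over \<open>A\<close>, as a vector space over \<open>K\<close>, and its operator \<open>\<partial>\<close>.\<close>

abbreviation over_A :: "('k, 'a) module \<Rightarrow> (nat \<Rightarrow> 'a, 'e) module \<Rightarrow> ('a, 'e) module" where
  "over_A A E \<equiv> restrict_scalars (cpoly A) E"

abbreviation over_K :: "('k, 'a) module \<Rightarrow> ('a, 'e) module \<Rightarrow> ('k, 'e) module" where
  "over_K A M \<equiv> restrict_scalars (\<lambda>c. c \<odot>\<^bsub>A\<^esub> \<one>\<^bsub>A\<^esub>) M"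

abbreviation del :: "('k, 'a) module \<Rightarrow> (nat \<Rightarrow> 'a, 'e) module \<Rightarrow> 'e \<Rightarrow> 'e" where
  "del A E u \<equiv> del_op A \<odot>\<^bsub>E\<^esub> u"


section \<open>The substitution convention\<close>

text \<open>
  Polynomials in the commuting indeterminates \<open>\<lambda>\<close>, \<open>x\<close>, \<open>y\<close> (from the innermost to the
  outermost). If \<open>P = \<Sum> c\<^sub>p\<^sub>q\<^sub>r \<lambda>\<^sup>p x\<^sup>q y\<^sup>r\<close>, then \<open>subst_xy M P f\<close> is
  \<open>\<Sum> c\<^sub>p\<^sub>q\<^sub>r \<lambda>\<^sup>p f q r \<in> M[\<lambda>]\<close>; here \<open>f q r\<close> is to be the expression in which \<open>x\<^sup>q\<close> and \<open>y\<^sup>r\<close>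
  have been replaced by \<open>\<partial>\<^sup>q\<close> and \<open>\<partial>\<^sup>r\<close> on the factors that the bars refer to.
\<close>

definition lam :: "int poly poly poly" where "lam = [:[:[:0, 1:]:]:]"
definition xv :: "int poly poly poly" where "xv = [:[:0, 1:]:]"
definition yv :: "int poly poly poly" where "yv = [:0, 1:]"

definition coeff3 :: "int poly poly poly \<Rightarrow> nat \<Rightarrow> nat \<Rightarrow> nat \<Rightarrow> int" where
  "coeff3 P p q r = Polynomial.coeff (Polynomial.coeff (Polynomial.coeff P r) q) p"

definition subst_xy ::
  "('m, 's) ring_scheme \<Rightarrow> int poly poly poly \<Rightarrow> (nat \<Rightarrow> nat \<Rightarrow> nat \<Rightarrow> 'm) \<Rightarrow> nat \<Rightarrow> 'm" where
  "subst_xy M P f =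
     (\<lambda>k. finsum M (\<lambda>(p, q, r). add_pow M (coeff3 P p q r) (f q r (k - p)))
                  {(p, q, r). p \<le> k \<and> coeff3 P p q r \<noteq> 0})"


section \<open>Conformal derivations\<close>

definition adjoint_symbol :: "('k, 'a) module \<Rightarrow> ('a \<Rightarrow> 'a) \<Rightarrow> (nat \<Rightarrow> 'a) \<Rightarrow> nat \<Rightarrow> 'a" where
  "adjoint_symbol A d P =
     polysum A (supp A P) (\<lambda>i. subst_xy A ((- lam - xv) ^ i) (\<lambda>q r. cpoly A ((d ^^ q) (P i))))"

text \<open>A map \<open>\<phi>\<^sub>\<lambda> : A \<rightarrow> A[\<lambda>]\<close> is \<open>\<phi> :: 'a \<Rightarrow> nat \<Rightarrow> 'a\<close>, where \<open>\<phi> a n\<close> is the coefficient of \<open>\<lambda>\<^sup>n\<close>.\<close>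

definition CDer :: "'k ring \<Rightarrow> ('k, 'a) module \<Rightarrow> ('a \<Rightarrow> 'a) \<Rightarrow> ('a \<Rightarrow> nat \<Rightarrow> 'a) set" where
  "CDer K A d =
     {\<phi> \<in> carrier A \<rightarrow> up A.
        (\<forall>a\<in>carrier A. \<forall>b\<in>carrier A. \<forall>n. \<phi> (a \<oplus>\<^bsub>A\<^esub> b) n = \<phi> a n \<oplus>\<^bsub>A\<^esub> \<phi> b n) \<and>
        (\<forall>c\<in>carrier K. \<forall>a\<in>carrier A. \<forall>n. \<phi> (c \<odot>\<^bsub>A\<^esub> a) n = c \<odot>\<^bsub>A\<^esub> \<phi> a n) \<and>
        (\<forall>a\<in>carrier A. \<forall>n.
           \<phi> (d a) n = d (\<phi> a n) \<oplus>\<^bsub>A\<^esub> (if n = 0 then \<zero>\<^bsub>A\<^esub> else \<phi> a (n - 1))) \<and>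
        (\<forall>a\<in>carrier A. \<forall>b\<in>carrier A. \<forall>n.
           \<phi> (a \<otimes>\<^bsub>A\<^esub> b) n = \<phi> a n \<otimes>\<^bsub>A\<^esub> b \<oplus>\<^bsub>A\<^esub> a \<otimes>\<^bsub>A\<^esub> \<phi> b n)}"

text \<open>\<open>(a(\<partial>)\<phi>)\<^sub>\<lambda> = (|\<^sub>x\<^sub>=\<^sub>\<partial> a\<^sup>*(\<lambda>)) \<phi>\<^bsub>\<lambda>+x\<^esub>\<close>\<close>

definition cder_smult ::
  "('k, 'a) module \<Rightarrow> ('a \<Rightarrow> 'a) \<Rightarrow> (nat \<Rightarrow> 'a) \<Rightarrow> ('a \<Rightarrow> nat \<Rightarrow> 'a) \<Rightarrow> 'a \<Rightarrow> nat \<Rightarrow> 'a" where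
  "cder_smult A d P \<phi> b =
     polysum A (supp A (\<phi> b)) (\<lambda>n. subst_xy A ((lam + xv) ^ n)
       (\<lambda>q r k. (d ^^ q) (adjoint_symbol A d P k) \<otimes>\<^bsub>A\<^esub> \<phi> b n))"

text \<open>\<open>\<phi>\<^sup>*\<^sub>\<lambda>(a) = (|\<^sub>x\<^sub>=\<^sub>\<partial> \<phi>\<^bsub>-\<lambda>-x\<^esub>(a))\<close>\<close>

definition cder_adjoint ::
  "('k, 'a) module \<Rightarrow> ('a \<Rightarrow> 'a) \<Rightarrow> ('a \<Rightarrow> nat \<Rightarrow> 'a) \<Rightarrow> 'a \<Rightarrow> nat \<Rightarrow> 'a" where
  "cder_adjoint A d \<phi> a =
     polysum A (supp A (\<phi> a)) (\<lambda>n. subst_xy A ((- lam - xv) ^ n)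
       (\<lambda>q r. cpoly A ((d ^^ q) (\<phi> a n))))"

definition cder_module_hom ::
  "'k ring \<Rightarrow> ('k, 'a) module \<Rightarrow> ('a \<Rightarrow> 'a) \<Rightarrow> (nat \<Rightarrow> 'a, 'e) module \<Rightarrow> ('e \<Rightarrow> 'a \<Rightarrow> nat \<Rightarrow> 'a) \<Rightarrow> bool"
where
  "cder_module_hom K A d E \<theta> \<longleftrightarrow>
     (\<forall>u\<in>carrier E. \<theta> u \<in> CDer K A d) \<and>
     (\<forall>u\<in>carrier E. \<forall>v\<in>carrier E. \<forall>a\<in>carrier A. \<forall>n.
        \<theta> (u \<oplus>\<^bsub>E\<^esub> v) a n = \<theta> u a n \<oplus>\<^bsub>A\<^esub> \<theta> v a n) \<and>
     (\<forall>P\<in>carrier (diffop_ring A d). \<forall>u\<in>carrier E. \<forall>a\<in>carrier A.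
        \<theta> (P \<odot>\<^bsub>E\<^esub> u) a = cder_smult A d P (\<theta> u) a)"

text \<open>
  The extension of a derivation \<open>D\<close> of \<open>R\<close> to a conformal derivation of the jet algebra; the
  values outside the carrier are fixed to make it unique as a HOL function.
\<close>

definition extends_der ::
  "'k ring \<Rightarrow> ('k, 'r) module \<Rightarrow> ('k, 'j) module \<Rightarrow> ('j \<Rightarrow> 'j) \<Rightarrow> ('r \<Rightarrow> 'j) \<Rightarrow> ('r \<Rightarrow> 'r)
    \<Rightarrow> ('j \<Rightarrow> nat \<Rightarrow> 'j) \<Rightarrow> bool" where
  "extends_der K R J d \<iota> D \<phi> \<longleftrightarrow>
     \<phi> \<in> CDer K J d \<and> \<phi> \<in> extensional (carrier J) \<and>
     (\<forall>r\<in>carrier R. \<phi> (\<iota> r) = cpoly J (\<iota> (D r)))"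

definition der_lift ::
  "'k ring \<Rightarrow> ('k, 'r) module \<Rightarrow> ('k, 'j) module \<Rightarrow> ('j \<Rightarrow> 'j) \<Rightarrow> ('r \<Rightarrow> 'j) \<Rightarrow> ('r \<Rightarrow> 'r)
    \<Rightarrow> 'j \<Rightarrow> nat \<Rightarrow> 'j" where
  "der_lift K R J d \<iota> D = (THE \<phi>. extends_der K R J d \<iota> D \<phi>)"


section \<open>Lie conformal algebras and algebroids\<close>

text \<open>In \<open>br u v n\<close> the natural number \<open>n\<close> selects the coefficient of \<open>\<lambda>\<^sup>n\<close> in \<open>[u\<^sub>\<lambda> v]\<close>.\<close>

definition bilinear_lambda_bracket ::
  "'k ring \<Rightarrow> ('k, 'e) module \<Rightarrow> ('e \<Rightarrow> 'e \<Rightarrow> nat \<Rightarrow> 'e) \<Rightarrow> bool" where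
  "bilinear_lambda_bracket K E br \<longleftrightarrow>
     (\<forall>u\<in>carrier E. \<forall>v\<in>carrier E. br u v \<in> up E) \<and>
     (\<forall>u\<in>carrier E. \<forall>v\<in>carrier E. \<forall>w\<in>carrier E. \<forall>n.
        br (u \<oplus>\<^bsub>E\<^esub> v) w n = br u w n \<oplus>\<^bsub>E\<^esub> br v w n \<and>
        br u (v \<oplus>\<^bsub>E\<^esub> w) n = br u v n \<oplus>\<^bsub>E\<^esub> br u w n) \<and>
     (\<forall>c\<in>carrier K. \<forall>u\<in>carrier E. \<forall>v\<in>carrier E. \<forall>n.
        br (c \<odot>\<^bsub>E\<^esub> u) v n = c \<odot>\<^bsub>E\<^esub> br u v n \<and>
        br u (c \<odot>\<^bsub>E\<^esub> v) n = c \<odot>\<^bsub>E\<^esub> br u v n)"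

text \<open>
  A \<open>K[\<partial>]\<close>-module is a \<open>K\<close>-vector space with a linear endomorphism \<open>D\<close>.
  The last clause is the Jacobi identity, read off at \<open>\<lambda>\<^sup>m \<mu>\<^sup>n\<close>; the coefficient of
  \<open>\<lambda>\<^sup>m \<mu>\<^sup>n\<close> in \<open>\<lambda>\<^sup>i (\<lambda>+\<mu>)\<^sup>j\<close> is \<open>j choose n\<close> if \<open>i + j = m + n\<close> and \<open>i \<le> m\<close>, and \<open>0\<close> otherwise.
\<close>

definition lie_conformal_algebra ::
  "'k ring \<Rightarrow> ('k, 'e) module \<Rightarrow> ('e \<Rightarrow> 'e) \<Rightarrow> ('e \<Rightarrow> 'e \<Rightarrow> nat \<Rightarrow> 'e) \<Rightarrow> bool" where
  "lie_conformal_algebra K E D br \<longleftrightarrow>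
     module K E \<and>
     D \<in> carrier E \<rightarrow> carrier E \<and>
     (\<forall>u\<in>carrier E. \<forall>v\<in>carrier E. D (u \<oplus>\<^bsub>E\<^esub> v) = D u \<oplus>\<^bsub>E\<^esub> D v) \<and>
     (\<forall>c\<in>carrier K. \<forall>u\<in>carrier E. D (c \<odot>\<^bsub>E\<^esub> u) = c \<odot>\<^bsub>E\<^esub> D u) \<and>
     bilinear_lambda_bracket K E br \<and>
     (\<forall>u\<in>carrier E. \<forall>v\<in>carrier E. \<forall>n.
        br (D u) v n = (if n = 0 then \<zero>\<^bsub>E\<^esub> else \<ominus>\<^bsub>E\<^esub> br u v (n - 1)) \<and>
        br u (D v) n = D (br u v n) \<oplus>\<^bsub>E\<^esub> (if n = 0 then \<zero>\<^bsub>E\<^esub> else br u v (n - 1))) \<and>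
     (\<forall>u\<in>carrier E. \<forall>v\<in>carrier E. \<forall>k.
        br v u k = \<ominus>\<^bsub>E\<^esub> polysum E (supp E (br u v)) (\<lambda>n. subst_xy E ((- lam - xv) ^ n)
                       (\<lambda>q r. cpoly E ((D ^^ q) (br u v n)))) k) \<and>
     (\<forall>u\<in>carrier E. \<forall>v\<in>carrier E. \<forall>w\<in>carrier E. \<forall>m n.
        br u (br v w n) m \<ominus>\<^bsub>E\<^esub> br v (br u w m) n =
        (\<Oplus>\<^bsub>E\<^esub>i\<in>{..m}. add_pow E ((m + n - i) choose n) (br (br u v i) w (m + n - i))))"

text \<open>
  The last two clauses are conditions (i) and (ii) on the bracket and the anchor. The second is read
  off at \<open>\<lambda>\<^sup>m \<mu>\<^sup>n\<close>, using that in \<open>(\<mu>-\<lambda>)\<^bsup>n+s\<^esup>\<close> the coefficient of \<open>\<lambda>\<^sup>s \<mu>\<^sup>n\<close> is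
  \<open>(-1)\<^sup>s (n + s choose n)\<close>.
\<close>

definition lie_conformal_algebroid ::
  "'k ring \<Rightarrow> ('k, 'a) module \<Rightarrow> ('a \<Rightarrow> 'a) \<Rightarrow> (nat \<Rightarrow> 'a, 'e) module
    \<Rightarrow> ('e \<Rightarrow> 'e \<Rightarrow> nat \<Rightarrow> 'e) \<Rightarrow> ('e \<Rightarrow> 'a \<Rightarrow> nat \<Rightarrow> 'a) \<Rightarrow> bool" where
  "lie_conformal_algebroid K A d E br \<theta> \<longleftrightarrow>
     differential_algebra K A d \<and>
     left_module (diffop_ring A d) E \<and>
     lie_conformal_algebra K (over_K A (over_A A E)) (del A E) br \<and>
     cder_module_hom K A d E \<theta> \<and>
     (\<forall>u\<in>carrier E. \<forall>v\<in>carrier E. \<forall>P\<in>carrier (diffop_ring A d). \<forall>k.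
        br u (P \<odot>\<^bsub>E\<^esub> v) k =
          polysum E (supp A P) (\<lambda>i. subst_xy E ((lam + xv) ^ i)
            (\<lambda>q r k. P i \<odot>\<^bsub>over_A A E\<^esub> ((del A E) ^^ q) (br u v k))) k
          \<oplus>\<^bsub>E\<^esub>
          polysum E (supp A P) (\<lambda>i. subst_xy E (xv ^ i)
            (\<lambda>q r k. \<theta> u (P i) k \<odot>\<^bsub>over_A A E\<^esub> ((del A E) ^^ q) v)) k) \<and>
     (\<forall>u\<in>carrier E. \<forall>v\<in>carrier E. \<forall>a\<in>carrier A. \<forall>m n.
        \<theta> (br u v m) a n =
        (\<Oplus>\<^bsub>A\<^esub>s\<in>{..m}. add_pow A ((- 1) ^ s * int ((n + s) choose n))
           (\<theta> u (\<theta> v a (n + s)) (m - s) \<ominus>\<^bsub>A\<^esub> \<theta> v (\<theta> u a (m - s)) (n + s))))"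


section \<open>Lie algebroids\<close>

definition lie_algebra :: "'k ring \<Rightarrow> ('k, 'e) module \<Rightarrow> ('e \<Rightarrow> 'e \<Rightarrow> 'e) \<Rightarrow> bool" where
  "lie_algebra K L bra \<longleftrightarrow>
     module K L \<and>
     (\<forall>u\<in>carrier L. \<forall>v\<in>carrier L. bra u v \<in> carrier L) \<and>
     (\<forall>u\<in>carrier L. \<forall>v\<in>carrier L. \<forall>w\<in>carrier L.
        bra (u \<oplus>\<^bsub>L\<^esub> v) w = bra u w \<oplus>\<^bsub>L\<^esub> bra v w \<and>
        bra u (v \<oplus>\<^bsub>L\<^esub> w) = bra u v \<oplus>\<^bsub>L\<^esub> bra u w) \<and>
     (\<forall>c\<in>carrier K. \<forall>u\<in>carrier L. \<forall>v\<in>carrier L.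
        bra (c \<odot>\<^bsub>L\<^esub> u) v = c \<odot>\<^bsub>L\<^esub> bra u v \<and>
        bra u (c \<odot>\<^bsub>L\<^esub> v) = c \<odot>\<^bsub>L\<^esub> bra u v) \<and>
     (\<forall>u\<in>carrier L. bra u u = \<zero>\<^bsub>L\<^esub>) \<and>
     (\<forall>u\<in>carrier L. \<forall>v\<in>carrier L. \<forall>w\<in>carrier L.
        bra u (bra v w) \<oplus>\<^bsub>L\<^esub> bra v (bra w u) \<oplus>\<^bsub>L\<^esub> bra w (bra u v) = \<zero>\<^bsub>L\<^esub>)"

definition lie_algebroid ::
  "'k ring \<Rightarrow> ('k, 'r) module \<Rightarrow> ('r, 'f) module \<Rightarrow> ('f \<Rightarrow> 'f \<Rightarrow> 'f) \<Rightarrow> ('f \<Rightarrow> 'r \<Rightarrow> 'r) \<Rightarrow> bool" where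
  "lie_algebroid K R F bra \<theta> \<longleftrightarrow>
     algebra K R \<and> module R F \<and>
     lie_algebra K (over_K R F) bra \<and>
     (\<forall>u\<in>carrier F. \<theta> u \<in> Der K R) \<and>
     (\<forall>u\<in>carrier F. \<forall>v\<in>carrier F. \<forall>r\<in>carrier R. \<theta> (u \<oplus>\<^bsub>F\<^esub> v) r = \<theta> u r \<oplus>\<^bsub>R\<^esub> \<theta> v r) \<and>
     (\<forall>a\<in>carrier R. \<forall>u\<in>carrier F. \<forall>r\<in>carrier R. \<theta> (a \<odot>\<^bsub>F\<^esub> u) r = a \<otimes>\<^bsub>R\<^esub> \<theta> u r) \<and>
     (\<forall>u\<in>carrier F. \<forall>v\<in>carrier F. \<forall>r\<in>carrier R.
        \<theta> (bra u v) r = \<theta> u (\<theta> v r) \<ominus>\<^bsub>R\<^esub> \<theta> v (\<theta> u r)) \<and>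
     (\<forall>a\<in>carrier R. \<forall>u\<in>carrier F. \<forall>v\<in>carrier F.
        bra u (a \<odot>\<^bsub>F\<^esub> v) = a \<odot>\<^bsub>F\<^esub> bra u v \<oplus>\<^bsub>F\<^esub> \<theta> u a \<odot>\<^bsub>F\<^esub> v)"

definition lie_algebroid_iso ::
  "'k ring \<Rightarrow>
   ('k, 'r) module \<Rightarrow> ('r, 'f) module \<Rightarrow> ('f \<Rightarrow> 'f \<Rightarrow> 'f) \<Rightarrow> ('f \<Rightarrow> 'r \<Rightarrow> 'r) \<Rightarrow>
   ('k, 's) module \<Rightarrow> ('s, 'g) module \<Rightarrow> ('g \<Rightarrow> 'g \<Rightarrow> 'g) \<Rightarrow> ('g \<Rightarrow> 's \<Rightarrow> 's) \<Rightarrow>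
   ('r \<Rightarrow> 's) \<Rightarrow> ('f \<Rightarrow> 'g) \<Rightarrow> bool" where
  "lie_algebroid_iso K R F bra \<theta> R' F' bra' \<theta>' f g \<longleftrightarrow>
     f \<in> algebra_hom K R R' \<and> bij_betw f (carrier R) (carrier R') \<and>
     bij_betw g (carrier F) (carrier F') \<and>
     (\<forall>u\<in>carrier F. \<forall>v\<in>carrier F. g (u \<oplus>\<^bsub>F\<^esub> v) = g u \<oplus>\<^bsub>F'\<^esub> g v) \<and>
     (\<forall>r\<in>carrier R. \<forall>u\<in>carrier F. g (r \<odot>\<^bsub>F\<^esub> u) = f r \<odot>\<^bsub>F'\<^esub> g u) \<and>
     (\<forall>u\<in>carrier F. \<forall>v\<in>carrier F. g (bra u v) = bra' (g u) (g v)) \<and>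
     (\<forall>u\<in>carrier F. \<forall>r\<in>carrier R. f (\<theta> u r) = \<theta>' (g u) (f r))"


section \<open>The quotient Lie algebroid\<close>

text \<open>
  Operations on cosets follow the library's \<^const>\<open>rcoset_mult\<close>: the union of the cosets of
  the results over all representatives, which is again a coset exactly when the
  operation is well defined.
\<close>

definition ideal_AdA :: "('k, 'a) module \<Rightarrow> ('a \<Rightarrow> 'a) \<Rightarrow> 'a set" where
  "ideal_AdA A d = genideal A (d ` carrier A)"

definition quot_A :: "('k, 'a) module \<Rightarrow> ('a \<Rightarrow> 'a) \<Rightarrow> ('k, 'a set) module" where
  "quot_A A d = (let I = ideal_AdA A d in \<lparr>
     carrier = carrier (A Quot I), mult = mult (A Quot I), one = one (A Quot I),
     zero = zero (A Quot I), add = add (A Quot I),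
     smult = (\<lambda>c X. \<Union>a\<in>X. I +>\<^bsub>A\<^esub> (c \<odot>\<^bsub>A\<^esub> a))\<rparr>)"

definition submodule_AdE :: "('k, 'a) module \<Rightarrow> (nat \<Rightarrow> 'a, 'e) module \<Rightarrow> 'e set" where
  "submodule_AdE A E = \<Inter> {H. submodule H A (over_A A E) \<and> del A E ` carrier E \<subseteq> H}"

definition quot_E :: "('k, 'a) module \<Rightarrow> (nat \<Rightarrow> 'a, 'e) module \<Rightarrow> ('a set, 'e set) module" where
  "quot_E A E = (let N = submodule_AdE A E in \<lparr>
     carrier = a_rcosets\<^bsub>E\<^esub> N, mult = undefined, one = undefined,
     zero = N, add = (\<lambda>X Y. X <+>\<^bsub>E\<^esub> Y),
     smult = (\<lambda>X U. \<Union>a\<in>X. \<Union>u\<in>U. N +>\<^bsub>E\<^esub> (a \<odot>\<^bsub>over_A A E\<^esub> u))\<rparr>)"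

definition quot_bracket ::
  "('k, 'a) module \<Rightarrow> (nat \<Rightarrow> 'a, 'e) module \<Rightarrow> ('e \<Rightarrow> 'e \<Rightarrow> nat \<Rightarrow> 'e) \<Rightarrow> 'e set \<Rightarrow> 'e set \<Rightarrow> 'e set" where
  "quot_bracket A E br U V = (\<Union>u\<in>U. \<Union>v\<in>V. submodule_AdE A E +>\<^bsub>E\<^esub> br u v 0)"

definition quot_anchor ::
  "('k, 'a) module \<Rightarrow> ('a \<Rightarrow> 'a) \<Rightarrow> ('e \<Rightarrow> 'a \<Rightarrow> nat \<Rightarrow> 'a) \<Rightarrow> 'e set \<Rightarrow> 'a set \<Rightarrow> 'a set" where
  "quot_anchor A d \<theta> U X = (\<Union>u\<in>U. \<Union>a\<in>X. ideal_AdA A d +>\<^bsub>A\<^esub> \<theta> u a 0)"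


section \<open>Tensor products\<close>

text \<open>
  The tensor product over \<open>R\<close> of the left \<open>S\<close>-module \<open>S\<close>, with right \<open>R\<close>-action \<open>ract\<close>, and an
  \<open>R\<close>-module \<open>F\<close>: the free abelian group on the pairs modulo the bilinearity and balancing relations,
  with \<open>S\<close> acting on the first factor.
\<close>

definition tensor_free :: "'s ring \<Rightarrow> ('r, 'f) module \<Rightarrow> ('s \<times> 'f \<Rightarrow>\<^sub>0 int) monoid" where
  "tensor_free S F = free_Abelian_group (carrier S \<times> carrier F)"

definition tensor_rels ::
  "'s ring \<Rightarrow> ('s \<Rightarrow> 'r \<Rightarrow> 's) \<Rightarrow> ('k, 'r) module \<Rightarrow> ('r, 'f) module \<Rightarrow> ('s \<times> 'f \<Rightarrow>\<^sub>0 int) set" where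
  "tensor_rels S ract R F = generate (tensor_free S F)
     ({frag_of (s \<oplus>\<^bsub>S\<^esub> t, u) - frag_of (s, u) - frag_of (t, u) | s t u.
         s \<in> carrier S \<and> t \<in> carrier S \<and> u \<in> carrier F} \<union>
      {frag_of (s, u \<oplus>\<^bsub>F\<^esub> v) - frag_of (s, u) - frag_of (s, v) | s u v.
         s \<in> carrier S \<and> u \<in> carrier F \<and> v \<in> carrier F} \<union>
      {frag_of (ract s r, u) - frag_of (s, r \<odot>\<^bsub>F\<^esub> u) | s r u.
         s \<in> carrier S \<and> r \<in> carrier R \<and> u \<in> carrier F})"

definition tensor_module ::
  "'s ring \<Rightarrow> ('s \<Rightarrow> 'r \<Rightarrow> 's) \<Rightarrow> ('k, 'r) module \<Rightarrow> ('r, 'f) module \<Rightarrow> ('s, ('s \<times> 'f \<Rightarrow>\<^sub>0 int) set) module"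
where
  "tensor_module S ract R F =
    (let G = tensor_free S F; N = tensor_rels S ract R F in \<lparr>
       carrier = carrier (G Mod N), mult = undefined, one = undefined,
       zero = one (G Mod N), add = mult (G Mod N),
       smult = (\<lambda>s X. \<Union>x\<in>X. N #>\<^bsub>G\<^esub> frag_extend (\<lambda>(t, u). frag_of (s \<otimes>\<^bsub>S\<^esub> t, u)) x)\<rparr>)"

definition tensor_elem ::
  "'s ring \<Rightarrow> ('s \<Rightarrow> 'r \<Rightarrow> 's) \<Rightarrow> ('k, 'r) module \<Rightarrow> ('r, 'f) module \<Rightarrow> 's \<Rightarrow> 'f \<Rightarrow> ('s \<times> 'f \<Rightarrow>\<^sub>0 int) set"
where
  "tensor_elem S ract R F s u = tensor_rels S ract R F #>\<^bsub>tensor_free S F\<^esub> frag_of (s, u)"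


section \<open>The current Lie conformal algebroid\<close>

definition right_action ::
  "('k, 'j) module \<Rightarrow> ('j \<Rightarrow> 'j) \<Rightarrow> ('r \<Rightarrow> 'j) \<Rightarrow> (nat \<Rightarrow> 'j) \<Rightarrow> 'r \<Rightarrow> nat \<Rightarrow> 'j" where
  "right_action J d \<iota> P r = P \<otimes>\<^bsub>diffop_ring J d\<^esub> cpoly J (\<iota> r)"

definition current_module ::
  "('k, 'r) module \<Rightarrow> ('r, 'f) module \<Rightarrow> ('k, 'j) module \<Rightarrow> ('j \<Rightarrow> 'j) \<Rightarrow> ('r \<Rightarrow> 'j)
    \<Rightarrow> (nat \<Rightarrow> 'j, ((nat \<Rightarrow> 'j) \<times> 'f \<Rightarrow>\<^sub>0 int) set) module" where
  "current_module R F J d \<iota> = tensor_module (diffop_ring J d) (right_action J d \<iota>) R F"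

definition current_emb ::
  "('k, 'r) module \<Rightarrow> ('r, 'f) module \<Rightarrow> ('k, 'j) module \<Rightarrow> ('j \<Rightarrow> 'j) \<Rightarrow> ('r \<Rightarrow> 'j)
    \<Rightarrow> 'f \<Rightarrow> ((nat \<Rightarrow> 'j) \<times> 'f \<Rightarrow>\<^sub>0 int) set" where
  "current_emb R F J d \<iota> u =
     tensor_elem (diffop_ring J d) (right_action J d \<iota>) R F \<one>\<^bsub>diffop_ring J d\<^esub> u"

definition is_current_anchor ::
  "'k ring \<Rightarrow> ('k, 'r) module \<Rightarrow> ('r, 'f) module \<Rightarrow> ('f \<Rightarrow> 'r \<Rightarrow> 'r)
    \<Rightarrow> ('k, 'j) module \<Rightarrow> ('j \<Rightarrow> 'j) \<Rightarrow> ('r \<Rightarrow> 'j)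
    \<Rightarrow> (((nat \<Rightarrow> 'j) \<times> 'f \<Rightarrow>\<^sub>0 int) set \<Rightarrow> 'j \<Rightarrow> nat \<Rightarrow> 'j) \<Rightarrow> bool" where
  "is_current_anchor K R F th J d \<iota> \<theta> \<longleftrightarrow>
     cder_module_hom K J d (current_module R F J d \<iota>) \<theta> \<and>
     (\<forall>u\<in>carrier F. \<forall>a\<in>carrier J.
        \<theta> (current_emb R F J d \<iota> u) a = der_lift K R J d \<iota> (th u) a)"

text \<open>
  The three summands of the extension formula for \<open>[a(\<partial>)u\<^sub>\<lambda> b(\<partial>)v]\<close>, in terms of
  \<open>w = [u\<^sub>\<lambda> v]\<close>, of \<open>\<phi> = \<theta>(u)\<close> and of \<open>\<psi> = \<theta>(v)\<^sup>*\<close> respectively. Each is expanded in the powers of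
  \<open>\<lambda>\<close>, \<open>x\<close>, \<open>y\<close> before the derivations are substituted.
\<close>

definition total_term1 ::
  "('k, 'a) module \<Rightarrow> ('a \<Rightarrow> 'a) \<Rightarrow> (nat \<Rightarrow> 'a, 'e) module
    \<Rightarrow> (nat \<Rightarrow> 'a) \<Rightarrow> (nat \<Rightarrow> 'a) \<Rightarrow> (nat \<Rightarrow> 'e) \<Rightarrow> nat \<Rightarrow> 'e" where
  "total_term1 A d E a b w =
     polysum E (supp A b \<times> supp E w) (\<lambda>(i, n).
       subst_xy E ((lam + xv + yv) ^ i * (lam + xv) ^ n)
         (\<lambda>q r k. ((d ^^ q) (adjoint_symbol A d a k) \<otimes>\<^bsub>A\<^esub> b i)
                    \<odot>\<^bsub>over_A A E\<^esub> ((del A E) ^^ r) (w n)))"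

definition total_term2 ::
  "('k, 'a) module \<Rightarrow> ('a \<Rightarrow> 'a) \<Rightarrow> (nat \<Rightarrow> 'a, 'e) module
    \<Rightarrow> (nat \<Rightarrow> 'a) \<Rightarrow> (nat \<Rightarrow> 'a) \<Rightarrow> ('a \<Rightarrow> nat \<Rightarrow> 'a) \<Rightarrow> 'e \<Rightarrow> nat \<Rightarrow> 'e" where
  "total_term2 A d E a b \<phi> v =
     polysum E (SIGMA i:supp A b. supp A (\<phi> (b i))) (\<lambda>(i, n).
       subst_xy E ((lam + xv) ^ n * yv ^ i)
         (\<lambda>q r k. ((d ^^ q) (adjoint_symbol A d a k) \<otimes>\<^bsub>A\<^esub> \<phi> (b i) n)
                    \<odot>\<^bsub>over_A A E\<^esub> ((del A E) ^^ r) v))"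

definition total_term3 ::
  "('k, 'a) module \<Rightarrow> ('a \<Rightarrow> 'a) \<Rightarrow> (nat \<Rightarrow> 'a, 'e) module
    \<Rightarrow> (nat \<Rightarrow> 'a) \<Rightarrow> (nat \<Rightarrow> 'a) \<Rightarrow> ('a \<Rightarrow> nat \<Rightarrow> 'a) \<Rightarrow> 'e \<Rightarrow> nat \<Rightarrow> 'e" where
  "total_term3 A d E a b \<psi> u =
     polysum E (supp A b \<times> (SIGMA i:supp A a. supp A (\<psi> (a i)))) (\<lambda>(j, i, n).
       subst_xy E ((lam + xv + yv) ^ j * (lam + xv) ^ n * xv ^ i)
         (\<lambda>q r. cpoly E ((b j \<otimes>\<^bsub>A\<^esub> (d ^^ r) (\<psi> (a i) n))
                            \<odot>\<^bsub>over_A A E\<^esub> ((del A E) ^^ q) u)))"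

definition is_current_bracket ::
  "'k ring \<Rightarrow> ('k, 'r) module \<Rightarrow> ('r, 'f) module \<Rightarrow> ('f \<Rightarrow> 'f \<Rightarrow> 'f)
    \<Rightarrow> ('k, 'j) module \<Rightarrow> ('j \<Rightarrow> 'j) \<Rightarrow> ('r \<Rightarrow> 'j)
    \<Rightarrow> (((nat \<Rightarrow> 'j) \<times> 'f \<Rightarrow>\<^sub>0 int) set \<Rightarrow> 'j \<Rightarrow> nat \<Rightarrow> 'j)
    \<Rightarrow> (((nat \<Rightarrow> 'j) \<times> 'f \<Rightarrow>\<^sub>0 int) set \<Rightarrow> ((nat \<Rightarrow> 'j) \<times> 'f \<Rightarrow>\<^sub>0 int) set
          \<Rightarrow> nat \<Rightarrow> ((nat \<Rightarrow> 'j) \<times> 'f \<Rightarrow>\<^sub>0 int) set) \<Rightarrow> bool" where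
  "is_current_bracket K R F bra J d \<iota> \<theta> br \<longleftrightarrow>
    (let E = current_module R F J d \<iota>; emb = current_emb R F J d \<iota> in
     bilinear_lambda_bracket K (over_K J (over_A J E)) br \<and>
     (\<forall>u\<in>carrier F. \<forall>v\<in>carrier F. br (emb u) (emb v) = cpoly E (emb (bra u v))) \<and>
     (\<forall>u\<in>carrier E. \<forall>v\<in>carrier E.
      \<forall>a\<in>carrier (diffop_ring J d). \<forall>b\<in>carrier (diffop_ring J d). \<forall>k.
        br (a \<odot>\<^bsub>E\<^esub> u) (b \<odot>\<^bsub>E\<^esub> v) k =
          total_term1 J d E a b (br u v) k \<oplus>\<^bsub>E\<^esub> total_term2 J d E a b (\<theta> u) v k
          \<ominus>\<^bsub>E\<^esub> total_term3 J d E a b (cder_adjoint J d (\<theta> v)) u k))"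

end

theory Submission
  imports Defs
begin

text \<open>
  The \<lambda>-bracket is forced by the total formula, so it is defined in two steps by the universal
  property of \<open>J[\<partial>] \<otimes>\<^sub>R F\<close>: first \<open>[u\<^sub>\<lambda> b(\<partial>)v]\<close> for \<open>u \<in> F\<close>, and then \<open>[a(\<partial>)u\<^sub>\<lambda> y]\<close>. This rests on the two
  commuting actions of \<open>J[\<partial>]\<close> on \<open>M[\<lambda>]\<close>, one through \<open>\<lambda>+\<partial>\<close> and one through \<open>-\<lambda>\<close>, which the substitution
  \<open>\<lambda> \<mapsto> -\<lambda>-\<partial>\<close> exchanges; that substitution is also the skew-symmetry of the bracket.

  In the Jacobi identity the roles of the three arguments can be permuted, and in its last argument it
  is stable under \<open>\<partial>\<close> and, given the compatibility of the anchor with the bracket, under multiplication by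
  functions. That compatibility is itself the Jacobi identity in the semidirect sum with the algebra, so
  it extends in the same way. Both identities thus follow from their instances for elements of \<open>F\<close>, which are the
  axioms of the Lie algebroid.

  For the quotient, \<open>R\<close> with the zero derivation is a differential algebra, so the identity of \<open>R\<close>
  extends to a retraction of the jet algebra that kills \<open>\<partial>\<close>.
\<close>

section \<open>Additive maps and polynomials\<close>

text \<open>The tensor product is a quotient of a free abelian group, so its universal property
  yields additive maps only. Hence all maps are treated as additive; K-linearity of the bracket
  returns at the end, because conformal derivations kill the constants. The obstacle of
  noncommutative scalars is avoided by presenting a module over the differential operators as a
  module over the commutative algebra with an operator \<partial> obeying the Leibniz rule. The
  action of an operator, the adjoint and the commutator with a conformal derivation are then all
  obtained in the same way, by prescribing additive maps on the coefficients of each degree. One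
  induction, over constants, multiplication by \<lambda> and sums, serves for all of them, and
  binomial coefficients appear only where the given definitions contain them. The Leibniz rules of
  the Lie algebroid enter the construction as balancing conditions over R: the rule in the second
  argument makes the bracket with an element of F well defined, and the rule in the first argument,
  where the anchor occurs through its adjoint, does the same for the other argument.\<close>

abbreviation ahom :: "('a, 's) ring_scheme \<Rightarrow> ('b, 't) ring_scheme \<Rightarrow> ('a \<Rightarrow> 'b) set" where
  "ahom M N \<equiv> hom (add_monoid M) (add_monoid N)"

lemma ahomI:
  assumes "\<And>x. x \<in> carrier M \<Longrightarrow> f x \<in> carrier N"
    and "\<And>x y. x \<in> carrier M \<Longrightarrow> y \<in> carrier M \<Longrightarrow> f (x \<oplus>\<^bsub>M\<^esub> y) = f x \<oplus>\<^bsub>N\<^esub> f y"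
  shows "f \<in> ahom M N"
  using assms by (auto simp: hom_def)

lemma ahom_closed: "f \<in> ahom M N \<Longrightarrow> x \<in> carrier M \<Longrightarrow> f x \<in> carrier N"
  by (auto simp: hom_def)

lemma ahom_add:
  "f \<in> ahom M N \<Longrightarrow> x \<in> carrier M \<Longrightarrow> y \<in> carrier M \<Longrightarrow> f (x \<oplus>\<^bsub>M\<^esub> y) = f x \<oplus>\<^bsub>N\<^esub> f y"
  by (auto simp: hom_def)

lemma ahom_comp:
  assumes "f \<in> ahom M N" "g \<in> ahom N Q"
  shows "(\<lambda>x. g (f x)) \<in> ahom M Q"
  by (rule ahomI) (simp_all add: ahom_closed[OF assms(1)] ahom_closed[OF assms(2)]
    ahom_add[OF assms(1)] ahom_add[OF assms(2)])

context
  fixes M :: "('a, 's) ring_scheme" and N :: "('b, 't) ring_scheme" and f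
  assumes M: "abelian_group M" and N: "abelian_group N" and f: "f \<in> ahom M N"
begin

interpretation M: abelian_group M by (rule M)
interpretation N: abelian_group N by (rule N)

lemma ahom_zero: "f \<zero>\<^bsub>M\<^esub> = \<zero>\<^bsub>N\<^esub>"
proof -
  have "f \<zero>\<^bsub>M\<^esub> \<oplus>\<^bsub>N\<^esub> f \<zero>\<^bsub>M\<^esub> = f \<zero>\<^bsub>M\<^esub>" by (simp flip: ahom_add[OF f])
  then show ?thesis using N.add.l_cancel_one[of "f \<zero>\<^bsub>M\<^esub>"] ahom_closed[OF f] by simp
qed

lemma ahom_minus: "x \<in> carrier M \<Longrightarrow> f (\<ominus>\<^bsub>M\<^esub> x) = \<ominus>\<^bsub>N\<^esub> f x"
  using ahom_add[OF f, of "\<ominus>\<^bsub>M\<^esub> x" x] ahom_closed[OF f]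
  by (intro N.minus_equality[symmetric]) (simp_all add: M.l_neg ahom_zero)

lemma ahom_diff: "x \<in> carrier M \<Longrightarrow> y \<in> carrier M \<Longrightarrow> f (x \<ominus>\<^bsub>M\<^esub> y) = f x \<ominus>\<^bsub>N\<^esub> f y"
  by (simp add: a_minus_def ahom_minus ahom_add[OF f])

lemma ahom_finsum:
  assumes "g \<in> I \<rightarrow> carrier M"
  shows "f (finsum M g I) = finsum N (\<lambda>i. f (g i)) I"
  using assms
proof (induction I rule: infinite_finite_induct)
  case (insert x F)
  then have g: "g x \<in> carrier M" "g \<in> F \<rightarrow> carrier M" by auto
  then have "(\<lambda>i. f (g i)) \<in> F \<rightarrow> carrier N" "f (g x) \<in> carrier N"
    using ahom_closed[OF f] by auto
  with g insert.hyps insert.IH show ?case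
    by (simp add: M.finsum_insert N.finsum_insert ahom_add[OF f] M.finsum_closed)
qed (simp_all add: ahom_zero)

lemma ahom_nat_pow: "x \<in> carrier M \<Longrightarrow> f (add_pow M (n::nat) x) = add_pow N n (f x)"
  using ahom_closed[OF f] by (induction n) (simp_all add: ahom_zero ahom_add[OF f])

lemma ahom_int_pow: "x \<in> carrier M \<Longrightarrow> f (add_pow M (k::int) x) = add_pow N k (f x)"
proof (cases k rule: int_cases2)
  case (nonneg n)
  then show "x \<in> carrier M \<Longrightarrow> ?thesis" using ahom_nat_pow[of x n] by (simp add: add_pow_def int_pow_int)
next
  case (nonpos n)
  then show "x \<in> carrier M \<Longrightarrow> ?thesis"
    using ahom_nat_pow[of x n] ahom_closed[OF f, of x]
    by (simp add: M.add.int_pow_neg_int N.add.int_pow_neg_int ahom_minus)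
qed

end

lemma (in abelian_group) add_ahom:
  assumes "f \<in> ahom M G" "g \<in> ahom M G"
  shows "(\<lambda>x. f x \<oplus> g x) \<in> ahom M G"
  by (rule ahomI) (simp_all add: ahom_closed[OF assms(1)] ahom_closed[OF assms(2)]
    ahom_add[OF assms(1)] ahom_add[OF assms(2)] a_ac)

lemma (in abelian_group) minus_ahom:
  assumes "f \<in> ahom M G"
  shows "(\<lambda>x. \<ominus> f x) \<in> ahom M G"
  by (rule ahomI) (simp_all add: ahom_closed[OF assms] ahom_add[OF assms] minus_add)

lemma (in abelian_monoid) finsum_Sigma:
  assumes "finite I" "\<And>i. i \<in> I \<Longrightarrow> finite (T i)"
    and "\<And>i j. i \<in> I \<Longrightarrow> j \<in> T i \<Longrightarrow> f i j \<in> carrier G"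
  shows "finsum G (\<lambda>(i, j). f i j) (Sigma I T) = (\<Oplus>i\<in>I. \<Oplus>j\<in>T i. f i j)"
  using assms
proof (induction I rule: finite_induct)
  case (insert x I)
  have "Sigma (insert x I) T = Pair x ` T x \<union> Sigma I T" by auto
  then have "finsum G (\<lambda>(i, j). f i j) (Sigma (insert x I) T)
      = finsum G (\<lambda>(i, j). f i j) (Pair x ` T x) \<oplus> finsum G (\<lambda>(i, j). f i j) (Sigma I T)"
    using insert.hyps insert.prems by (simp, subst finsum_Un_disjoint) (auto simp: Pi_iff)
  also have "finsum G (\<lambda>(i, j). f i j) (Pair x ` T x) = (\<Oplus>j\<in>T x. f x j)"
    using insert.prems by (subst finsum_reindex) (auto simp: inj_on_def)
  also have "finsum G (\<lambda>(i, j). f i j) (Sigma I T) = (\<Oplus>i\<in>I. \<Oplus>j\<in>T i. f i j)"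
    using insert by simp
  finally show ?case
    using insert.hyps insert.prems by (subst finsum_insert) (auto intro!: finsum_closed)
qed simp

lemma id_ahom: "(\<lambda>x. x) \<in> ahom M M"
  by (rule ahomI) auto

lemma funpow_ahom: "f \<in> ahom M M \<Longrightarrow> f ^^ n \<in> ahom M M"
  by (induction n) (auto simp: hom_def Pi_iff)

section \<open>Polynomials with coefficients in an abelian group\<close>

definition pmod :: "('a, 'm) module \<Rightarrow> ('a, nat \<Rightarrow> 'm) module" where
  "pmod M = \<lparr>carrier = up M, mult = undefined, one = undefined, zero = (\<lambda>_. \<zero>\<^bsub>M\<^esub>),
     add = (\<lambda>p q n. p n \<oplus>\<^bsub>M\<^esub> q n), smult = (\<lambda>a p n. a \<odot>\<^bsub>M\<^esub> p n)\<rparr>"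

definition lshift :: "('m, 's) ring_scheme \<Rightarrow> (nat \<Rightarrow> 'm) \<Rightarrow> nat \<Rightarrow> 'm" where
  "lshift M p = (\<lambda>n. if n = 0 then \<zero>\<^bsub>M\<^esub> else p (n - 1))"

lemma up_eq: "up M = carrier (pmod M)"
  by (simp add: pmod_def)

text \<open>Rules that read off a coefficient are kept out of the simplifier by default: most
  calculations stay in \<open>pmod M\<close>, and only a last step passes to coefficients.\<close>

named_theorems coeff

lemma pmod_apply [coeff]:
  "\<zero>\<^bsub>pmod M\<^esub> n = \<zero>\<^bsub>M\<^esub>" "(p \<oplus>\<^bsub>pmod M\<^esub> q) n = p n \<oplus>\<^bsub>M\<^esub> q n" "(a \<odot>\<^bsub>pmod M\<^esub> p) n = a \<odot>\<^bsub>M\<^esub> p n"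
  by (simp_all add: pmod_def)

lemma pmod_coeff [simp]: "p \<in> carrier (pmod M) \<Longrightarrow> p n \<in> carrier M"
  by (auto simp: pmod_def)

lemma cpoly_apply: "cpoly M x n = (if n = 0 then x else \<zero>\<^bsub>M\<^esub>)"
  by (simp add: cpoly_def)

lemma cpoly_0 [simp]: "cpoly M x 0 = x"
  by (simp add: cpoly_def)

lemma lshift_simps [simp]: "lshift M p 0 = \<zero>\<^bsub>M\<^esub>" "lshift M p (Suc n) = p n"
  by (simp_all add: lshift_def)

lemma pmod_iff:
  "p \<in> carrier (pmod M) \<longleftrightarrow> (\<forall>n. p n \<in> carrier M) \<and> finite (supp M p)"
proof
  assume p: "p \<in> carrier (pmod M)"
  then obtain n where n: "bound \<zero>\<^bsub>M\<^esub> n p" unfolding pmod_def up_def by force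
  have "supp M p \<subseteq> {..n}" using bound.bound[OF n] by (auto simp: supp_def intro: leI)
  then show "(\<forall>n. p n \<in> carrier M) \<and> finite (supp M p)" using p finite_subset by auto
next
  assume p: "(\<forall>n. p n \<in> carrier M) \<and> finite (supp M p)"
  have "bound \<zero>\<^bsub>M\<^esub> (Max (insert 0 (supp M p))) p"
  proof
    fix m assume *: "Max (insert 0 (supp M p)) < m"
    show "p m = \<zero>\<^bsub>M\<^esub>"
      using * Max_ge[of "insert 0 (supp M p)" m] p by (auto simp: supp_def)
  qed
  then have "\<exists>n. bound \<zero>\<^bsub>M\<^esub> n p" by (rule exI)
  then show "p \<in> carrier (pmod M)" using p unfolding up_eq[symmetric] by (intro mem_upI, simp_all)
qed

lemma pmodI:
  assumes "\<And>n. p n \<in> carrier M" "\<And>n. n \<notin> T \<Longrightarrow> p n = \<zero>\<^bsub>M\<^esub>" "finite T"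
  shows "p \<in> carrier (pmod M)"
proof -
  have "supp M p \<subseteq> T" using assms(2) by (auto simp: supp_def)
  then show ?thesis using assms(1,3) finite_subset by (auto simp: pmod_iff)
qed

lemma pmod_supp [simp]: "p \<in> carrier (pmod M) \<Longrightarrow> finite (supp M p)"
  by (simp add: pmod_iff)

lemma not_supp: "n \<notin> supp M p \<Longrightarrow> p n = \<zero>\<^bsub>M\<^esub>"
  by (simp add: supp_def)

lemma pmod_abelian_group:
  fixes M :: "('c, 'a) module"
  assumes "abelian_group M" shows "abelian_group (pmod M)"
proof -
  interpret M: abelian_group M by fact
  show ?thesis
  proof (rule abelian_groupI, goal_cases)
    case (1 x y)
    then show ?case by (intro pmodI[of _ _ "supp M x \<union> supp M y"]) (auto simp: not_supp coeff)
  next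
    case 2 show ?case by (rule pmodI[of _ _ "{}"]) (auto simp: coeff)
  next
    case (6 x)
    show ?case
      by (rule bexI[of _ "\<lambda>n. \<ominus>\<^bsub>M\<^esub> x n"]; (rule ext | rule pmodI[of _ _ "supp M x"]))
         (use 6 in \<open>auto simp: not_supp M.l_neg coeff\<close>)
  qed (auto intro!: ext simp: M.a_ac coeff)
qed

locale agroup = abelian_group M for M :: "('c, 'm) module" (structure)
begin

sublocale P: abelian_group "pmod M"
  by (rule pmod_abelian_group) unfold_locales

lemma pmod_minus [coeff]: "p \<in> carrier (pmod M) \<Longrightarrow> (\<ominus>\<^bsub>pmod M\<^esub> p) n = \<ominus> p n"
proof -
  assume p: "p \<in> carrier (pmod M)"
  have "(\<lambda>n. \<ominus> p n) \<in> carrier (pmod M)"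
    using p by (intro pmodI[of _ _ "supp M p"]) (auto simp: not_supp)
  then have "\<ominus>\<^bsub>pmod M\<^esub> p = (\<lambda>n. \<ominus> p n)"
    using p by (intro P.minus_equality) (auto intro!: ext simp: l_neg coeff)
  then show ?thesis by simp
qed

lemma pmod_diff [coeff]:
  "p \<in> carrier (pmod M) \<Longrightarrow> q \<in> carrier (pmod M) \<Longrightarrow> (p \<ominus>\<^bsub>pmod M\<^esub> q) n = p n \<ominus> q n"
  by (simp add: a_minus_def coeff)

lemma coeff_ahom: "(\<lambda>p. p n) \<in> ahom (pmod M) M"
  by (rule ahomI) (auto simp: coeff)

lemma pmod_finsum:
  "f \<in> I \<rightarrow> carrier (pmod M) \<Longrightarrow> finsum (pmod M) f I n = (\<Oplus>i\<in>I. f i n)"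
  by (rule ahom_finsum[OF P.abelian_group_axioms abelian_group_axioms coeff_ahom])

lemma cpoly_ahom: "cpoly M \<in> ahom M (pmod M)"
  by (rule ahomI) (auto intro!: ext pmodI[where T = "{0}"] simp: cpoly_apply coeff split: if_splits)

lemmas cpoly_closed [simp] = ahom_closed[OF cpoly_ahom]
lemmas cpoly_add = ahom_add[OF cpoly_ahom]
lemmas cpoly_zero [simp] = ahom_zero[OF abelian_group_axioms P.abelian_group_axioms cpoly_ahom]
lemmas cpoly_minus = ahom_minus[OF abelian_group_axioms P.abelian_group_axioms cpoly_ahom]

lemma lshift_ahom: "lshift M \<in> ahom (pmod M) (pmod M)"
proof (rule ahomI)
  fix x assume x: "x \<in> carrier (pmod M)"
  show "lshift M x \<in> carrier (pmod M)"
  proof (rule pmodI)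
    show "lshift M x n = \<zero>" if "n \<notin> Suc ` supp M x" for n
      using that by (cases n) (auto simp: supp_def)
  qed (use x in \<open>simp_all add: lshift_def\<close>)
qed (auto simp: lshift_def coeff)

lemmas lshift_closed [simp] = ahom_closed[OF lshift_ahom]
lemmas lshift_add = ahom_add[OF lshift_ahom]
lemmas lshift_zero [simp] = ahom_zero[OF P.abelian_group_axioms P.abelian_group_axioms lshift_ahom]
lemmas lshift_minus = ahom_minus[OF P.abelian_group_axioms P.abelian_group_axioms lshift_ahom]

text \<open>Horner's scheme p = p(0) + \<lambda> q. In the shift case a factor \<lambda> (or
  \<partial>, for differential operators) is passed on to another argument, which is why this rule
  is mostly used with that argument arbitrary.\<close>

lemma pmod_induct [consumes 1, case_names const shift add]:
  assumes p: "p \<in> carrier (pmod M)"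
    and c: "\<And>x. x \<in> carrier M \<Longrightarrow> Q (cpoly M x)"
    and s: "\<And>p. p \<in> carrier (pmod M) \<Longrightarrow> Q p \<Longrightarrow> Q (lshift M p)"
    and a: "\<And>p q. p \<in> carrier (pmod M) \<Longrightarrow> q \<in> carrier (pmod M) \<Longrightarrow> Q p \<Longrightarrow> Q q \<Longrightarrow> Q (p \<oplus>\<^bsub>pmod M\<^esub> q)"
  shows "Q p"
proof -
  obtain N where "supp M p \<subseteq> {..<N}"
    using pmod_supp[OF p] finite_nat_iff_bounded by blast
  then have "\<forall>n\<ge>N. p n = \<zero>" by (meson lessThan_iff leD not_supp subsetD)
  then show ?thesis using p
  proof (induction N arbitrary: p)
    case 0
    then have "p = cpoly M \<zero>" by (auto simp: fun_eq_iff cpoly_def coeff)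
    then show ?case using c[of \<zero>] zero_closed by metis
  next
    case (Suc N)
    \<comment> \<open>The quotient of p - p(0) by \<lambda>, of smaller degree bound.\<close>
    define q where "q = (\<lambda>n. p (Suc n))"
    have "supp M q = Suc -` supp M p" by (auto simp: q_def supp_def)
    then have q: "q \<in> carrier (pmod M)"
      using Suc.prems(2) using finite_vimageI[of "supp M p" Suc] by (intro pmod_iff[THEN iffD2]) (simp add: q_def)
    have "p = cpoly M (p 0) \<oplus>\<^bsub>pmod M\<^esub> lshift M q"
      using Suc.prems(2) by (auto simp: fun_eq_iff cpoly_def lshift_def q_def coeff gr0_conv_Suc)
    moreover have "Q q" using Suc.prems by (intro Suc.IH q) (auto simp: q_def)
    ultimately show ?case using a[of "cpoly M (p 0)" "lshift M q"] c[of "p 0"] s q Suc.prems(2)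
      by simp
  qed
qed

end

text \<open>The additive map sending x \<lambda>^i to \<open>H i x\<close>. The substitution of
  -\<lambda>-\<partial>, the action of operators, the twisted product and the commutator are all of
  this form.\<close>

definition pext ::
  "('m, 's) ring_scheme \<Rightarrow> ('n, 't) ring_scheme \<Rightarrow> (nat \<Rightarrow> 'm \<Rightarrow> 'n) \<Rightarrow> (nat \<Rightarrow> 'm) \<Rightarrow> 'n" where
  "pext M N H p = finsum N (\<lambda>i. H i (p i)) (supp M p)"

locale poly_ext = M: agroup M + N: abelian_group N
  for M :: "('c, 'm) module" and N :: "('n, 't) ring_scheme" +
  fixes H :: "nat \<Rightarrow> 'm \<Rightarrow> 'n"
  assumes H: "\<And>i. H i \<in> ahom M N"
begin

lemma H_closed [simp]: "x \<in> carrier M \<Longrightarrow> H i x \<in> carrier N"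
  using ahom_closed[OF H] .

lemma H_zero [simp]: "H i \<zero>\<^bsub>M\<^esub> = \<zero>\<^bsub>N\<^esub>"
  by (rule ahom_zero[OF M.abelian_group_axioms N.abelian_group_axioms H])

lemma superset:
  assumes "p \<in> carrier (pmod M)" "supp M p \<subseteq> T" "finite T"
  shows "pext M N H p = finsum N (\<lambda>i. H i (p i)) T"
  unfolding pext_def
  by (rule N.add.finprod_mono_neutral_cong_left) (use assms in \<open>auto simp: supp_def\<close>)

lemma ahom: "pext M N H \<in> ahom (pmod M) N"
proof (rule ahomI)
  fix p assume p: "p \<in> carrier (pmod M)"
  then show "pext M N H p \<in> carrier N"
    unfolding pext_def by (intro N.finsum_closed) auto
  fix q assume q: "q \<in> carrier (pmod M)"
  let ?T = "supp M p \<union> supp M q"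
  have sub: "supp M (p \<oplus>\<^bsub>pmod M\<^esub> q) \<subseteq> ?T" by (auto simp: supp_def coeff)
  show "pext M N H (p \<oplus>\<^bsub>pmod M\<^esub> q) = pext M N H p \<oplus>\<^bsub>N\<^esub> pext M N H q"
    using p q sub
    by (subst (1 2 3) superset[where T = ?T]) (auto simp: ahom_add[OF H] N.finsum_addf Pi_iff coeff)
qed

lemma cpoly: "x \<in> carrier M \<Longrightarrow> pext M N H (cpoly M x) = H 0 x"
  by (subst superset[where T = "{0}"]) (auto simp: supp_def cpoly_apply split: if_splits)

text \<open>Multiplication by \<lambda> only renumbers the family. If the family consists of powers
  of an operator, this moves one factor of that operator onto its argument.\<close>

lemma shift:
  assumes "p \<in> carrier (pmod M)"
  shows "pext M N H (lshift M p) = pext M N (\<lambda>i. H (Suc i)) p"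
proof -
  have "n \<in> supp M (lshift M p) \<longleftrightarrow> n \<in> Suc ` supp M p" for n
    by (cases n) (auto simp: supp_def)
  then have "supp M (lshift M p) = Suc ` supp M p" by blast
  then have "pext M N H (lshift M p) = finsum N (\<lambda>i. H i (lshift M p i)) (Suc ` supp M p)"
    by (simp add: pext_def)
  also have "\<dots> = finsum N (\<lambda>i. H (Suc i) (p i)) (supp M p)"
    using assms by (subst N.finsum_reindex) (auto simp: Pi_iff)
  finally show ?thesis by (simp add: pext_def)
qed

lemma hom:
  assumes "abelian_group Q" "f \<in> ahom N Q" "p \<in> carrier (pmod M)"
  shows "f (pext M N H p) = pext M Q (\<lambda>i x. f (H i x)) p"
  unfolding pext_def using assms
  by (intro ahom_finsum[OF N.abelian_group_axioms]) auto

end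

section \<open>Substituting \<open>-\<lambda>-\<partial>\<close> and \<open>\<lambda>+\<mu>\<close>\<close>

definition pmap :: "('a \<Rightarrow> 'b) \<Rightarrow> (nat \<Rightarrow> 'a) \<Rightarrow> nat \<Rightarrow> 'b" where
  "pmap f p = (\<lambda>n. f (p n))"

lemma pmap_apply [coeff]: "pmap f p n = f (p n)"
  by (simp add: pmap_def)

lemma pmap_ahom:
  fixes M :: "('c, 'm) module" and N :: "('d, 'n) module"
  assumes "abelian_group M" "abelian_group N" "f \<in> ahom M N"
  shows "pmap f \<in> ahom (pmod M) (pmod N)"
proof (rule ahomI)
  show "pmap f x \<in> carrier (pmod N)" if "x \<in> carrier (pmod M)" for x
    using that ahom_zero[OF assms] ahom_closed[OF assms(3)]
    by (intro pmodI[where T = "supp M x"]) (auto simp: not_supp coeff)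
qed (auto simp: coeff ahom_add[OF assms(3)])

lemma pmap_cpoly:
  assumes "abelian_group M" "abelian_group N" "f \<in> ahom M N"
  shows "pmap f (cpoly M x) = cpoly N (f x)"
  using ahom_zero[OF assms] by (auto simp: cpoly_def coeff)

lemma pmap_lshift:
  assumes "abelian_group M" "abelian_group N" "f \<in> ahom M N"
  shows "pmap f (lshift M p) = lshift N (pmap f p)"
  using ahom_zero[OF assms] by (auto simp: lshift_def coeff)

text \<open>The operator \<lambda>+\<partial>, with \<partial> acting on the coefficients.\<close>

definition ldel :: "('c, 'm) module \<Rightarrow> ('m \<Rightarrow> 'm) \<Rightarrow> (nat \<Rightarrow> 'm) \<Rightarrow> nat \<Rightarrow> 'm" where
  "ldel M D p = lshift M p \<oplus>\<^bsub>pmod M\<^esub> pmap D p"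

text \<open>p(-\<lambda>-\<partial>), with \<partial> acting on the coefficients. On symbols this is
  the adjoint; up to sign, on brackets, it is skew-symmetry.\<close>

definition flip :: "('c, 'm) module \<Rightarrow> ('m \<Rightarrow> 'm) \<Rightarrow> (nat \<Rightarrow> 'm) \<Rightarrow> nat \<Rightarrow> 'm" where
  "flip M D = pext M (pmod M) (\<lambda>n x. ((\<lambda>q. \<ominus>\<^bsub>pmod M\<^esub> ldel M D q) ^^ n) (cpoly M x))"

text \<open>If \<open>X i\<close> is the coefficient of \<open>\<lambda>\<^sup>i\<close> in \<open>X(\<lambda>, \<nu>)\<close>, then \<open>umap X\<close> is \<open>X(\<lambda>, \<lambda>+\<mu>)\<close> and
  \<open>vmap X\<close> is \<open>X(\<lambda>, \<mu>-\<lambda>)\<close>.\<close>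

definition umap :: "('m, 's) ring_scheme \<Rightarrow> (nat \<Rightarrow> nat \<Rightarrow> 'm) \<Rightarrow> nat \<Rightarrow> nat \<Rightarrow> 'm" where
  "umap M X m n = (\<Oplus>\<^bsub>M\<^esub>i\<in>{..m}. add_pow M ((m + n - i) choose n) (X i (m + n - i)))"

definition vmap :: "('m, 's) ring_scheme \<Rightarrow> (nat \<Rightarrow> nat \<Rightarrow> 'm) \<Rightarrow> nat \<Rightarrow> nat \<Rightarrow> 'm" where
  "vmap M Y m n = (\<Oplus>\<^bsub>M\<^esub>s\<in>{..m}. add_pow M ((- 1) ^ s * int ((n + s) choose n)) (Y (m - s) (n + s)))"

section \<open>The substitution of \<lambda>+\<mu> and its inverse\<close>

context agroup
begin

lemma umap_closed [simp]: "(\<And>i j. X i j \<in> carrier M) \<Longrightarrow> umap M X m n \<in> carrier M"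
  by (simp add: umap_def finsum_closed)

text \<open>Comes from X(\<lambda>,\<nu>) = X_0(\<nu>) + \<lambda> X'(\<lambda>,\<nu>): the binomial
  coefficient is the one in (\<lambda>+\<mu>)^(m+n). It allows induction on the exponent of
  \<lambda> in place of manipulating the sum.\<close>

lemma umap_rec:
  assumes X: "\<And>i j. X i j \<in> carrier M"
  shows "umap M X m n = (if m = 0 then \<zero> else umap M (\<lambda>i. X (Suc i)) (m - 1) n)
           \<oplus> add_pow M ((m + n) choose n) (X 0 (m + n))"
proof (cases m)
  case 0
  then show ?thesis using X by (simp add: umap_def)
next
  case (Suc k)
  then show ?thesis unfolding umap_def Suc using X by (subst finsum_Suc2) auto
qed

lemma umap_add:
  assumes "\<And>i j. X i j \<in> carrier M" "\<And>i j. Y i j \<in> carrier M"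
  shows "umap M (\<lambda>i. X i \<oplus>\<^bsub>pmod M\<^esub> Y i) m n = umap M X m n \<oplus> umap M Y m n"
  using assms by (simp add: umap_def add.nat_pow_distrib finsum_addf coeff)

lemma umap_hom:
  assumes "\<And>i j. X i j \<in> carrier M" "abelian_group N" "f \<in> ahom M N"
  shows "umap N (\<lambda>i. pmap f (X i)) m n = f (umap M X m n)"
  using assms by (simp add: umap_def coeff ahom_finsum[OF abelian_group_axioms assms(2,3)]
      ahom_nat_pow[OF abelian_group_axioms assms(2,3)])

lemma umap_cong: "(\<And>i j. X i j = Y i j) \<Longrightarrow> umap M X m n = umap M Y m n"
  by (simp add: umap_def)

lemma umap_minus:
  assumes "\<And>i. X i \<in> carrier (pmod M)"
  shows "umap M (\<lambda>i. \<ominus>\<^bsub>pmod M\<^esub> X i) m n = \<ominus> umap M X m n"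
  using umap_hom[OF _ abelian_group_axioms minus_ahom[OF id_ahom], of X m n] assms
  by (simp add: umap_def coeff)

text \<open>Multiplication by \<nu> turns into multiplication by \<lambda>+\<mu>; on coefficients
  this is Pascal's rule.\<close>

lemma umap_lshift:
  assumes "\<And>i j. X i j \<in> carrier M"
  shows "umap M (\<lambda>i. lshift M (X i)) m n =
    (if m = 0 then \<zero> else umap M X (m - 1) n) \<oplus> (if n = 0 then \<zero> else umap M X m (n - 1))"
  using assms
proof (induction m arbitrary: X)
  case 0
  then show ?case by (simp add: umap_def lshift_def)
next
  case (Suc m)
  let ?X = "\<lambda>i. X (Suc i)"
  have L: "lshift M (X i) j \<in> carrier M" for i j using Suc.prems by (simp add: lshift_def)
  have c: "umap M ?X k l \<in> carrier M" for k l using Suc.prems by simp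
  have "umap M (\<lambda>i. lshift M (X i)) (Suc m) n =
     (if m = 0 then \<zero> else umap M ?X (m - 1) n) \<oplus> (if n = 0 then \<zero> else umap M ?X m (n - 1))
       \<oplus> add_pow M (Suc (m + n) choose n) (X 0 (m + n))"
    using Suc.IH[of ?X] Suc.prems by (subst umap_rec[OF L]) simp
  also have "\<dots> = umap M X m n \<oplus> (if n = 0 then \<zero> else umap M X (Suc m) (n - 1))"
  proof (cases n)
    case 0
    then show ?thesis using Suc.prems c by (subst umap_rec[of X m n]) auto
  next
    case (Suc k)
    have "add_pow M (Suc (m + n) choose n) (X 0 (m + n)) =
      add_pow M ((m + n) choose n) (X 0 (m + n)) \<oplus> add_pow M ((m + n) choose k) (X 0 (m + n))"
      using Suc.prems Suc \<open>\<And>i j. X i j \<in> carrier M\<close>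
      by (simp add: add.nat_pow_mult add.commute)
    then show ?thesis using c Suc \<open>\<And>i j. X i j \<in> carrier M\<close>
      by (subst (2) umap_rec, simp, subst (3) umap_rec) (auto simp: a_ac)
  qed
  finally show ?case by simp
qed

text \<open>Only the rows i \<le> m contribute to \<lambda>^m, and each of them involves finitely
  many powers of \<mu>.\<close>

lemma umap_row_closed [simp]:
  assumes "\<And>i. X i \<in> carrier (pmod M)"
  shows "umap M X m \<in> carrier (pmod M)"
proof (rule pmodI)
  let ?T = "\<Union>i\<in>{..m}. \<Union>s\<in>supp M (X i). {..s}"
  show "finite ?T" using assms by auto
  show "umap M X m n = \<zero>" if n: "n \<notin> ?T" for n
  proof -
    have "X i (m + n - i) = \<zero>" if "i \<le> m" for i
      using n that by (intro not_supp) fastforce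
    then have "umap M X m n = (\<Oplus>i\<in>{..m}. \<zero>)"
      unfolding umap_def by (intro finsum_cong') auto
    then show ?thesis by simp
  qed
qed (use assms in auto)

lemma int_pow_zero [simp]: "add_pow M (0::int) x = \<zero>"
  by (simp add: add_pow_def)

lemma int_pow_nat_pow:
  "x \<in> carrier M \<Longrightarrow> add_pow M (k::int) (add_pow M (n::nat) x) = add_pow M (k * int n) x"
  using add.int_pow_pow[of x k "int n"] by (simp add: add_pow_def int_pow_int mult.commute)

lemma finsum_int_pow:
  fixes k :: "'i \<Rightarrow> int"
  assumes "finite I" "x \<in> carrier M"
  shows "(\<Oplus>i\<in>I. add_pow M (k i) x) = add_pow M (\<Sum>i\<in>I. k i) x"
  using assms by (induction I rule: finite_induct) (auto simp: finsum_insert add.int_pow_mult)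

text \<open>The bridge between the two forms of the compatibility of anchor and bracket: condition
  (ii) is stated with \<mu>-\<lambda>, while the proofs use \<lambda>+\<mu> as in the Jacobi
  identity.\<close>

lemma vmap_umap:
  assumes "\<And>i j. X i j \<in> carrier M"
  shows "vmap M (umap M X) m n = X m n"
  using assms
proof (induction m arbitrary: X)
  case 0
  then show ?case by (simp add: vmap_def umap_def)
next
  case (Suc m)
  let ?X = "\<lambda>i. X (Suc i)"
  let ?c = "\<lambda>s. (- 1) ^ s * int ((n + s) choose n)"
  let ?b = "\<lambda>s. add_pow M ((Suc m + n) choose (n + s)) (X 0 (Suc m + n))"
  have c: "umap M ?X k l \<in> carrier M" for k l using Suc.prems by simp
  \<comment> \<open>At \<open>s = Suc m\<close> no power of \<lambda> is left, so only the row X_0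
    contributes; hence the zero there.\<close>
  have "vmap M (umap M X) (Suc m) n = (\<Oplus>s\<in>{..Suc m}.
      add_pow M (?c s) (if s = Suc m then \<zero> else umap M ?X (m - s) (n + s)) \<oplus> add_pow M (?c s) (?b s))"
    unfolding vmap_def using Suc.prems
    by (intro finsum_cong') (auto simp: umap_rec[of X] add.int_pow_distrib c Suc_diff_le)
  also have "\<dots> = (\<Oplus>s\<in>{..Suc m}. add_pow M (?c s) (if s = Suc m then \<zero> else umap M ?X (m - s) (n + s)))
      \<oplus> (\<Oplus>s\<in>{..Suc m}. add_pow M (?c s) (?b s))"
    using Suc.prems c by (intro finsum_addf) auto
  also have "(\<Oplus>s\<in>{..Suc m}. add_pow M (?c s) (if s = Suc m then \<zero> else umap M ?X (m - s) (n + s)))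
     = vmap M (umap M ?X) m n"
    unfolding vmap_def using c by (subst finsum_Suc) (auto intro!: finsum_cong' finsum_closed)
  also have "(\<Oplus>s\<in>{..Suc m}. add_pow M (?c s) (?b s)) =
      (\<Oplus>s\<in>{..Suc m}. add_pow M (?c s * int ((Suc m + n) choose (n + s))) (X 0 (Suc m + n)))"
    using Suc.prems by (intro finsum_cong') (auto simp: int_pow_nat_pow)
  also have "\<dots> = add_pow M (\<Sum>s\<le>Suc m. ?c s * int ((Suc m + n) choose (n + s))) (X 0 (Suc m + n))"
    using Suc.prems by (intro finsum_int_pow) auto
  \<comment> \<open>Choosing n+s elements and then n among them amounts to choosing n and then s of
    the remaining ones. What is left is the alternating sum for (1-1)^(m+1).\<close>
  also have "(\<Sum>s\<le>Suc m. ?c s * int ((Suc m + n) choose (n + s))) =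
      (\<Sum>s\<le>Suc m. int ((Suc m + n) choose n) * ((- 1) ^ s * int (Suc m choose s)))"
  proof (intro sum.cong refl)
    fix s assume "s \<in> {..Suc m}"
    then have "((Suc m + n) choose (n + s)) * ((n + s) choose n) = ((Suc m + n) choose n) * (Suc m choose s)"
      using choose_mult[of n "n + s" "Suc m + n"] by simp
    then have "int ((Suc m + n) choose (n + s)) * int ((n + s) choose n) = int ((Suc m + n) choose n) * int (Suc m choose s)"
      by (metis of_nat_mult)
    then show "?c s * int ((Suc m + n) choose (n + s)) = int ((Suc m + n) choose n) * ((- 1) ^ s * int (Suc m choose s))"
      by (simp only: mult.assoc mult.left_commute mult.commute)
  qed
  also have "\<dots> = 0"
    using choose_alternating_sum[of "Suc m", where 'a = int] by (simp flip: sum_distrib_left)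
  also have "vmap M (umap M ?X) m n = X (Suc m) n" using Suc by simp
  finally show ?case using Suc.prems by simp
qed

end

section \<open>The substitution of -\<lambda>-\<partial> for \<lambda>\<close>

locale del_group = agroup M for M :: "('c, 'm) module" (structure) +
  fixes D :: "'m \<Rightarrow> 'm"
  assumes D: "D \<in> ahom M M"
begin

lemmas D_closed [simp] = ahom_closed[OF D]
lemmas D_add = ahom_add[OF D]
lemmas D_zero [simp] = ahom_zero[OF abelian_group_axioms abelian_group_axioms D]
lemmas D_minus = ahom_minus[OF abelian_group_axioms abelian_group_axioms D]

lemmas pmap_D = pmap_ahom[OF abelian_group_axioms abelian_group_axioms D]
lemmas pmap_D_closed [simp] = ahom_closed[OF pmap_D]

lemma ldel_ahom: "ldel M D \<in> ahom (pmod M) (pmod M)"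
  using P.add_ahom[OF lshift_ahom pmap_D] by (simp add: ldel_def[abs_def])

lemmas ldel_closed [simp] = ahom_closed[OF ldel_ahom]
lemmas ldel_add = ahom_add[OF ldel_ahom]
lemmas ldel_minus = ahom_minus[OF P.abelian_group_axioms P.abelian_group_axioms ldel_ahom]

lemmas ldel_zero = ahom_zero[OF P.abelian_group_axioms P.abelian_group_axioms ldel_ahom]

lemma pmap_D_lshift: "pmap D (lshift M p) = lshift M (pmap D p)"
  by (rule pmap_lshift[OF abelian_group_axioms abelian_group_axioms D])

lemma ldel_lshift: "p \<in> carrier (pmod M) \<Longrightarrow> ldel M D (lshift M p) = lshift M (ldel M D p)"
  by (simp add: ldel_def lshift_add pmap_D_lshift)

sublocale flip: poly_ext M "pmod M" "\<lambda>n x. ((\<lambda>q. \<ominus>\<^bsub>pmod M\<^esub> ldel M D q) ^^ n) (cpoly M x)"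
  by unfold_locales (rule ahom_comp[OF cpoly_ahom funpow_ahom[OF P.minus_ahom[OF ldel_ahom]]])

lemma flip_ahom: "flip M D \<in> ahom (pmod M) (pmod M)"
  unfolding flip_def by (rule flip.ahom)

lemmas flip_closed [simp] = ahom_closed[OF flip_ahom]
lemmas flip_add = ahom_add[OF flip_ahom]
lemmas flip_minus = ahom_minus[OF P.abelian_group_axioms P.abelian_group_axioms flip_ahom]
lemmas flip_zero [simp] = ahom_zero[OF P.abelian_group_axioms P.abelian_group_axioms flip_ahom]

lemma flip_cpoly [simp]: "x \<in> carrier M \<Longrightarrow> flip M D (cpoly M x) = cpoly M x"
  unfolding flip_def by (simp add: flip.cpoly)

lemma flip_lshift:
  "p \<in> carrier (pmod M) \<Longrightarrow> flip M D (lshift M p) = \<ominus>\<^bsub>pmod M\<^esub> ldel M D (flip M D p)"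
  unfolding flip_def
  by (simp add: flip.shift flip.hom[OF P.abelian_group_axioms P.minus_ahom[OF ldel_ahom]])

end

text \<open>Naturality in the coefficients. It is used for \<partial> itself, for the projections of
  the semidirect sum and for multiplication by constants.\<close>

lemma flip_hom:
  assumes "del_group M D" "del_group N D'" "f \<in> ahom M N"
    and f: "\<And>x. x \<in> carrier M \<Longrightarrow> f (D x) = D' (f x)" and p: "p \<in> carrier (pmod M)"
  shows "flip N D' (pmap f p) = pmap f (flip M D p)"
proof -
  interpret M: del_group M D by fact
  interpret N: del_group N D' by fact
  note ab = M.abelian_group_axioms N.abelian_group_axioms
  note F = pmap_ahom[OF ab assms(3)]
  note [simp] = ahom_closed[OF assms(3)] ahom_closed[OF F]
  note simps = pmap_cpoly[OF ab assms(3)] pmap_lshift[OF ab assms(3)] ahom_add[OF F]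
    ahom_minus[OF M.P.abelian_group_axioms N.P.abelian_group_axioms F]
  have L: "pmap f (ldel M D p) = ldel N D' (pmap f p)" if "p \<in> carrier (pmod M)" for p
    using that by (auto simp: ldel_def simps fun_eq_iff f coeff)
  show ?thesis using p
    by (induction p rule: M.pmod_induct) (simp_all add: simps M.flip_add N.flip_add M.flip_lshift N.flip_lshift L)
qed

context del_group
begin

lemma flip_pmap_D: "p \<in> carrier (pmod M) \<Longrightarrow> flip M D (pmap D p) = pmap D (flip M D p)"
  by (rule flip_hom) (auto intro: del_group_axioms D)

text \<open>Since (-\<lambda>-\<partial>)+\<partial> = -\<lambda>. With the rule for \<lambda> this
  makes the substitution an involution.\<close>

lemma flip_ldel:
  assumes p: "p \<in> carrier (pmod M)"
  shows "flip M D (ldel M D p) = \<ominus>\<^bsub>pmod M\<^esub> lshift M (flip M D p)"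
proof -
  have "flip M D (ldel M D p) = \<ominus>\<^bsub>pmod M\<^esub> ldel M D (flip M D p) \<oplus>\<^bsub>pmod M\<^esub> pmap D (flip M D p)"
    using p by (simp add: ldel_def[of M D p] flip_add flip_lshift flip_pmap_D)
  also have "\<dots> = \<ominus>\<^bsub>pmod M\<^esub> lshift M (flip M D p)"
    using p by (simp add: ldel_def[of M D "flip M D p"] P.minus_add P.a_assoc P.l_neg)
  finally show ?thesis .
qed

lemma flip_flip [simp]: "p \<in> carrier (pmod M) \<Longrightarrow> flip M D (flip M D p) = p"
  by (induction p rule: pmod_induct) (simp_all add: flip_add flip_lshift flip_minus flip_ldel P.minus_minus)

text \<open>The operator \<nu>+\<partial> at \<nu> = \<lambda>+\<mu> splits as \<lambda> plus
  \<mu>+\<partial>.\<close>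

lemma umap_ldel:
  assumes X: "\<And>i. X i \<in> carrier (pmod M)"
  shows "umap M (\<lambda>i. ldel M D (X i)) m n =
    (if m = 0 then \<zero> else umap M X (m - 1) n) \<oplus> ldel M D (umap M X m) n"
proof -
  have "umap M (\<lambda>i. ldel M D (X i)) m n = umap M (\<lambda>i. lshift M (X i)) m n \<oplus> umap M (\<lambda>i. pmap D (X i)) m n"
    unfolding ldel_def using X by (intro umap_add) auto
  also have "\<dots> = ((if m = 0 then \<zero> else umap M X (m - 1) n) \<oplus> (if n = 0 then \<zero> else umap M X m (n - 1)))
     \<oplus> D (umap M X m n)"
    using X by (simp add: umap_lshift umap_hom[OF _ abelian_group_axioms D])
  finally show ?thesis using X by (auto simp: ldel_def lshift_def a_assoc coeff)
qed

text \<open>The case in which X does not depend on \<lambda>: p(\<lambda>+\<mu>) becomes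
  p(\<lambda>-\<mu>-\<partial>) and then, with \<lambda>+\<mu> for \<mu>, p(-\<mu>-\<partial>). All
  powers of \<lambda> cancel.\<close>

lemma umap_flip_subst:
  assumes p: "p \<in> carrier (pmod M)"
  shows "umap M (\<lambda>i. flip M D (umap M (\<lambda>j. if j = 0 then p else \<zero>\<^bsub>pmod M\<^esub>) i)) m n =
    (if m = 0 then flip M D p n else \<zero>)"
  using p
proof (induction p arbitrary: m n rule: pmod_induct)
  case (const x)
  have *: "umap M (\<lambda>j. if j = 0 then cpoly M x else \<zero>\<^bsub>pmod M\<^esub>) i =
     (if i = 0 then cpoly M x else \<zero>\<^bsub>pmod M\<^esub>)" for i
    using const by (intro ext, subst umap_rec) (auto simp: cpoly_apply umap_def coeff)
  show ?case using const unfolding *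
    by (subst umap_rec) (auto simp: cpoly_apply umap_def coeff)
next
  case (add p q)
  let ?S = "\<lambda>p. umap M (\<lambda>j. if j = 0 then p else \<zero>\<^bsub>pmod M\<^esub>)"
  have S: "?S r i \<in> carrier (pmod M)" if "r \<in> carrier (pmod M)" for r i
    using that by simp
  have "?S (p \<oplus>\<^bsub>pmod M\<^esub> q) i = ?S p i \<oplus>\<^bsub>pmod M\<^esub> ?S q i" for i
    using add(1,2) by (intro ext, subst pmod_apply, subst umap_add[symmetric]) (auto intro!: umap_cong simp: coeff)
  then have "flip M D (?S (p \<oplus>\<^bsub>pmod M\<^esub> q) i) = flip M D (?S p i) \<oplus>\<^bsub>pmod M\<^esub> flip M D (?S q i)" for i
    using add(1,2) S by (simp add: flip_add)
  then have "umap M (\<lambda>i. flip M D (?S (p \<oplus>\<^bsub>pmod M\<^esub> q) i)) m n =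
      umap M (\<lambda>i. flip M D (?S p i)) m n \<oplus> umap M (\<lambda>i. flip M D (?S q i)) m n"
    using add(1,2) S by (simp add: umap_add)
  moreover have "flip M D (p \<oplus>\<^bsub>pmod M\<^esub> q) n = flip M D p n \<oplus> flip M D q n"
    using add(1,2) by (simp only: flip_add pmod_apply)
  ultimately show ?case by (simp add: add(3,4))
next
  case (shift p)
  let ?S = "\<lambda>p. umap M (\<lambda>j. if j = 0 then p else \<zero>\<^bsub>pmod M\<^esub>)"
  define Y where "Y = (\<lambda>i. flip M D (?S p i))"
  have Sp: "?S p i \<in> carrier (pmod M)" for i using shift(1) by simp
  then have Y: "Y i \<in> carrier (pmod M)" for i by (simp add: Y_def)
  \<comment> \<open>Y multiplied by \<lambda>: row i-1 moves to row i.\<close>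
  define Z where "Z = (\<lambda>i. if i = 0 then \<zero>\<^bsub>pmod M\<^esub> else Y (i - 1))"
  have Z: "Z i \<in> carrier (pmod M)" for i using Y by (simp add: Z_def)
  have SL: "?S (lshift M p) i = (if i = 0 then \<zero>\<^bsub>pmod M\<^esub> else ?S p (i - 1)) \<oplus>\<^bsub>pmod M\<^esub> lshift M (?S p i)" for i
  proof
    fix n
    have "?S (lshift M p) i n = umap M (\<lambda>j. lshift M (if j = 0 then p else \<zero>\<^bsub>pmod M\<^esub>)) i n"
      by (intro umap_cong) auto
    also have "\<dots> = (if i = 0 then \<zero> else ?S p (i - 1) n) \<oplus> (if n = 0 then \<zero> else ?S p i (n - 1))"
      using shift(1) by (intro umap_lshift) (auto simp: coeff)
    finally show "?S (lshift M p) i n = ((if i = 0 then \<zero>\<^bsub>pmod M\<^esub> else ?S p (i - 1)) \<oplus>\<^bsub>pmod M\<^esub> lshift M (?S p i)) n"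
      by (simp add: lshift_def coeff)
  qed
  have flipSL: "flip M D (?S (lshift M p) i) = Z i \<oplus>\<^bsub>pmod M\<^esub> (\<ominus>\<^bsub>pmod M\<^esub> ldel M D (Y i))" for i
    unfolding SL using Sp by (auto simp: flip_add flip_lshift Z_def Y_def)
  have Zu: "umap M Z m n = (if m = 0 then \<zero> else umap M Y (m - 1) n)"
    using Z Y by (subst umap_rec) (auto simp: Z_def coeff)
  have "umap M (\<lambda>i. flip M D (?S (lshift M p) i)) m n = umap M Z m n \<oplus> umap M (\<lambda>i. \<ominus>\<^bsub>pmod M\<^esub> ldel M D (Y i)) m n"
    unfolding flipSL using Z Y by (intro umap_add) auto
  \<comment> \<open>The \<lambda> that comes from \<lambda>+\<mu> inside cancels against the one
    created by the outer substitution.\<close>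
  also have "\<dots> = (if m = 0 then \<zero> else umap M Y (m - 1) n) \<ominus>
     ((if m = 0 then \<zero> else umap M Y (m - 1) n) \<oplus> ldel M D (umap M Y m) n)"
    using Y by (simp add: umap_minus umap_ldel Zu a_minus_def coeff)
  also have "\<dots> = \<ominus> ldel M D (umap M Y m) n"
    using Y by (simp add: a_minus_def minus_add r_neg2 coeff)
  also have "umap M Y m = (if m = 0 then flip M D p else \<zero>\<^bsub>pmod M\<^esub>)"
    using shift(2) by (auto simp: Y_def fun_eq_iff coeff)
  finally show ?case
    using shift(1) ldel_zero by (cases "m = 0") (simp_all add: flip_lshift, simp_all add: coeff)
qed

text \<open>The substitution \<open>\<mu> \<mapsto> -\<lambda>-\<mu>-\<partial>\<close>, which is \<open>umap\<close> after \<open>flip\<close>, is an involution.\<close>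

lemma umap_flip_umap:
  assumes "\<And>i. X i \<in> carrier (pmod M)"
  shows "umap M (\<lambda>i. flip M D (umap M X i)) m n = flip M D (X m) n"
  using assms
proof (induction m arbitrary: X)
  case 0
  have "umap M X 0 = X 0" using 0 by (auto simp: umap_def fun_eq_iff)
  then show ?case using 0 umap_row_closed[OF 0] by (simp add: umap_def)
next
  case (Suc m)
  let ?X = "\<lambda>i. X (Suc i)"
  let ?S = "umap M (\<lambda>j. if j = 0 then X 0 else \<zero>\<^bsub>pmod M\<^esub>)"
  \<comment> \<open>X is split as X_0 + \<lambda> X'. The part X_0 contributes to \<lambda>^0 only,
    by the preceding case, and Z is the contribution of \<lambda> X'.\<close>
  define Z where "Z = (\<lambda>i. if i = 0 then \<zero>\<^bsub>pmod M\<^esub> else flip M D (umap M ?X (i - 1)))"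
  have Z: "Z i \<in> carrier (pmod M)" for i using Suc.prems by (simp add: Z_def)
  have S: "?S i \<in> carrier (pmod M)" for i using Suc.prems by simp
  have S': "?S i n = add_pow M ((i + n) choose n) (X 0 (i + n))" for i n
    using Suc.prems by (subst umap_rec) (auto simp: umap_def coeff)
  have "umap M X i = (if i = 0 then \<zero>\<^bsub>pmod M\<^esub> else umap M ?X (i - 1)) \<oplus>\<^bsub>pmod M\<^esub> ?S i" for i
    using Suc.prems by (intro ext, subst umap_rec) (auto simp: S' coeff)
  then have "flip M D (umap M X i) = Z i \<oplus>\<^bsub>pmod M\<^esub> flip M D (?S i)" for i
    using Suc.prems S by (simp add: flip_add Z_def)
  then have "umap M (\<lambda>i. flip M D (umap M X i)) (Suc m) n = umap M Z (Suc m) n \<oplus>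
      umap M (\<lambda>i. flip M D (?S i)) (Suc m) n"
    using Z S by (simp add: umap_add)
  also have "\<dots> = umap M Z (Suc m) n"
    using Suc.prems Z by (simp add: umap_flip_subst coeff)
  also have "\<dots> = umap M (\<lambda>i. flip M D (umap M ?X i)) m n"
    using Suc.prems Z by (subst umap_rec) (auto simp: Z_def coeff)
  finally show ?case using Suc.IH[of ?X] Suc.prems by simp
qed

end

section \<open>Modules over the ring of differential operators\<close>

locale diff_ring = del_group A d + cring A
  for A :: "('k, 'a) module" (structure) and d :: "'a \<Rightarrow> 'a" +
  assumes d_mult: "a \<in> carrier A \<Longrightarrow> b \<in> carrier A \<Longrightarrow> d (a \<otimes> b) = d a \<otimes> b \<oplus> a \<otimes> d b"
begin

lemma d_one [simp]: "d \<one> = \<zero>"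
proof -
  have "d \<one> \<oplus> d \<one> = d \<one>" using d_mult[of \<one> \<one>] by simp
  then show ?thesis using add.l_cancel_one[of "d \<one>" "d \<one>"] by simp
qed

end

text \<open>The Leibniz rule expresses the defining relation \<partial> a = a \<partial> +
  \<partial>(a) of the operator ring, so these data amount to a left
  \<open>A[\<partial>]\<close>-module with all scalars commutative; \<open>act\<close> recovers the
  operators.\<close>

locale diff_module = del_group M D + Q: diff_ring A d + V: module A M
  for A :: "('k, 'a) module" and d :: "'a \<Rightarrow> 'a" and M :: "('a, 'm) module" (structure) and D +
  assumes D_smult:
    "a \<in> carrier A \<Longrightarrow> x \<in> carrier M \<Longrightarrow> D (a \<odot> x) = d a \<odot> x \<oplus> a \<odot> D x"

lemma diff_moduleI:
  assumes "diff_ring A d" "module A M" "D \<in> ahom M M"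
    and "\<And>a x. a \<in> carrier A \<Longrightarrow> x \<in> carrier M \<Longrightarrow> D (a \<odot>\<^bsub>M\<^esub> x) = d a \<odot>\<^bsub>M\<^esub> x \<oplus>\<^bsub>M\<^esub> a \<odot>\<^bsub>M\<^esub> D x"
  shows "diff_module A d M D"
proof -
  interpret diff_ring A d by fact
  interpret V: module A M by fact
  show ?thesis by unfold_locales (use assms in auto)
qed

text \<open>The scalars of the record \<open>A\<close> are those of the ground field; here
  \<open>A\<close> acts on itself by multiplication.\<close>

definition selfm :: "('k, 'a) module \<Rightarrow> ('a, 'a) module" where
  "selfm A = \<lparr>carrier = carrier A, mult = mult A, one = one A, zero = zero A, add = add A, smult = mult A\<rparr>"

lemma selfm_simps [simp]:
  "carrier (selfm A) = carrier A" "mult (selfm A) = mult A" "one (selfm A) = one A"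
  "zero (selfm A) = zero A" "add (selfm A) = add A" "smult (selfm A) = mult A"
  by (simp_all add: selfm_def)

lemma selfm_derived [simp]:
  "finsum (selfm A) = finsum A" "a_inv (selfm A) = a_inv A" "a_minus (selfm A) = a_minus A"
  "(add_pow (selfm A) :: nat \<Rightarrow> _) = add_pow A" "(add_pow (selfm A) :: int \<Rightarrow> _) = add_pow A"
  "supp (selfm A) = supp A" "cpoly (selfm A) = cpoly A" "lshift (selfm A) = lshift A" "up (selfm A) = up A"
  by (auto simp: finsum_def finprod_def a_inv_def m_inv_def a_minus_def add_pow_def nat_pow_def
      int_pow_def Let_def supp_def cpoly_def lshift_def up_def fun_eq_iff)

lemma selfm_pmod [simp]:
  "carrier (pmod (selfm A)) = carrier (pmod A)" "zero (pmod (selfm A)) = zero (pmod A)"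
  "add (pmod (selfm A)) = add (pmod A)"
  by (simp_all add: pmod_def)

lemma selfm_pmod_derived [simp]:
  "finsum (pmod (selfm A)) = finsum (pmod A)" "a_inv (pmod (selfm A)) = a_inv (pmod A)"
  "a_minus (pmod (selfm A)) = a_minus (pmod A)"
  by (auto simp: finsum_def finprod_def a_inv_def m_inv_def a_minus_def fun_eq_iff)

lemma selfm_ldel [simp]: "ldel (selfm A) d = ldel A d" "flip (selfm A) d = flip A d"
  by (auto simp: ldel_def flip_def pext_def fun_eq_iff)

definition act ::
  "('k, 'a) module \<Rightarrow> ('a, 'm) module \<Rightarrow> ('m \<Rightarrow> 'm) \<Rightarrow> (nat \<Rightarrow> 'a) \<Rightarrow> 'm \<Rightarrow> 'm" where
  "act A M D P x = pext A M (\<lambda>i a. a \<odot>\<^bsub>M\<^esub> (D ^^ i) x) P"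

context diff_module
begin

lemma smult_ahom: "a \<in> carrier A \<Longrightarrow> smult M a \<in> ahom M M"
  by (rule ahomI) (auto simp: V.smult_r_distr)

lemma smult_ahom_l: "x \<in> carrier M \<Longrightarrow> (\<lambda>a. a \<odot> x) \<in> ahom A M"
  by (rule ahomI) (auto simp: V.smult_l_distr)

lemma funpow_D_closed [simp]: "x \<in> carrier M \<Longrightarrow> (D ^^ i) x \<in> carrier M"
  by (rule ahom_closed[OF funpow_ahom[OF D]])

lemma act_ext: "x \<in> carrier M \<Longrightarrow> poly_ext A M (\<lambda>i a. a \<odot> (D ^^ i) x)"
  by unfold_locales (rule smult_ahom_l, simp)

lemma act_ahom_l: "x \<in> carrier M \<Longrightarrow> (\<lambda>P. act A M D P x) \<in> ahom (pmod A) M"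
  unfolding act_def using poly_ext.ahom[OF act_ext] by simp

lemma act_closed [simp]: "x \<in> carrier M \<Longrightarrow> P \<in> carrier (pmod A) \<Longrightarrow> act A M D P x \<in> carrier M"
  using ahom_closed[OF act_ahom_l] by simp

lemma act_add_l: "x \<in> carrier M \<Longrightarrow> P \<in> carrier (pmod A) \<Longrightarrow> P' \<in> carrier (pmod A)
    \<Longrightarrow> act A M D (P \<oplus>\<^bsub>pmod A\<^esub> P') x = act A M D P x \<oplus> act A M D P' x"
  using ahom_add[OF act_ahom_l] by simp

lemma act_cpoly [simp]: "x \<in> carrier M \<Longrightarrow> a \<in> carrier A \<Longrightarrow> act A M D (cpoly A a) x = a \<odot> x"
  by (simp add: act_def poly_ext.cpoly[OF act_ext])

text \<open>Multiplying a symbol by the indeterminate composes the operator with \<partial> on the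
  right.\<close>

lemma act_lshift: "x \<in> carrier M \<Longrightarrow> P \<in> carrier (pmod A) \<Longrightarrow> act A M D (lshift A P) x = act A M D P (D x)"
  by (simp add: act_def poly_ext.shift[OF act_ext] funpow_swap1)

lemma act_add_r:
  assumes "x \<in> carrier M" "y \<in> carrier M" "P \<in> carrier (pmod A)"
  shows "act A M D P (x \<oplus> y) = act A M D P x \<oplus> act A M D P y"
  using assms(3,1,2)
  by (induction P arbitrary: x y rule: Q.pmod_induct)
    (simp_all add: V.smult_r_distr act_lshift D_add act_add_l a_ac)

lemma act_one: "x \<in> carrier M \<Longrightarrow> act A M D (cpoly A \<one>\<^bsub>A\<^esub>) x = x"
  by simp

lemma del_op_eq: "del_op A = lshift A (cpoly A \<one>\<^bsub>A\<^esub>)"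
  by (auto simp: del_op_def lshift_def cpoly_def)

lemma act_del_op: "x \<in> carrier M \<Longrightarrow> act A M D (del_op A) x = D x"
  by (simp add: del_op_eq act_lshift)

lemma module_pmod: "module A (pmod M)"
proof (rule moduleI[OF Q.is_cring P.abelian_group_axioms])
  fix a p assume "a \<in> carrier A" "p \<in> carrier (pmod M)"
  then show "a \<odot>\<^bsub>pmod M\<^esub> p \<in> carrier (pmod M)"
    by (intro pmodI[where T = "supp M p"]) (auto simp: not_supp coeff)
qed (auto intro!: ext simp: coeff V.smult_l_distr V.smult_r_distr V.smult_assoc1)

lemma lshift_smult: "a \<in> carrier A \<Longrightarrow> lshift M (a \<odot>\<^bsub>pmod M\<^esub> p) = a \<odot>\<^bsub>pmod M\<^esub> lshift M p"
  by (auto simp: lshift_def coeff)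

text \<open>One of the two actions on \<open>M[\<lambda>]\<close>. For M = A it is left
  multiplication of differential operators.\<close>

lemma diff_module_pmod: "diff_module A d (pmod M) (ldel M D)"
proof (rule diff_moduleI[OF Q.diff_ring_axioms module_pmod ldel_ahom])
  interpret N: module A "pmod M" by (rule module_pmod)
  fix a p assume *: "a \<in> carrier A" "p \<in> carrier (pmod M)"
  have "pmap D (a \<odot>\<^bsub>pmod M\<^esub> p) = d a \<odot>\<^bsub>pmod M\<^esub> p \<oplus>\<^bsub>pmod M\<^esub> a \<odot>\<^bsub>pmod M\<^esub> pmap D p"
    using * by (auto simp: coeff D_smult)
  then show "ldel M D (a \<odot>\<^bsub>pmod M\<^esub> p) = d a \<odot>\<^bsub>pmod M\<^esub> p \<oplus>\<^bsub>pmod M\<^esub> a \<odot>\<^bsub>pmod M\<^esub> ldel M D p"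
    using * by (simp add: ldel_def lshift_smult N.smult_r_distr P.a_ac)
qed

end

lemma (in diff_ring) diff_module_self: "diff_module A d (selfm A) d"
proof -
  have ab: "abelian_group (selfm A)"
    by (rule abelian_groupI) (auto simp: a_ac intro: l_neg)
  have m: "module A (selfm A)"
    by (rule moduleI[OF is_cring ab]) (auto simp: l_distr r_distr m_assoc)
  have d: "d \<in> ahom (selfm A) (selfm A)"
    by (rule ahomI) (auto simp: D_add)
  show ?thesis
    by (rule diff_moduleI[OF diff_ring_axioms m d]) (auto simp: d_mult)
qed

text \<open>Compatibility with scalars and with \<partial> suffices for compatibility with all
  operators. Most commutation rules below are instances in which \<open>f\<close> is itself a
  substitution or an action.\<close>

lemma act_hom:
  assumes "diff_module A d M D" "diff_module A d N D'" "f \<in> ahom M N"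
    and "\<And>a x. a \<in> carrier A \<Longrightarrow> x \<in> carrier M \<Longrightarrow> f (a \<odot>\<^bsub>M\<^esub> x) = a \<odot>\<^bsub>N\<^esub> f x"
    and "\<And>x. x \<in> carrier M \<Longrightarrow> f (D x) = D' (f x)"
    and "P \<in> carrier (pmod A)" "x \<in> carrier M"
  shows "f (act A M D P x) = act A N D' P (f x)"
proof -
  interpret M: diff_module A d M D by fact
  interpret N: diff_module A d N D' by fact
  show ?thesis using assms(6,7)
    by (induction P arbitrary: x rule: M.Q.pmod_induct)
      (simp_all add: M.act_lshift N.act_lshift M.act_add_l N.act_add_l
        ahom_closed[OF assms(3)] ahom_add[OF assms(3)] assms(4,5))
qed

text \<open>Composition of differential operators is the action of \<open>A[\<partial>]\<close> on itself.\<close>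

definition opmul :: "('k, 'a) module \<Rightarrow> ('a \<Rightarrow> 'a) \<Rightarrow> (nat \<Rightarrow> 'a) \<Rightarrow> (nat \<Rightarrow> 'a) \<Rightarrow> nat \<Rightarrow> 'a" where
  "opmul A d = act A (pmod (selfm A)) (ldel A d)"

context diff_ring
begin

interpretation S: diff_module A d "selfm A" d by (rule diff_module_self)

lemma diff_module_opmul: "diff_module A d (pmod (selfm A)) (ldel A d)"
  using S.diff_module_pmod by simp

interpretation O: diff_module A d "pmod (selfm A)" "ldel A d" by (rule diff_module_opmul)

lemma opmul_closed [simp]:
  "P \<in> carrier (pmod A) \<Longrightarrow> Q \<in> carrier (pmod A) \<Longrightarrow> opmul A d P Q \<in> carrier (pmod A)"
  using O.act_closed by (simp add: opmul_def)

lemma opmul_add_l: "P \<in> carrier (pmod A) \<Longrightarrow> Q \<in> carrier (pmod A) \<Longrightarrow> Q' \<in> carrier (pmod A)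
    \<Longrightarrow> opmul A d (P \<oplus>\<^bsub>pmod A\<^esub> Q) Q' = opmul A d P Q' \<oplus>\<^bsub>pmod A\<^esub> opmul A d Q Q'"
  using O.act_add_l by (simp add: opmul_def)

lemma opmul_add_r: "P \<in> carrier (pmod A) \<Longrightarrow> Q \<in> carrier (pmod A) \<Longrightarrow> Q' \<in> carrier (pmod A)
    \<Longrightarrow> opmul A d P (Q \<oplus>\<^bsub>pmod A\<^esub> Q') = opmul A d P Q \<oplus>\<^bsub>pmod A\<^esub> opmul A d P Q'"
  using O.act_add_r by (simp add: opmul_def)

lemma opmul_cpoly: "a \<in> carrier A \<Longrightarrow> Q \<in> carrier (pmod A) \<Longrightarrow> opmul A d (cpoly A a) Q = a \<odot>\<^bsub>pmod (selfm A)\<^esub> Q"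
  by (simp add: opmul_def)

lemma opmul_lshift: "P \<in> carrier (pmod A) \<Longrightarrow> Q \<in> carrier (pmod A)
    \<Longrightarrow> opmul A d (lshift A P) Q = opmul A d P (ldel A d Q)"
  using O.act_lshift by (simp add: opmul_def)

lemma smult_pmod_closed [simp]: "a \<in> carrier A \<Longrightarrow> Q \<in> carrier (pmod A) \<Longrightarrow> a \<odot>\<^bsub>pmod (selfm A)\<^esub> Q \<in> carrier (pmod A)"
  using O.V.smult_closed by simp

lemma smult_cpoly: "a \<in> carrier A \<Longrightarrow> a \<odot>\<^bsub>pmod (selfm A)\<^esub> cpoly A b = cpoly A (a \<otimes> b)"
  by (auto simp: coeff cpoly_def)

lemma smult_lshift: "a \<in> carrier A \<Longrightarrow> a \<odot>\<^bsub>pmod (selfm A)\<^esub> lshift A Q = lshift A (a \<odot>\<^bsub>pmod (selfm A)\<^esub> Q)"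
  using S.lshift_smult[of a Q] by simp

lemma ldel_cpoly: "a \<in> carrier A \<Longrightarrow> ldel A d (cpoly A a) = lshift A (cpoly A a) \<oplus>\<^bsub>pmod A\<^esub> cpoly A (d a)"
  by (simp add: ldel_def pmap_cpoly[OF abelian_group_axioms abelian_group_axioms D])

lemma opmul_lshift_r: "P \<in> carrier (pmod A) \<Longrightarrow> Q \<in> carrier (pmod A)
    \<Longrightarrow> opmul A d P (lshift A Q) = lshift A (opmul A d P Q)"
proof -
  have h: "lshift A \<in> ahom (pmod (selfm A)) (pmod (selfm A))"
    by (rule ahomI) (auto simp: lshift_add)
  show "P \<in> carrier (pmod A) \<Longrightarrow> Q \<in> carrier (pmod A) \<Longrightarrow> ?thesis"
    unfolding opmul_def
    by (rule act_hom[OF diff_module_opmul diff_module_opmul h, symmetric])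
       (auto simp: smult_lshift ldel_lshift)
qed

lemma opmul_cpoly_cpoly: "a \<in> carrier A \<Longrightarrow> b \<in> carrier A \<Longrightarrow> opmul A d (cpoly A a) (cpoly A b) = cpoly A (a \<otimes> b)"
  by (simp add: opmul_cpoly smult_cpoly)

lemma opmul_one: "P \<in> carrier (pmod A) \<Longrightarrow> opmul A d P (cpoly A \<one>) = P"
proof (induction P rule: pmod_induct)
  case (shift P)
  then show ?case by (simp add: opmul_lshift ldel_cpoly P.r_zero opmul_lshift_r flip: pmod_apply)
qed (simp_all add: opmul_cpoly_cpoly opmul_add_l)

lemma opmul_one_l: "P \<in> carrier (pmod A) \<Longrightarrow> opmul A d (cpoly A \<one>) P = P"
  using O.act_one by (simp add: opmul_def)

end

context diff_module
begin

lemma act_smult: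
  assumes "P \<in> carrier (pmod A)" "a \<in> carrier A" "x \<in> carrier M"
  shows "act A M D (a \<odot>\<^bsub>pmod (selfm A)\<^esub> P) x = a \<odot> act A M D P x"
  using assms(1,3)
proof (induction P arbitrary: x rule: Q.pmod_induct)
  case (add P P')
  interpret O: diff_module A d "pmod (selfm A)" "ldel A d" by (rule Q.diff_module_opmul)
  show ?case using add assms(2) O.V.smult_r_distr[of a P P'] by (simp add: act_add_l V.smult_r_distr)
qed (use assms(2) in \<open>simp_all add: Q.smult_cpoly Q.smult_lshift V.smult_assoc1 act_lshift\<close>)

lemma act_ldel:
  assumes "P \<in> carrier (pmod A)" "x \<in> carrier M"
  shows "act A M D (ldel A d P) x = D (act A M D P x)"
  using assms
  by (induction P arbitrary: x rule: Q.pmod_induct)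
    (simp_all add: Q.ldel_cpoly D_smult act_add_l act_lshift Q.ldel_lshift Q.ldel_add D_add a_comm)

text \<open>Composition is an instance of \<open>act\<close>, so the same statement, applied to the
  operators themselves, is associativity of the operator ring.\<close>

lemma act_opmul:
  assumes "P \<in> carrier (pmod A)" "P' \<in> carrier (pmod A)" "x \<in> carrier M"
  shows "act A M D (opmul A d P P') x = act A M D P (act A M D P' x)"
  using assms
  by (induction P arbitrary: P' x rule: Q.pmod_induct)
    (simp_all add: Q.opmul_cpoly act_smult Q.opmul_lshift act_lshift act_ldel Q.opmul_add_l act_add_l)

end

section \<open>The explicit product of differential operators\<close>

context diff_ring
begin

text \<open>The binomial theorem for the commuting operators \<lambda> and \<partial>.\<close>

lemma funpow_ldel:
  assumes Q: "Q \<in> carrier (pmod A)"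
  shows "(ldel A d ^^ i) Q n = (\<Oplus>j\<in>{..n}. add_pow A (i choose (n - j)) ((d ^^ (i - (n - j))) (Q j)))"
proof (induction i arbitrary: n)
  case 0
  have "(\<Oplus>j\<in>{..n}. add_pow A (0 choose (n - j)) ((d ^^ (0 - (n - j))) (Q j))) = (\<Oplus>j\<in>{..n}. if n = j then Q j else \<zero>)"
    using Q by (intro finsum_cong') (auto simp: binomial_eq_0)
  also have "\<dots> = Q n" using Q by (subst finsum_singleton) auto
  finally show ?case by simp
next
  case (Suc i)
  interpret S: diff_module A d "selfm A" d by (rule diff_module_self)
  have dc [simp]: "a \<in> carrier A \<Longrightarrow> (d ^^ k) a \<in> carrier A" for k a using S.funpow_D_closed by simp
  have lc: "(ldel A d ^^ i) Q \<in> carrier (pmod A)" by (rule ahom_closed[OF funpow_ahom[OF ldel_ahom] Q])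
  define t where "t k j l = add_pow A (i choose k) ((d ^^ l) (Q j))" for k j l
  have tc [simp]: "t k j l \<in> carrier A" for k j l using Q by (simp add: t_def)
  have dt: "d (t k j l) = t k j (Suc l)" for k j l
    using Q by (simp add: t_def ahom_nat_pow[OF abelian_group_axioms abelian_group_axioms D])
  have dd: "d (\<Oplus>j\<in>{..n}. t (n - j) j (i - (n - j))) = (\<Oplus>j\<in>{..n}. t (n - j) j (Suc i - (n - j)))"
    for n
  proof -
    have "d (t (n - j) j (i - (n - j))) = t (n - j) j (Suc i - (n - j))" for j
    proof (cases "n - j \<le> i")
      case False then show ?thesis by (simp add: t_def binomial_eq_0)
    qed (simp add: dt Suc_diff_le)
    then show ?thesis
      using ahom_finsum[OF abelian_group_axioms abelian_group_axioms D, of "\<lambda>j. t (n - j) j (i - (n - j))" "{..n}"]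
      by simp
  qed
  show ?case
  proof (cases n)
    case 0
    have "t 0 0 i \<in> carrier A" "t 0 0 (Suc i) \<in> carrier A" by simp_all
    then show ?thesis
      using 0 Suc[of 0] lc dt[of 0 0 i] by (simp add: ldel_def[of A d "(ldel A d ^^ i) Q"] coeff t_def)
  next
    case n: (Suc m)
    have "(ldel A d ^^ Suc i) Q n = (ldel A d ^^ i) Q m \<oplus> d ((ldel A d ^^ i) Q n)"
      by (simp add: ldel_def coeff n)
    also have "\<dots> = (\<Oplus>j\<in>{..m}. t (m - j) j (i - (m - j))) \<oplus> (\<Oplus>j\<in>{..n}. t (n - j) j (Suc i - (n - j)))"
      using dd[of n] by (simp add: Suc t_def)
    also have "(\<Oplus>j\<in>{..n}. t (n - j) j (Suc i - (n - j))) = t 0 n (Suc i) \<oplus> (\<Oplus>j\<in>{..m}. t (n - j) j (Suc i - (n - j)))"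
      by (simp add: n)
    also have "(\<Oplus>j\<in>{..m}. t (m - j) j (i - (m - j))) \<oplus> (t 0 n (Suc i) \<oplus> (\<Oplus>j\<in>{..m}. t (n - j) j (Suc i - (n - j))))
      = t 0 n (Suc i) \<oplus> ((\<Oplus>j\<in>{..m}. t (m - j) j (i - (m - j))) \<oplus> (\<Oplus>j\<in>{..m}. t (n - j) j (Suc i - (n - j))))"
      by (simp add: a_lcomm finsum_closed)
    also have "(\<Oplus>j\<in>{..m}. t (m - j) j (i - (m - j))) \<oplus> (\<Oplus>j\<in>{..m}. t (n - j) j (Suc i - (n - j)))
      = (\<Oplus>j\<in>{..m}. t (m - j) j (i - (m - j)) \<oplus> t (n - j) j (Suc i - (n - j)))"
      by (simp add: finsum_addf)
    also have "\<dots> = (\<Oplus>j\<in>{..m}. add_pow A (Suc i choose (n - j)) ((d ^^ (Suc i - (n - j))) (Q j)))"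
      using Q by (intro finsum_cong') (auto simp: t_def n Suc_diff_le add.nat_pow_mult)
    finally show ?thesis using Q by (simp add: n t_def)
  qed
qed

text \<open>Connects the closed formula in \<open>diffop_ring\<close> with the recursive
  composition, which is used from here on.\<close>

lemma mult_diffop_ring:
  assumes P: "P \<in> carrier (pmod A)" and Q: "Q \<in> carrier (pmod A)"
  shows "mult (diffop_ring A d) P Q = opmul A d P Q"
proof
  fix n
  interpret S: diff_module A d "selfm A" d by (rule diff_module_self)
  have dc [simp]: "a \<in> carrier A \<Longrightarrow> (d ^^ k) a \<in> carrier A" for k a using S.funpow_D_closed by simp
  have lc: "(ldel A d ^^ i) Q \<in> carrier (pmod A)" for i by (rule ahom_closed[OF funpow_ahom[OF ldel_ahom] Q])
  have "opmul A d P Q n = (\<Oplus>i\<in>supp A P. P i \<otimes> (ldel A d ^^ i) Q n)"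
    unfolding opmul_def act_def pext_def using P lc
    by (simp, subst pmod_finsum) (auto simp: coeff)
  also have "\<dots> = (\<Oplus>i\<in>supp A P. \<Oplus>j\<in>{j. j \<le> n \<and> n \<le> i + j}. add_pow A (i choose (i + j - n)) (P i \<otimes> (d ^^ (i + j - n)) (Q j)))"
  proof (rule finsum_cong'[OF refl])
    fix i
    have "P i \<otimes> (ldel A d ^^ i) Q n = (\<Oplus>j\<in>{..n}. P i \<otimes> add_pow A (i choose (n - j)) ((d ^^ (i - (n - j))) (Q j)))"
      using P Q by (subst funpow_ldel[OF Q]) (simp add: finsum_rdistr)
    also have "\<dots> = (\<Oplus>j\<in>{j. j \<le> n \<and> n \<le> i + j}. P i \<otimes> add_pow A (i choose (n - j)) ((d ^^ (i - (n - j))) (Q j)))"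
      using P Q by (intro add.finprod_mono_neutral_cong_right) (auto simp: binomial_eq_0)
    also have "\<dots> = (\<Oplus>j\<in>{j. j \<le> n \<and> n \<le> i + j}. add_pow A (i choose (i + j - n)) (P i \<otimes> (d ^^ (i + j - n)) (Q j)))"
    proof (rule finsum_cong'[OF refl])
      fix j assume j: "j \<in> {j. j \<le> n \<and> n \<le> i + j}"
      \<comment> \<open>The definition counts the derivatives that fall on the coefficient, the
        expansion counts the remaining factors; the binomial coefficient is symmetric in the
        two.\<close>
      then have "i - (n - j) = i + j - n" "(i choose (n - j)) = (i choose (i + j - n))"
        using binomial_symmetric[of "n - j" i] by auto
      then show "P i \<otimes> add_pow A (i choose (n - j)) ((d ^^ (i - (n - j))) (Q j)) =
         add_pow A (i choose (i + j - n)) (P i \<otimes> (d ^^ (i + j - n)) (Q j))"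
        using P Q by (simp add: add_pow_rdistr)
    qed (use P Q in auto)
    finally show "P i \<otimes> (ldel A d ^^ i) Q n = (\<Oplus>j\<in>{j. j \<le> n \<and> n \<le> i + j}. add_pow A (i choose (i + j - n)) (P i \<otimes> (d ^^ (i + j - n)) (Q j)))" .
  qed (use P Q in \<open>auto intro!: finsum_closed\<close>)
  also have "\<dots> = finsum A (\<lambda>(i, j). add_pow A (i choose (i + j - n)) (P i \<otimes> (d ^^ (i + j - n)) (Q j)))
      (SIGMA i:supp A P. {j. j \<le> n \<and> n \<le> i + j})"
    using P Q by (subst finsum_Sigma) auto
  also have "(SIGMA i:supp A P. {j. j \<le> n \<and> n \<le> i + j}) = {(i, j). i \<in> supp A P \<and> j \<le> n \<and> n \<le> i + j}"
    by auto
  finally show "mult (diffop_ring A d) P Q n = opmul A d P Q n"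
    by (simp add: diffop_ring_def)
qed

lemma diffop_simps [simp]:
  "carrier (diffop_ring A d) = carrier (pmod A)" "\<zero>\<^bsub>diffop_ring A d\<^esub> = \<zero>\<^bsub>pmod A\<^esub>"
  "add (diffop_ring A d) = add (pmod A)" "\<one>\<^bsub>diffop_ring A d\<^esub> = cpoly A \<one>"
  by (simp_all add: diffop_ring_def pmod_def)

lemma diffop_abelian_group: "abelian_group (diffop_ring A d)"
  by (rule abelian_groupI) (auto simp: P.a_ac intro: P.l_neg P.a_inv_closed)

lemma ring_diffop_ring: "ring (diffop_ring A d)"
proof (rule ringI[OF diffop_abelian_group])
  interpret O: diff_module A d "pmod (selfm A)" "ldel A d" by (rule diff_module_opmul)
  show "monoid (diffop_ring A d)"
    using O.act_opmul by unfold_locales (auto simp: mult_diffop_ring opmul_one opmul_one_l, simp add: opmul_def)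
qed (auto simp: mult_diffop_ring opmul_add_l opmul_add_r)

end

lemma restrict_scalars_simps [simp]:
  "carrier (restrict_scalars h M) = carrier M" "mult (restrict_scalars h M) = mult M"
  "one (restrict_scalars h M) = one M" "zero (restrict_scalars h M) = zero M"
  "add (restrict_scalars h M) = add M" "c \<odot>\<^bsub>restrict_scalars h M\<^esub> x = h c \<odot>\<^bsub>M\<^esub> x"
  by (simp_all add: restrict_scalars_def)

lemma restrict_scalars_derived [simp]:
  "finsum (restrict_scalars h A) = finsum A" "a_inv (restrict_scalars h A) = a_inv A" "a_minus (restrict_scalars h A) = a_minus A"
  "(add_pow (restrict_scalars h A) :: nat \<Rightarrow> _) = add_pow A" "(add_pow (restrict_scalars h A) :: int \<Rightarrow> _) = add_pow A"
  "supp (restrict_scalars h A) = supp A" "cpoly (restrict_scalars h A) = cpoly A"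
  "lshift (restrict_scalars h A) = lshift A" "up (restrict_scalars h A) = up A"
  by (auto simp: finsum_def finprod_def a_inv_def m_inv_def a_minus_def add_pow_def nat_pow_def
      int_pow_def Let_def supp_def cpoly_def lshift_def up_def fun_eq_iff)

lemma module_over_K:
  assumes "algebra K A" "module A M"
  shows "module K (over_K A M)"
proof -
  interpret algebra K A by fact
  interpret V: module A M by fact
  show ?thesis
  proof (rule moduleI[OF R.is_cring])
    show "abelian_group (over_K A M)"
      by (rule abelian_groupI) (auto simp: V.M.a_ac intro: V.M.l_neg)
    fix a b x assume *: "a \<in> carrier K" "b \<in> carrier K" "x \<in> carrier (over_K A M)"
    have "(a \<otimes>\<^bsub>K\<^esub> b) \<odot>\<^bsub>A\<^esub> \<one>\<^bsub>A\<^esub> = (a \<odot>\<^bsub>A\<^esub> \<one>\<^bsub>A\<^esub>) \<otimes>\<^bsub>A\<^esub> (b \<odot>\<^bsub>A\<^esub> \<one>\<^bsub>A\<^esub>)"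
      using * by (simp add: smult_assoc1 smult_assoc2)
    then show "(a \<otimes>\<^bsub>K\<^esub> b) \<odot>\<^bsub>over_K A M\<^esub> x = a \<odot>\<^bsub>over_K A M\<^esub> (b \<odot>\<^bsub>over_K A M\<^esub> x)"
      using * by (simp add: V.smult_assoc1)
  qed (auto simp: smult_l_distr V.smult_l_distr V.smult_r_distr)
qed

section \<open>Left modules over the ring of differential operators\<close>

locale diffop_module = diff_ring A d + E: left_module "diffop_ring A d" E
  for A :: "('k, 'a) module" (structure) and d and E :: "(nat \<Rightarrow> 'a, 'e) module"
begin

lemma E_closed [simp]: "P \<in> carrier (pmod A) \<Longrightarrow> x \<in> carrier E \<Longrightarrow> P \<odot>\<^bsub>E\<^esub> x \<in> carrier E"
  using E.smult_closed by simp

lemma E_assoc: "P \<in> carrier (pmod A) \<Longrightarrow> Q \<in> carrier (pmod A) \<Longrightarrow> x \<in> carrier E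
    \<Longrightarrow> P \<odot>\<^bsub>E\<^esub> (Q \<odot>\<^bsub>E\<^esub> x) = opmul A d P Q \<odot>\<^bsub>E\<^esub> x"
  using E.smult_assoc[of P Q x] by (simp add: mult_diffop_ring)

lemma del_op_eq: "del_op A = lshift A (cpoly A \<one>)"
  by (auto simp: del_op_def lshift_def cpoly_def)

lemma diff_module_E: "diff_module A d (over_A A E) (del A E)"
proof (rule diff_moduleI[OF diff_ring_axioms])
  show "module A (over_A A E)"
  proof (rule moduleI[OF is_cring])
    show "abelian_group (over_A A E)"
      by (rule abelian_groupI) (auto simp: E.M.a_ac intro: E.M.l_neg)
  qed (use E.smult_one in \<open>auto simp: E_assoc opmul_cpoly_cpoly E.smult_r_distr cpoly_add E.smult_l_distr[simplified]\<close>)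
  show "del A E \<in> ahom (over_A A E) (over_A A E)"
    by (rule ahomI) (auto simp: del_op_eq E.smult_r_distr)
  fix a x assume *: "a \<in> carrier A" "x \<in> carrier (over_A A E)"
  then have "del A E (a \<odot>\<^bsub>over_A A E\<^esub> x) = opmul A d (del_op A) (cpoly A a) \<odot>\<^bsub>E\<^esub> x"
    by (simp add: E_assoc del_op_eq)
  \<comment> \<open>The relation \<partial> a = a \<partial> + \<partial>(a) in the operator ring,
    from which the Leibniz rule is read off.\<close>
  also have "opmul A d (del_op A) (cpoly A a) = lshift A (cpoly A a) \<oplus>\<^bsub>pmod A\<^esub> cpoly A (d a)"
    using * by (simp add: del_op_eq opmul_lshift opmul_one_l ldel_cpoly)
  also have "lshift A (cpoly A a) = opmul A d (cpoly A a) (del_op A)"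
    using * by (simp add: del_op_eq opmul_cpoly smult_lshift smult_cpoly)
  finally show "del A E (a \<odot>\<^bsub>over_A A E\<^esub> x) = d a \<odot>\<^bsub>over_A A E\<^esub> x \<oplus>\<^bsub>over_A A E\<^esub> a \<odot>\<^bsub>over_A A E\<^esub> del A E x"
    using * by (simp add: E.smult_l_distr[simplified] E_assoc del_op_eq E.M.a_comm)
qed

text \<open>An operator is a sum of products of scalars and powers of \<partial>, so its action is
  determined by these; calculations with the given scalar multiplication can thus be done with
  \<open>act\<close>.\<close>

lemma smult_eq_act:
  assumes "P \<in> carrier (pmod A)" "x \<in> carrier E"
  shows "P \<odot>\<^bsub>E\<^esub> x = act A (over_A A E) (del A E) P x"
proof -
  interpret D: diff_module A d "over_A A E" "del A E" by (rule diff_module_E)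
  show ?thesis using assms
  proof (induction P arbitrary: x rule: pmod_induct)
    case (shift P)
    have "lshift A P = opmul A d P (del_op A)"
      using shift by (simp add: del_op_eq opmul_lshift_r opmul_one)
    then have "lshift A P \<odot>\<^bsub>E\<^esub> x = P \<odot>\<^bsub>E\<^esub> del A E x"
      using shift by (simp add: E_assoc del_op_eq)
    then show ?case using shift D.act_lshift[of x P] by (simp add: del_op_eq)
  next
    case (const a) then show ?case using D.act_cpoly[of x a] by simp
  next
    case (add P Q) then show ?case using D.act_add_l[of x P Q] by (simp add: E.smult_l_distr[simplified])
  qed
qed

end

section \<open>The two module structures on \<open>M[\<lambda>]\<close>\<close>

text \<open>
  On \<open>M[\<lambda>]\<close> there are two commuting actions of \<open>A[\<partial>]\<close>: the one on the coefficients, with \<open>\<partial>\<close> acting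
  as \<open>\<lambda>+\<partial>\<close>, and the one of \<open>(a(\<partial>)p)(\<lambda>) = (|\<^sub>x\<^sub>=\<^sub>\<partial> a\<^sup>*(\<lambda>)) p(\<lambda>+x)\<close>, with \<open>\<partial>\<close> acting as \<open>-\<lambda>\<close>. The
  substitution of \<open>-\<lambda>-\<partial>\<close> for \<open>\<lambda>\<close> exchanges them.
\<close>

definition pairm :: "('a, 'm) module \<Rightarrow> (nat \<Rightarrow> 'a) \<Rightarrow> 'm \<Rightarrow> nat \<Rightarrow> 'm" where
  "pairm M f x = (\<lambda>n. f n \<odot>\<^bsub>M\<^esub> x)"

text \<open>The expression f(\<lambda>) p(\<lambda>+x) with x = \<partial> acting on f: the power
  (\<lambda>+x)^n is applied to f, and the result, evaluated on the n-th coefficient of p by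
  \<open>pairm\<close>, is summed over n.\<close>

definition conv ::
  "('k, 'a) module \<Rightarrow> ('a \<Rightarrow> 'a) \<Rightarrow> ('a, 'm) module \<Rightarrow> (nat \<Rightarrow> 'a) \<Rightarrow> (nat \<Rightarrow> 'm) \<Rightarrow> nat \<Rightarrow> 'm" where
  "conv A d M f p = pext M (pmod M) (\<lambda>n x. pairm M ((ldel A d ^^ n) f) x) p"

text \<open>The same polynomials, with a scalar a acting by a p(\<lambda>+x), where x = \<partial>
  acts on a. The operator \<partial> is to act as -\<lambda>, its own adjoint symbol.\<close>

definition pmod1 :: "('k, 'a) module \<Rightarrow> ('a \<Rightarrow> 'a) \<Rightarrow> ('a, 'm) module \<Rightarrow> ('a, nat \<Rightarrow> 'm) module" where
  "pmod1 A d M = (pmod M)\<lparr>smult := \<lambda>a. conv A d M (cpoly A a)\<rparr>"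

definition del1 :: "('a, 'm) module \<Rightarrow> (nat \<Rightarrow> 'm) \<Rightarrow> nat \<Rightarrow> 'm" where
  "del1 M p = \<ominus>\<^bsub>pmod M\<^esub> lshift M p"

definition act1 ::
  "('k, 'a) module \<Rightarrow> ('a \<Rightarrow> 'a) \<Rightarrow> ('a, 'm) module \<Rightarrow> (nat \<Rightarrow> 'a) \<Rightarrow> (nat \<Rightarrow> 'm) \<Rightarrow> nat \<Rightarrow> 'm" where
  "act1 A d M = act A (pmod1 A d M) (del1 M)"

definition act2 ::
  "('k, 'a) module \<Rightarrow> ('a, 'm) module \<Rightarrow> ('m \<Rightarrow> 'm) \<Rightarrow> (nat \<Rightarrow> 'a) \<Rightarrow> (nat \<Rightarrow> 'm) \<Rightarrow> nat \<Rightarrow> 'm" where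
  "act2 A M D = act A (pmod M) (ldel M D)"

lemma pmod1_simps [simp]:
  "carrier (pmod1 A d M) = carrier (pmod M)" "zero (pmod1 A d M) = zero (pmod M)"
  "add (pmod1 A d M) = add (pmod M)" "a \<odot>\<^bsub>pmod1 A d M\<^esub> p = conv A d M (cpoly A a) p"
  by (simp_all add: pmod1_def)

lemma (in abelian_group) minus_add_cancel:
  assumes "x \<in> carrier G" "y \<in> carrier G"
  shows "\<ominus> (x \<oplus> y) \<oplus> x = \<ominus> y"
proof -
  have "\<ominus> (x \<oplus> y) \<oplus> x = \<ominus> y \<oplus> (x \<oplus> \<ominus> x)"
    using assms by (simp add: minus_add a_ac)
  then show ?thesis using assms by (simp add: r_neg)
qed

context diff_module
begin

lemma pairm_ahom: "f \<in> carrier (pmod A) \<Longrightarrow> pairm M f \<in> ahom M (pmod M)"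
  by (rule ahomI, rule pmodI[where T = "supp A f"])
    (auto simp: pairm_def not_supp coeff V.smult_r_distr)

lemmas pairm_closed [simp] = ahom_closed[OF pairm_ahom]
lemmas pairm_add_r = ahom_add[OF pairm_ahom]

lemma pairm_ahom_l: "x \<in> carrier M \<Longrightarrow> (\<lambda>f. pairm M f x) \<in> ahom (pmod A) (pmod M)"
  by (rule ahomI, simp) (auto simp: pairm_def coeff V.smult_l_distr)

lemmas pairm_add_l = ahom_add[OF pairm_ahom_l]
lemmas pairm_minus_l = ahom_minus[OF Q.P.abelian_group_axioms P.abelian_group_axioms pairm_ahom_l]

lemma pairm_cpoly: "x \<in> carrier M \<Longrightarrow> pairm M (cpoly A a) x = cpoly M (a \<odot> x)"
  by (auto simp: pairm_def cpoly_def)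

lemma pairm_lshift: "x \<in> carrier M \<Longrightarrow> pairm M (lshift A f) x = lshift M (pairm M f x)"
  by (auto simp: pairm_def lshift_def)

lemma pairm_smult_l: "x \<in> carrier M \<Longrightarrow> a \<in> carrier A \<Longrightarrow> f \<in> carrier (pmod A) \<Longrightarrow>
   pairm M (a \<odot>\<^bsub>pmod (selfm A)\<^esub> f) x = a \<odot>\<^bsub>pmod M\<^esub> pairm M f x"
  by (auto simp: pairm_def coeff V.smult_assoc1)

lemma pairm_smult_r: "x \<in> carrier M \<Longrightarrow> a \<in> carrier A \<Longrightarrow> f \<in> carrier (pmod A) \<Longrightarrow>
   pairm M f (a \<odot> x) = a \<odot>\<^bsub>pmod M\<^esub> pairm M f x"
  by (auto simp: pairm_def coeff Q.m_comm simp flip: V.smult_assoc1)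

lemma ldel_pairm: "x \<in> carrier M \<Longrightarrow> f \<in> carrier (pmod A) \<Longrightarrow>
   ldel M D (pairm M f x) = pairm M (ldel A d f) x \<oplus>\<^bsub>pmod M\<^esub> pairm M f (D x)"
  by (auto simp: ldel_def pairm_def coeff lshift_def D_smult V.smult_l_distr a_assoc)

lemma Q_funpow_ldel [simp]: "f \<in> carrier (pmod A) \<Longrightarrow> (ldel A d ^^ n) f \<in> carrier (pmod A)"
  by (rule ahom_closed[OF funpow_ahom[OF Q.ldel_ahom]])

lemma conv_ext: "f \<in> carrier (pmod A) \<Longrightarrow> poly_ext M (pmod M) (\<lambda>n x. pairm M ((ldel A d ^^ n) f) x)"
  by unfold_locales (simp add: pairm_ahom)

lemma conv_ahom: "f \<in> carrier (pmod A) \<Longrightarrow> conv A d M f \<in> ahom (pmod M) (pmod M)"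
  using poly_ext.ahom[OF conv_ext] by (simp add: conv_def[abs_def])

lemmas conv_closed [simp] = ahom_closed[OF conv_ahom]
lemmas conv_add_r = ahom_add[OF conv_ahom]
lemmas conv_minus_r = ahom_minus[OF P.abelian_group_axioms P.abelian_group_axioms conv_ahom]

lemma conv_cpoly: "f \<in> carrier (pmod A) \<Longrightarrow> x \<in> carrier M \<Longrightarrow> conv A d M f (cpoly M x) = pairm M f x"
  by (simp add: conv_def poly_ext.cpoly[OF conv_ext])

lemma conv_lshift: "f \<in> carrier (pmod A) \<Longrightarrow> p \<in> carrier (pmod M) \<Longrightarrow>
    conv A d M f (lshift M p) = conv A d M (ldel A d f) p"
  by (simp add: conv_def poly_ext.shift[OF conv_ext] funpow_swap1)

lemma conv_add_l:
  assumes "p \<in> carrier (pmod M)" "f \<in> carrier (pmod A)" "g \<in> carrier (pmod A)"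
  shows "conv A d M (f \<oplus>\<^bsub>pmod A\<^esub> g) p = conv A d M f p \<oplus>\<^bsub>pmod M\<^esub> conv A d M g p"
  using assms
  by (induction p arbitrary: f g rule: pmod_induct)
    (simp_all add: conv_cpoly pairm_add_l conv_lshift Q.ldel_add conv_add_r P.a_ac)

lemma conv_ahom_l: "p \<in> carrier (pmod M) \<Longrightarrow> (\<lambda>f. conv A d M f p) \<in> ahom (pmod A) (pmod M)"
  by (rule ahomI) (auto simp: conv_add_l)

lemmas conv_minus_l = ahom_minus[OF Q.P.abelian_group_axioms P.abelian_group_axioms conv_ahom_l]

lemma lshift_conv:
  assumes "p \<in> carrier (pmod M)" "f \<in> carrier (pmod A)"
  shows "conv A d M (lshift A f) p = lshift M (conv A d M f p)"
  using assms
  by (induction p arbitrary: f rule: pmod_induct)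
    (simp_all add: conv_cpoly pairm_lshift conv_lshift Q.ldel_lshift lshift_add conv_add_r)

lemma star_cpoly: "a \<in> carrier A \<Longrightarrow> x \<in> carrier M \<Longrightarrow> conv A d M (cpoly A a) (cpoly M x) = cpoly M (a \<odot> x)"
  by (simp add: conv_cpoly pairm_cpoly)

text \<open>Moving \<lambda> past a twisted scalar differentiates the scalar. This is the Leibniz
  rule for the operator -\<lambda>.\<close>

lemma star_lshift: "a \<in> carrier A \<Longrightarrow> p \<in> carrier (pmod M) \<Longrightarrow> conv A d M (cpoly A a) (lshift M p) =
    lshift M (conv A d M (cpoly A a) p) \<oplus>\<^bsub>pmod M\<^esub> conv A d M (cpoly A (d a)) p"
  by (simp add: conv_lshift Q.ldel_cpoly conv_add_l lshift_conv)

lemma star_add: "a \<in> carrier A \<Longrightarrow> b \<in> carrier A \<Longrightarrow> p \<in> carrier (pmod M) \<Longrightarrow>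
   conv A d M (cpoly A (a \<oplus>\<^bsub>A\<^esub> b)) p = conv A d M (cpoly A a) p \<oplus>\<^bsub>pmod M\<^esub> conv A d M (cpoly A b) p"
  by (simp add: Q.cpoly_add conv_add_l)

lemma star_assoc:
  assumes "p \<in> carrier (pmod M)" "a \<in> carrier A" "b \<in> carrier A"
  shows "conv A d M (cpoly A (a \<otimes>\<^bsub>A\<^esub> b)) p = conv A d M (cpoly A a) (conv A d M (cpoly A b) p)"
  using assms
  by (induction p arbitrary: a b rule: pmod_induct)
    (simp_all add: star_cpoly star_lshift V.smult_assoc1 conv_add_r Q.d_mult star_add P.a_ac lshift_add)

lemma star_one: "p \<in> carrier (pmod M) \<Longrightarrow> conv A d M (cpoly A \<one>\<^bsub>A\<^esub>) p = p"
proof (induction p rule: pmod_induct)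
  case (shift p)
  have "conv A d M \<zero>\<^bsub>pmod A\<^esub> p = \<zero>\<^bsub>pmod M\<^esub>"
    by (rule ahom_zero[OF Q.P.abelian_group_axioms P.abelian_group_axioms conv_ahom_l[OF shift(1)]])
  then show ?case using shift by (simp add: star_lshift P.r_zero)
qed (simp_all add: star_cpoly conv_add_r)

lemma diff_module_pmod1: "diff_module A d (pmod1 A d M) (del1 M)"
proof (rule diff_moduleI[OF Q.diff_ring_axioms])
  have ab: "abelian_group (pmod1 A d M)"
    by (rule abelian_groupI) (auto simp: P.a_ac intro: P.l_neg P.a_inv_closed)
  show "module A (pmod1 A d M)"
    by (rule moduleI[OF Q.is_cring ab]) (simp_all add: star_add conv_add_r star_assoc star_one)
  show "del1 M \<in> ahom (pmod1 A d M) (pmod1 A d M)"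
    by (rule ahomI) (auto simp: del1_def lshift_add P.minus_add)
  fix a p assume "a \<in> carrier A" "p \<in> carrier (pmod1 A d M)"
  then show "del1 M (a \<odot>\<^bsub>pmod1 A d M\<^esub> p) = d a \<odot>\<^bsub>pmod1 A d M\<^esub> p \<oplus>\<^bsub>pmod1 A d M\<^esub> a \<odot>\<^bsub>pmod1 A d M\<^esub> del1 M p"
    by (simp add: del1_def conv_minus_r star_lshift P.minus_add P.a_lcomm[of "conv A d M (cpoly A (d a)) p"] P.r_neg)
qed

lemma star_smult:
  assumes "p \<in> carrier (pmod M)" "a \<in> carrier A" "b \<in> carrier A"
  shows "conv A d M (cpoly A a) (b \<odot>\<^bsub>pmod M\<^esub> p) = b \<odot>\<^bsub>pmod M\<^esub> conv A d M (cpoly A a) p"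
proof -
  interpret N: module A "pmod M" by (rule module_pmod)
  have c: "b \<odot>\<^bsub>pmod M\<^esub> cpoly M x = cpoly M (b \<odot> x)" for x
    using assms(3) by (auto simp: coeff cpoly_def)
  show ?thesis using assms(1,2)
  proof (induction p arbitrary: a rule: pmod_induct)
    case (const x)
    have "a \<odot> (b \<odot> x) = b \<odot> (a \<odot> x)" using const assms(3) Q.m_comm by (simp flip: V.smult_assoc1)
    then show ?case using const assms(3) by (simp add: c star_cpoly)
  qed (use assms(3) in \<open>simp_all add: star_lshift N.smult_r_distr conv_add_r flip: lshift_smult\<close>)
qed

lemma ldel_cpoly: "x \<in> carrier M \<Longrightarrow> ldel M D (cpoly M x) = lshift M (cpoly M x) \<oplus>\<^bsub>pmod M\<^esub> cpoly M (D x)"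
  by (simp add: ldel_def pmap_cpoly[OF abelian_group_axioms abelian_group_axioms D])

lemma star_ldel:
  assumes "p \<in> carrier (pmod M)" "a \<in> carrier A"
  shows "conv A d M (cpoly A a) (ldel M D p) = ldel M D (conv A d M (cpoly A a) p)"
  using assms
  by (induction p arbitrary: a rule: pmod_induct)
    (simp_all add: ldel_cpoly star_cpoly conv_add_r star_lshift cpoly_add D_smult ldel_lshift ldel_add P.a_ac)

text \<open>In -\<lambda>-\<partial> the operator \<partial> differentiates the scalar together with
  the coefficient; the derivatives of the scalar created this way cancel those in the twisted
  action.\<close>

lemma flip_star:
  assumes "p \<in> carrier (pmod M)" "a \<in> carrier A"
  shows "flip M D (conv A d M (cpoly A a) p) = a \<odot>\<^bsub>pmod M\<^esub> flip M D p"
proof -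
  interpret N: diff_module A d "pmod M" "ldel M D" by (rule diff_module_pmod)
  have c: "a \<odot>\<^bsub>pmod M\<^esub> cpoly M x = cpoly M (a \<odot> x)" if "a \<in> carrier A" for a x
    using that by (auto simp: coeff cpoly_def)
  have m: "a \<odot>\<^bsub>pmod M\<^esub> (\<ominus>\<^bsub>pmod M\<^esub> q) = \<ominus>\<^bsub>pmod M\<^esub> (a \<odot>\<^bsub>pmod M\<^esub> q)"
    if "a \<in> carrier A" "q \<in> carrier (pmod M)" for a q
    using that by (rule N.V.smult_r_minus)
  show ?thesis using assms
  proof (induction p arbitrary: a rule: pmod_induct)
    case (shift p)
    then show ?case
      by (simp add: star_lshift flip_lshift flip_add m N.D_smult P.minus_add_cancel)
  qed (simp_all add: c star_cpoly conv_add_r flip_add N.V.smult_r_distr)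
qed

lemma pmod_smult_closed [simp]: "a \<in> carrier A \<Longrightarrow> p \<in> carrier (pmod M) \<Longrightarrow> a \<odot>\<^bsub>pmod M\<^esub> p \<in> carrier (pmod M)"
  by (rule module.smult_closed[OF module_pmod])

lemma act2_closed [simp]: "P \<in> carrier (pmod A) \<Longrightarrow> p \<in> carrier (pmod M) \<Longrightarrow> act2 A M D P p \<in> carrier (pmod M)"
  unfolding act2_def by (rule diff_module.act_closed[OF diff_module_pmod])

lemma act1_closed [simp]: "P \<in> carrier (pmod A) \<Longrightarrow> p \<in> carrier (pmod M) \<Longrightarrow> act1 A d M P p \<in> carrier (pmod M)"
  unfolding act1_def using diff_module.act_closed[OF diff_module_pmod1] by simp

lemma act2_add_r: "P \<in> carrier (pmod A) \<Longrightarrow> p \<in> carrier (pmod M) \<Longrightarrow> q \<in> carrier (pmod M) \<Longrightarrow>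
    act2 A M D P (p \<oplus>\<^bsub>pmod M\<^esub> q) = act2 A M D P p \<oplus>\<^bsub>pmod M\<^esub> act2 A M D P q"
  unfolding act2_def by (rule diff_module.act_add_r[OF diff_module_pmod])

lemma act1_add_r: "P \<in> carrier (pmod A) \<Longrightarrow> p \<in> carrier (pmod M) \<Longrightarrow> q \<in> carrier (pmod M) \<Longrightarrow>
    act1 A d M P (p \<oplus>\<^bsub>pmod M\<^esub> q) = act1 A d M P p \<oplus>\<^bsub>pmod M\<^esub> act1 A d M P q"
  unfolding act1_def using diff_module.act_add_r[OF diff_module_pmod1] by simp

lemma act2_ahom: "P \<in> carrier (pmod A) \<Longrightarrow> act2 A M D P \<in> ahom (pmod M) (pmod M)"
  by (rule ahomI) (auto simp: act2_add_r)

lemma act1_ahom: "P \<in> carrier (pmod A) \<Longrightarrow> act1 A d M P \<in> ahom (pmod M) (pmod M)"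
  by (rule ahomI) (auto simp: act1_add_r)

lemmas act1_minus = ahom_minus[OF P.abelian_group_axioms P.abelian_group_axioms act1_ahom]
lemmas act2_minus = ahom_minus[OF P.abelian_group_axioms P.abelian_group_axioms act2_ahom]

lemma act2_add_l: "P \<in> carrier (pmod A) \<Longrightarrow> P' \<in> carrier (pmod A) \<Longrightarrow> p \<in> carrier (pmod M) \<Longrightarrow>
    act2 A M D (P \<oplus>\<^bsub>pmod A\<^esub> P') p = act2 A M D P p \<oplus>\<^bsub>pmod M\<^esub> act2 A M D P' p"
  unfolding act2_def by (rule diff_module.act_add_l[OF diff_module_pmod])

lemma act1_add_l: "P \<in> carrier (pmod A) \<Longrightarrow> P' \<in> carrier (pmod A) \<Longrightarrow> p \<in> carrier (pmod M) \<Longrightarrow>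
    act1 A d M (P \<oplus>\<^bsub>pmod A\<^esub> P') p = act1 A d M P p \<oplus>\<^bsub>pmod M\<^esub> act1 A d M P' p"
  unfolding act1_def using diff_module.act_add_l[OF diff_module_pmod1] by simp

lemma act2_cpoly: "a \<in> carrier A \<Longrightarrow> p \<in> carrier (pmod M) \<Longrightarrow> act2 A M D (cpoly A a) p = a \<odot>\<^bsub>pmod M\<^esub> p"
  unfolding act2_def by (rule diff_module.act_cpoly[OF diff_module_pmod])

lemma act1_cpoly: "a \<in> carrier A \<Longrightarrow> p \<in> carrier (pmod M) \<Longrightarrow> act1 A d M (cpoly A a) p = conv A d M (cpoly A a) p"
  unfolding act1_def using diff_module.act_cpoly[OF diff_module_pmod1] by simp

lemma act2_lshift: "P \<in> carrier (pmod A) \<Longrightarrow> p \<in> carrier (pmod M) \<Longrightarrow> act2 A M D (lshift A P) p = act2 A M D P (ldel M D p)"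
  unfolding act2_def by (rule diff_module.act_lshift[OF diff_module_pmod])

lemma act1_lshift: "P \<in> carrier (pmod A) \<Longrightarrow> p \<in> carrier (pmod M) \<Longrightarrow> act1 A d M (lshift A P) p = act1 A d M P (del1 M p)"
  unfolding act1_def using diff_module.act_lshift[OF diff_module_pmod1] by simp

lemma act2_opmul: "P \<in> carrier (pmod A) \<Longrightarrow> P' \<in> carrier (pmod A) \<Longrightarrow> p \<in> carrier (pmod M) \<Longrightarrow>
    act2 A M D (opmul A d P P') p = act2 A M D P (act2 A M D P' p)"
  unfolding act2_def by (rule diff_module.act_opmul[OF diff_module_pmod])

lemma act1_opmul: "P \<in> carrier (pmod A) \<Longrightarrow> P' \<in> carrier (pmod A) \<Longrightarrow> p \<in> carrier (pmod M) \<Longrightarrow>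
    act1 A d M (opmul A d P P') p = act1 A d M P (act1 A d M P' p)"
  unfolding act1_def using diff_module.act_opmul[OF diff_module_pmod1] by simp

text \<open>The substitution is a module isomorphism: it takes twisted scalars to ordinary ones and
  -\<lambda> to \<lambda>+\<partial>.\<close>

lemma flip_act1:
  assumes "P \<in> carrier (pmod A)" "p \<in> carrier (pmod M)"
  shows "flip M D (act1 A d M P p) = act2 A M D P (flip M D p)"
  unfolding act1_def act2_def
proof (rule act_hom[OF diff_module_pmod1 diff_module_pmod])
  show "flip M D \<in> ahom (pmod1 A d M) (pmod M)" by (rule ahomI) (auto simp: flip_add)
qed (use assms in \<open>auto simp: flip_star del1_def flip_minus flip_lshift P.minus_minus\<close>)

lemma flip_act2:
  assumes "P \<in> carrier (pmod A)" "p \<in> carrier (pmod M)"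
  shows "flip M D (act2 A M D P p) = act1 A d M P (flip M D p)"
  using flip_act1[of P "flip M D p"] assms flip_flip[of "act1 A d M P (flip M D p)"] by simp

lemma act2_star:
  assumes "P \<in> carrier (pmod A)" "p \<in> carrier (pmod M)" "a \<in> carrier A"
  shows "conv A d M (cpoly A a) (act2 A M D P p) = act2 A M D P (conv A d M (cpoly A a) p)"
  unfolding act2_def
  by (rule act_hom[OF diff_module_pmod diff_module_pmod])
    (use assms in \<open>auto simp: conv_ahom star_smult star_ldel\<close>)

lemma act2_lshift_r:
  assumes "P \<in> carrier (pmod A)" "p \<in> carrier (pmod M)"
  shows "lshift M (act2 A M D P p) = act2 A M D P (lshift M p)"
  unfolding act2_def
  by (rule act_hom[OF diff_module_pmod diff_module_pmod])
    (use assms in \<open>auto simp: lshift_ahom lshift_smult ldel_lshift\<close>)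

text \<open>Each operator of the second action commutes with the twisted scalars and with \<lambda>,
  hence is a homomorphism for the first action.\<close>

lemma act1_act2:
  assumes "P \<in> carrier (pmod A)" "P' \<in> carrier (pmod A)" "p \<in> carrier (pmod M)"
  shows "act2 A M D P' (act1 A d M P p) = act1 A d M P (act2 A M D P' p)"
  unfolding act1_def
proof (rule act_hom[OF diff_module_pmod1 diff_module_pmod1])
  show "act2 A M D P' \<in> ahom (pmod1 A d M) (pmod1 A d M)"
    by (rule ahomI) (use assms in \<open>auto simp: act2_add_r\<close>)
qed (use assms in \<open>auto simp: act2_star del1_def act2_minus act2_lshift_r\<close>)

text \<open>For fixed x, the map taking f(\<lambda>) to f(\<lambda>) x is a homomorphism of the
  twisted structures. It relates the operators on values of a conformal derivation to those on
  values of the bracket.\<close>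

lemma act1_pairm:
  assumes "P \<in> carrier (pmod A)" "f \<in> carrier (pmod A)" "x \<in> carrier M"
  shows "pairm M (act1 A d (selfm A) P f) x = act1 A d M P (pairm M f x)"
  unfolding act1_def
proof (rule act_hom[OF diff_module.diff_module_pmod1[OF Q.diff_module_self] diff_module_pmod1])
  interpret S: diff_module A d "selfm A" d by (rule Q.diff_module_self)
  show "(\<lambda>f. pairm M f x) \<in> ahom (pmod1 A d (selfm A)) (pmod1 A d M)"
    by (rule ahomI) (use assms in \<open>auto simp: pairm_add_l\<close>)
  show "pairm M (del1 (selfm A) f) x = del1 M (pairm M f x)" if "f \<in> carrier (pmod1 A d (selfm A))" for f
    using that assms by (simp add: del1_def pairm_minus_l pairm_lshift)
  show "pairm M (a \<odot>\<^bsub>pmod1 A d (selfm A)\<^esub> f) x = a \<odot>\<^bsub>pmod1 A d M\<^esub> pairm M f x"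
    if a: "a \<in> carrier A" and f: "f \<in> carrier (pmod1 A d (selfm A))" for a f
  proof -
    have sc: "conv A d (selfm A) (cpoly A a) f \<in> carrier (pmod A)" if "a \<in> carrier A" "f \<in> carrier (pmod A)" for a f
      using S.conv_closed[of "cpoly A a" f] that by simp
    have "f \<in> carrier (pmod A)" using f by simp
    then have "pairm M (conv A d (selfm A) (cpoly A a) f) x = conv A d M (cpoly A a) (pairm M f x)"
      using a assms(3)
    proof (induction f arbitrary: a rule: Q.pmod_induct)
      case (const b)
      then show ?case using S.star_cpoly[of a b] by (simp add: pairm_cpoly star_cpoly V.smult_assoc1)
    next
      case (shift p)
      then show ?case using S.star_lshift[of a p] sc
        by (simp add: pairm_lshift star_lshift pairm_add_l)
    next
      case (add p q)
      then show ?case using S.conv_add_r[of "cpoly A a" p q] sc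
        by (simp add: pairm_add_l conv_add_r)
    qed
    then show ?thesis by simp
  qed
qed (use assms in auto)

text \<open>As \<open>flip A d P\<close> is the adjoint symbol, this identifies the module action
  \<open>act1\<close> with the expression by which conformal derivations are multiplied by
  operators.\<close>

lemma conv_flip:
  assumes "P \<in> carrier (pmod A)" "p \<in> carrier (pmod M)"
  shows "conv A d M (flip A d P) p = act1 A d M P p"
  using assms
proof (induction P arbitrary: p rule: Q.pmod_induct)
  case (shift P)
  have "act1 A d M (lshift A P) p = conv A d M (flip A d P) (\<ominus>\<^bsub>pmod M\<^esub> lshift M p)"
    using shift by (simp add: act1_lshift del1_def)
  then show ?case
    using shift(1,3) by (simp add: Q.flip_lshift conv_minus_l conv_minus_r conv_lshift)
qed (simp_all add: act1_cpoly conv_add_l act1_add_l Q.flip_add)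

end

section \<open>Conformal derivations\<close>

text \<open>Conformal derivations of the differential ring alone; linearity over the ground field is
  added in \<open>CDer_iff\<close>.\<close>

definition cder :: "('k, 'a) module \<Rightarrow> ('a \<Rightarrow> 'a) \<Rightarrow> ('a \<Rightarrow> nat \<Rightarrow> 'a) \<Rightarrow> bool" where
  "cder A d \<phi> \<longleftrightarrow> \<phi> \<in> ahom A (pmod A) \<and> (\<forall>a\<in>carrier A. \<phi> (d a) = ldel A d (\<phi> a)) \<and>
     (\<forall>a\<in>carrier A. \<forall>b\<in>carrier A.
        \<phi> (a \<otimes>\<^bsub>A\<^esub> b) = b \<odot>\<^bsub>pmod (selfm A)\<^esub> \<phi> a \<oplus>\<^bsub>pmod A\<^esub> a \<odot>\<^bsub>pmod (selfm A)\<^esub> \<phi> b)"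

text \<open>\<open>dact A M D \<phi> P x\<close> is \<open>\<phi>\<^sub>\<lambda>(a(x)) (|\<^sub>x\<^sub>=\<^sub>\<partial> v)\<close>, the commutator of \<open>\<phi>\<close> with the operator \<open>a(\<partial>)\<close>.\<close>

definition dact ::
  "('k, 'a) module \<Rightarrow> ('a, 'm) module \<Rightarrow> ('m \<Rightarrow> 'm) \<Rightarrow> ('a \<Rightarrow> nat \<Rightarrow> 'a) \<Rightarrow> (nat \<Rightarrow> 'a) \<Rightarrow> 'm \<Rightarrow> nat \<Rightarrow> 'm" where
  "dact A M D \<phi> P x = pext A (pmod M) (\<lambda>i a. pairm M (\<phi> a) ((D ^^ i) x)) P"

context diff_module
begin

context
  fixes \<phi> assumes \<phi>: "\<phi> \<in> ahom A (pmod A)"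
begin

lemma dact_ext: "x \<in> carrier M \<Longrightarrow> poly_ext A (pmod M) (\<lambda>i a. pairm M (\<phi> a) ((D ^^ i) x))"
  by unfold_locales (rule ahom_comp[OF \<phi> pairm_ahom_l], simp)

lemma dact_ahom_l: "x \<in> carrier M \<Longrightarrow> (\<lambda>P. dact A M D \<phi> P x) \<in> ahom (pmod A) (pmod M)"
  unfolding dact_def using poly_ext.ahom[OF dact_ext] by simp

lemmas dact_closed [simp] = ahom_closed[OF dact_ahom_l]
lemmas dact_add_l = ahom_add[OF dact_ahom_l]

lemma dact_cpoly: "x \<in> carrier M \<Longrightarrow> a \<in> carrier A \<Longrightarrow> dact A M D \<phi> (cpoly A a) x = pairm M (\<phi> a) x"
  by (simp add: dact_def poly_ext.cpoly[OF dact_ext])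

lemma dact_lshift: "x \<in> carrier M \<Longrightarrow> P \<in> carrier (pmod A) \<Longrightarrow> dact A M D \<phi> (lshift A P) x = dact A M D \<phi> P (D x)"
  by (simp add: dact_def poly_ext.shift[OF dact_ext] funpow_swap1)

lemma dact_add_r:
  assumes "P \<in> carrier (pmod A)" "x \<in> carrier M" "y \<in> carrier M"
  shows "dact A M D \<phi> P (x \<oplus> y) = dact A M D \<phi> P x \<oplus>\<^bsub>pmod M\<^esub> dact A M D \<phi> P y"
  using assms
  by (induction P arbitrary: x y rule: Q.pmod_induct)
    (simp_all add: dact_cpoly dact_lshift dact_add_l pairm_add_r ahom_closed[OF \<phi>] D_add P.a_ac)

lemma act1_dact:
  assumes "P \<in> carrier (pmod A)" "P' \<in> carrier (pmod A)" "x \<in> carrier M"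
  shows "act1 A d M P (dact A M D \<phi> P' x) = pext A (pmod M) (\<lambda>i a. pairm M (act1 A d (selfm A) P (\<phi> a)) ((D ^^ i) x)) P'"
proof -
  have c: "pairm M (act1 A d (selfm A) P (\<phi> (P' i))) ((D ^^ i) x) = act1 A d M P (pairm M (\<phi> (P' i)) ((D ^^ i) x))" for i
    using assms ahom_closed[OF \<phi>] by (simp add: act1_pairm)
  have "act1 A d M P (dact A M D \<phi> P' x) = pext A (pmod M) (\<lambda>i a. act1 A d M P (pairm M (\<phi> a) ((D ^^ i) x))) P'"
    unfolding dact_def
    by (rule poly_ext.hom[OF dact_ext P.abelian_group_axioms act1_ahom]) (use assms in auto)
  then show ?thesis by (simp add: pext_def c)
qed

end

context
  fixes \<phi> assumes \<phi>: "cder A d \<phi>"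
begin

private lemma \<phi>_ahom: "\<phi> \<in> ahom A (pmod A)"
  using \<phi> by (simp add: cder_def)

private lemma \<phi>_simps:
  "a \<in> carrier A \<Longrightarrow> \<phi> a \<in> carrier (pmod A)"
  "a \<in> carrier A \<Longrightarrow> \<phi> (d a) = ldel A d (\<phi> a)"
  "a \<in> carrier A \<Longrightarrow> b \<in> carrier A \<Longrightarrow>
     \<phi> (a \<otimes>\<^bsub>A\<^esub> b) = b \<odot>\<^bsub>pmod (selfm A)\<^esub> \<phi> a \<oplus>\<^bsub>pmod A\<^esub> a \<odot>\<^bsub>pmod (selfm A)\<^esub> \<phi> b"
  using \<phi> ahom_closed[of \<phi>] by (auto simp: cder_def)

lemma dact_smult:
  assumes "P \<in> carrier (pmod A)" "x \<in> carrier M" "a \<in> carrier A"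
  shows "dact A M D \<phi> (a \<odot>\<^bsub>pmod (selfm A)\<^esub> P) x =
    pairm M (\<phi> a) (act A M D P x) \<oplus>\<^bsub>pmod M\<^esub> a \<odot>\<^bsub>pmod M\<^esub> dact A M D \<phi> P x"
proof -
  interpret O: diff_module A d "pmod (selfm A)" "ldel A d" by (rule Q.diff_module_opmul)
  interpret N: module A "pmod M" by (rule module_pmod)
  note [simp] = dact_closed[OF \<phi>_ahom]
  show ?thesis using assms(1,2)
  proof (induction P arbitrary: x rule: Q.pmod_induct)
    case (const b)
    then show ?case using assms(3)
      by (simp add: Q.smult_cpoly dact_cpoly[OF \<phi>_ahom] \<phi>_simps pairm_add_l pairm_smult_l pairm_smult_r)
  next
    case (shift P)
    then show ?case using assms(3) by (simp add: Q.smult_lshift dact_lshift[OF \<phi>_ahom] act_lshift)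
  next
    case (add P P')
    then show ?case using assms(3) O.V.smult_r_distr[of a P P']
      by (simp add: dact_add_l[OF \<phi>_ahom] act_add_l pairm_add_r \<phi>_simps N.smult_r_distr P.a_ac)
  qed
qed

lemma dact_ldel:
  assumes "P \<in> carrier (pmod A)" "x \<in> carrier M"
  shows "dact A M D \<phi> (ldel A d P) x = ldel M D (dact A M D \<phi> P x)"
  using assms
  by (induction P arbitrary: x rule: Q.pmod_induct)
   (simp_all add: Q.ldel_cpoly dact_add_l[OF \<phi>_ahom] dact_lshift[OF \<phi>_ahom] dact_cpoly[OF \<phi>_ahom]
     \<phi>_simps Q.ldel_lshift Q.ldel_add ldel_add ldel_pairm P.a_ac dact_closed[OF \<phi>_ahom])

text \<open>The Leibniz rule for the commutator of \<phi> with a composite. Taking P' to be a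
  function of R gives the balancing conditions needed on tensors.\<close>

lemma dact_opmul:
  assumes "P \<in> carrier (pmod A)" "P' \<in> carrier (pmod A)" "x \<in> carrier M"
  shows "dact A M D \<phi> (opmul A d P P') x =
    dact A M D \<phi> P (act A M D P' x) \<oplus>\<^bsub>pmod M\<^esub> act2 A M D P (dact A M D \<phi> P' x)"
  using assms
proof (induction P arbitrary: P' x rule: Q.pmod_induct)
  case (const a)
  then show ?case
    by (simp add: Q.opmul_cpoly dact_smult dact_cpoly[OF \<phi>_ahom] act2_cpoly dact_closed[OF \<phi>_ahom])
next
  case (shift P)
  then show ?case
    by (simp add: Q.opmul_lshift dact_lshift[OF \<phi>_ahom] act2_lshift act_ldel dact_ldel dact_closed[OF \<phi>_ahom])
next
  case (add P P'')
  then show ?case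
    by (simp add: Q.opmul_add_l dact_add_l[OF \<phi>_ahom] act2_add_l P.a_ac dact_closed[OF \<phi>_ahom])
qed

end

end

section \<open>Conformal derivations as a module over the differential operators\<close>

context diff_ring
begin

interpretation S: diff_module A d "selfm A" d by (rule diff_module_self)

lemma cder_star:
  assumes "cder A d \<phi>" "c \<in> carrier A"
  shows "cder A d (\<lambda>a. conv A d (selfm A) (cpoly A c) (\<phi> a))"
proof -
  have \<phi>: "\<phi> \<in> ahom A (pmod A)" and c [simp]: "a \<in> carrier A \<Longrightarrow> \<phi> a \<in> carrier (pmod A)" for a
    using assms ahom_closed[of \<phi>] by (auto simp: cder_def)
  have sc: "conv A d (selfm A) (cpoly A c) f \<in> carrier (pmod A)" if "f \<in> carrier (pmod A)" for f
    using S.conv_closed[of "cpoly A c" f] that assms(2) by simp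
  note simps = S.conv_add_r[of "cpoly A c", simplified] S.star_smult[simplified] S.star_ldel[simplified]
  show ?thesis unfolding cder_def
    using assms by (auto simp: ahom_add[OF \<phi>] simps sc cder_def intro!: ahomI)
qed

lemma cder_lshift:
  assumes "cder A d \<phi>"
  shows "cder A d (\<lambda>a. \<ominus>\<^bsub>pmod A\<^esub> lshift A (\<phi> a))"
proof -
  interpret O: diff_module A d "pmod (selfm A)" "ldel A d" by (rule diff_module_opmul)
  have \<phi>: "\<phi> \<in> ahom A (pmod A)" and c [simp]: "a \<in> carrier A \<Longrightarrow> \<phi> a \<in> carrier (pmod A)" for a
    using assms ahom_closed[of \<phi>] by (auto simp: cder_def)
  show ?thesis unfolding cder_def
    using assms
    by (auto simp: ahom_add[OF \<phi>] lshift_add P.minus_add ldel_minus ldel_lshift cder_def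
        O.V.smult_r_minus[simplified] smult_lshift intro!: ahomI)
qed

lemma cder_add:
  assumes "cder A d \<phi>" "cder A d \<psi>"
  shows "cder A d (\<lambda>a. \<phi> a \<oplus>\<^bsub>pmod A\<^esub> \<psi> a)"
proof -
  interpret O: diff_module A d "pmod (selfm A)" "ldel A d" by (rule diff_module_opmul)
  have ah: "\<phi> \<in> ahom A (pmod A)" "\<psi> \<in> ahom A (pmod A)" using assms by (auto simp: cder_def)
  note [simp] = ahom_closed[OF ah(1)] ahom_closed[OF ah(2)]
  show ?thesis unfolding cder_def
    using assms
    by (auto simp: ahom_add[OF ah(1)] ahom_add[OF ah(2)] ldel_add cder_def
        O.V.smult_r_distr[simplified] P.a_ac intro!: ahomI)
qed

lemma cder_cong:
  assumes "cder A d \<phi>" "\<And>a. a \<in> carrier A \<Longrightarrow> \<psi> a = \<phi> a"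
  shows "cder A d \<psi>"
  using assms unfolding cder_def hom_def by (auto simp: Pi_iff)

text \<open>Conformal derivations are closed under twisted scalars, under -\<lambda> and under sums,
  and every operator acts through these.\<close>

lemma cder_act1:
  assumes "P \<in> carrier (pmod A)" "cder A d \<phi>"
  shows "cder A d (\<lambda>a. act1 A d (selfm A) P (\<phi> a))"
  using assms
proof (induction P arbitrary: \<phi> rule: pmod_induct)
  case (const a)
  then have "\<phi> \<in> ahom A (pmod A)" by (simp add: cder_def)
  note [simp] = ahom_closed[OF this]
  have "cder A d (\<lambda>b. conv A d (selfm A) (cpoly A a) (\<phi> b))" by (rule cder_star) (use const in auto)
  then show ?case using S.act1_cpoly[of a] const(1) by (auto elim!: cder_cong)
next
  case (shift P)
  then have "\<phi> \<in> ahom A (pmod A)" by (simp add: cder_def)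
  note [simp] = ahom_closed[OF this]
  have "cder A d (\<lambda>b. act1 A d (selfm A) P (del1 (selfm A) (\<phi> b)))"
    using shift(2)[OF cder_lshift[OF shift(3)]] by (simp add: del1_def)
  then show ?case using S.act1_lshift[of P] shift(1) by (auto elim!: cder_cong)
next
  case (add P P')
  then have "\<phi> \<in> ahom A (pmod A)" by (simp add: cder_def)
  note [simp] = ahom_closed[OF this]
  show ?case using cder_add[OF add(3,4)[OF add(5)]] S.act1_add_l[of P P'] add(1,2)
    by (auto elim!: cder_cong)
qed

end

context diff_module
begin

lemma dact_cong:
  "P \<in> carrier (pmod A) \<Longrightarrow> (\<And>a. a \<in> carrier A \<Longrightarrow> \<phi> a = \<psi> a) \<Longrightarrow> dact A M D \<phi> P x = dact A M D \<psi> P x"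
  by (simp add: dact_def pext_def)

lemma dact_add_phi:
  assumes "\<And>a. a \<in> carrier A \<Longrightarrow> \<phi> a \<in> carrier (pmod A)" "\<And>a. a \<in> carrier A \<Longrightarrow> \<psi> a \<in> carrier (pmod A)"
    and "P \<in> carrier (pmod A)" "x \<in> carrier M"
  shows "dact A M D (\<lambda>a. \<phi> a \<oplus>\<^bsub>pmod A\<^esub> \<psi> a) P x = dact A M D \<phi> P x \<oplus>\<^bsub>pmod M\<^esub> dact A M D \<psi> P x"
  unfolding dact_def pext_def using assms
  by (subst P.finsum_addf[symmetric]) (auto simp: pairm_add_l intro!: P.finsum_cong')

lemma act1_dact_comp:
  assumes "\<phi> \<in> ahom A (pmod A)" "P \<in> carrier (pmod A)" "P' \<in> carrier (pmod A)" "x \<in> carrier M"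
  shows "act1 A d M P (dact A M D \<phi> P' x) = dact A M D (\<lambda>a. act1 A d (selfm A) P (\<phi> a)) P' x"
  using act1_dact[OF assms] by (simp add: dact_def)

end

lemma (in diff_ring) cder_one:
  assumes "cder A d \<psi>"
  shows "\<psi> \<one> = \<zero>\<^bsub>pmod A\<^esub>"
proof -
  interpret O: diff_module A d "pmod (selfm A)" "ldel A d" by (rule diff_module_opmul)
  have c: "\<psi> \<one> \<in> carrier (pmod A)" using assms ahom_closed[of \<psi> A "pmod A"] by (simp add: cder_def)
  have "\<psi> (\<one> \<otimes> \<one>) = \<one> \<odot>\<^bsub>pmod (selfm A)\<^esub> \<psi> \<one> \<oplus>\<^bsub>pmod A\<^esub> \<one> \<odot>\<^bsub>pmod (selfm A)\<^esub> \<psi> \<one>"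
    using assms unfolding cder_def by blast
  then have "\<psi> \<one> \<oplus>\<^bsub>pmod A\<^esub> \<psi> \<one> = \<psi> \<one>" using c O.V.smult_one[of "\<psi> \<one>"] by simp
  then show ?thesis using c P.add.l_cancel_one[of "\<psi> \<one>" "\<psi> \<one>"] by simp
qed

section \<open>The substitution convention\<close>

lemma polysum_restrict_scalars [simp]: "polysum (restrict_scalars h M) = polysum M"
  by (simp add: polysum_def fun_eq_iff)

lemma subst_xy_restrict_scalars [simp]: "subst_xy (restrict_scalars h M) = subst_xy M"
  by (simp add: subst_xy_def fun_eq_iff)

lemma finite_coeff3: "finite {(p, q, r). coeff3 P p q r \<noteq> 0}"
proof (rule finite_subset)
  let ?c = "Polynomial.coeff" and ?d = "Polynomial.degree"
  show "{(p, q, r). coeff3 P p q r \<noteq> 0} \<subseteq> (\<lambda>(r, q, p). (p, q, r)) `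
      (SIGMA r:{..?d P}. SIGMA q:{..?d (?c P r)}. {..?d (?c (?c P r) q)})"
    by (force simp: coeff3_def image_iff intro: le_degree)
qed auto

lemma coeff3_simps:
  "coeff3 (P + Q) p q r = coeff3 P p q r + coeff3 Q p q r"
  "coeff3 (- P) p q r = - coeff3 P p q r"
  "coeff3 (lam * P) p q r = (if p = 0 then 0 else coeff3 P (p - 1) q r)"
  "coeff3 (xv * P) p q r = (if q = 0 then 0 else coeff3 P p (q - 1) r)"
  "coeff3 (yv * P) p q r = (if r = 0 then 0 else coeff3 P p q (r - 1))"
  "coeff3 1 p q r = (if p = 0 \<and> q = 0 \<and> r = 0 then 1 else 0)"
  by (auto simp: coeff3_def lam_def xv_def yv_def coeff_pCons split: nat.splits)

context agroup
begin

context
  fixes f :: "nat \<Rightarrow> nat \<Rightarrow> nat \<Rightarrow> 'm"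
  assumes f [simp]: "\<And>q r k. f q r k \<in> carrier M"
begin

lemma subst_superset:
  assumes "finite T" "\<And>p q r. coeff3 P p q r \<noteq> 0 \<Longrightarrow> (p, q, r) \<in> T"
  shows "subst_xy M P f k =
    finsum M (\<lambda>(p, q, r). add_pow M (coeff3 P p q r) (if p \<le> k then f q r (k - p) else \<zero>)) T"
  unfolding subst_xy_def
  by (rule add.finprod_mono_neutral_cong_left) (use assms in \<open>auto split: if_splits\<close>)

lemma subst_closed [simp]: "subst_xy M P f k \<in> carrier M"
  unfolding subst_xy_def by (rule finsum_closed) auto

lemma subst_add: "subst_xy M (P + Q) f k = subst_xy M P f k \<oplus> subst_xy M Q f k"
proof -
  let ?T = "{(p, q, r). coeff3 P p q r \<noteq> 0} \<union> {(p, q, r). coeff3 Q p q r \<noteq> 0}"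
  have "finite ?T" using finite_coeff3 by auto
  then show ?thesis
    by (subst (1 2 3) subst_superset[where T = ?T]; (subst finsum_addf[symmetric])?)
      (auto simp: coeff3_simps add.int_pow_mult intro!: finsum_cong')
qed

lemma subst_minus: "subst_xy M (- P) f k = \<ominus> subst_xy M P f k"
proof -
  let ?T = "{(p, q, r). coeff3 P p q r \<noteq> 0}"
  \<comment> \<open>The sum of P and -P is the zero polynomial, so the negative is obtained from
    additivity.\<close>
  have "subst_xy M P f k \<oplus> subst_xy M (- P) f k = \<zero>"
    by (subst subst_add[symmetric]) (simp add: subst_xy_def coeff3_def case_prod_unfold)
  then show ?thesis by (intro minus_equality[symmetric]) (simp_all add: a_comm)
qed

lemma subst_one: "subst_xy M 1 f = f 0 0"
  by (rule ext, subst subst_superset[where T = "{(0, 0, 0)}"]) (auto simp: coeff3_simps split: if_splits)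

text \<open>With the corresponding rules for x and y, an expression is evaluated factor by factor,
  so that powers of \<lambda>+x or \<lambda>+x+y need not be expanded.\<close>

lemma subst_lam: "subst_xy M (lam * P) f = lshift M (subst_xy M P f)"
proof
  fix k
  let ?T = "{(p, q, r). coeff3 P p q r \<noteq> 0}" and ?h = "\<lambda>(p, q, r). (Suc p, q, r)"
  have T: "(p, q, r) \<in> ?h ` ?T" if "coeff3 (lam * P) p q r \<noteq> 0" for p q r
    using that by (intro image_eqI[where x = "(p - 1, q, r)"]) (auto simp: coeff3_simps split: if_splits)
  have "subst_xy M (lam * P) f k = finsum M (\<lambda>(p, q, r). add_pow M (coeff3 (lam * P) p q r) (if p \<le> k then f q r (k - p) else \<zero>)) (?h ` ?T)"
    using finite_coeff3 T by (intro subst_superset) auto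
  also have "\<dots> = finsum M (\<lambda>(p, q, r). add_pow M (coeff3 P p q r) (if Suc p \<le> k then f q r (k - Suc p) else \<zero>)) ?T"
    by (subst finsum_reindex) (auto simp: inj_on_def coeff3_simps intro!: finsum_cong')
  also have "\<dots> = lshift M (subst_xy M P f) k"
  proof (cases k)
    case 0
    have "finsum M (\<lambda>(p, q, r). add_pow M (coeff3 P p q r) (if Suc p \<le> k then f q r (k - Suc p) else \<zero>)) ?T = (\<Oplus>x\<in>?T. \<zero>)"
      using 0 by (intro finsum_cong') auto
    then show ?thesis using 0 by simp
  next
    case (Suc l)
    then show ?thesis using finite_coeff3 by (simp add: subst_superset[where T = ?T] cong: if_cong)
  qed
  finally show "subst_xy M (lam * P) f k = lshift M (subst_xy M P f) k" .
qed

lemma subst_x: "subst_xy M (xv * P) f = subst_xy M P (\<lambda>q. f (Suc q))"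
proof
  fix k
  let ?T = "{(p, q, r). coeff3 P p q r \<noteq> 0}" and ?h = "\<lambda>(p, q, r). (p, Suc q, r)"
  have T: "(p, q, r) \<in> ?h ` ?T" if "coeff3 (xv * P) p q r \<noteq> 0" for p q r
    using that by (intro image_eqI[where x = "(p, q - 1, r)"]) (auto simp: coeff3_simps split: if_splits)
  have "subst_xy M (xv * P) f k = finsum M (\<lambda>(p, q, r). add_pow M (coeff3 (xv * P) p q r) (if p \<le> k then f q r (k - p) else \<zero>)) (?h ` ?T)"
    using finite_coeff3 T by (intro subst_superset) auto
  also have "\<dots> = finsum M (\<lambda>(p, q, r). add_pow M (coeff3 P p q r) (if p \<le> k then f (Suc q) r (k - p) else \<zero>)) ?T"
    by (subst finsum_reindex) (auto simp: inj_on_def coeff3_simps intro!: finsum_cong')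
  also have "\<dots> = subst_xy M P (\<lambda>q. f (Suc q)) k"
    unfolding subst_xy_def by (rule add.finprod_mono_neutral_cong_right) (use finite_coeff3 in \<open>auto split: if_splits\<close>)
  finally show "subst_xy M (xv * P) f k = subst_xy M P (\<lambda>q. f (Suc q)) k" .
qed

lemma subst_y: "subst_xy M (yv * P) f = subst_xy M P (\<lambda>q r. f q (Suc r))"
proof
  fix k
  let ?T = "{(p, q, r). coeff3 P p q r \<noteq> 0}" and ?h = "\<lambda>(p, q, r). (p, q, Suc r)"
  have T: "(p, q, r) \<in> ?h ` ?T" if "coeff3 (yv * P) p q r \<noteq> 0" for p q r
    using that by (intro image_eqI[where x = "(p, q, r - 1)"]) (auto simp: coeff3_simps split: if_splits)
  have "subst_xy M (yv * P) f k = finsum M (\<lambda>(p, q, r). add_pow M (coeff3 (yv * P) p q r) (if p \<le> k then f q r (k - p) else \<zero>)) (?h ` ?T)"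
    using finite_coeff3 T by (intro subst_superset) auto
  also have "\<dots> = finsum M (\<lambda>(p, q, r). add_pow M (coeff3 P p q r) (if p \<le> k then f q (Suc r) (k - p) else \<zero>)) ?T"
    by (subst finsum_reindex) (auto simp: inj_on_def coeff3_simps intro!: finsum_cong')
  also have "\<dots> = subst_xy M P (\<lambda>q r. f q (Suc r)) k"
    unfolding subst_xy_def by (rule add.finprod_mono_neutral_cong_right) (use finite_coeff3 in \<open>auto split: if_splits\<close>)
  finally show "subst_xy M (yv * P) f k = subst_xy M P (\<lambda>q r. f q (Suc r)) k" .
qed

lemma subst_lshift: "subst_xy M P (\<lambda>q r. lshift M (f q r)) = lshift M (subst_xy M P f)"
proof
  fix k
  let ?T = "{(p, q, r). coeff3 P p q r \<noteq> 0}"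
  show "subst_xy M P (\<lambda>q r. lshift M (f q r)) k = lshift M (subst_xy M P f) k"
  proof (cases k)
    case 0
    have "subst_xy M P (\<lambda>q r. lshift M (f q r)) k = (\<Oplus>x\<in>{(p, q, r). p \<le> k \<and> coeff3 P p q r \<noteq> 0}. \<zero>)"
      unfolding subst_xy_def using 0 by (intro finsum_cong') auto
    then show ?thesis using 0 by simp
  next
    case (Suc l)
    have "subst_xy M P (\<lambda>q r. lshift M (f q r)) k =
        finsum M (\<lambda>(p, q, r). add_pow M (coeff3 P p q r) (if p \<le> l then f q r (l - p) else \<zero>)) ?T"
      unfolding subst_xy_def
      by (rule add.finprod_mono_neutral_cong_left)
        (use finite_coeff3 Suc in \<open>auto simp: lshift_def le_Suc_eq Suc_diff_le split: if_splits\<close>)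
    then show ?thesis using finite_coeff3 Suc by (simp add: subst_superset[where T = ?T])
  qed
qed

lemma subst_map:
  assumes "abelian_group N" "g \<in> ahom M N"
  shows "subst_xy N P (\<lambda>q r k. g (f q r k)) k = g (subst_xy M P f k)"
  unfolding subst_xy_def
  by (subst ahom_finsum[OF abelian_group_axioms assms])
    (auto simp: ahom_int_pow[OF abelian_group_axioms assms] case_prod_unfold)

end

lemma subst_fadd:
  assumes "\<And>q r k. f q r k \<in> carrier M" "\<And>q r k. g q r k \<in> carrier M"
  shows "subst_xy M P (\<lambda>q r k. f q r k \<oplus> g q r k) k = subst_xy M P f k \<oplus> subst_xy M P g k"
  unfolding subst_xy_def using assms
  by (subst finsum_addf[symmetric]) (auto simp: add.int_pow_distrib intro!: finsum_cong')

lemma subst_lam_x_step: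
  assumes f: "\<And>q r k. f q r k \<in> carrier M"
  shows "subst_xy M ((lam + xv) * P) f k =
    subst_xy M P (\<lambda>q r k. lshift M (f q r) k \<oplus> f (Suc q) r k) k"
proof -
  have "subst_xy M ((lam + xv) * P) f k = lshift M (subst_xy M P f) k \<oplus> subst_xy M P (\<lambda>q. f (Suc q)) k"
    using f by (simp add: distrib_right subst_add[of f] subst_lam[of f] subst_x[of f])
  also have "lshift M (subst_xy M P f) k = subst_xy M P (\<lambda>q r. lshift M (f q r)) k"
    using f by (simp add: subst_lshift[of f])
  also have "\<dots> \<oplus> subst_xy M P (\<lambda>q. f (Suc q)) k = subst_xy M P (\<lambda>q r k. lshift M (f q r) k \<oplus> f (Suc q) r k) k"
    using f by (intro subst_fadd[symmetric]) (auto simp: lshift_def)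
  finally show ?thesis .
qed

text \<open>A factor W that can be absorbed into the parameter of the substituted family can be
  absorbed n times.\<close>

lemma subst_iter:
  assumes "\<And>p P. p \<in> C \<Longrightarrow> subst_xy M (W * P) (F p) = subst_xy M P (F (Z p))" "\<And>p. p \<in> C \<Longrightarrow> Z p \<in> C" "p \<in> C"
  shows "subst_xy M (W ^ n * P) (F p) = subst_xy M P (F ((Z ^^ n) p))"
  using assms(3) by (induction n arbitrary: p) (simp_all add: assms(1,2) mult.assoc funpow_swap1)

lemma polysum_eq:
  "(\<And>i. i \<in> I \<Longrightarrow> f i \<in> carrier (pmod M)) \<Longrightarrow> polysum M I f = finsum (pmod M) f I"
  by (auto simp: polysum_def pmod_finsum fun_eq_iff)

end

context del_group
begin

lemma funpow_closed [simp]: "x \<in> carrier M \<Longrightarrow> (D ^^ i) x \<in> carrier M"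
  by (rule ahom_closed[OF funpow_ahom[OF D]])

lemma funpow_ldel_closed [simp]: "x \<in> carrier (pmod M) \<Longrightarrow> (ldel M D ^^ i) x \<in> carrier (pmod M)"
  by (rule ahom_closed[OF funpow_ahom[OF ldel_ahom]])

text \<open>If x stands for \<partial> on the coefficients of p, then \<lambda>+x is the operator
  \<open>ldel\<close>. The map \<open>g\<close> is whatever is done to these coefficients
  afterwards, such as multiplication by another factor.\<close>

lemma subst_funpow_step:
  assumes "p \<in> carrier (pmod M)" "g \<in> ahom M N" "agroup N"
  shows "subst_xy N ((lam + xv) * P) (\<lambda>q r k. g ((D ^^ q) (p k))) = subst_xy N P (\<lambda>q r k. g ((D ^^ q) (ldel M D p k)))"
    (is "_ = subst_xy N P (?F (ldel M D p))")
proof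
  fix k
  interpret N: agroup N by fact
  have c: "?F p q r k \<in> carrier N" if "p \<in> carrier (pmod M)" for p q r k
    using that by (simp add: ahom_closed[OF assms(2)])
  have 0: "g \<zero> = \<zero>\<^bsub>N\<^esub>" by (rule ahom_zero[OF abelian_group_axioms N.abelian_group_axioms assms(2)])
  have D0: "(D ^^ q) \<zero> = \<zero>" for q by (induction q) simp_all
  have L: "?F (ldel M D p) q r k = lshift N (?F p q r) k \<oplus>\<^bsub>N\<^esub> ?F p (Suc q) r k" for q r k
    using assms(1) by (auto simp: ldel_def coeff lshift_def ahom_add[OF funpow_ahom[OF D]] ahom_add[OF assms(2)] 0 D0 funpow_swap1)
  have "subst_xy N ((lam + xv) * P) (?F p) k = subst_xy N P (\<lambda>q r k. lshift N (?F p q r) k \<oplus>\<^bsub>N\<^esub> ?F p (Suc q) r k) k"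
    by (rule N.subst_lam_x_step) (rule c[OF assms(1)])
  then show "subst_xy N ((lam + xv) * P) (?F p) k = subst_xy N P (?F (ldel M D p)) k"
    by (simp only: L)
qed

lemma subst_lam_x:
  assumes "p \<in> carrier (pmod M)" "g \<in> ahom M N" "agroup N"
  shows "subst_xy N ((lam + xv) ^ n * P) (\<lambda>q r k. g ((D ^^ q) (p k))) =
    subst_xy N P (\<lambda>q r k. g ((D ^^ q) ((ldel M D ^^ n) p k)))"
proof -
  interpret N: agroup N by fact
  show ?thesis
    by (rule N.subst_iter[where C = "carrier (pmod M)" and F = "\<lambda>p q r k. g ((D ^^ q) (p k))"])
       (use assms subst_funpow_step in auto)
qed

text \<open>The same expression occurs in the adjoint symbol, in the adjoint of a conformal
  derivation and in the skew-symmetry axiom.\<close>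

lemma flip_eq_polysum:
  assumes p: "p \<in> carrier (pmod M)"
  shows "polysum M (supp M p) (\<lambda>n. subst_xy M ((- lam - xv) ^ n) (\<lambda>q r. cpoly M ((D ^^ q) (p n)))) = flip M D p"
proof -
  let ?Z = "\<lambda>q. \<ominus>\<^bsub>pmod M\<^esub> ldel M D q" and ?F = "\<lambda>p q (r::nat) k. (D ^^ q) (p k)"
  have D0: "(D ^^ q) \<zero> = \<zero>" for q by (induction q) simp_all
  have Z: "?Z p \<in> carrier (pmod M)" if "p \<in> carrier (pmod M)" for p using that by simp
  have step: "subst_xy M ((- lam - xv) * P) (?F p) = subst_xy M P (?F (?Z p))" if p: "p \<in> carrier (pmod M)" for p P
  proof
    fix k
    have c: "?F p q r k \<in> carrier M" if "p \<in> carrier (pmod M)" for p q r k using that by simp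
    have e: "(- lam - xv) * P = - ((lam + xv) * P)" by (simp add: algebra_simps)
    have "subst_xy M ((- lam - xv) * P) (?F p) k = \<ominus> subst_xy M P (?F (ldel M D p)) k"
      unfolding e using subst_funpow_step[OF p id_ahom agroup_axioms, of P] c[OF p] by (simp add: subst_minus[of "?F p"])
    also have "\<dots> = subst_xy M P (\<lambda>q r k. \<ominus> (?F (ldel M D p) q r k)) k"
      by (rule subst_map[symmetric, OF _ abelian_group_axioms minus_ahom[OF id_ahom]]) (use p in auto)
    also have "\<dots> = subst_xy M P (?F (?Z p)) k"
      using p by (simp add: coeff ahom_minus[OF abelian_group_axioms abelian_group_axioms funpow_ahom[OF D]])
    finally show "subst_xy M ((- lam - xv) * P) (?F p) k = subst_xy M P (?F (?Z p)) k" .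
  qed
  have it: "subst_xy M ((- lam - xv) ^ n) (\<lambda>q r. cpoly M ((D ^^ q) x)) = (?Z ^^ n) (cpoly M x)" if x: "x \<in> carrier M" for n x
  proof -
    have F: "?F (cpoly M x) = (\<lambda>q r. cpoly M ((D ^^ q) x))" using D0 by (auto simp: cpoly_def fun_eq_iff)
    have zc: "(?Z ^^ n) (cpoly M x) \<in> carrier (pmod M)"
      by (rule ahom_closed[OF funpow_ahom[OF P.minus_ahom[OF ldel_ahom]]]) (use x in simp)
    have "subst_xy M ((- lam - xv) ^ n * 1) (?F (cpoly M x)) = subst_xy M 1 (?F ((?Z ^^ n) (cpoly M x)))"
      by (rule subst_iter[where C = "carrier (pmod M)"]) (use step Z x in auto)
    also have "\<dots> = (?Z ^^ n) (cpoly M x)"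
      using zc by (subst subst_one) auto
    finally show ?thesis by (simp add: F)
  qed
  have zc: "(?Z ^^ n) (cpoly M x) \<in> carrier (pmod M)" if "x \<in> carrier M" for x n
    by (rule ahom_closed[OF funpow_ahom[OF P.minus_ahom[OF ldel_ahom]]]) (use that in simp)
  show ?thesis
    unfolding flip_def pext_def using p by (subst polysum_eq) (auto simp: it zc)
qed

end

lemma (in diff_ring) adjoint_symbol_eq: "P \<in> carrier (pmod A) \<Longrightarrow> adjoint_symbol A d P = flip A d P"
  unfolding adjoint_symbol_def by (rule flip_eq_polysum)

lemma (in diff_ring) cder_adjoint_eq: "\<phi> a \<in> carrier (pmod A) \<Longrightarrow> cder_adjoint A d \<phi> a = flip A d (\<phi> a)"
  unfolding cder_adjoint_def by (rule flip_eq_polysum)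

text \<open>\<open>(|\<^sub>x\<^sub>=\<^sub>\<partial> c) (\<lambda>+y)\<^sup>n (|\<^sub>y\<^sub>=\<^sub>\<partial> u)\<close>\<close>

primrec wpow :: "('a, 'm) module \<Rightarrow> ('m \<Rightarrow> 'm) \<Rightarrow> nat \<Rightarrow> 'a \<Rightarrow> 'm \<Rightarrow> nat \<Rightarrow> 'm" where
  "wpow M D 0 c u = cpoly M (c \<odot>\<^bsub>M\<^esub> u)"
| "wpow M D (Suc n) c u = lshift M (wpow M D n c u) \<oplus>\<^bsub>pmod M\<^esub> wpow M D n c (D u)"

context diff_module
begin

lemma act2_eq_polysum:
  assumes "P \<in> carrier (pmod A)" "p \<in> carrier (pmod M)"
  shows "polysum M (supp A P) (\<lambda>i. subst_xy M ((lam + xv) ^ i) (\<lambda>q r k. P i \<odot> (D ^^ q) (p k))) = act2 A M D P p"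
proof -
  interpret N: module A "pmod M" by (rule module_pmod)
  have "subst_xy M ((lam + xv) ^ i) (\<lambda>q r k. P i \<odot> (D ^^ q) (p k)) = P i \<odot>\<^bsub>pmod M\<^esub> (ldel M D ^^ i) p" for i
  proof -
    have c: "(ldel M D ^^ i) p \<in> carrier (pmod M)" using assms by simp
    have "subst_xy M ((lam + xv) ^ i * 1) (\<lambda>q r k. P i \<odot> (D ^^ q) (p k)) =
        subst_xy M 1 (\<lambda>q r k. P i \<odot> (D ^^ q) ((ldel M D ^^ i) p k))"
      by (rule subst_lam_x[OF assms(2) smult_ahom agroup_axioms]) (use assms in auto)
    then show ?thesis using assms c by (subst (asm) subst_one) (auto simp: coeff fun_eq_iff)
  qed
  then show ?thesis
    unfolding act2_def act_def pext_def using assms by (subst polysum_eq) auto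
qed

lemma dact_eq_polysum:
  assumes "P \<in> carrier (pmod A)" "x \<in> carrier M" "\<phi> \<in> ahom A (pmod A)"
  shows "polysum M (supp A P) (\<lambda>i. subst_xy M (xv ^ i) (\<lambda>q r k. \<phi> (P i) k \<odot> (D ^^ q) x)) = dact A M D \<phi> P x"
proof -
  have [simp]: "\<phi> (P i) \<in> carrier (pmod A)" for i using assms ahom_closed by fastforce
  have "subst_xy M (xv ^ i) (\<lambda>q r k. \<phi> (P i) k \<odot> (D ^^ q) x) = pairm M (\<phi> (P i)) ((D ^^ i) x)" for i
  proof -
    let ?F = "\<lambda>x q (r::nat) k. \<phi> (P i) k \<odot> (D ^^ q) x"
    have "subst_xy M (xv ^ i * 1) (?F x) = subst_xy M 1 (?F ((D ^^ i) x))"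
      by (rule subst_iter[where C = "carrier M"]) (use assms in \<open>auto simp: subst_x funpow_swap1\<close>)
    also have "\<dots> = pairm M (\<phi> (P i)) ((D ^^ i) x)"
      using assms by (subst subst_one) (auto simp: pairm_def)
    finally show ?thesis by simp
  qed
  then show ?thesis unfolding dact_def pext_def using assms by (subst polysum_eq) auto
qed

section \<open>The three summands of the total formula\<close>

lemma conv_superset:
  assumes "f \<in> carrier (pmod A)" "p \<in> carrier (pmod M)" "supp M p \<subseteq> T" "finite T"
  shows "conv A d M f p = finsum (pmod M) (\<lambda>n. pairm M ((ldel A d ^^ n) f) (p n)) T"
  unfolding conv_def by (rule poly_ext.superset[OF conv_ext]) (use assms in auto)

lemma subst_tensor:
  assumes "f \<in> carrier (pmod A)" "b \<in> carrier A" "x \<in> carrier M"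
  shows "subst_xy M ((lam + xv) ^ n * P) (\<lambda>q r k. ((d ^^ q) (f k) \<otimes>\<^bsub>A\<^esub> b) \<odot> (D ^^ r) x) =
    subst_xy M P (\<lambda>q r k. ((d ^^ q) ((ldel A d ^^ n) f k) \<otimes>\<^bsub>A\<^esub> b) \<odot> (D ^^ r) x)"
proof (rule subst_iter[where C = "carrier (pmod A)" and F = "\<lambda>f q r k. ((d ^^ q) (f k) \<otimes>\<^bsub>A\<^esub> b) \<odot> (D ^^ r) x"])
  fix f P assume f: "f \<in> carrier (pmod A)"
  let ?F = "\<lambda>f q r k. ((d ^^ q) (f k) \<otimes>\<^bsub>A\<^esub> b) \<odot> (D ^^ r) x"
  have c: "?F f q r k \<in> carrier M" if "f \<in> carrier (pmod A)" for f q r k using that assms by simp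
  have d0: "(d ^^ q) \<zero>\<^bsub>A\<^esub> = \<zero>\<^bsub>A\<^esub>" for q by (induction q) simp_all
  have L: "?F (ldel A d f) q r k = lshift M (?F f q r) k \<oplus> ?F f (Suc q) r k" for q r k
    using f assms d0
    by (auto simp: ldel_def coeff lshift_def ahom_add[OF funpow_ahom[OF Q.D]] Q.l_distr V.smult_l_distr funpow_swap1)
  have "subst_xy M ((lam + xv) * P) (?F f) k = subst_xy M P (\<lambda>q r k. lshift M (?F f q r) k \<oplus> ?F f (Suc q) r k) k" for k
    by (rule subst_lam_x_step) (rule c[OF f])
  then show "subst_xy M ((lam + xv) * P) (?F f) = subst_xy M P (?F (ldel A d f))"
    by (intro ext) (simp only: L)
qed (use assms in auto)

lemma subst_tensor_y:
  assumes "f \<in> carrier (pmod A)" "b \<in> carrier A" "x \<in> carrier M"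
  shows "subst_xy M (yv ^ n * P) (\<lambda>q r k. ((d ^^ q) (f k) \<otimes>\<^bsub>A\<^esub> b) \<odot> (D ^^ r) x) =
    subst_xy M P (\<lambda>q r k. ((d ^^ q) (f k) \<otimes>\<^bsub>A\<^esub> b) \<odot> (D ^^ r) ((D ^^ n) x))"
  by (rule subst_iter[where C = "carrier M" and F = "\<lambda>x q r k. ((d ^^ q) (f k) \<otimes>\<^bsub>A\<^esub> b) \<odot> (D ^^ r) x"])
    (use assms in \<open>auto simp: subst_y funpow_swap1\<close>)

text \<open>Here x differentiates f and y the module element, so by the Leibniz rule \<lambda>+x+y
  acts as \<lambda>+\<partial> on the product f(\<lambda>) x.\<close>

lemma subst_tensor_xy:
  assumes "f \<in> carrier (pmod A)" "b \<in> carrier A" "x \<in> carrier M"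
  shows "subst_xy M ((lam + xv + yv) ^ n) (\<lambda>q r k. ((d ^^ q) (f k) \<otimes>\<^bsub>A\<^esub> b) \<odot> (D ^^ r) x) =
     b \<odot>\<^bsub>pmod M\<^esub> (ldel M D ^^ n) (pairm M f x)"
  using assms(1,3)
proof (induction n arbitrary: f x)
  case 0
  then show ?case using assms(2)
    by (simp, subst subst_one) (auto simp: pairm_def coeff Q.m_comm V.smult_assoc1[symmetric] simp del: V.smult_assoc1)
next
  case (Suc n)
  interpret N: module A "pmod M" by (rule module_pmod)
  let ?P = "(lam + xv + yv) ^ n"
  let ?F = "\<lambda>f x q r k. ((d ^^ q) (f k) \<otimes>\<^bsub>A\<^esub> b) \<odot> (D ^^ r) x"
  have c: "?F f x q r k \<in> carrier M" for q r k using Suc.prems assms by simp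
  have e: "(lam + xv + yv) ^ Suc n = (lam + xv) ^ 1 * ?P + yv ^ 1 * ?P" by (simp add: algebra_simps)
  have "subst_xy M ((lam + xv + yv) ^ Suc n) (?F f x) k =
      (subst_xy M ?P (?F (ldel A d f) x) k \<oplus> subst_xy M ?P (?F f (D x)) k)" for k
    unfolding e subst_add[of "?F f x", OF c]
    unfolding subst_tensor[OF Suc.prems(1) assms(2) Suc.prems(2)] subst_tensor_y[OF Suc.prems(1) assms(2) Suc.prems(2)]
    by simp
  then have "subst_xy M ((lam + xv + yv) ^ Suc n) (?F f x) =
    b \<odot>\<^bsub>pmod M\<^esub> (ldel M D ^^ n) (pairm M (ldel A d f) x) \<oplus>\<^bsub>pmod M\<^esub> b \<odot>\<^bsub>pmod M\<^esub> (ldel M D ^^ n) (pairm M f (D x))"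
    using Suc.IH[of "ldel A d f" x] Suc.IH[of f "D x"] Suc.prems by (auto simp: fun_eq_iff coeff)
  also have "\<dots> = b \<odot>\<^bsub>pmod M\<^esub> (ldel M D ^^ n) (pairm M (ldel A d f) x \<oplus>\<^bsub>pmod M\<^esub> pairm M f (D x))"
    using Suc.prems assms by (simp add: N.smult_r_distr ahom_add[OF funpow_ahom[OF ldel_ahom]])
  also have "pairm M (ldel A d f) x \<oplus>\<^bsub>pmod M\<^esub> pairm M f (D x) = ldel M D (pairm M f x)"
    using Suc.prems by (simp add: ldel_pairm)
  finally show ?case by (simp add: funpow_swap1)
qed

text \<open>The powers of \<lambda>+x are absorbed by f and form the twisted product with w; those
  of \<lambda>+x+y then act on the whole product as powers of \<lambda>+\<partial>, which is the
  action of b.\<close>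

lemma term1_eq:
  assumes f: "f \<in> carrier (pmod A)" and b: "b \<in> carrier (pmod A)" and w: "w \<in> carrier (pmod M)"
  shows "polysum M (supp A b \<times> supp M w) (\<lambda>(i, n).
       subst_xy M ((lam + xv + yv) ^ i * (lam + xv) ^ n)
         (\<lambda>q r k. ((d ^^ q) (f k) \<otimes>\<^bsub>A\<^esub> b i) \<odot> (D ^^ r) (w n))) = act2 A M D b (conv A d M f w)"
proof -
  interpret N: module A "pmod M" by (rule module_pmod)
  define g where "g i = (\<lambda>p. b i \<odot>\<^bsub>pmod M\<^esub> (ldel M D ^^ i) p)" for i
  have g: "g i \<in> ahom (pmod M) (pmod M)" for i
    unfolding g_def using b
    by (intro ahomI) (auto simp: ahom_add[OF funpow_ahom[OF ldel_ahom]] N.smult_r_distr)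
  have gc [simp]: "p \<in> carrier (pmod M) \<Longrightarrow> g i p \<in> carrier (pmod M)" for i p by (rule ahom_closed[OF g])
  have s: "subst_xy M ((lam + xv + yv) ^ i * (lam + xv) ^ n) (\<lambda>q r k. ((d ^^ q) (f k) \<otimes>\<^bsub>A\<^esub> b i) \<odot> (D ^^ r) (w n))
     = g i (pairm M ((ldel A d ^^ n) f) (w n))" for i n
    using f b w by (subst mult.commute) (simp add: subst_tensor subst_tensor_xy g_def)
  have "polysum M (supp A b \<times> supp M w) (\<lambda>(i, n).
       subst_xy M ((lam + xv + yv) ^ i * (lam + xv) ^ n)
         (\<lambda>q r k. ((d ^^ q) (f k) \<otimes>\<^bsub>A\<^esub> b i) \<odot> (D ^^ r) (w n)))
    = finsum (pmod M) (\<lambda>(i, n). g i (pairm M ((ldel A d ^^ n) f) (w n))) (SIGMA i:supp A b. supp M w)"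
    unfolding s using f w by (subst polysum_eq) auto
  also have "\<dots> = finsum (pmod M) (\<lambda>i. finsum (pmod M) (\<lambda>n. g i (pairm M ((ldel A d ^^ n) f) (w n))) (supp M w)) (supp A b)"
    using f b w by (subst P.finsum_Sigma) auto
  also have "\<dots> = finsum (pmod M) (\<lambda>i. g i (conv A d M f w)) (supp A b)"
    unfolding conv_def pext_def
    using f w by (subst ahom_finsum[OF P.abelian_group_axioms P.abelian_group_axioms g, symmetric]) auto
  also have "\<dots> = act2 A M D b (conv A d M f w)"
    by (simp add: act2_def act_def pext_def g_def)
  finally show ?thesis .
qed

lemma term2_eq:
  assumes f: "f \<in> carrier (pmod A)" and b: "b \<in> carrier (pmod A)" and v: "v \<in> carrier M" and \<phi>: "\<phi> \<in> ahom A (pmod A)"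
  shows "polysum M (SIGMA i:supp A b. supp A (\<phi> (b i))) (\<lambda>(i, n).
       subst_xy M ((lam + xv) ^ n * yv ^ i)
         (\<lambda>q r k. ((d ^^ q) (f k) \<otimes>\<^bsub>A\<^esub> \<phi> (b i) n) \<odot> (D ^^ r) v)) = conv A d M f (dact A M D \<phi> b v)"
proof -
  have [simp]: "\<phi> (b i) \<in> carrier (pmod A)" for i using b ahom_closed[OF \<phi>] by simp
  have s: "subst_xy M ((lam + xv) ^ n * yv ^ i) (\<lambda>q r k. ((d ^^ q) (f k) \<otimes>\<^bsub>A\<^esub> \<phi> (b i) n) \<odot> (D ^^ r) v)
     = pairm M ((ldel A d ^^ n) f) (pairm M (\<phi> (b i)) ((D ^^ i) v) n)" for i n
  proof -
    have "subst_xy M ((lam + xv) ^ n * yv ^ i) (\<lambda>q r k. ((d ^^ q) (f k) \<otimes>\<^bsub>A\<^esub> \<phi> (b i) n) \<odot> (D ^^ r) v)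
       = subst_xy M (yv ^ i * 1) (\<lambda>q r k. ((d ^^ q) ((ldel A d ^^ n) f k) \<otimes>\<^bsub>A\<^esub> \<phi> (b i) n) \<odot> (D ^^ r) v)"
      using f v by (simp add: subst_tensor)
    also have "\<dots> = (\<lambda>k. ((ldel A d ^^ n) f k \<otimes>\<^bsub>A\<^esub> \<phi> (b i) n) \<odot> (D ^^ i) v)"
      using f v by (subst subst_tensor_y; simp?; subst subst_one) auto
    finally show ?thesis using f v by (auto simp: pairm_def V.smult_assoc1)
  qed
  have "polysum M (SIGMA i:supp A b. supp A (\<phi> (b i))) (\<lambda>(i, n).
       subst_xy M ((lam + xv) ^ n * yv ^ i)
         (\<lambda>q r k. ((d ^^ q) (f k) \<otimes>\<^bsub>A\<^esub> \<phi> (b i) n) \<odot> (D ^^ r) v)) =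
    finsum (pmod M) (\<lambda>(i, n). pairm M ((ldel A d ^^ n) f) (pairm M (\<phi> (b i)) ((D ^^ i) v) n)) (SIGMA i:supp A b. supp A (\<phi> (b i)))"
    unfolding s using f v by (subst polysum_eq) auto
  also have "\<dots> = finsum (pmod M) (\<lambda>i. finsum (pmod M) (\<lambda>n. pairm M ((ldel A d ^^ n) f) (pairm M (\<phi> (b i)) ((D ^^ i) v) n)) (supp A (\<phi> (b i)))) (supp A b)"
    using f b v by (subst P.finsum_Sigma) auto
  also have "\<dots> = finsum (pmod M) (\<lambda>i. conv A d M f (pairm M (\<phi> (b i)) ((D ^^ i) v))) (supp A b)"
  proof -
    have "conv A d M f (pairm M (\<phi> (b i)) ((D ^^ i) v)) =
        finsum (pmod M) (\<lambda>n. pairm M ((ldel A d ^^ n) f) (pairm M (\<phi> (b i)) ((D ^^ i) v) n)) (supp A (\<phi> (b i)))" for i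
    proof (rule conv_superset[OF f])
      show "supp M (pairm M (\<phi> (b i)) ((D ^^ i) v)) \<subseteq> supp A (\<phi> (b i))"
        using v by (auto simp: supp_def pairm_def)
    qed (use v in auto)
    then show ?thesis by simp
  qed
  also have "\<dots> = conv A d M f (dact A M D \<phi> b v)"
    unfolding dact_def pext_def
    using f v by (subst ahom_finsum[OF P.abelian_group_axioms P.abelian_group_axioms conv_ahom]) auto
  finally show ?thesis .
qed

lemma wpow_closed [simp]: "c \<in> carrier A \<Longrightarrow> u \<in> carrier M \<Longrightarrow> wpow M D n c u \<in> carrier (pmod M)"
  by (induction n arbitrary: u) auto

lemma wpow_add: "c \<in> carrier A \<Longrightarrow> c' \<in> carrier A \<Longrightarrow> u \<in> carrier M \<Longrightarrow>
    wpow M D n (c \<oplus>\<^bsub>A\<^esub> c') u = wpow M D n c u \<oplus>\<^bsub>pmod M\<^esub> wpow M D n c' u"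
  by (induction n arbitrary: u) (auto simp: V.smult_l_distr cpoly_add lshift_add P.a_ac)

lemma ldel_wpow: "c \<in> carrier A \<Longrightarrow> u \<in> carrier M \<Longrightarrow>
    ldel M D (wpow M D n c u) = lshift M (wpow M D n c u) \<oplus>\<^bsub>pmod M\<^esub> (wpow M D n c (D u) \<oplus>\<^bsub>pmod M\<^esub> wpow M D n (d c) u)"
proof (induction n arbitrary: u)
  case 0
  then show ?case by (simp add: ldel_cpoly D_smult cpoly_add P.a_ac)
next
  case (Suc n)
  then show ?case by (simp add: ldel_add ldel_lshift lshift_add P.a_ac)
qed

text \<open>Now x differentiates u and y differentiates c. Thus \<lambda>+x+y is
  \<lambda>+\<partial> on the product, whereas the factor (\<lambda>+x)^n touches u only and is kept
  in \<open>wpow\<close>.\<close>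

lemma subst_wpow:
  assumes "b \<in> carrier A" "c \<in> carrier A" "u \<in> carrier M"
  shows "subst_xy M ((lam + xv + yv) ^ j * (lam + xv) ^ n) (\<lambda>q r. cpoly M ((b \<otimes>\<^bsub>A\<^esub> (d ^^ r) c) \<odot> (D ^^ q) u))
    = b \<odot>\<^bsub>pmod M\<^esub> (ldel M D ^^ j) (wpow M D n c u)"
  using assms(2,3)
proof (induction j arbitrary: c u)
  case 0
  interpret N: module A "pmod M" by (rule module_pmod)
  let ?F = "\<lambda>u q r. cpoly M ((b \<otimes>\<^bsub>A\<^esub> (d ^^ r) c) \<odot> (D ^^ q) u)"
  have "subst_xy M ((lam + xv) ^ n) (?F u) = b \<odot>\<^bsub>pmod M\<^esub> wpow M D n c u" if "u \<in> carrier M" for u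
    using that
  proof (induction n arbitrary: u)
    case 0
    then show ?case using \<open>c \<in> carrier A\<close> assms(1)
      by (simp, subst subst_one) (auto simp: V.smult_assoc1 cpoly_def coeff)
  next
    case (Suc n)
    have c: "?F u q r k \<in> carrier M" if "u \<in> carrier M" for u q r k
      using \<open>c \<in> carrier A\<close> assms(1) that by simp
    have "subst_xy M ((lam + xv) ^ Suc n) (?F u) k = (lshift M (subst_xy M ((lam + xv) ^ n) (?F u)) \<oplus>\<^bsub>pmod M\<^esub> subst_xy M ((lam + xv) ^ n) (?F (D u))) k" for k
      using c[OF Suc.prems]
      by (simp add: distrib_right subst_add[of "?F u"] subst_lam[of "?F u"] subst_x[of "?F u"] coeff funpow_swap1 del: funpow.simps)
        (simp add: funpow_swap1)
    then have "subst_xy M ((lam + xv) ^ Suc n) (?F u) = lshift M (subst_xy M ((lam + xv) ^ n) (?F u)) \<oplus>\<^bsub>pmod M\<^esub> subst_xy M ((lam + xv) ^ n) (?F (D u))" ..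
    then show ?case using Suc \<open>c \<in> carrier A\<close> assms(1) by (simp add: lshift_smult N.smult_r_distr)
  qed
  then show ?case using 0 by simp
next
  case (Suc j)
  interpret N: module A "pmod M" by (rule module_pmod)
  let ?F = "\<lambda>c u q r. cpoly M ((b \<otimes>\<^bsub>A\<^esub> (d ^^ r) c) \<odot> (D ^^ q) u)"
  let ?P = "(lam + xv + yv) ^ j * (lam + xv) ^ n"
  have c: "?F c u q r k \<in> carrier M" for q r k
    using Suc.prems assms(1) by simp
  have e: "(lam + xv + yv) ^ Suc j * (lam + xv) ^ n = lam * ?P + (xv * ?P + yv * ?P)" by (simp add: algebra_simps)
  have "subst_xy M ((lam + xv + yv) ^ Suc j * (lam + xv) ^ n) (?F c u) k =
     (lshift M (subst_xy M ?P (?F c u)) \<oplus>\<^bsub>pmod M\<^esub> (subst_xy M ?P (?F c (D u)) \<oplus>\<^bsub>pmod M\<^esub> subst_xy M ?P (?F (d c) u))) k" for k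
    unfolding e subst_add[of "?F c u", OF c] subst_lam[of "?F c u", OF c] subst_x[of "?F c u", OF c] subst_y[of "?F c u", OF c]
    by (simp add: coeff funpow_swap1)
  then have "subst_xy M ((lam + xv + yv) ^ Suc j * (lam + xv) ^ n) (?F c u) =
     lshift M (subst_xy M ?P (?F c u)) \<oplus>\<^bsub>pmod M\<^esub> (subst_xy M ?P (?F c (D u)) \<oplus>\<^bsub>pmod M\<^esub> subst_xy M ?P (?F (d c) u))" ..
  also have "\<dots> = b \<odot>\<^bsub>pmod M\<^esub> (ldel M D ^^ j) (lshift M (wpow M D n c u) \<oplus>\<^bsub>pmod M\<^esub> (wpow M D n c (D u) \<oplus>\<^bsub>pmod M\<^esub> wpow M D n (d c) u))"
  proof -
    have "lshift M ((ldel M D ^^ j) p) = (ldel M D ^^ j) (lshift M p)" if "p \<in> carrier (pmod M)" for p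
      using that by (induction j) (simp_all add: ldel_lshift[symmetric])
    then show ?thesis using Suc assms(1)
      by (simp add: lshift_smult[symmetric] N.smult_r_distr ahom_add[OF funpow_ahom[OF ldel_ahom]] lshift_smult)
  qed
  also have "\<dots> = b \<odot>\<^bsub>pmod M\<^esub> (ldel M D ^^ Suc j) (wpow M D n c u)"
    using Suc.prems by (simp add: ldel_wpow[symmetric] funpow_swap1)
  finally show ?case .
qed

lemma wpow_ext: "u \<in> carrier M \<Longrightarrow> poly_ext A (pmod M) (\<lambda>n c. wpow M D n c u)"
  by unfold_locales (rule ahomI, auto simp: wpow_add)

text \<open>The adjoint of f, evaluated at \<lambda>+x with x acting on u, is
  f(-\<lambda>-\<partial>) with \<partial> acting on the coefficients and on u together. This
  explains the adjoint anchor in the third summand.\<close>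

lemma wpow_flip:
  assumes "f \<in> carrier (pmod A)" "u \<in> carrier M"
  shows "pext A (pmod M) (\<lambda>n c. wpow M D n c u) (flip A d f) = flip M D (pairm M f u)"
proof -
  define t where "t f u = pext A (pmod M) (\<lambda>n c. wpow M D n c u) f" for f u
  have t: "(\<lambda>f. t f u) \<in> ahom (pmod A) (pmod M)" if "u \<in> carrier M" for u
    unfolding t_def by (rule poly_ext.ahom[OF wpow_ext[OF that]])
  note [simp] = ahom_closed[OF t]
  note tadd = ahom_add[OF t] and tminus = ahom_minus[OF Q.P.abelian_group_axioms P.abelian_group_axioms t]
  have tc: "t (cpoly A c) u = cpoly M (c \<odot> u)" if "c \<in> carrier A" "u \<in> carrier M" for c u
    using that by (simp add: t_def poly_ext.cpoly[OF wpow_ext])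
  have tl: "t (lshift A f) u = lshift M (t f u) \<oplus>\<^bsub>pmod M\<^esub> t f (D u)" if "f \<in> carrier (pmod A)" "u \<in> carrier M" for f u
  proof -
    have "t (lshift A f) u = finsum (pmod M) (\<lambda>n. lshift M (wpow M D n (f n) u) \<oplus>\<^bsub>pmod M\<^esub> wpow M D n (f n) (D u)) (supp A f)"
      using that unfolding t_def by (subst poly_ext.shift[OF wpow_ext]) (simp_all add: pext_def)
    also have "\<dots> = lshift M (t f u) \<oplus>\<^bsub>pmod M\<^esub> t f (D u)"
      using that unfolding t_def pext_def
      by (subst P.finsum_addf) (auto simp: ahom_finsum[OF P.abelian_group_axioms P.abelian_group_axioms lshift_ahom])
    finally show ?thesis .
  qed
  have td: "ldel M D (t f u) = t (ldel A d f) u" if "f \<in> carrier (pmod A)" "u \<in> carrier M" for f u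
    using that
  proof (induction f arbitrary: u rule: Q.pmod_induct)
    case (const c)
    then show ?case by (simp add: tc ldel_cpoly Q.ldel_cpoly tl tadd D_smult cpoly_add P.a_ac)
  next
    case (shift f)
    then show ?case by (simp add: tl Q.ldel_lshift ldel_add ldel_lshift)
  next
    case (add f g)
    then show ?case by (simp add: tadd Q.ldel_add ldel_add)
  qed
  have "t (flip A d f) u = flip M D (pairm M f u)"
    using assms
  proof (induction f arbitrary: u rule: Q.pmod_induct)
    case (const c)
    then show ?case by (simp add: tc pairm_cpoly)
  next
    case (shift f)
    then show ?case by (simp add: Q.flip_lshift tminus td[symmetric] pairm_lshift flip_lshift)
  next
    case (add f g)
    then show ?case by (simp add: Q.flip_add tadd pairm_add_l flip_add)
  qed
  then show ?thesis by (simp add: t_def)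
qed

text \<open>For each i the power x^i puts \<partial>^i on u and the sum over n is
  \<open>wpow_flip\<close>, so the sum over i is the flipped commutator; the powers of \<lambda>+x+y
  give the action of b.\<close>

lemma term3_eq:
  assumes a: "a \<in> carrier (pmod A)" and b: "b \<in> carrier (pmod A)" and u: "u \<in> carrier M" and \<phi>: "\<phi> \<in> ahom A (pmod A)"
    and \<psi>: "\<And>c. c \<in> carrier A \<Longrightarrow> \<psi> c = flip A d (\<phi> c)"
  shows "polysum M (supp A b \<times> (SIGMA i:supp A a. supp A (\<psi> (a i)))) (\<lambda>(j, i, n).
       subst_xy M ((lam + xv + yv) ^ j * (lam + xv) ^ n * xv ^ i)
         (\<lambda>q r. cpoly M ((b j \<otimes>\<^bsub>A\<^esub> (d ^^ r) (\<psi> (a i) n)) \<odot> (D ^^ q) u))) =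
    act2 A M D b (flip M D (dact A M D \<phi> a u))"
proof -
  interpret N: module A "pmod M" by (rule module_pmod)
  have [simp]: "\<phi> (a i) \<in> carrier (pmod A)" for i using a ahom_closed[OF \<phi>] by simp
  have \<psi>a: "\<psi> (a i) = flip A d (\<phi> (a i))" for i using a \<psi> by simp
  have \<psi>c [simp]: "\<psi> (a i) \<in> carrier (pmod A)" for i by (simp add: \<psi>a)
  define g where "g i = (\<lambda>p. b i \<odot>\<^bsub>pmod M\<^esub> (ldel M D ^^ i) p)" for i
  have g: "g i \<in> ahom (pmod M) (pmod M)" for i
    unfolding g_def using b
    by (intro ahomI) (auto simp: ahom_add[OF funpow_ahom[OF ldel_ahom]] N.smult_r_distr)
  have gc [simp]: "p \<in> carrier (pmod M) \<Longrightarrow> g i p \<in> carrier (pmod M)" for i p by (rule ahom_closed[OF g])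
  define w where "w i n = wpow M D n (\<psi> (a i) n) ((D ^^ i) u)" for i n
  have wc [simp]: "w i n \<in> carrier (pmod M)" for i n using u by (simp add: w_def)
  have s: "subst_xy M ((lam + xv + yv) ^ j * (lam + xv) ^ n * xv ^ i)
         (\<lambda>q r. cpoly M ((b j \<otimes>\<^bsub>A\<^esub> (d ^^ r) (\<psi> (a i) n)) \<odot> (D ^^ q) u)) = g j (w i n)" for j i n
  proof -
    let ?F = "\<lambda>u q r. cpoly M ((b j \<otimes>\<^bsub>A\<^esub> (d ^^ r) (\<psi> (a i) n)) \<odot> (D ^^ q) u)"
    let ?P = "(lam + xv + yv) ^ j * (lam + xv) ^ n"
    have "subst_xy M (xv ^ i * ?P) (?F u) = subst_xy M ?P (?F ((D ^^ i) u))"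
      by (rule subst_iter[where C = "carrier M" and F = ?F]) (use b u in \<open>auto simp: subst_x funpow_swap1\<close>)
    then show ?thesis using b u by (simp add: mult.commute[of _ "xv ^ i"] subst_wpow g_def w_def)
  qed
  have "polysum M (supp A b \<times> (SIGMA i:supp A a. supp A (\<psi> (a i)))) (\<lambda>(j, i, n).
       subst_xy M ((lam + xv + yv) ^ j * (lam + xv) ^ n * xv ^ i)
         (\<lambda>q r. cpoly M ((b j \<otimes>\<^bsub>A\<^esub> (d ^^ r) (\<psi> (a i) n)) \<odot> (D ^^ q) u))) =
    finsum (pmod M) (\<lambda>(j, x). (\<lambda>(i, n). g j (w i n)) x) (SIGMA j:supp A b. (SIGMA i:supp A a. supp A (\<psi> (a i))))"
    unfolding s by (subst polysum_eq) (auto simp: case_prod_unfold)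
  also have "\<dots> = finsum (pmod M) (\<lambda>j. finsum (pmod M) (\<lambda>(i, n). g j (w i n)) (SIGMA i:supp A a. supp A (\<psi> (a i)))) (supp A b)"
    using a b by (subst P.finsum_Sigma) auto
  also have "\<dots> = finsum (pmod M) (\<lambda>j. finsum (pmod M) (\<lambda>i. finsum (pmod M) (\<lambda>n. g j (w i n)) (supp A (\<psi> (a i)))) (supp A a)) (supp A b)"
  proof -
    have "finsum (pmod M) (\<lambda>(i, n). g j (w i n)) (SIGMA i:supp A a. supp A (\<psi> (a i))) =
        finsum (pmod M) (\<lambda>i. finsum (pmod M) (\<lambda>n. g j (w i n)) (supp A (\<psi> (a i)))) (supp A a)" for j
      using a by (intro P.finsum_Sigma) auto
    then show ?thesis by simp
  qed
  also have "\<dots> = finsum (pmod M) (\<lambda>j. g j (finsum (pmod M) (\<lambda>i. finsum (pmod M) (w i) (supp A (\<psi> (a i)))) (supp A a))) (supp A b)"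
    by (simp add: ahom_finsum[OF P.abelian_group_axioms P.abelian_group_axioms g] P.finsum_closed)
  also have "(\<lambda>i. finsum (pmod M) (w i) (supp A (\<psi> (a i)))) = (\<lambda>i. flip M D (pairm M (\<phi> (a i)) ((D ^^ i) u)))"
    using wpow_flip[symmetric] u by (simp add: pext_def \<psi>a w_def[abs_def])
  also have "finsum (pmod M) (\<lambda>i. flip M D (pairm M (\<phi> (a i)) ((D ^^ i) u))) (supp A a) = flip M D (dact A M D \<phi> a u)"
    unfolding dact_def pext_def
    using u by (subst ahom_finsum[OF P.abelian_group_axioms P.abelian_group_axioms flip_ahom]) auto
  finally show ?thesis by (simp add: act2_def act_def pext_def g_def)
qed

end

lemma (in diff_ring) cder_smult_eq:
  assumes "P \<in> carrier (pmod A)" "\<phi> b \<in> carrier (pmod A)"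
  shows "cder_smult A d P \<phi> b = act1 A d (selfm A) P (\<phi> b)"
proof -
  interpret S: diff_module A d "selfm A" d by (rule diff_module_self)
  have f: "flip A d P \<in> carrier (pmod A)" using assms by simp
  have m: "(\<lambda>x. x \<otimes> c) \<in> ahom A A" if "c \<in> carrier A" for c
    by (rule ahomI) (use that in \<open>auto simp: l_distr\<close>)
  have "subst_xy A ((lam + xv) ^ n) (\<lambda>q r k. (d ^^ q) (flip A d P k) \<otimes> \<phi> b n) =
      pairm (selfm A) ((ldel A d ^^ n) (flip A d P)) (\<phi> b n)" for n
  proof -
    have "subst_xy A ((lam + xv) ^ n * 1) (\<lambda>q r k. (d ^^ q) (flip A d P k) \<otimes> \<phi> b n) =
       subst_xy A 1 (\<lambda>q r k. (d ^^ q) ((ldel A d ^^ n) (flip A d P) k) \<otimes> \<phi> b n)"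
      by (rule subst_lam_x[OF f m agroup_axioms]) (use assms in auto)
    then show ?thesis using assms by (subst (asm) subst_one) (auto simp: pairm_def)
  qed
  then have "cder_smult A d P \<phi> b = polysum A (supp A (\<phi> b)) (\<lambda>n. pairm (selfm A) ((ldel A d ^^ n) (flip A d P)) (\<phi> b n))"
    using assms by (simp add: cder_smult_def adjoint_symbol_eq)
  also have "\<dots> = conv A d (selfm A) (flip A d P) (\<phi> b)"
    using assms S.pairm_closed by (subst polysum_eq) (auto simp: conv_def pext_def)
  finally show ?thesis using S.conv_flip[of P "\<phi> b"] assms by simp
qed

section \<open>Jet algebras\<close>

lemma ex1_unique: "\<exists>!x. P x \<Longrightarrow> P a \<Longrightarrow> P b \<Longrightarrow> a = b"
  by blast

locale jet_setup =
  fixes K :: "'k ring" and R :: "('k, 'r) module" and J :: "('k, 'j) module"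
    and d :: "'j \<Rightarrow> 'j" and \<iota> :: "'r \<Rightarrow> 'j"
  assumes K: "field K" "char_zero K" and R: "algebra K R" and jet: "jet_algebra K R J d \<iota>"
begin

lemma diff_alg: "differential_algebra K J d"
  using jet by (simp add: jet_algebra_def)

lemma diff_ring_J: "diff_ring J d"
proof -
  interpret algebra K J using diff_alg by (simp add: differential_algebra_def)
  show ?thesis
    using diff_alg by unfold_locales (auto simp: differential_algebra_def Der_def intro!: ahomI)
qed

sublocale diff_ring J d by (rule diff_ring_J)

sublocale JJ: algebra K J using diff_alg by (simp add: differential_algebra_def)

sublocale RR: algebra K R by (rule R)

lemma d_smult: "c \<in> carrier K \<Longrightarrow> a \<in> carrier J \<Longrightarrow> d (c \<odot>\<^bsub>J\<^esub> a) = c \<odot>\<^bsub>J\<^esub> d a"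
  using diff_alg by (auto simp: differential_algebra_def Der_def)

lemma d_const [simp]: "c \<in> carrier K \<Longrightarrow> d (c \<odot>\<^bsub>J\<^esub> \<one>\<^bsub>J\<^esub>) = \<zero>\<^bsub>J\<^esub>"
  by (simp add: d_smult)

lemma \<iota>_hom: "\<iota> \<in> algebra_hom K R J"
  using jet by (simp add: jet_algebra_def)

lemma \<iota>_closed [simp]: "r \<in> carrier R \<Longrightarrow> \<iota> r \<in> carrier J"
  and \<iota>_add: "r \<in> carrier R \<Longrightarrow> s \<in> carrier R \<Longrightarrow> \<iota> (r \<oplus>\<^bsub>R\<^esub> s) = \<iota> r \<oplus>\<^bsub>J\<^esub> \<iota> s"
  and \<iota>_mult: "r \<in> carrier R \<Longrightarrow> s \<in> carrier R \<Longrightarrow> \<iota> (r \<otimes>\<^bsub>R\<^esub> s) = \<iota> r \<otimes>\<^bsub>J\<^esub> \<iota> s"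
  and \<iota>_one: "\<iota> \<one>\<^bsub>R\<^esub> = \<one>\<^bsub>J\<^esub>"
  and \<iota>_smult: "c \<in> carrier K \<Longrightarrow> r \<in> carrier R \<Longrightarrow> \<iota> (c \<odot>\<^bsub>R\<^esub> r) = c \<odot>\<^bsub>J\<^esub> \<iota> r"
  using \<iota>_hom by (auto simp: algebra_hom_def ring_hom_def)

lemma \<iota>_ahom: "\<iota> \<in> ahom R J"
  by (rule ahomI) (auto simp: \<iota>_add)

lemmas \<iota>_zero [simp] = ahom_zero[OF RR.M.abelian_group_axioms abelian_group_axioms \<iota>_ahom]
lemmas \<iota>_diff = ahom_diff[OF RR.M.abelian_group_axioms abelian_group_axioms \<iota>_ahom]

lemma smult_eq_mult: "c \<in> carrier K \<Longrightarrow> a \<in> carrier J \<Longrightarrow> c \<odot>\<^bsub>J\<^esub> a = (c \<odot>\<^bsub>J\<^esub> \<one>\<^bsub>J\<^esub>) \<otimes>\<^bsub>J\<^esub> a"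
  by (simp add: JJ.smult_assoc2)

lemma mult_const: "c \<in> carrier K \<Longrightarrow> a \<in> carrier J \<Longrightarrow> a \<otimes>\<^bsub>J\<^esub> (c \<odot>\<^bsub>J\<^esub> \<one>\<^bsub>J\<^esub>) = c \<odot>\<^bsub>J\<^esub> a"
  by (simp add: m_comm[of a] JJ.smult_assoc2)

text \<open>The universal property asserts uniqueness among extensional maps, so both maps are first
  restricted to the carrier.\<close>

lemma jet_hom_unique:
  assumes "differential_algebra K B d'"
    and "g \<in> differential_algebra_hom K J d B d'" "h \<in> differential_algebra_hom K J d B d'"
    and "\<And>r. r \<in> carrier R \<Longrightarrow> g (\<iota> r) = h (\<iota> r)" and "a \<in> carrier J"
  shows "g a = h a"
proof -
  have r: "restrict g (carrier J) \<in> differential_algebra_hom K J d B d'"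
    if "g \<in> differential_algebra_hom K J d B d'" for g
    by (rule differential_algebra_homI) (simp_all add: differential_algebra_homD[OF that])
  have f: "(\<lambda>r. g (\<iota> r)) \<in> algebra_hom K R B"
    using differential_algebra_homD[OF assms(2)]
    by (auto simp: algebra_hom_def ring_hom_def \<iota>_add \<iota>_mult \<iota>_one \<iota>_smult)
  let ?P = "\<lambda>k. k \<in> differential_algebra_hom K J d B d' \<and> k \<in> extensional (carrier J) \<and> (\<forall>r\<in>carrier R. g (\<iota> r) = k (\<iota> r))"
  have U: "\<exists>!k. ?P k" by (rule jet_algebra_universal[OF K R jet assms(1) f])
  have g: "?P (restrict g (carrier J))" using r[OF assms(2)] by simp
  have h: "?P (restrict h (carrier J))" using r[OF assms(3)] assms(4) by simp
  have "restrict g (carrier J) = restrict h (carrier J)"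
    by (rule ex1_unique[where P = ?P, OF U]) (rule g, rule h)
  then show ?thesis using assms(5) by (metis restrict_apply')
qed

lemma jet_hom_exists:
  assumes "differential_algebra K B d'" "f \<in> algebra_hom K R B"
  obtains h where "h \<in> differential_algebra_hom K J d B d'" "\<And>r. r \<in> carrier R \<Longrightarrow> h (\<iota> r) = f r"
  using jet_algebra_universal[OF K R jet assms] by auto

text \<open>The elements with property Q form a differential subalgebra containing the image of
  \<iota>. The universal property maps J into it, and by uniqueness this map followed by the
  inclusion is the identity.\<close>

lemma jet_induct [consumes 1, case_names base add mult d]:
  assumes a: "a \<in> carrier J"
    and Q: "\<And>r. r \<in> carrier R \<Longrightarrow> Q (\<iota> r)"
      "\<And>a b. a \<in> carrier J \<Longrightarrow> b \<in> carrier J \<Longrightarrow> Q a \<Longrightarrow> Q b \<Longrightarrow> Q (a \<oplus>\<^bsub>J\<^esub> b)"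
      "\<And>a b. a \<in> carrier J \<Longrightarrow> b \<in> carrier J \<Longrightarrow> Q a \<Longrightarrow> Q b \<Longrightarrow> Q (a \<otimes>\<^bsub>J\<^esub> b)"
      "\<And>a. a \<in> carrier J \<Longrightarrow> Q a \<Longrightarrow> Q (d a)"
  shows "Q a"
proof -
  define S where "S = {a \<in> carrier J. Q a}"
  have "Q \<one>\<^bsub>J\<^esub>" using Q(1)[of "\<one>\<^bsub>R\<^esub>"] by (simp add: \<iota>_one)
  \<comment> \<open>Closure under ground scalars follows from closure under products, since c times
    1 lies in the image of \<iota>.\<close>
  moreover have "Q (c \<odot>\<^bsub>J\<^esub> a)" if "c \<in> carrier K" "a \<in> carrier J" "Q a" for c a
  proof -
    have "Q (c \<odot>\<^bsub>J\<^esub> \<one>\<^bsub>J\<^esub>)" using Q(1)[of "c \<odot>\<^bsub>R\<^esub> \<one>\<^bsub>R\<^esub>"] that by (simp add: \<iota>_one \<iota>_smult)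
    then show ?thesis using that Q(3) by (subst smult_eq_mult) auto
  qed
  ultimately have S: "S \<subseteq> carrier J" "\<one>\<^bsub>J\<^esub> \<in> S"
      "\<forall>a\<in>S. \<forall>b\<in>S. a \<oplus>\<^bsub>J\<^esub> b \<in> S" "\<forall>a\<in>S. \<forall>b\<in>S. a \<otimes>\<^bsub>J\<^esub> b \<in> S"
      "\<forall>c\<in>carrier K. \<forall>a\<in>S. c \<odot>\<^bsub>J\<^esub> a \<in> S" "\<forall>a\<in>S. d a \<in> S"
    using Q by (auto simp: S_def)
  note tr = transport_differential_algebra[OF diff_alg S inj_on_id]
  let ?D = "transport_algebra J S id" and ?dD = "\<lambda>x. id (d (inv_into S id x))"
  have "(\<lambda>a. id (\<iota> a)) \<in> algebra_hom K R ?D"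
    using Q(1) by (intro tr(3)[OF \<iota>_hom]) (auto simp: S_def)
  from jet_hom_exists[OF tr(1) this] obtain k where k: "k \<in> differential_algebra_hom K J d ?D ?dD"
    and k\<iota>: "\<And>r. r \<in> carrier R \<Longrightarrow> k (\<iota> r) = \<iota> r" by auto
  have kS: "k a \<in> S" if "a \<in> carrier J" for a
    using differential_algebra_homD(1)[OF k that] by (simp add: transport_algebra_def Let_def)
  have inv: "inv_into S id a = a" if "a \<in> S" for a using inv_into_f_f[of id S a] that by simp
  note kD = differential_algebra_homD[OF k] and wD = differential_algebra_homD[OF tr(2)]
  have H: "(\<lambda>a. inv_into S id (k a)) \<in> differential_algebra_hom K J d J d"
    by (rule differential_algebra_homI) (simp_all add: kD wD del: id_apply)
  have I: "(\<lambda>a. a) \<in> differential_algebra_hom K J d J d"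
    by (rule differential_algebra_homI) simp_all
  have base: "inv_into S id (k (\<iota> r)) = \<iota> r" if "r \<in> carrier R" for r
    using inv[of "\<iota> r"] Q(1) that by (simp add: k\<iota> S_def)
  have "inv_into S id (k a) = a"
    by (rule jet_hom_unique[OF diff_alg H I base a])
  then show ?thesis using kS[OF a] inv[of "k a"] by (simp add: S_def)
qed

lemma obtain_retraction:
  obtains h where "h \<in> ahom J R" "\<And>a b. a \<in> carrier J \<Longrightarrow> b \<in> carrier J \<Longrightarrow> h (a \<otimes>\<^bsub>J\<^esub> b) = h a \<otimes>\<^bsub>R\<^esub> h b"
    "\<And>r. r \<in> carrier R \<Longrightarrow> h (\<iota> r) = r" "\<And>a. a \<in> carrier J \<Longrightarrow> h (d a) = \<zero>\<^bsub>R\<^esub>"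
proof -
  have "differential_algebra K R (\<lambda>_. \<zero>\<^bsub>R\<^esub>)"
    using R by (auto simp: differential_algebra_def Der_def)
  moreover have "(\<lambda>r. r) \<in> algebra_hom K R R"
    by (auto simp: algebra_hom_def ring_hom_def)
  ultimately obtain h where h: "h \<in> differential_algebra_hom K J d R (\<lambda>_. \<zero>\<^bsub>R\<^esub>)"
    and "\<And>r. r \<in> carrier R \<Longrightarrow> h (\<iota> r) = r" using jet_hom_exists by blast
  then show ?thesis
    using differential_algebra_homD[OF h] by (intro that[of h]) (auto intro!: ahomI)
qed

lemma CDer_iff:
  "\<phi> \<in> CDer K J d \<longleftrightarrow> cder J d \<phi> \<and>
     (\<forall>c\<in>carrier K. \<forall>a\<in>carrier J. \<phi> (c \<odot>\<^bsub>J\<^esub> a) = (c \<odot>\<^bsub>J\<^esub> \<one>\<^bsub>J\<^esub>) \<odot>\<^bsub>pmod (selfm J)\<^esub> \<phi> a)"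
  (is "?L \<longleftrightarrow> ?C \<and> ?K")
proof
  assume L: ?L
  then have c: "\<phi> a \<in> carrier (pmod J)" if "a \<in> carrier J" for a
    using that by (auto simp: CDer_def up_eq)
  show "?C \<and> ?K"
    using L c unfolding CDer_def cder_def
    by (auto intro!: ahomI ext simp: coeff ldel_def lshift_def a_comm m_comm mult_const)
next
  assume CK: "?C \<and> ?K"
  then have ah: "\<phi> \<in> ahom J (pmod J)" by (simp add: cder_def)
  then have c [simp]: "\<phi> a \<in> carrier (pmod J)" if "a \<in> carrier J" for a
    using that ahom_closed by fast
  show ?L
    using CK unfolding CDer_def cder_def
    by (auto simp: up_eq coeff ahom_add[OF ah] ldel_def lshift_def a_comm m_comm mult_const)
qed

text \<open>J is generated by \<iota>(R), and both maps obey the same rules for sums, products and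
  \<partial>. Properties of lifts are therefore checked on R only.\<close>

lemma cder_unique:
  assumes "cder J d \<phi>" "cder J d \<psi>" "\<And>r. r \<in> carrier R \<Longrightarrow> \<phi> (\<iota> r) = \<psi> (\<iota> r)" "a \<in> carrier J"
  shows "\<phi> a = \<psi> a"
  using assms(4)
proof (induction a rule: jet_induct)
  case (add a b)
  then show ?case using assms(1,2) ahom_add[of \<phi> J "pmod J"] ahom_add[of \<psi> J "pmod J"] by (simp add: cder_def)
qed (use assms(1-3) in \<open>simp_all add: cder_def\<close>)

section \<open>Extending derivations through a square-zero extension\<close>

definition sqzero :: "('k, 'j \<times> (nat \<Rightarrow> 'j)) module" where
  "sqzero = \<lparr>carrier = carrier J \<times> carrier (pmod J),
     mult = (\<lambda>x y. (fst x \<otimes>\<^bsub>J\<^esub> fst y, fst x \<odot>\<^bsub>pmod (selfm J)\<^esub> snd y \<oplus>\<^bsub>pmod J\<^esub> fst y \<odot>\<^bsub>pmod (selfm J)\<^esub> snd x)),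
     one = (\<one>\<^bsub>J\<^esub>, \<zero>\<^bsub>pmod J\<^esub>), zero = (\<zero>\<^bsub>J\<^esub>, \<zero>\<^bsub>pmod J\<^esub>),
     add = (\<lambda>x y. (fst x \<oplus>\<^bsub>J\<^esub> fst y, snd x \<oplus>\<^bsub>pmod J\<^esub> snd y)),
     smult = (\<lambda>c x. (c \<odot>\<^bsub>J\<^esub> fst x, (c \<odot>\<^bsub>J\<^esub> \<one>\<^bsub>J\<^esub>) \<odot>\<^bsub>pmod (selfm J)\<^esub> snd x))\<rparr>"

text \<open>A conformal derivation \<open>\<phi>\<close> is the same as a homomorphism of differential algebras
  \<open>a \<mapsto> (a, \<phi>\<^sub>\<lambda>(a))\<close> to the square-zero extension of \<open>J\<close> by \<open>J[\<lambda>]\<close> with the derivation \<open>(\<partial>, \<lambda>+\<partial>)\<close>.\<close>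

lemma sqzero_differential_algebra:
  "differential_algebra K sqzero (\<lambda>x. (d (fst x), ldel J d (snd x)))"
proof -
  interpret O: diff_module J d "pmod (selfm J)" "ldel J d" by (rule diff_module_opmul)
  note [simp] = O.V.smult_closed[simplified] O.V.smult_one[simplified]
  have smult_zero [simp]: "a \<in> carrier J \<Longrightarrow> a \<odot>\<^bsub>pmod (selfm J)\<^esub> \<zero>\<^bsub>pmod J\<^esub> = \<zero>\<^bsub>pmod J\<^esub>" for a
    using O.V.smult_r_null by simp
  have zero_smult [simp]: "f \<in> carrier (pmod J) \<Longrightarrow> \<zero>\<^bsub>J\<^esub> \<odot>\<^bsub>pmod (selfm J)\<^esub> f = \<zero>\<^bsub>pmod J\<^esub>" for f
    using O.V.smult_l_null by simp
  note dist = O.V.smult_l_distr[simplified] O.V.smult_r_distr[simplified]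
  have assoc: "a \<in> carrier J \<Longrightarrow> b \<in> carrier J \<Longrightarrow> f \<in> carrier (pmod J) \<Longrightarrow>
    a \<odot>\<^bsub>pmod (selfm J)\<^esub> (b \<odot>\<^bsub>pmod (selfm J)\<^esub> f) = (a \<otimes>\<^bsub>J\<^esub> b) \<odot>\<^bsub>pmod (selfm J)\<^esub> f" for a b f
    using O.V.smult_assoc1 by simp
  have kk: "c \<in> carrier K \<Longrightarrow> a \<in> carrier J \<Longrightarrow> (c \<odot>\<^bsub>J\<^esub> \<one>\<^bsub>J\<^esub>) \<otimes>\<^bsub>J\<^esub> a = c \<odot>\<^bsub>J\<^esub> a" for c a
    by (simp add: JJ.smult_assoc2)
  have kk': "c \<in> carrier K \<Longrightarrow> a \<in> carrier J \<Longrightarrow> b \<in> carrier J \<Longrightarrow> a \<otimes>\<^bsub>J\<^esub> (c \<odot>\<^bsub>J\<^esub> b) = c \<odot>\<^bsub>J\<^esub> (a \<otimes>\<^bsub>J\<^esub> b)" for c a b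
    using JJ.smult_assoc2[of c b a] by (simp add: m_comm)
  have kk2: "c \<in> carrier K \<Longrightarrow> c' \<in> carrier K \<Longrightarrow> c \<odot>\<^bsub>J\<^esub> (c' \<odot>\<^bsub>J\<^esub> \<one>\<^bsub>J\<^esub>) = c' \<odot>\<^bsub>J\<^esub> (c \<odot>\<^bsub>J\<^esub> \<one>\<^bsub>J\<^esub>)" for c c'
    by (simp add: JJ.R.m_comm flip: JJ.smult_assoc1)
  have ab: "abelian_group sqzero"
    by (rule abelian_groupI)
      (auto simp: sqzero_def a_ac P.a_ac intro!: bexI[of _ "(\<ominus>\<^bsub>J\<^esub> _, \<ominus>\<^bsub>pmod J\<^esub> _)"] l_neg P.l_neg)
  have cm: "comm_monoid sqzero"
    by (rule comm_monoidI)
      (auto simp: sqzero_def m_ac P.a_ac dist assoc)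
  have cr: "cring sqzero"
    by (rule cringI[OF ab cm]) (auto simp: sqzero_def l_distr P.a_ac dist)
  have alg: "algebra K sqzero"
    by (rule algebraI[OF JJ.R_cring cr])
      (auto simp: sqzero_def JJ.smult_l_distr JJ.smult_r_distr JJ.smult_assoc1 JJ.smult_assoc2 dist assoc kk kk' kk2)
  have dd: "ldel J d (a \<odot>\<^bsub>pmod (selfm J)\<^esub> f) = d a \<odot>\<^bsub>pmod (selfm J)\<^esub> f \<oplus>\<^bsub>pmod J\<^esub> a \<odot>\<^bsub>pmod (selfm J)\<^esub> ldel J d f"
    if "a \<in> carrier J" "f \<in> carrier (pmod J)" for a f
    using O.D_smult that by simp
  show ?thesis
    unfolding differential_algebra_def Der_def using alg
    by (auto simp: sqzero_def D_add ldel_add d_smult dd d_mult P.a_ac)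
qed

text \<open>The pair formed by r and D r, both mapped by \<iota>, depends on r by an algebra
  homomorphism because D is a derivation. Its extension to J has the wanted map as second
  component.\<close>

lemma extends_der_exists:
  assumes D: "D \<in> Der K R"
  shows "\<exists>\<phi>. cder J d \<phi> \<and> \<phi> \<in> CDer K J d \<and> (\<forall>r\<in>carrier R. \<phi> (\<iota> r) = cpoly J (\<iota> (D r)))"
proof -
  interpret O: diff_module J d "pmod (selfm J)" "ldel J d" by (rule diff_module_opmul)
  have DD: "r \<in> carrier R \<Longrightarrow> D r \<in> carrier R"
    "r \<in> carrier R \<Longrightarrow> s \<in> carrier R \<Longrightarrow> D (r \<oplus>\<^bsub>R\<^esub> s) = D r \<oplus>\<^bsub>R\<^esub> D s"
    "r \<in> carrier R \<Longrightarrow> s \<in> carrier R \<Longrightarrow> D (r \<otimes>\<^bsub>R\<^esub> s) = D r \<otimes>\<^bsub>R\<^esub> s \<oplus>\<^bsub>R\<^esub> r \<otimes>\<^bsub>R\<^esub> D s"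
    "c \<in> carrier K \<Longrightarrow> r \<in> carrier R \<Longrightarrow> D (c \<odot>\<^bsub>R\<^esub> r) = c \<odot>\<^bsub>R\<^esub> D r" for r s c
    using D by (auto simp: Der_def)
  have D1: "D \<one>\<^bsub>R\<^esub> = \<zero>\<^bsub>R\<^esub>"
    using DD(3)[of "\<one>\<^bsub>R\<^esub>" "\<one>\<^bsub>R\<^esub>"] DD(1)[of "\<one>\<^bsub>R\<^esub>"] RR.M.add.l_cancel_one[of "D \<one>\<^bsub>R\<^esub>" "D \<one>\<^bsub>R\<^esub>"] by simp
  have f: "(\<lambda>r. (\<iota> r, cpoly J (\<iota> (D r)))) \<in> algebra_hom K R sqzero"
    by (auto simp: algebra_hom_def ring_hom_def sqzero_def \<iota>_add \<iota>_mult \<iota>_one \<iota>_smult DD D1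
      cpoly_add smult_cpoly a_comm m_comm P.a_comm mult_const)
  obtain h where h: "h \<in> differential_algebra_hom K J d sqzero (\<lambda>x. (d (fst x), ldel J d (snd x)))"
    and h\<iota>: "\<And>r. r \<in> carrier R \<Longrightarrow> h (\<iota> r) = (\<iota> r, cpoly J (\<iota> (D r)))"
    using jet_hom_exists[OF sqzero_differential_algebra f] by blast
  note hD = differential_algebra_homD[OF h, unfolded sqzero_def, simplified]
  \<comment> \<open>The second component satisfies the derivation rules relative to the first, which
    therefore has to be the identity.\<close>
  have fst: "fst (h a) = a" if "a \<in> carrier J" for a
    using that by (induction a rule: jet_induct) (simp_all add: h\<iota> hD)
  have snd [simp]: "snd (h a) \<in> carrier (pmod J)" if "a \<in> carrier J" for a
    using hD(1)[OF that] by auto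
  have c: "cder J d (\<lambda>a. snd (h a))"
    unfolding cder_def by (auto intro!: ahomI simp: hD fst P.a_comm)
  moreover have "snd (h (c \<odot>\<^bsub>J\<^esub> a)) = (c \<odot>\<^bsub>J\<^esub> \<one>\<^bsub>J\<^esub>) \<odot>\<^bsub>pmod (selfm J)\<^esub> snd (h a)" if "c \<in> carrier K" "a \<in> carrier J" for c a
    using that by (simp add: hD)
  ultimately have "(\<lambda>a. snd (h a)) \<in> CDer K J d" by (simp add: CDer_iff)
  with c h\<iota> show ?thesis by (intro exI[of _ "\<lambda>a. snd (h a)"]) simp
qed

lemma extends_der_unique_exists:
  assumes D: "D \<in> Der K R"
  shows "\<exists>!\<phi>. extends_der K R J d \<iota> D \<phi>"
proof -
  obtain \<phi> where \<phi>: "\<phi> \<in> CDer K J d" "\<And>r. r \<in> carrier R \<Longrightarrow> \<phi> (\<iota> r) = cpoly J (\<iota> (D r))"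
    using extends_der_exists[OF D] by blast
  have "restrict \<phi> (carrier J) \<in> CDer K J d"
    using \<phi>(1) by (auto simp: CDer_def Pi_iff)
  then have "extends_der K R J d \<iota> D (restrict \<phi> (carrier J))"
    using \<phi>(2) by (simp add: extends_der_def)
  moreover have "\<psi> = \<psi>'" if "extends_der K R J d \<iota> D \<psi>" "extends_der K R J d \<iota> D \<psi>'" for \<psi> \<psi>'
    using that cder_unique[of \<psi> \<psi>']
    by (intro extensionalityI[of _ "carrier J"]) (auto simp: extends_der_def CDer_iff)
  ultimately show ?thesis by blast
qed

lemma der_lift:
  assumes "D \<in> Der K R"
  shows "der_lift K R J d \<iota> D \<in> CDer K J d" "cder J d (der_lift K R J d \<iota> D)"
    "r \<in> carrier R \<Longrightarrow> der_lift K R J d \<iota> D (\<iota> r) = cpoly J (\<iota> (D r))"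
  using theI'[OF extends_der_unique_exists[OF assms]]
  by (auto simp: extends_der_def CDer_iff der_lift_def)

end

section \<open>Tensor products\<close>

locale tensor = S: ring S + F: abelian_group F
  for S :: "'s ring" and R :: "('k, 'r) module" and F :: "('r, 'f) module" +
  fixes ract :: "'s \<Rightarrow> 'r \<Rightarrow> 's"
  assumes ract_closed [simp]: "s \<in> carrier S \<Longrightarrow> r \<in> carrier R \<Longrightarrow> ract s r \<in> carrier S"
    and ract_mult: "s \<in> carrier S \<Longrightarrow> t \<in> carrier S \<Longrightarrow> r \<in> carrier R \<Longrightarrow> s \<otimes>\<^bsub>S\<^esub> ract t r = ract (s \<otimes>\<^bsub>S\<^esub> t) r"
    and F_smult_closed [simp]: "r \<in> carrier R \<Longrightarrow> u \<in> carrier F \<Longrightarrow> r \<odot>\<^bsub>F\<^esub> u \<in> carrier F"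
begin

abbreviation "G \<equiv> tensor_free S F"
abbreviation "N \<equiv> tensor_rels S ract R F"
abbreviation "T \<equiv> tensor_module S ract R F"
abbreviation "cls x \<equiv> N #>\<^bsub>G\<^esub> x"
abbreviation "ten \<equiv> tensor_elem S ract R F"

definition rels :: "('s \<times> 'f \<Rightarrow>\<^sub>0 int) set" where
  "rels = {frag_of (s \<oplus>\<^bsub>S\<^esub> t, u) - frag_of (s, u) - frag_of (t, u) | s t u.
         s \<in> carrier S \<and> t \<in> carrier S \<and> u \<in> carrier F} \<union>
      {frag_of (s, u \<oplus>\<^bsub>F\<^esub> v) - frag_of (s, u) - frag_of (s, v) | s u v.
         s \<in> carrier S \<and> u \<in> carrier F \<and> v \<in> carrier F} \<union>
      {frag_of (ract s r, u) - frag_of (s, r \<odot>\<^bsub>F\<^esub> u) | s r u.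
         s \<in> carrier S \<and> r \<in> carrier R \<and> u \<in> carrier F}"

lemma N_eq: "N = generate G rels"
  by (simp add: tensor_rels_def rels_def)

sublocale G: comm_group G
  unfolding tensor_free_def by (rule abelian_free_Abelian_group)

lemma G_simps [simp]:
  "x \<in> carrier G \<longleftrightarrow> Poly_Mapping.keys x \<subseteq> carrier S \<times> carrier F"
  "\<one>\<^bsub>G\<^esub> = 0" "x \<otimes>\<^bsub>G\<^esub> y = x + y"
  by (simp_all add: tensor_free_def)

lemma G_add: "x \<in> carrier G \<Longrightarrow> y \<in> carrier G \<Longrightarrow> x + y \<in> carrier G"
  using G.m_closed[of x y] by simp

lemma G_minus: "x \<in> carrier G \<Longrightarrow> - x \<in> carrier G"
  by simp

lemma G_diff: "x \<in> carrier G \<Longrightarrow> y \<in> carrier G \<Longrightarrow> x - y \<in> carrier G"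
  using G_add[of x "- y"] by simp

lemma G_frag: "s \<in> carrier S \<Longrightarrow> u \<in> carrier F \<Longrightarrow> frag_of (s, u) \<in> carrier G"
  by simp

lemma rels_G: "rels \<subseteq> carrier G"
  unfolding rels_def by (auto intro!: G_diff G_frag simp del: G_simps(1))

lemma N_subgroup: "subgroup N G"
  unfolding N_eq by (rule G.generate_is_subgroup[OF rels_G])

sublocale Nn: normal N G
  by (rule G.subgroup_imp_normal[OF N_subgroup])

sublocale Q: comm_group "G Mod N"
  by (rule G.abelian_FactGroup[OF N_subgroup])

lemma N_G: "n \<in> N \<Longrightarrow> n \<in> carrier G"
  using subgroup.subset[OF N_subgroup] by blast

lemma T_simps:
  "carrier T = carrier (G Mod N)" "add T = mult (G Mod N)" "zero T = one (G Mod N)"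
  "s \<odot>\<^bsub>T\<^esub> X = (\<Union>x\<in>X. cls (frag_extend (\<lambda>(t, u). frag_of (s \<otimes>\<^bsub>S\<^esub> t, u)) x))"
  by (simp_all add: tensor_module_def Let_def)

lemma T_abelian_group: "abelian_group T"
  by (rule abelian_groupI; unfold T_simps(1-3);
      (rule Q.m_closed Q.one_closed Q.m_assoc Q.m_comm Q.l_one Q.l_inv_ex; assumption)?)

sublocale T: abelian_group T
  by (rule T_abelian_group)

lemma carrier_T: "carrier T = {cls x | x. x \<in> carrier G}"
  by (auto simp: T_simps FactGroup_def RCOSETS_def)

lemma cls_closed: "x \<in> carrier G \<Longrightarrow> cls x \<in> carrier T"
  by (auto simp: carrier_T)

lemma cls_add: "x \<in> carrier G \<Longrightarrow> y \<in> carrier G \<Longrightarrow> cls x \<oplus>\<^bsub>T\<^esub> cls y = cls (x + y)"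
  using Nn.rcos_sum[of x y] by (simp add: T_simps FactGroup_def del: G_simps(1))

lemma cls_mem: "y \<in> cls x \<longleftrightarrow> (\<exists>n\<in>N. y = n + x)"
  by (auto simp: r_coset_def)

lemma cls_eq:
  assumes "x \<in> carrier G" "x - y \<in> N"
  shows "cls x = cls y"
proof -
  have "y = - (x - y) + x" by simp
  moreover have "- (x - y) \<in> N"
    using subgroup.m_inv_closed[OF N_subgroup assms(2)] N_G[OF assms(2)]
    by (simp add: tensor_free_def)
  ultimately have "y \<in> cls x" unfolding cls_mem by blast
  then show ?thesis using G.repr_independence[OF _ assms(1) N_subgroup] by blast
qed

lemma ten_eq: "ten s u = cls (frag_of (s, u))"
  by (simp add: tensor_elem_def)

lemma ten_closed [simp]: "s \<in> carrier S \<Longrightarrow> u \<in> carrier F \<Longrightarrow> ten s u \<in> carrier T"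
  unfolding ten_eq by (intro cls_closed G_frag)

lemma rels_N: "x \<in> rels \<Longrightarrow> x \<in> N"
  unfolding N_eq by (rule generate.incl)

lemma ten_add_l:
  assumes "s \<in> carrier S" "t \<in> carrier S" "u \<in> carrier F"
  shows "ten (s \<oplus>\<^bsub>S\<^esub> t) u = ten s u \<oplus>\<^bsub>T\<^esub> ten t u"
proof -
  have "frag_of (s \<oplus>\<^bsub>S\<^esub> t, u) - frag_of (s, u) - frag_of (t, u) \<in> rels"
    using assms unfolding rels_def by blast
  then have "cls (frag_of (s \<oplus>\<^bsub>S\<^esub> t, u)) = cls (frag_of (s, u) + frag_of (t, u))"
    using assms by (intro cls_eq G_frag rels_N) (simp_all add: diff_diff_eq)
  then show ?thesis using assms by (simp add: ten_eq cls_add)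
qed

lemma ten_add_r:
  assumes "s \<in> carrier S" "u \<in> carrier F" "v \<in> carrier F"
  shows "ten s (u \<oplus>\<^bsub>F\<^esub> v) = ten s u \<oplus>\<^bsub>T\<^esub> ten s v"
proof -
  have "frag_of (s, u \<oplus>\<^bsub>F\<^esub> v) - frag_of (s, u) - frag_of (s, v) \<in> rels"
    using assms unfolding rels_def by blast
  then have "cls (frag_of (s, u \<oplus>\<^bsub>F\<^esub> v)) = cls (frag_of (s, u) + frag_of (s, v))"
    using assms by (intro cls_eq G_frag rels_N) (simp_all add: diff_diff_eq)
  then show ?thesis using assms by (simp add: ten_eq cls_add)
qed

lemma ten_balanced:
  assumes "s \<in> carrier S" "r \<in> carrier R" "u \<in> carrier F"
  shows "ten (ract s r) u = ten s (r \<odot>\<^bsub>F\<^esub> u)"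
proof -
  have "frag_of (ract s r, u) - frag_of (s, r \<odot>\<^bsub>F\<^esub> u) \<in> rels"
    using assms unfolding rels_def by blast
  then show ?thesis unfolding ten_eq using assms by (intro cls_eq G_frag rels_N) simp_all
qed

lemma ten_ahom_l: "u \<in> carrier F \<Longrightarrow> (\<lambda>s. ten s u) \<in> ahom S T"
  by (rule ahomI) (auto simp: ten_add_l)

text \<open>The formal negative of a pair is the class of a pure tensor with negated first factor,
  so sums of pure tensors suffice.\<close>

lemma T_induct [consumes 1, case_names elem add]:
  assumes "x \<in> carrier T" "\<And>s u. s \<in> carrier S \<Longrightarrow> u \<in> carrier F \<Longrightarrow> P (ten s u)"
    and "\<And>x y. x \<in> carrier T \<Longrightarrow> y \<in> carrier T \<Longrightarrow> P x \<Longrightarrow> P y \<Longrightarrow> P (x \<oplus>\<^bsub>T\<^esub> y)"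
  shows "P x"
proof -
  have cls0: "cls 0 = \<zero>\<^bsub>T\<^esub>"
    using subgroup.subset[OF N_subgroup] by (simp add: T_simps FactGroup_def r_coset_def)
  have neg: "cls (- x) = \<ominus>\<^bsub>T\<^esub> cls x" if "x \<in> carrier G" for x
    using cls_add[of "- x" x] that cls0 by (intro T.minus_equality[symmetric] cls_closed) auto
  obtain c where c: "x = cls c" "Poly_Mapping.keys c \<subseteq> carrier S \<times> carrier F"
    using assms(1) by (auto simp: carrier_T)
  \<comment> \<open>The free group is generated by differences, so the claim is proved for c and -c
    together.\<close>
  have "P (cls c) \<and> P (cls (- c))"
    using c(2)
  proof (induction c rule: free_Abelian_group_induct[consumes 1, case_names zero diff base])
    case zero
    have "ten \<zero>\<^bsub>S\<^esub> \<zero>\<^bsub>F\<^esub> = \<zero>\<^bsub>T\<^esub>"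
      by (rule ahom_zero[OF S.abelian_group_axioms T_abelian_group ten_ahom_l]) simp
    then show ?case using assms(2)[of "\<zero>\<^bsub>S\<^esub>" "\<zero>\<^bsub>F\<^esub>"] by (simp add: cls0)
  next
    case (diff a b)
    have "cls (a - b) = cls a \<oplus>\<^bsub>T\<^esub> cls (- b)" using diff cls_add[of a "- b"] by simp
    moreover have "cls (- (a - b)) = cls b \<oplus>\<^bsub>T\<^esub> cls (- a)" using diff cls_add[of b "- a"] by simp
    ultimately show ?case using diff assms(3) cls_closed by simp
  next
    case (base a)
    obtain s u where a: "a = (s, u)" "s \<in> carrier S" "u \<in> carrier F" using base by auto
    have "cls (- frag_of a) = ten (\<ominus>\<^bsub>S\<^esub> s) u"
      using a neg[of "frag_of a"] ahom_minus[OF S.abelian_group_axioms T_abelian_group ten_ahom_l[OF a(3)] a(2)]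
      by (simp add: ten_eq)
    then show ?case using a assms(2) by (simp add: ten_eq[symmetric])
  qed
  then show ?thesis using c by simp
qed

text \<open>The three conditions on \<open>b\<close> say that the extension to the free group kills
  the three families of relations.\<close>

lemma T_universal:
  assumes H: "abelian_group H"
    and b: "\<And>u. u \<in> carrier F \<Longrightarrow> (\<lambda>s. b s u) \<in> ahom S H" "\<And>s. s \<in> carrier S \<Longrightarrow> b s \<in> ahom F H"
    and bal: "\<And>s r u. s \<in> carrier S \<Longrightarrow> r \<in> carrier R \<Longrightarrow> u \<in> carrier F \<Longrightarrow> b (ract s r) u = b s (r \<odot>\<^bsub>F\<^esub> u)"
  obtains h where "h \<in> ahom T H" "\<And>s u. s \<in> carrier S \<Longrightarrow> u \<in> carrier F \<Longrightarrow> h (ten s u) = b s u"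
proof -
  interpret H: abelian_group H by fact
  have bc [simp]: "b s u \<in> carrier H" if "s \<in> carrier S" "u \<in> carrier F" for s u
    using ahom_closed[OF b(2)] that .
  have im: "(\<lambda>(s, u). b s u) ` (carrier S \<times> carrier F) \<subseteq> carrier (add_monoid H)" by auto
  obtain g where g: "g \<in> hom G (add_monoid H)"
    and gf: "\<And>x. x \<in> carrier S \<times> carrier F \<Longrightarrow> g (frag_of x) = (\<lambda>(s, u). b s u) x"
    using comm_group.free_Abelian_group_universal[OF H.a_comm_group im] unfolding tensor_free_def by metis
  interpret g: group_hom G "add_monoid H" g
    by unfold_locales (rule g)
  have gadd: "g (x + y) = g x \<oplus>\<^bsub>H\<^esub> g y" if "x \<in> carrier G" "y \<in> carrier G" for x y
    using g.hom_mult[OF that] by simp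
  have gminus: "g (- x) = \<ominus>\<^bsub>H\<^esub> g x" if "x \<in> carrier G" for x
  proof -
    have "g (- x) \<oplus>\<^bsub>H\<^esub> g x = \<zero>\<^bsub>H\<^esub>"
      using gadd[OF G_minus[OF that] that] g.hom_one by simp
    then show ?thesis using that g.hom_closed[OF that] g.hom_closed[OF G_minus[OF that]]
      by (intro H.minus_equality[symmetric]) simp_all
  qed
  have gdiff: "g (x - y) = g x \<ominus>\<^bsub>H\<^esub> g y" if "x \<in> carrier G" "y \<in> carrier G" for x y
    using gadd[OF that(1) G_minus[OF that(2)]] gminus[OF that(2)] by (simp add: a_minus_def)
  have gc: "x \<in> carrier G \<Longrightarrow> g x \<in> carrier H" for x
    using g.hom_closed[of x] by simp
  have z: "x \<oplus>\<^bsub>H\<^esub> (y \<oplus>\<^bsub>H\<^esub> (\<ominus>\<^bsub>H\<^esub> x \<oplus>\<^bsub>H\<^esub> \<ominus>\<^bsub>H\<^esub> y)) = \<zero>\<^bsub>H\<^esub>" if "x \<in> carrier H" "y \<in> carrier H" for x y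
    using that H.r_neg[of "x \<oplus>\<^bsub>H\<^esub> y"] by (simp add: H.minus_add H.a_assoc)
  have "rels \<subseteq> kernel G (add_monoid H) g"
  proof
    fix x assume x: "x \<in> rels"
    then have "x \<in> carrier G" using rels_G by blast
    moreover have "g x = \<zero>\<^bsub>H\<^esub>"
      using x unfolding rels_def
      by (auto simp: gdiff G_diff G_frag gf ahom_add[OF b(1)] ahom_add[OF b(2)] bal a_minus_def
          H.minus_add H.r_neg H.a_assoc gc z simp del: G_simps(1))
    ultimately show "x \<in> kernel G (add_monoid H) g" by (simp add: kernel_def)
  qed
  then have ker: "N \<subseteq> kernel G (add_monoid H) g"
    unfolding N_eq by (rule G.generate_subgroup_incl[OF _ g.subgroup_kernel])
  obtain h where hh: "h \<in> hom (G Mod N) (add_monoid H)" and h: "\<And>x. x \<in> carrier G \<Longrightarrow> h (cls x) = g x"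
    using g.FactGroup_universal_kernel[OF Nn.normal_axioms ker] by blast
  have "h \<in> ahom T H"
    using hh by (simp add: hom_def T_simps)
  moreover have "h (ten s u) = b s u" if "s \<in> carrier S" "u \<in> carrier F" for s u
    using that h[OF G_frag[OF that]] gf[of "(s, u)"] by (simp add: ten_eq)
  ultimately show ?thesis by (rule that)
qed

section \<open>The left module structure on the tensor product\<close>

abbreviation (input) "mm s \<equiv> frag_extend (\<lambda>(t, u). frag_of (s \<otimes>\<^bsub>S\<^esub> t, u))"

lemma mm_G:
  assumes "s \<in> carrier S" "x \<in> carrier G"
  shows "mm s x \<in> carrier G"
proof -
  have "Poly_Mapping.keys (mm s x) \<subseteq> (\<Union>y\<in>Poly_Mapping.keys x. Poly_Mapping.keys (case y of (t, u) \<Rightarrow> frag_of (s \<otimes>\<^bsub>S\<^esub> t, u)))"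
    by (rule keys_frag_extend)
  also have "\<dots> \<subseteq> carrier S \<times> carrier F"
    using assms by fastforce
  finally show ?thesis by simp
qed

text \<open>The elements sent into \<open>N\<close> form a subgroup, and left multiplication
  permutes neither type of relation: each generator goes to a generator of the same family.\<close>

lemma mm_N:
  assumes "s \<in> carrier S" "n \<in> N"
  shows "mm s n \<in> N"
proof -
  let ?K = "{x \<in> carrier G. mm s x \<in> N}"
  have "subgroup ?K G"
  proof (rule G.subgroupI)
    have "0 \<in> N" using subgroup.one_closed[OF N_subgroup] by simp
    then show "?K \<noteq> {}" by (auto intro!: exI[of _ 0])
    fix a assume a: "a \<in> ?K"
    have i: "inv\<^bsub>G\<^esub> x = - x" if "x \<in> carrier G" for x using that by (simp add: tensor_free_def)
    have aN: "mm s a \<in> N" using a by blast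
    have "- mm s a \<in> N"
      using subgroup.m_inv_closed[OF N_subgroup aN] unfolding i[OF N_G[OF aN]] .
    then show "inv\<^bsub>G\<^esub> a \<in> ?K"
      using a i[of a] by (simp add: frag_extend_minus)
    fix b assume b: "b \<in> ?K"
    show "a \<otimes>\<^bsub>G\<^esub> b \<in> ?K"
      using a b subgroup.m_closed[OF N_subgroup, of "mm s a" "mm s b"] G_add[of a b]
      by (simp add: frag_extend_add)
  qed auto
  moreover have "rels \<subseteq> ?K"
  proof
    fix x assume x: "x \<in> rels"
    then consider (1) t t' u where "x = frag_of (t \<oplus>\<^bsub>S\<^esub> t', u) - frag_of (t, u) - frag_of (t', u)" "t \<in> carrier S" "t' \<in> carrier S" "u \<in> carrier F"
      | (2) t u v where "x = frag_of (t, u \<oplus>\<^bsub>F\<^esub> v) - frag_of (t, u) - frag_of (t, v)" "t \<in> carrier S" "u \<in> carrier F" "v \<in> carrier F"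
      | (3) t r u where "x = frag_of (ract t r, u) - frag_of (t, r \<odot>\<^bsub>F\<^esub> u)" "t \<in> carrier S" "r \<in> carrier R" "u \<in> carrier F"
      unfolding rels_def by blast
    then have "mm s x \<in> rels"
    proof cases
      case 1
      then have "mm s x = frag_of (s \<otimes>\<^bsub>S\<^esub> t \<oplus>\<^bsub>S\<^esub> s \<otimes>\<^bsub>S\<^esub> t', u) - frag_of (s \<otimes>\<^bsub>S\<^esub> t, u) - frag_of (s \<otimes>\<^bsub>S\<^esub> t', u)"
        using assms(1) by (simp add: frag_extend_diff S.r_distr)
      then show ?thesis using 1 assms(1) unfolding rels_def by blast
    next
      case 2
      then have "mm s x = frag_of (s \<otimes>\<^bsub>S\<^esub> t, u \<oplus>\<^bsub>F\<^esub> v) - frag_of (s \<otimes>\<^bsub>S\<^esub> t, u) - frag_of (s \<otimes>\<^bsub>S\<^esub> t, v)"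
        using assms(1) by (simp add: frag_extend_diff)
      then show ?thesis using 2 assms(1) unfolding rels_def by blast
    next
      case 3
      then have "mm s x = frag_of (ract (s \<otimes>\<^bsub>S\<^esub> t) r, u) - frag_of (s \<otimes>\<^bsub>S\<^esub> t, r \<odot>\<^bsub>F\<^esub> u)"
        using assms(1) by (simp add: frag_extend_diff ract_mult)
      then show ?thesis using 3 assms(1) unfolding rels_def by blast
    qed
    then show "x \<in> ?K" using x rels_G rels_N by blast
  qed
  ultimately have "N \<subseteq> ?K" unfolding N_eq by (intro G.generate_subgroup_incl)
  then show ?thesis using assms(2) by blast
qed

text \<open>All representatives give the same coset, so the union in the definition of the scalar
  action collapses to it.\<close>

lemma smult_cls:
  assumes s: "s \<in> carrier S" and x: "x \<in> carrier G"
  shows "s \<odot>\<^bsub>T\<^esub> cls x = cls (mm s x)"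
proof -
  have "cls (mm s y) = cls (mm s x)" if y: "y \<in> cls x" for y
  proof -
    obtain n where n: "n \<in> N" "y = n + x" using y unfolding cls_mem by blast
    then have "mm s y - mm s x = mm s n" by (simp add: frag_extend_add)
    moreover have "y \<in> carrier G" using n N_G x G_add by blast
    ultimately show ?thesis using mm_N[OF s n(1)] by (intro cls_eq mm_G s) simp_all
  qed
  moreover have "x \<in> cls x" by (rule G.rcos_self[OF x N_subgroup])
  ultimately show ?thesis unfolding T_simps by blast
qed

lemma smult_elem: "s \<in> carrier S \<Longrightarrow> t \<in> carrier S \<Longrightarrow> u \<in> carrier F \<Longrightarrow> s \<odot>\<^bsub>T\<^esub> ten t u = ten (s \<otimes>\<^bsub>S\<^esub> t) u"
  unfolding ten_eq by (subst smult_cls) auto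

lemma smult_add:
  assumes s: "s \<in> carrier S" and xy: "x \<in> carrier T" "y \<in> carrier T"
  shows "s \<odot>\<^bsub>T\<^esub> (x \<oplus>\<^bsub>T\<^esub> y) = s \<odot>\<^bsub>T\<^esub> x \<oplus>\<^bsub>T\<^esub> s \<odot>\<^bsub>T\<^esub> y"
proof -
  obtain a b where ab: "x = cls a" "y = cls b" "a \<in> carrier G" "b \<in> carrier G"
    using xy by (auto simp: carrier_T simp del: G_simps(1))
  then show ?thesis
    by (simp add: cls_add smult_cls[OF s] G_add mm_G[OF s] frag_extend_add del: G_simps(1))
qed

lemma smult_closed [simp]: "s \<in> carrier S \<Longrightarrow> x \<in> carrier T \<Longrightarrow> s \<odot>\<^bsub>T\<^esub> x \<in> carrier T"
  using smult_cls cls_closed mm_G by (auto simp: carrier_T simp del: G_simps(1))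

lemma left_module_T: "left_module S T"
proof (intro left_module.intro left_module_axioms.intro S.ring_axioms T_abelian_group)
  fix a b x assume ab: "a \<in> carrier S" "b \<in> carrier S" and x: "x \<in> carrier T"
  show "(a \<oplus>\<^bsub>S\<^esub> b) \<odot>\<^bsub>T\<^esub> x = a \<odot>\<^bsub>T\<^esub> x \<oplus>\<^bsub>T\<^esub> b \<odot>\<^bsub>T\<^esub> x"
    using x ab by (induction x rule: T_induct) (simp_all add: smult_elem S.l_distr ten_add_l smult_add T.a_ac)
  show "(a \<otimes>\<^bsub>S\<^esub> b) \<odot>\<^bsub>T\<^esub> x = a \<odot>\<^bsub>T\<^esub> (b \<odot>\<^bsub>T\<^esub> x)"
    using x ab by (induction x rule: T_induct) (simp_all add: smult_elem S.m_assoc smult_add)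
next
  fix x assume x: "x \<in> carrier T"
  show "\<one>\<^bsub>S\<^esub> \<odot>\<^bsub>T\<^esub> x = x"
    using x by (induction x rule: T_induct) (simp_all add: smult_elem smult_add)
qed (simp_all add: smult_add)

end

section \<open>The Jacobi identity\<close>

definition jac :: "('c, 'm) module \<Rightarrow> ('m \<Rightarrow> 'm \<Rightarrow> nat \<Rightarrow> 'm) \<Rightarrow> 'm \<Rightarrow> 'm \<Rightarrow> 'm \<Rightarrow> bool" where
  "jac M br u v w \<longleftrightarrow> (\<forall>m n. br u (br v w n) m \<ominus>\<^bsub>M\<^esub> br v (br u w m) n = umap M (\<lambda>i. br (br u v i) w) m n)"

text \<open>Condition (ii) after replacing \<mu> by \<lambda>+\<mu>, which gives it the shape of the
  Jacobi identity.\<close>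

definition anchor_hom ::
  "('k, 'a) module \<Rightarrow> ('m \<Rightarrow> 'm \<Rightarrow> nat \<Rightarrow> 'm) \<Rightarrow> ('m \<Rightarrow> 'a \<Rightarrow> nat \<Rightarrow> 'a) \<Rightarrow> 'm \<Rightarrow> 'm \<Rightarrow> 'a \<Rightarrow> bool" where
  "anchor_hom A br \<theta> u v b \<longleftrightarrow>
     (\<forall>m n. \<theta> u (\<theta> v b n) m \<ominus>\<^bsub>A\<^esub> \<theta> v (\<theta> u b m) n = umap A (\<lambda>i. \<theta> (br u v i) b) m n)"

context abelian_group
begin

lemma a_inv_zero: "\<ominus> \<zero> = \<zero>"
  using r_neg[OF zero_closed] by simp

lemma diff_eq_iff:
  assumes "a \<in> carrier G" "b \<in> carrier G" "c \<in> carrier G"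
  shows "a \<ominus> b = c \<longleftrightarrow> a = b \<oplus> c"
proof -
  have "b \<oplus> (a \<ominus> b) = a" using assms by (simp add: a_minus_def a_lcomm r_neg)
  moreover have "b \<oplus> c \<ominus> b = c" using assms by (simp add: a_minus_def a_ac r_neg1 r_neg)
      (simp add: assms a_lcomm[of b] r_neg)?
  ultimately show ?thesis by auto
qed

lemma diff_add_diff:
  assumes "a \<in> carrier G" "b \<in> carrier G" "a' \<in> carrier G" "b' \<in> carrier G"
  shows "(a \<oplus> b) \<ominus> (a' \<oplus> b') = (a \<ominus> a') \<oplus> (b \<ominus> b')"
  using assms by (simp add: a_minus_def minus_add a_ac)

end

locale lambda_bracket = del_group M D for M :: "('c, 'm) module" (structure) and D +
  fixes br :: "'m \<Rightarrow> 'm \<Rightarrow> nat \<Rightarrow> 'm"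
  assumes br_ahom_l: "v \<in> carrier M \<Longrightarrow> (\<lambda>u. br u v) \<in> ahom M (pmod M)"
    and br_ahom_r: "u \<in> carrier M \<Longrightarrow> br u \<in> ahom M (pmod M)"
    and br_D_r: "u \<in> carrier M \<Longrightarrow> v \<in> carrier M \<Longrightarrow> br u (D v) = ldel M D (br u v)"
    and br_skew: "u \<in> carrier M \<Longrightarrow> v \<in> carrier M \<Longrightarrow> br v u = \<ominus>\<^bsub>pmod M\<^esub> flip M D (br u v)"
begin

lemmas br_closed [simp] = ahom_closed[OF br_ahom_r]
lemmas br_add_l = ahom_add[OF br_ahom_l]
lemmas br_add_r = ahom_add[OF br_ahom_r]
lemmas br_zero_l = ahom_zero[OF abelian_group_axioms P.abelian_group_axioms br_ahom_l]
lemmas br_zero_r = ahom_zero[OF abelian_group_axioms P.abelian_group_axioms br_ahom_r]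
lemmas br_minus_r = ahom_minus[OF abelian_group_axioms P.abelian_group_axioms br_ahom_r]

text \<open>Skew-symmetry carries the rule for the second argument to the first, where
  \<lambda>+\<partial> becomes -\<lambda>.\<close>

lemma br_D_l:
  assumes "u \<in> carrier M" "v \<in> carrier M"
  shows "br (D u) v = \<ominus>\<^bsub>pmod M\<^esub> lshift M (br u v)"
proof -
  have "br (D u) v = lshift M (flip M D (br v u))"
    using assms by (subst br_skew[of v "D u"]) (simp_all add: br_D_r flip_ldel P.minus_minus)
  also have "flip M D (br v u) = \<ominus>\<^bsub>pmod M\<^esub> br u v"
    using assms br_skew[of v u] by (simp add: P.minus_minus)
  finally show ?thesis using assms by (simp add: lshift_minus)
qed

text \<open>The bracket of p(\<lambda>) with w at \<lambda>+\<mu>, read off at \<lambda>^m \<mu>^n: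
  the right side of the Jacobi identity with an arbitrary polynomial in place of the inner
  bracket.\<close>

definition j3 :: "(nat \<Rightarrow> 'm) \<Rightarrow> 'm \<Rightarrow> nat \<Rightarrow> nat \<Rightarrow> 'm" where
  "j3 p w = umap M (\<lambda>i. br (p i) w)"

lemma j3_closed [simp]: "p \<in> carrier (pmod M) \<Longrightarrow> w \<in> carrier M \<Longrightarrow> j3 p w m n \<in> carrier M"
  by (simp add: j3_def)

lemma j3_ahom: "w \<in> carrier M \<Longrightarrow> (\<lambda>p. j3 p w m n) \<in> ahom (pmod M) M"
proof (rule ahomI)
  fix p q assume w: "w \<in> carrier M" and p: "p \<in> carrier (pmod M)" "q \<in> carrier (pmod M)"
  then have "br ((p \<oplus>\<^bsub>pmod M\<^esub> q) i) w = br (p i) w \<oplus>\<^bsub>pmod M\<^esub> br (q i) w" for i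
    by (simp add: pmod_apply(2)[of M p q] br_add_l)
  then show "j3 (p \<oplus>\<^bsub>pmod M\<^esub> q) w m n = j3 p w m n \<oplus> j3 q w m n"
    using w p by (simp add: j3_def umap_add)
qed simp

lemmas j3_add = ahom_add[OF j3_ahom]
lemmas j3_minus = ahom_minus[OF P.abelian_group_axioms abelian_group_axioms j3_ahom]

lemma j3_cpoly:
  assumes "x \<in> carrier M" "w \<in> carrier M"
  shows "j3 (cpoly M x) w m n = add_pow M ((m + n) choose n) (br x w (m + n))"
proof -
  have "umap M (\<lambda>i. br (cpoly M x (Suc i)) w) k n = \<zero>" for k
    using assms by (simp add: umap_def cpoly_apply br_zero_l coeff)
  then show ?thesis unfolding j3_def using assms by (subst umap_rec) simp_all
qed

lemma j3_lshift:
  assumes "p \<in> carrier (pmod M)" "w \<in> carrier M"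
  shows "j3 (lshift M p) w m n = (if m = 0 then \<zero> else j3 p w (m - 1) n)"
  unfolding j3_def using assms
  by (subst umap_rec) (simp_all add: br_zero_l coeff)

lemma j3_D:
  assumes "p \<in> carrier (pmod M)" "w \<in> carrier M"
  shows "j3 (pmap D p) w m n = \<ominus> ((if m = 0 then \<zero> else j3 p w (m - 1) n) \<oplus> (if n = 0 then \<zero> else j3 p w m (n - 1)))"
  unfolding j3_def using assms
  by (simp add: pmap_apply br_D_l umap_minus umap_lshift)

text \<open>In the first argument of a bracket at \<lambda>+\<mu>, \<partial> is -(\<lambda>+\<mu>),
  so -\<lambda>-\<partial> becomes \<mu>: the substitution interchanges \<lambda> and \<mu>.\<close>

lemma j3_flip:
  assumes "p \<in> carrier (pmod M)" "w \<in> carrier M"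
  shows "j3 (flip M D p) w n m = j3 p w m n"
  using assms(1)
proof (induction p arbitrary: m n rule: pmod_induct)
  case (const x)
  then show ?case using assms(2) binomial_symmetric[of n "m + n"] by (simp add: j3_cpoly add.commute)
next
  case (shift p)
  let ?q = "flip M D p"
  let ?a = "if n = 0 then \<zero> else j3 ?q w (n - 1) m" and ?b = "if m = 0 then \<zero> else j3 ?q w n (m - 1)"
  have ab: "?a \<in> carrier M" "?b \<in> carrier M" using shift assms(2) by auto
  have "j3 (flip M D (lshift M p)) w n m = \<ominus> (?a \<oplus> \<ominus> (?a \<oplus> ?b))"
    using shift(1) assms(2) by (simp add: flip_lshift j3_minus ldel_def j3_add j3_lshift j3_D)
  also have "?a \<oplus> \<ominus> (?a \<oplus> ?b) = \<ominus> ?b"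
    using ab by (simp only: minus_add a_inv_closed r_neg2)
  also have "\<ominus> (\<ominus> ?b) = ?b"
    by (rule minus_minus[OF ab(2)])
  finally show ?case using shift assms(2) by (simp add: j3_lshift)
next
  case (add p q)
  then show ?case using assms(2) by (simp add: flip_add j3_add)
qed

lemma jac_iff: "jac M br u v w \<longleftrightarrow> (\<forall>m n. br u (br v w n) m \<ominus> br v (br u w m) n = j3 (br u v) w m n)"
  by (simp add: jac_def j3_def)

lemma minus_diff: "a \<in> carrier M \<Longrightarrow> b \<in> carrier M \<Longrightarrow> \<ominus> (a \<ominus> b) = b \<ominus> a"
  by (simp add: a_minus_def minus_add minus_minus a_comm)

text \<open>The left side changes sign when u, \<lambda> and v, \<mu> are interchanged; by
  \<open>j3_flip\<close> and skew-symmetry so does the right side.\<close>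

lemma jac_swap:
  assumes "u \<in> carrier M" "v \<in> carrier M" "w \<in> carrier M" "jac M br u v w"
  shows "jac M br v u w"
  unfolding jac_iff
proof (intro allI)
  fix m n
  have "br v (br u w n) m \<ominus> br u (br v w m) n = \<ominus> (br u (br v w m) n \<ominus> br v (br u w n) m)"
    using assms by (simp add: minus_diff)
  also have "br u (br v w m) n \<ominus> br v (br u w n) m = j3 (br u v) w n m"
    using assms(4) unfolding jac_iff by blast
  also have "\<dots> = j3 (flip M D (br u v)) w m n"
    using assms by (simp add: j3_flip)
  also have "\<ominus> \<dots> = j3 (br v u) w m n"
    using assms br_skew[of u v] by (simp add: j3_minus)
  finally show "br v (br u w n) m \<ominus> br u (br v w m) n = j3 (br v u) w m n" .
qed

lemma row_closed: "u \<in> carrier M \<Longrightarrow> q \<in> carrier (pmod M) \<Longrightarrow> (\<lambda>n. br u (q n) i) \<in> carrier (pmod M)"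
  by (rule pmodI[where T = "supp M q"]) (auto simp: not_supp br_zero_r coeff)

text \<open>Outside the bracket with u, \<partial> equals \<partial> inside minus \<lambda>, so
  -\<lambda>-\<mu>-\<partial> outside is -\<mu>-\<partial> inside.\<close>

lemma umap_flip_br:
  assumes "q \<in> carrier (pmod M)" and u: "u \<in> carrier M"
  shows "umap M (\<lambda>i. flip M D (\<lambda>n. br u (q n) i)) m n = br u (flip M D q n) m"
  using assms(1)
proof (induction q arbitrary: m n rule: pmod_induct)
  case (const e)
  have y: "(\<lambda>n. br u (cpoly M e n) i) = cpoly M (br u e i)" for i
    using u const by (auto simp: cpoly_apply br_zero_r coeff)
  have "umap M (\<lambda>i. cpoly M (br u e i)) m n = (\<Oplus>i\<in>{..m}. if m = i then (if n = 0 then br u e m else \<zero>) else \<zero>)"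
    unfolding umap_def using u const by (intro finsum_cong') (auto simp: cpoly_apply)
  also have "\<dots> = (if n = 0 then br u e m else \<zero>)"
    using u const by (subst finsum_singleton) auto
  finally show ?case using u const by (simp add: y) (simp add: cpoly_apply br_zero_r coeff)
next
  case (add p q)
  have "(\<lambda>n. br u ((p \<oplus>\<^bsub>pmod M\<^esub> q) n) i) = (\<lambda>n. br u (p n) i) \<oplus>\<^bsub>pmod M\<^esub> (\<lambda>n. br u (q n) i)" for i
    using add u by (auto simp: coeff br_add_r)
  then have f: "flip M D (\<lambda>n. br u ((p \<oplus>\<^bsub>pmod M\<^esub> q) n) i) = flip M D (\<lambda>n. br u (p n) i) \<oplus>\<^bsub>pmod M\<^esub> flip M D (\<lambda>n. br u (q n) i)" for i
    using row_closed[OF u add(1)] row_closed[OF u add(2)] by (simp add: flip_add)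
  have "br u (flip M D (p \<oplus>\<^bsub>pmod M\<^esub> q) n) m = br u (flip M D p n) m \<oplus> br u (flip M D q n) m"
    using add(1,2) u by (simp add: flip_add pmod_apply(2)[of M "flip M D p"] br_add_r)
      (simp add: coeff)
  then show ?case
    unfolding f using row_closed[OF u add(1)] row_closed[OF u add(2)] by (simp add: umap_add add(3,4))
next
  case (shift q)
  define Z where "Z i = flip M D (\<lambda>n. br u (q n) i)" for i
  have Z: "Z i \<in> carrier (pmod M)" for i using row_closed[OF u shift(1)] by (simp add: Z_def)
  have "(\<lambda>n. br u (lshift M q n) i) = lshift M (\<lambda>n. br u (q n) i)" for i
    using u by (auto simp: lshift_def br_zero_r coeff)
  then have f: "flip M D (\<lambda>n. br u (lshift M q n) i) = \<ominus>\<^bsub>pmod M\<^esub> ldel M D (Z i)" for i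
    using row_closed[OF u shift(1)] by (simp add: flip_lshift Z_def)
  have ZU: "umap M Z m = (\<lambda>n. br u (flip M D q n) m)" for m
    unfolding Z_def by (rule ext) (rule shift(2))
  have fc: "flip M D q \<in> carrier (pmod M)" using shift by simp
  have l: "br u (lshift M (flip M D q) n) m = lshift M (\<lambda>n. br u (flip M D q n) m) n" for m
    using u by (auto simp: lshift_def br_zero_r coeff)
  have "umap M (\<lambda>i. flip M D (\<lambda>n. br u (lshift M q n) i)) m n =
     \<ominus> ((if m = 0 then \<zero> else br u (flip M D q n) (m - 1)) \<oplus> (br u (lshift M (flip M D q) n) m \<oplus> D (br u (flip M D q n) m)))"
    unfolding f using Z u fc by (simp add: umap_minus umap_ldel) (simp add: ZU ldel_def coeff l[symmetric])
  also have "\<dots> = \<ominus> (br u (lshift M (flip M D q) n) m \<oplus> ldel M D (br u (flip M D q n)) m)"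
  proof -
    have "br u (lshift M (flip M D q) n) m \<in> carrier M" using u fc by simp
    then show ?thesis
      using u fc by (auto simp: ldel_def coeff lshift_def a_lcomm)
  qed
  also have "\<dots> = br u (flip M D (lshift M q) n) m"
  proof -
    have "flip M D (lshift M q) n = \<ominus> (lshift M (flip M D q) n \<oplus> D (flip M D q n))"
      using shift(1) by (simp add: flip_lshift coeff ldel_def)
    moreover have "br u (\<ominus> (lshift M (flip M D q) n \<oplus> D (flip M D q n))) = \<ominus>\<^bsub>pmod M\<^esub> (br u (lshift M (flip M D q) n) \<oplus>\<^bsub>pmod M\<^esub> ldel M D (br u (flip M D q n)))"
      using u fc by (simp add: br_minus_r br_add_r br_D_r)
    ultimately show ?thesis using u fc by (simp add: coeff)
  qed
  finally show ?case .
qed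

text \<open>All three terms are subjected to \<mu> -> -\<lambda>-\<mu>-\<partial>. By skew-symmetry
  each becomes, up to the common sign -1, a term of the identity with v and w interchanged.\<close>

lemma jac_rot:
  assumes u: "u \<in> carrier M" "v \<in> carrier M" "w \<in> carrier M" and J: "jac M br u v w"
  shows "jac M br u w v"
  unfolding jac_def
proof (intro allI)
  fix m n
  define q where "q = br v w"
  define X where "X i = br (br u v i) w" for i
  define Y where "Y i = (\<lambda>n. br u (q n) i)" for i
  have c: "q \<in> carrier (pmod M)" "X i \<in> carrier (pmod M)" "Y i \<in> carrier (pmod M)" for i
    using u row_closed by (simp_all add: q_def X_def Y_def)
  have "br v (br u w i) = Y i \<ominus>\<^bsub>pmod M\<^esub> umap M X i" for i
  proof
    fix n
    have "Y i n \<ominus> br v (br u w i) n = umap M X i n"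
      using J unfolding jac_def X_def Y_def q_def by blast
    then have "Y i n = br v (br u w i) n \<oplus> umap M X i n"
      using u c by (simp add: diff_eq_iff)
    then have "br v (br u w i) n = Y i n \<ominus> umap M X i n"
      using u c by (simp add: a_minus_def a_assoc r_neg)
    then show "br v (br u w i) n = (Y i \<ominus>\<^bsub>pmod M\<^esub> umap M X i) n"
      using c by (simp add: coeff)
  qed
  then have "br (br u w i) v = \<ominus>\<^bsub>pmod M\<^esub> (flip M D (Y i) \<oplus>\<^bsub>pmod M\<^esub> \<ominus>\<^bsub>pmod M\<^esub> flip M D (umap M X i))" for i
    using u c by (subst br_skew[of v]) (simp_all add: a_minus_def flip_add flip_minus)
  then have "umap M (\<lambda>i. br (br u w i) v) m n = \<ominus> (umap M (\<lambda>i. flip M D (Y i)) m n \<ominus> umap M (\<lambda>i. flip M D (umap M X i)) m n)"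
    using c by (simp add: umap_minus umap_add a_minus_def)
  also have "\<dots> = \<ominus> (br u (flip M D q n) m \<ominus> flip M D (X m) n)"
    using u c by (simp add: umap_flip_umap umap_flip_br Y_def)
  also have "\<dots> = \<ominus> br u (flip M D q n) m \<ominus> \<ominus> flip M D (X m) n"
    using u c by (simp add: a_minus_def minus_add)
  also have "\<ominus> br u (flip M D q n) m = br u (br w v n) m"
    using u c br_skew[of v w] by (simp add: q_def[symmetric] pmod_minus br_minus_r)
  also have "\<ominus> flip M D (X m) n = br w (br u v m) n"
    using u c br_skew[of "br u v m" w] by (simp add: X_def[symmetric] pmod_minus)
  finally show "br u (br w v n) m \<ominus> br w (br u v m) n = umap M (\<lambda>i. br (br u w i) v) m n" by simp
qed

lemma jac_add:
  assumes u: "u \<in> carrier M" "v \<in> carrier M" "w \<in> carrier M" "w' \<in> carrier M"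
    and J: "jac M br u v w" "jac M br u v w'"
  shows "jac M br u v (w \<oplus> w')"
  unfolding jac_def
proof (intro allI)
  fix m n
  have "umap M (\<lambda>i. br (br u v i) (w \<oplus> w')) m n = umap M (\<lambda>i. br (br u v i) w) m n \<oplus> umap M (\<lambda>i. br (br u v i) w') m n"
    using u by (simp add: br_add_r umap_add)
  moreover have "br u (br v (w \<oplus> w') n) m = br u (br v w n) m \<oplus> br u (br v w' n) m"
    "br v (br u (w \<oplus> w') m) n = br v (br u w m) n \<oplus> br v (br u w' m) n"
    using u by (simp_all add: br_add_r pmod_apply)
  moreover have "br u (br v w n) m \<ominus> br v (br u w m) n = umap M (\<lambda>i. br (br u v i) w) m n"
    "br u (br v w' n) m \<ominus> br v (br u w' m) n = umap M (\<lambda>i. br (br u v i) w') m n"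
    using J unfolding jac_def by blast+
  ultimately show "br u (br v (w \<oplus> w') n) m \<ominus> br v (br u (w \<oplus> w') m) n = umap M (\<lambda>i. br (br u v i) (w \<oplus> w')) m n"
    using u by (simp add: diff_add_diff)
qed

text \<open>Each of the three terms gets multiplied by \<lambda>+\<mu>+\<partial>.\<close>

lemma jac_D:
  assumes u: "u \<in> carrier M" "v \<in> carrier M" "w \<in> carrier M" and J: "jac M br u v w"
  shows "jac M br u v (D w)"
  unfolding jac_def
proof (intro allI)
  fix m n
  define s t where "s m n = br u (br v w n) m" and "t m n = br v (br u w m) n" for m n
  define X where "X i = br (br u v i) w" for i
  have st [simp]: "s m n \<in> carrier M" "t m n \<in> carrier M" for m n using u by (simp_all add: s_def t_def)
  have X: "X i \<in> carrier (pmod M)" for i using u by (simp add: X_def)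
  have J': "s m n \<ominus> t m n = umap M X m n" for m n
    using J unfolding jac_def s_def t_def X_def by blast
  have lsh: "br u (lshift M p n) m = (if n = 0 then \<zero> else br u (p (n - 1)) m)" if "u \<in> carrier M" for u p n m
    using that by (auto simp: lshift_def br_zero_r coeff)
  have 1: "br u (br v (D w) n) m = (if n = 0 then \<zero> else s m (n - 1)) \<oplus> ((if m = 0 then \<zero> else s (m - 1) n) \<oplus> D (s m n))"
    using u by (simp add: br_D_r ldel_def[of M D "br v w"] pmod_apply pmap_apply br_add_r lsh)
      (simp add: ldel_def coeff lshift_def s_def)
  have 2: "br v (br u (D w) m) n = (if n = 0 then \<zero> else t m (n - 1)) \<oplus> ((if m = 0 then \<zero> else t (m - 1) n) \<oplus> D (t m n))"
    using u by (simp add: br_D_r ldel_def[of M D "br u w"] pmod_apply pmap_apply br_add_r lsh)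
      (simp add: ldel_def coeff lshift_def t_def a_lcomm)
  have "umap M (\<lambda>i. br (br u v i) (D w)) m n = (if m = 0 then \<zero> else umap M X (m - 1) n) \<oplus> ldel M D (umap M X m) n"
    using u X by (simp add: br_D_r X_def[symmetric] umap_ldel)
  also have "\<dots> = (if n = 0 then \<zero> else umap M X m (n - 1)) \<oplus> ((if m = 0 then \<zero> else umap M X (m - 1) n) \<oplus> D (umap M X m n))"
    using X by (simp add: ldel_def coeff lshift_def a_lcomm)
  also have "\<dots> = br u (br v (D w) n) m \<ominus> br v (br u (D w) m) n"
    unfolding 1 2 J'[symmetric] by (simp add: a_minus_def D_add D_minus minus_add a_ac a_inv_zero)
  finally show "br u (br v (D w) n) m \<ominus> br v (br u (D w) m) n = umap M (\<lambda>i. br (br u v i) (D w)) m n" by simp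
qed

end

section \<open>Brackets with an anchor\<close>

locale anchored_bracket = diff_module A d M D + lambda_bracket M D br
  for A :: "('k, 'a) module" and d and M :: "('a, 'm) module" (structure) and D br +
  fixes \<theta> :: "'m \<Rightarrow> 'a \<Rightarrow> nat \<Rightarrow> 'a"
  assumes \<theta>_cder: "u \<in> carrier M \<Longrightarrow> cder A d (\<theta> u)"
    and br_smult_r: "u \<in> carrier M \<Longrightarrow> v \<in> carrier M \<Longrightarrow> a \<in> carrier A \<Longrightarrow>
      br u (a \<odot> v) = a \<odot>\<^bsub>pmod M\<^esub> br u v \<oplus>\<^bsub>pmod M\<^esub> pairm M (\<theta> u a) v"
begin

lemma \<theta>_ahom: "u \<in> carrier M \<Longrightarrow> \<theta> u \<in> ahom A (pmod A)"
  using \<theta>_cder by (simp add: cder_def)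

lemmas \<theta>_closed [simp] = ahom_closed[OF \<theta>_ahom]

lemma br_smult_coeff: "u \<in> carrier M \<Longrightarrow> v \<in> carrier M \<Longrightarrow> a \<in> carrier A \<Longrightarrow>
    br u (a \<odot> v) m = a \<odot> br u v m \<oplus> \<theta> u a m \<odot> v"
  by (simp add: br_smult_r coeff pairm_def)

text \<open>The mixed terms, with one anchor and one bracket, cancel. What remains is b times the
  identity for w plus the compatibility of anchor and bracket at b, applied to w.\<close>

lemma jac_smult:
  assumes u: "u \<in> carrier M" "v \<in> carrier M" "w \<in> carrier M" and b: "b \<in> carrier A"
    and J: "jac M br u v w" and B: "anchor_hom A br \<theta> u v b"
  shows "jac M br u v (b \<odot> w)"
  unfolding jac_def
proof (intro allI)
  fix m n
  let ?s = "br u (br v w n) m" and ?t = "br v (br u w m) n"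
  let ?p = "\<theta> u (\<theta> v b n) m" and ?q = "\<theta> v (\<theta> u b m) n"
  let ?x = "\<theta> u b m \<odot> br v w n" and ?y = "\<theta> v b n \<odot> br u w m"
  have 1: "br u (br v (b \<odot> w) n) m = (b \<odot> ?s \<oplus> ?x) \<oplus> (?y \<oplus> ?p \<odot> w)"
    using u b by (simp add: br_smult_coeff br_add_r pmod_apply)
  have 2: "br v (br u (b \<odot> w) m) n = (b \<odot> ?t \<oplus> ?x) \<oplus> (?y \<oplus> ?q \<odot> w)"
    using u b by (simp add: br_smult_coeff br_add_r pmod_apply) (simp add: a_ac)
  have c: "?s \<in> carrier M" "?t \<in> carrier M" "?p \<in> carrier A" "?q \<in> carrier A" "?x \<in> carrier M" "?y \<in> carrier M"
    using u b by simp_all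
  have "br u (br v (b \<odot> w) n) m \<ominus> br v (br u (b \<odot> w) m) n = (b \<odot> ?s \<ominus> b \<odot> ?t) \<oplus> (?p \<odot> w \<ominus> ?q \<odot> w)"
    unfolding 1 2 using u b c by (simp add: diff_add_diff) (simp add: a_minus_def r_neg)
  also have "b \<odot> ?s \<ominus> b \<odot> ?t = b \<odot> (?s \<ominus> ?t)"
    using u b c by (simp add: a_minus_def V.smult_r_distr V.smult_r_minus)
  also have "?s \<ominus> ?t = umap M (\<lambda>i. br (br u v i) w) m n"
    using J unfolding jac_def by blast
  also have "?p \<odot> w \<ominus> ?q \<odot> w = (?p \<ominus>\<^bsub>A\<^esub> ?q) \<odot> w"
    using u c by (simp add: a_minus_def V.smult_l_distr V.smult_l_minus)
  also have "?p \<ominus>\<^bsub>A\<^esub> ?q = umap A (\<lambda>i. \<theta> (br u v i) b) m n"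
    using B unfolding anchor_hom_def by blast
  also have "b \<odot> umap M (\<lambda>i. br (br u v i) w) m n = umap M (\<lambda>i. b \<odot>\<^bsub>pmod M\<^esub> br (br u v i) w) m n"
    using u b umap_hom[OF _ abelian_group_axioms smult_ahom[OF b], of "\<lambda>i. br (br u v i) w" m n]
    by (simp add: umap_def coeff)
  also have "umap A (\<lambda>i. \<theta> (br u v i) b) m n \<odot> w = umap M (\<lambda>i. pairm M (\<theta> (br u v i) b) w) m n"
    using u b Q.umap_hom[OF _ abelian_group_axioms smult_ahom_l[OF u(3)], of "\<lambda>i. \<theta> (br u v i) b" m n]
    by (simp add: umap_def coeff pairm_def)
  also have "umap M (\<lambda>i. b \<odot>\<^bsub>pmod M\<^esub> br (br u v i) w) m n \<oplus> umap M (\<lambda>i. pairm M (\<theta> (br u v i) b) w) m n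
     = umap M (\<lambda>i. br (br u v i) (b \<odot> w)) m n"
    using u b by (simp add: br_smult_r umap_add)
  finally show "br u (br v (b \<odot> w) n) m \<ominus> br v (br u (b \<odot> w) m) n = umap M (\<lambda>i. br (br u v i) (b \<odot> w)) m n" .
qed

end

text \<open>The linearity and Leibniz properties without the Jacobi identity and without condition
  (ii), which are to be deduced from generators. Linearity of the anchor in u serves to extend the
  bracket to the semidirect sum.\<close>

locale pre_algebroid = anchored_bracket A d M D br \<theta>
  for A :: "('k, 'a) module" and d and M :: "('a, 'm) module" (structure) and D br \<theta> +
  assumes \<theta>_ahom_l: "a \<in> carrier A \<Longrightarrow> (\<lambda>u. \<theta> u a) \<in> ahom M (pmod A)"
    and \<theta>_D: "u \<in> carrier M \<Longrightarrow> a \<in> carrier A \<Longrightarrow> \<theta> (D u) a = \<ominus>\<^bsub>pmod A\<^esub> lshift A (\<theta> u a)"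
    and \<theta>_smult: "u \<in> carrier M \<Longrightarrow> a \<in> carrier A \<Longrightarrow> b \<in> carrier A \<Longrightarrow>
      \<theta> (b \<odot> u) a = conv A d (selfm A) (cpoly A b) (\<theta> u a)"

text \<open>Condition (ii) is the Jacobi identity for \<open>u, v, a\<close> in the semidirect sum of the module
  with the algebra, on which the bracket is \<open>[u\<^sub>\<lambda> a] = \<theta>(u)\<^sub>\<lambda>(a)\<close>.\<close>

definition semi :: "('k, 'a) module \<Rightarrow> ('a, 'm) module \<Rightarrow> ('a, 'm \<times> 'a) module" where
  "semi A M = \<lparr>carrier = carrier M \<times> carrier A, mult = undefined, one = undefined,
     zero = (\<zero>\<^bsub>M\<^esub>, \<zero>\<^bsub>A\<^esub>), add = (\<lambda>x y. (fst x \<oplus>\<^bsub>M\<^esub> fst y, snd x \<oplus>\<^bsub>A\<^esub> snd y)),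
     smult = (\<lambda>a x. (a \<odot>\<^bsub>M\<^esub> fst x, a \<otimes>\<^bsub>A\<^esub> snd x))\<rparr>"

definition semi_del :: "('a \<Rightarrow> 'a) \<Rightarrow> ('m \<Rightarrow> 'm) \<Rightarrow> 'm \<times> 'a \<Rightarrow> 'm \<times> 'a" where
  "semi_del d D x = (D (fst x), d (snd x))"

text \<open>The bracket of two functions is zero, and the term with the adjoint anchor of the second
  argument is forced by skew-symmetry.\<close>

definition semi_br ::
  "('k, 'a) module \<Rightarrow> ('a \<Rightarrow> 'a) \<Rightarrow> ('m \<Rightarrow> 'm \<Rightarrow> nat \<Rightarrow> 'm) \<Rightarrow> ('m \<Rightarrow> 'a \<Rightarrow> nat \<Rightarrow> 'a)
    \<Rightarrow> 'm \<times> 'a \<Rightarrow> 'm \<times> 'a \<Rightarrow> nat \<Rightarrow> 'm \<times> 'a" where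
  "semi_br A d br \<theta> x y n =
     (br (fst x) (fst y) n, (\<theta> (fst x) (snd y) \<ominus>\<^bsub>pmod A\<^esub> flip A d (\<theta> (fst y) (snd x))) n)"

context pre_algebroid
begin

abbreviation "MA \<equiv> semi A M"
abbreviation "DD \<equiv> semi_del d D"
abbreviation "brr \<equiv> semi_br A d br \<theta>"

lemmas \<theta>_add_l = ahom_add[OF \<theta>_ahom_l]
lemmas \<theta>_add_r = ahom_add[OF \<theta>_ahom]
lemmas \<theta>_zero_l = ahom_zero[OF abelian_group_axioms Q.P.abelian_group_axioms \<theta>_ahom_l]
lemmas \<theta>_zero_r = ahom_zero[OF Q.abelian_group_axioms Q.P.abelian_group_axioms \<theta>_ahom]

lemma semi_simps [simp]:
  "carrier MA = carrier M \<times> carrier A" "\<zero>\<^bsub>MA\<^esub> = (\<zero>, \<zero>\<^bsub>A\<^esub>)"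
  "x \<oplus>\<^bsub>MA\<^esub> y = (fst x \<oplus> fst y, snd x \<oplus>\<^bsub>A\<^esub> snd y)" "a \<odot>\<^bsub>MA\<^esub> x = (a \<odot> fst x, a \<otimes>\<^bsub>A\<^esub> snd x)"
  by (simp_all add: semi_def)

lemma semi_abelian_group: "abelian_group MA"
  by (rule abelian_groupI)
    (auto simp: a_ac Q.a_ac intro!: bexI[of _ "(\<ominus> _, \<ominus>\<^bsub>A\<^esub> _)"] l_neg Q.l_neg)

lemma fst_ahom: "fst \<in> ahom MA M" and snd_ahom: "snd \<in> ahom MA A"
  by (rule ahomI; auto)+

lemma semi_diff_module: "diff_module A d MA DD"
proof (rule diff_moduleI[OF Q.diff_ring_axioms])
  show "module A MA"
    by (rule moduleI[OF Q.is_cring semi_abelian_group])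
      (auto simp: V.smult_l_distr V.smult_r_distr V.smult_assoc1 Q.l_distr Q.r_distr Q.m_assoc)
  show "DD \<in> ahom MA MA"
    by (rule ahomI) (auto simp: semi_del_def D_add Q.D_add)
qed (auto simp: semi_del_def D_smult Q.d_mult)

interpretation X: diff_module A d MA DD by (rule semi_diff_module)

lemmas fst_p = pmap_ahom[OF semi_abelian_group abelian_group_axioms fst_ahom]
lemmas snd_p = pmap_ahom[OF semi_abelian_group Q.abelian_group_axioms snd_ahom]

lemma pmod_semi_eqI: "pmap fst p = pmap fst q \<Longrightarrow> pmap snd p = pmap snd q \<Longrightarrow> p = q"
  by (auto simp: pmap_def fun_eq_iff prod_eq_iff)

lemma fst_simps:
  "p \<in> carrier (pmod MA) \<Longrightarrow> pmap fst (flip MA DD p) = flip M D (pmap fst p)"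
  "p \<in> carrier (pmod MA) \<Longrightarrow> q \<in> carrier (pmod MA) \<Longrightarrow> pmap fst (p \<oplus>\<^bsub>pmod MA\<^esub> q) = pmap fst p \<oplus>\<^bsub>pmod M\<^esub> pmap fst q"
  "p \<in> carrier (pmod MA) \<Longrightarrow> pmap fst (\<ominus>\<^bsub>pmod MA\<^esub> p) = \<ominus>\<^bsub>pmod M\<^esub> pmap fst p"
  "p \<in> carrier (pmod MA) \<Longrightarrow> pmap fst (ldel MA DD p) = ldel M D (pmap fst p)"
  "pmap fst (a \<odot>\<^bsub>pmod MA\<^esub> p) = a \<odot>\<^bsub>pmod M\<^esub> pmap fst p"
  "pmap fst (pairm MA f x) = pairm M f (fst x)"
  using flip_hom[OF X.del_group_axioms del_group_axioms fst_ahom, of p]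
    ahom_add[OF fst_p] ahom_minus[OF X.P.abelian_group_axioms P.abelian_group_axioms fst_p]
  by (auto simp: semi_del_def) (auto simp: coeff ldel_def lshift_def fun_eq_iff semi_del_def pairm_def)

lemma snd_simps:
  "p \<in> carrier (pmod MA) \<Longrightarrow> pmap snd (flip MA DD p) = flip A d (pmap snd p)"
  "p \<in> carrier (pmod MA) \<Longrightarrow> q \<in> carrier (pmod MA) \<Longrightarrow> pmap snd (p \<oplus>\<^bsub>pmod MA\<^esub> q) = pmap snd p \<oplus>\<^bsub>pmod A\<^esub> pmap snd q"
  "p \<in> carrier (pmod MA) \<Longrightarrow> pmap snd (\<ominus>\<^bsub>pmod MA\<^esub> p) = \<ominus>\<^bsub>pmod A\<^esub> pmap snd p"
  "p \<in> carrier (pmod MA) \<Longrightarrow> pmap snd (ldel MA DD p) = ldel A d (pmap snd p)"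
  "pmap snd (a \<odot>\<^bsub>pmod MA\<^esub> p) = a \<odot>\<^bsub>pmod (selfm A)\<^esub> pmap snd p"
  "pmap snd (pairm MA f x) = pairm (selfm A) f (snd x)"
  using flip_hom[OF X.del_group_axioms Q.del_group_axioms snd_ahom, of p]
    ahom_add[OF snd_p] ahom_minus[OF X.P.abelian_group_axioms Q.P.abelian_group_axioms snd_p]
  by (auto simp: semi_del_def) (auto simp: coeff ldel_def lshift_def fun_eq_iff semi_del_def pairm_def)

lemma fst_brr: "pmap fst (brr x y) = br (fst x) (fst y)"
  and snd_brr: "pmap snd (brr x y) = \<theta> (fst x) (snd y) \<ominus>\<^bsub>pmod A\<^esub> flip A d (\<theta> (fst y) (snd x))"
  by (auto simp: semi_br_def pmap_def)

lemma brr_closed: "x \<in> carrier MA \<Longrightarrow> y \<in> carrier MA \<Longrightarrow> brr x y \<in> carrier (pmod MA)"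
proof (rule pmodI[where T = "supp M (br (fst x) (fst y)) \<union> supp A (\<theta> (fst x) (snd y) \<ominus>\<^bsub>pmod A\<^esub> flip A d (\<theta> (fst y) (snd x)))"])
  assume "x \<in> carrier MA" "y \<in> carrier MA"
  then have c: "br (fst x) (fst y) \<in> carrier (pmod M)"
    "\<theta> (fst x) (snd y) \<ominus>\<^bsub>pmod A\<^esub> flip A d (\<theta> (fst y) (snd x)) \<in> carrier (pmod A)" by auto
  show "brr x y n \<in> carrier MA" for n
    using pmod_coeff[OF c(1)] pmod_coeff[OF c(2)] by (simp add: semi_br_def)
  show "finite (supp M (br (fst x) (fst y)) \<union> supp A (\<theta> (fst x) (snd y) \<ominus>\<^bsub>pmod A\<^esub> flip A d (\<theta> (fst y) (snd x))))"
    using c by simp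
qed (auto simp: semi_br_def not_supp)

lemma pairm_self: "f \<in> carrier (pmod A) \<Longrightarrow> a \<in> carrier A \<Longrightarrow> pairm (selfm A) f a = a \<odot>\<^bsub>pmod (selfm A)\<^esub> f"
  by (auto simp: pairm_def coeff Q.m_comm)

interpretation O: diff_module A d "pmod (selfm A)" "ldel A d" by (rule Q.diff_module_opmul)
interpretation S: diff_module A d "selfm A" d by (rule Q.diff_module_self)

text \<open>The anchor sees only the component in M. For the functions, the rules in the second
  argument come from \<theta>(u) being a derivation and from linearity of \<theta> in v, whose
  twisted scalars the substitution turns into ordinary ones.\<close>

lemma semi_anchored_bracket: "anchored_bracket A d MA DD brr (\<lambda>x. \<theta> (fst x))"
proof (rule anchored_bracket.intro[OF semi_diff_module lambda_bracket.intro[OF X.del_group_axioms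
    lambda_bracket_axioms.intro] anchored_bracket_axioms.intro])
  fix v assume v: "v \<in> carrier MA"
  show "(\<lambda>u. brr u v) \<in> ahom MA (pmod MA)"
  proof (rule ahomI)
    fix x y assume xy: "x \<in> carrier MA" "y \<in> carrier MA"
    have xyc: "x \<oplus>\<^bsub>MA\<^esub> y \<in> carrier MA" using xy by auto
    show "brr (x \<oplus>\<^bsub>MA\<^esub> y) v = brr x v \<oplus>\<^bsub>pmod MA\<^esub> brr y v"
      using xy v brr_closed[OF xy(1) v] brr_closed[OF xy(2) v]
      by (intro pmod_semi_eqI)
        (auto simp: fst_simps snd_simps fst_brr snd_brr br_add_l \<theta>_add_l \<theta>_add_r Q.flip_add a_minus_def Q.P.minus_add Q.P.a_ac)
  qed (rule brr_closed[OF _ v])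
next
  fix u assume u: "u \<in> carrier MA"
  show "brr u \<in> ahom MA (pmod MA)"
  proof (rule ahomI)
    fix x y assume xy: "x \<in> carrier MA" "y \<in> carrier MA"
    show "brr u (x \<oplus>\<^bsub>MA\<^esub> y) = brr u x \<oplus>\<^bsub>pmod MA\<^esub> brr u y"
      using xy u brr_closed[OF u xy(1)] brr_closed[OF u xy(2)]
      by (intro pmod_semi_eqI)
        (auto simp: fst_simps snd_simps fst_brr snd_brr br_add_r \<theta>_add_l \<theta>_add_r Q.flip_add a_minus_def Q.P.minus_add Q.P.a_ac)
  qed (rule brr_closed[OF u])
next
  fix u v assume uv: "u \<in> carrier MA" "v \<in> carrier MA"
  then have c: "fst u \<in> carrier M" "snd u \<in> carrier A" "fst v \<in> carrier M" "snd v \<in> carrier A" by auto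
  have td: "\<theta> (fst u) (d (snd v)) = ldel A d (\<theta> (fst u) (snd v))"
    using \<theta>_cder[OF c(1)] c by (simp add: cder_def)
  show "brr u (DD v) = ldel MA DD (brr u v)"
    using c td brr_closed[OF uv]
    by (intro pmod_semi_eqI)
      (simp_all add: fst_simps snd_simps fst_brr snd_brr, simp_all add: semi_del_def br_D_r \<theta>_D Q.flip_minus Q.flip_lshift
         a_minus_def Q.ldel_add Q.ldel_minus)
  show "brr v u = \<ominus>\<^bsub>pmod MA\<^esub> flip MA DD (brr u v)"
    using c brr_closed[OF uv] br_skew[OF c(1,3)]
    by (intro pmod_semi_eqI)
      (simp_all add: fst_simps snd_simps fst_brr snd_brr a_minus_def Q.flip_add Q.flip_minus Q.P.minus_add Q.P.minus_minus Q.P.a_comm)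
  fix a assume a: "a \<in> carrier A"
  have tm: "\<theta> (fst u) (a \<otimes>\<^bsub>A\<^esub> snd v) = snd v \<odot>\<^bsub>pmod (selfm A)\<^esub> \<theta> (fst u) a \<oplus>\<^bsub>pmod A\<^esub> a \<odot>\<^bsub>pmod (selfm A)\<^esub> \<theta> (fst u) (snd v)"
    using \<theta>_cder[OF c(1)] c a by (simp add: cder_def)
  have fs: "flip A d (conv A d (selfm A) (cpoly A a) f) = a \<odot>\<^bsub>pmod (selfm A)\<^esub> flip A d f" if "f \<in> carrier (pmod A)" for f
    using S.flip_star[of f a] that a by simp
  have ac: "a \<odot>\<^bsub>MA\<^esub> v \<in> carrier MA" using c a by simp
  show "brr u (a \<odot>\<^bsub>MA\<^esub> v) = a \<odot>\<^bsub>pmod MA\<^esub> brr u v \<oplus>\<^bsub>pmod MA\<^esub> pairm MA (\<theta> (fst u) a) v"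
    using c a brr_closed[OF uv] X.pmod_smult_closed[OF a brr_closed[OF uv]] X.pairm_closed[OF _ uv(2), of "\<theta> (fst u) a"]
    by (intro pmod_semi_eqI)
      (simp_all add: fst_simps snd_simps fst_brr snd_brr br_smult_r \<theta>_smult tm fs pairm_self a_minus_def
        O.V.smult_r_distr[simplified] O.V.smult_r_minus[simplified] Q.P.a_ac)
next
  fix u assume "u \<in> carrier MA"
  then show "cder A d (\<theta> (fst u))" by (auto intro: \<theta>_cder)
qed

interpretation XB: anchored_bracket A d MA DD brr "\<lambda>x. \<theta> (fst x)"
  by (rule semi_anchored_bracket)

lemma semi_umap:
  assumes "\<And>i. Y i \<in> carrier (pmod MA)"
  shows "umap MA Y m n = (umap M (\<lambda>i. pmap fst (Y i)) m n, umap A (\<lambda>i. pmap snd (Y i)) m n)"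
  using X.umap_hom[OF pmod_coeff[OF assms] abelian_group_axioms fst_ahom, where m = m and n = n]
    X.umap_hom[OF pmod_coeff[OF assms] Q.abelian_group_axioms snd_ahom, where m = m and n = n]
  by (simp add: prod_eq_iff)

lemma semi_minus: "x \<in> carrier MA \<Longrightarrow> y \<in> carrier MA \<Longrightarrow> x \<ominus>\<^bsub>MA\<^esub> y = (fst x \<ominus> fst y, snd x \<ominus>\<^bsub>A\<^esub> snd y)"
  using ahom_diff[OF semi_abelian_group abelian_group_axioms fst_ahom, of x y]
    ahom_diff[OF semi_abelian_group Q.abelian_group_axioms snd_ahom, of x y] by (simp add: prod_eq_iff)

text \<open>On these arguments the component in M is zero, and the brackets with b are values of the
  anchor.\<close>

lemma anchor_hom_iff:
  assumes "u \<in> carrier M" "v \<in> carrier M" "b \<in> carrier A"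
  shows "jac MA brr (u, \<zero>\<^bsub>A\<^esub>) (v, \<zero>\<^bsub>A\<^esub>) (\<zero>, b) \<longleftrightarrow> anchor_hom A br \<theta> u v b"
proof -
  have b1: "brr (u, \<zero>\<^bsub>A\<^esub>) (\<zero>, b) n = (\<zero>, \<theta> u b n)" if "u \<in> carrier M" "b \<in> carrier A" for u b n
    using that by (simp add: semi_br_def br_zero_r \<theta>_zero_r \<theta>_zero_l a_minus_def Q.P.r_zero)
      (simp add: coeff)
  have b2: "brr (u, \<zero>\<^bsub>A\<^esub>) (v, \<zero>\<^bsub>A\<^esub>) n = (br u v n, \<zero>\<^bsub>A\<^esub>)" if "u \<in> carrier M" "v \<in> carrier M" for u v n
    using that by (simp add: semi_br_def \<theta>_zero_r a_minus_def Q.P.r_zero) (simp add: coeff)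
  have b3: "brr (br u v i, \<zero>\<^bsub>A\<^esub>) (\<zero>, b) = (\<lambda>n. (\<zero>, \<theta> (br u v i) b n))" for i
    using assms b1 by (intro ext) simp
  have c: "(\<lambda>n. (\<zero>, \<theta> (br u v i) b n)) \<in> carrier (pmod MA)" for i
    unfolding b3[symmetric] using assms by (intro brr_closed) auto
  have z: "umap M (\<lambda>i n. \<zero>) m n = \<zero>" "\<zero> \<ominus> \<zero> = \<zero>" for m n by (simp_all add: umap_def a_minus_def r_neg)
  show ?thesis
    unfolding jac_def anchor_hom_def using assms
    by (simp add: b1 b2 b3 semi_umap[OF c] semi_minus) (simp add: pmap_def z)
qed

lemma anchor_hom_zero:
  assumes "u \<in> carrier M" "b \<in> carrier A"
  shows "anchor_hom A br \<theta> u \<zero> b"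
  unfolding anchor_hom_def using assms
  by (simp add: br_zero_r \<theta>_zero_l \<theta>_zero_r coeff umap_def)

lemma anchor_hom_semi:
  assumes "u \<in> carrier M" "v \<in> carrier M" "b \<in> carrier A" "a \<in> carrier A" "a' \<in> carrier A"
  shows "anchor_hom A brr (\<lambda>x. \<theta> (fst x)) (u, a) (v, a') b \<longleftrightarrow> anchor_hom A br \<theta> u v b"
  by (simp add: anchor_hom_def semi_br_def)

text \<open>(0, bc) is b times (0, c), and multiplying the last argument of the Jacobi identity by b
  requires exactly the compatibility at b.\<close>

lemma anchor_hom_mult:
  assumes uv: "u \<in> carrier M" "v \<in> carrier M" and bc: "b \<in> carrier A" "c \<in> carrier A"
    and "anchor_hom A br \<theta> u v b" "anchor_hom A br \<theta> u v c"
  shows "anchor_hom A br \<theta> u v (b \<otimes>\<^bsub>A\<^esub> c)"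
proof -
  have "jac MA brr (u, \<zero>\<^bsub>A\<^esub>) (v, \<zero>\<^bsub>A\<^esub>) (b \<odot>\<^bsub>MA\<^esub> (\<zero>, c))"
    by (rule XB.jac_smult) (use assms in \<open>simp_all add: anchor_hom_iff anchor_hom_semi\<close>)
  then show ?thesis using assms anchor_hom_iff[of u v "b \<otimes>\<^bsub>A\<^esub> c"] by simp
qed

lemma anchor_hom_d:
  assumes uv: "u \<in> carrier M" "v \<in> carrier M" and bc: "b \<in> carrier A"
    and "anchor_hom A br \<theta> u v b"
  shows "anchor_hom A br \<theta> u v (d b)"
proof -
  have "jac MA brr (u, \<zero>\<^bsub>A\<^esub>) (v, \<zero>\<^bsub>A\<^esub>) (DD (\<zero>, b))"
    by (rule XB.jac_D) (use assms in \<open>simp_all add: anchor_hom_iff\<close>)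
  then show ?thesis using assms anchor_hom_iff[of u v "d b"] by (simp add: semi_del_def)
qed

lemma anchor_hom_add:
  assumes uv: "u \<in> carrier M" "v \<in> carrier M" and bc: "b \<in> carrier A" "c \<in> carrier A"
    and "anchor_hom A br \<theta> u v b" "anchor_hom A br \<theta> u v c"
  shows "anchor_hom A br \<theta> u v (b \<oplus>\<^bsub>A\<^esub> c)"
proof -
  have "jac MA brr (u, \<zero>\<^bsub>A\<^esub>) (v, \<zero>\<^bsub>A\<^esub>) ((\<zero>, b) \<oplus>\<^bsub>MA\<^esub> (\<zero>, c))"
    by (rule XB.jac_add) (use assms in \<open>simp_all add: anchor_hom_iff\<close>)
  then show ?thesis using assms anchor_hom_iff[of u v "b \<oplus>\<^bsub>A\<^esub> c"] by simp
qed

section \<open>From generators to the whole module\<close>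

context
  fixes S :: "'m set"
  assumes S: "S \<subseteq> carrier M"
    and span: "\<And>P x. x \<in> carrier M \<Longrightarrow> (\<And>g. g \<in> S \<Longrightarrow> P g) \<Longrightarrow>
      (\<And>x y. x \<in> carrier M \<Longrightarrow> y \<in> carrier M \<Longrightarrow> P x \<Longrightarrow> P y \<Longrightarrow> P (x \<oplus> y)) \<Longrightarrow>
      (\<And>x. x \<in> carrier M \<Longrightarrow> P x \<Longrightarrow> P (D x)) \<Longrightarrow>
      (\<And>a x. a \<in> carrier A \<Longrightarrow> x \<in> carrier M \<Longrightarrow> P x \<Longrightarrow> P (a \<odot> x)) \<Longrightarrow> P x"
begin

text \<open>As a Jacobi identity the condition can be rotated so that v is last; there it extends
  from generators to all of M. Interchanging u and v then gives the same for u.\<close>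

lemma anchor_hom_span:
  assumes anchor_S: "\<And>g g' b. g \<in> S \<Longrightarrow> g' \<in> S \<Longrightarrow> b \<in> carrier A \<Longrightarrow> anchor_hom A br \<theta> g g' b"
    and uv: "u \<in> carrier M" "v \<in> carrier M" and b: "b \<in> carrier A"
  shows "anchor_hom A br \<theta> u v b"
proof -
  note zc = Q.zero_closed zero_closed
  have sw: "anchor_hom A br \<theta> v u b" if "anchor_hom A br \<theta> u v b" "u \<in> carrier M" "v \<in> carrier M" "b \<in> carrier A" for u v b
    using XB.jac_swap[of "(u, \<zero>\<^bsub>A\<^esub>)" "(v, \<zero>\<^bsub>A\<^esub>)" "(\<zero>, b)"] that by (simp add: anchor_hom_iff)
  have ext: "anchor_hom A br \<theta> u v b"
    if u: "u \<in> carrier M" and g: "\<And>g b. g \<in> S \<Longrightarrow> b \<in> carrier A \<Longrightarrow> anchor_hom A br \<theta> u g b"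
      and v: "v \<in> carrier M" and b: "b \<in> carrier A" for u v b
  proof -
    have "jac MA brr (u, \<zero>\<^bsub>A\<^esub>) (\<zero>, b) (v, \<zero>\<^bsub>A\<^esub>)"
    proof (rule span[where P = "\<lambda>v. jac MA brr (u, \<zero>\<^bsub>A\<^esub>) (\<zero>, b) (v, \<zero>\<^bsub>A\<^esub>)", OF v])
      fix g assume gS: "g \<in> S"
      then have J: "jac MA brr (u, \<zero>\<^bsub>A\<^esub>) (g, \<zero>\<^bsub>A\<^esub>) (\<zero>, b)" using g[OF gS b] anchor_hom_iff[of u g b] u b S by auto
      show "jac MA brr (u, \<zero>\<^bsub>A\<^esub>) (\<zero>, b) (g, \<zero>\<^bsub>A\<^esub>)"
        by (rule XB.jac_rot[OF _ _ _ J]) (use u b S gS in auto)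
    next
      fix x y assume xy: "x \<in> carrier M" "y \<in> carrier M"
        "jac MA brr (u, \<zero>\<^bsub>A\<^esub>) (\<zero>, b) (x, \<zero>\<^bsub>A\<^esub>)" "jac MA brr (u, \<zero>\<^bsub>A\<^esub>) (\<zero>, b) (y, \<zero>\<^bsub>A\<^esub>)"
      have "jac MA brr (u, \<zero>\<^bsub>A\<^esub>) (\<zero>, b) ((x, \<zero>\<^bsub>A\<^esub>) \<oplus>\<^bsub>MA\<^esub> (y, \<zero>\<^bsub>A\<^esub>))"
        by (rule XB.jac_add) (use u b xy in simp_all)
      then show "jac MA brr (u, \<zero>\<^bsub>A\<^esub>) (\<zero>, b) (x \<oplus> y, \<zero>\<^bsub>A\<^esub>)" by simp
    next
      fix x assume x: "x \<in> carrier M" "jac MA brr (u, \<zero>\<^bsub>A\<^esub>) (\<zero>, b) (x, \<zero>\<^bsub>A\<^esub>)"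
      have "jac MA brr (u, \<zero>\<^bsub>A\<^esub>) (\<zero>, b) (DD (x, \<zero>\<^bsub>A\<^esub>))"
        by (rule XB.jac_D) (use u b x in simp_all)
      then show "jac MA brr (u, \<zero>\<^bsub>A\<^esub>) (\<zero>, b) (D x, \<zero>\<^bsub>A\<^esub>)" by (simp add: semi_del_def)
      fix a assume a: "a \<in> carrier A"
      \<comment> \<open>The second argument has zero component in M, so the compatibility needed for
        multiplication by a is trivial here.\<close>
      have "jac MA brr (u, \<zero>\<^bsub>A\<^esub>) (\<zero>, b) (a \<odot>\<^bsub>MA\<^esub> (x, \<zero>\<^bsub>A\<^esub>))"
        by (rule XB.jac_smult) (use u b x a in \<open>simp_all add: anchor_hom_semi anchor_hom_zero\<close>)
      then show "jac MA brr (u, \<zero>\<^bsub>A\<^esub>) (\<zero>, b) (a \<odot> x, \<zero>\<^bsub>A\<^esub>)" using a by simp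
    qed
    from XB.jac_rot[OF _ _ _ this] have "jac MA brr (u, \<zero>\<^bsub>A\<^esub>) (v, \<zero>\<^bsub>A\<^esub>) (\<zero>, b)"
      using u v b by simp
    then show ?thesis using u v b by (simp add: anchor_hom_iff)
  qed
  have 1: "anchor_hom A br \<theta> g v b" if "g \<in> S" "v \<in> carrier M" "b \<in> carrier A" for g v b
    using ext[of g v b] anchor_S that S by blast
  have "anchor_hom A br \<theta> v g b" if "g \<in> S" "v \<in> carrier M" "b \<in> carrier A" for g v b
    using sw[OF 1[OF that]] that S by blast
  then show ?thesis using ext[OF uv(1) _ uv(2) b] uv(1) by blast
qed

text \<open>With the compatibility of the anchor known everywhere, the last argument extends from
  generators to M; permuting the arguments brings each of them to the last place in turn.\<close>

lemma jac_span:
  assumes anchor_S: "\<And>g g' b. g \<in> S \<Longrightarrow> g' \<in> S \<Longrightarrow> b \<in> carrier A \<Longrightarrow> anchor_hom A br \<theta> g g' b"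
    and jac_S: "\<And>g g' g''. g \<in> S \<Longrightarrow> g' \<in> S \<Longrightarrow> g'' \<in> S \<Longrightarrow> jac M br g g' g''"
    and uvw: "u \<in> carrier M" "v \<in> carrier M" "w \<in> carrier M"
  shows "jac M br u v w"
proof -
  have ext: "jac M br u v w" if uv: "u \<in> carrier M" "v \<in> carrier M" and g: "\<And>g. g \<in> S \<Longrightarrow> jac M br u v g" and w: "w \<in> carrier M" for u v w
  proof (rule span[where P = "jac M br u v", OF w])
    fix a x assume ax: "a \<in> carrier A" "x \<in> carrier M" "jac M br u v x"
    show "jac M br u v (a \<odot> x)"
      by (rule jac_smult[OF uv ax(2,1,3) anchor_hom_span[OF anchor_S uv ax(1)]])
  qed (rule g jac_add[OF uv] jac_D[OF uv]; assumption)+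
  have Sc: "g \<in> S \<Longrightarrow> g \<in> carrier M" for g using S by blast
  \<comment> \<open>The three facts free one more argument each: first the last one, then after a
    rotation the middle one, and after a swap and a rotation the remaining generator is
    last.\<close>
  have 1: "jac M br g g' w" if "g \<in> S" "g' \<in> S" "w \<in> carrier M" for g g' w
    by (rule ext) (use that Sc jac_S in auto)
  have 2: "jac M br g w v" if g: "g \<in> S" and w: "w \<in> carrier M" and v: "v \<in> carrier M" for g w v
    by (rule ext[OF Sc[OF g] w jac_rot[OF Sc[OF g] Sc w 1[OF g _ w]] v])
  have 3: "jac M br w v g" if g: "g \<in> S" and w: "w \<in> carrier M" and v: "v \<in> carrier M" for g w v
    by (rule jac_rot[OF w Sc[OF g] v jac_swap[OF Sc[OF g] w v 2[OF g w v]]])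
  show ?thesis by (rule ext[OF uvw(1,2) 3[OF _ uvw(1,2)] uvw(3)])
qed

end

end

section \<open>The current Lie conformal algebroid\<close>

locale current = jet_setup K R J d \<iota>
  for K :: "'k ring" and R :: "('k, 'r) module" and J :: "('k, 'j) module"
    and d :: "'j \<Rightarrow> 'j" and \<iota> :: "'r \<Rightarrow> 'j" +
  fixes F :: "('r, 'f) module" and bra :: "'f \<Rightarrow> 'f \<Rightarrow> 'f" and th :: "'f \<Rightarrow> 'r \<Rightarrow> 'r"
  assumes LA: "lie_algebroid K R F bra th"
begin

sublocale FF: module R F
  using LA by (simp add: lie_algebroid_def)

lemma th_Der: "u \<in> carrier F \<Longrightarrow> th u \<in> Der K R"
  and th_add: "u \<in> carrier F \<Longrightarrow> v \<in> carrier F \<Longrightarrow> r \<in> carrier R \<Longrightarrow> th (u \<oplus>\<^bsub>F\<^esub> v) r = th u r \<oplus>\<^bsub>R\<^esub> th v r"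
  and th_smult: "s \<in> carrier R \<Longrightarrow> u \<in> carrier F \<Longrightarrow> r \<in> carrier R \<Longrightarrow> th (s \<odot>\<^bsub>F\<^esub> u) r = s \<otimes>\<^bsub>R\<^esub> th u r"
  and th_bra: "u \<in> carrier F \<Longrightarrow> v \<in> carrier F \<Longrightarrow> r \<in> carrier R \<Longrightarrow>
    th (bra u v) r = th u (th v r) \<ominus>\<^bsub>R\<^esub> th v (th u r)"
  and bra_smult_r: "s \<in> carrier R \<Longrightarrow> u \<in> carrier F \<Longrightarrow> v \<in> carrier F \<Longrightarrow>
    bra u (s \<odot>\<^bsub>F\<^esub> v) = s \<odot>\<^bsub>F\<^esub> bra u v \<oplus>\<^bsub>F\<^esub> th u s \<odot>\<^bsub>F\<^esub> v"
  using LA by (simp_all add: lie_algebroid_def)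

lemma th_closed [simp]: "u \<in> carrier F \<Longrightarrow> r \<in> carrier R \<Longrightarrow> th u r \<in> carrier R"
  using th_Der[of u] by (auto simp: Der_def)

lemma bra_closed [simp]: "u \<in> carrier F \<Longrightarrow> v \<in> carrier F \<Longrightarrow> bra u v \<in> carrier F"
  and bra_add_l: "u \<in> carrier F \<Longrightarrow> v \<in> carrier F \<Longrightarrow> w \<in> carrier F \<Longrightarrow> bra (u \<oplus>\<^bsub>F\<^esub> v) w = bra u w \<oplus>\<^bsub>F\<^esub> bra v w"
  and bra_add_r: "u \<in> carrier F \<Longrightarrow> v \<in> carrier F \<Longrightarrow> w \<in> carrier F \<Longrightarrow> bra u (v \<oplus>\<^bsub>F\<^esub> w) = bra u v \<oplus>\<^bsub>F\<^esub> bra u w"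
  and bra_self: "u \<in> carrier F \<Longrightarrow> bra u u = \<zero>\<^bsub>F\<^esub>"
  and bra_jacobi: "u \<in> carrier F \<Longrightarrow> v \<in> carrier F \<Longrightarrow> w \<in> carrier F \<Longrightarrow>
     bra u (bra v w) \<oplus>\<^bsub>F\<^esub> bra v (bra w u) \<oplus>\<^bsub>F\<^esub> bra w (bra u v) = \<zero>\<^bsub>F\<^esub>"
  using LA by (simp_all add: lie_algebroid_def lie_algebra_def)

lemma bra_anti:
  assumes "u \<in> carrier F" "v \<in> carrier F"
  shows "bra v u = \<ominus>\<^bsub>F\<^esub> bra u v"
proof -
  have "bra (u \<oplus>\<^bsub>F\<^esub> v) (u \<oplus>\<^bsub>F\<^esub> v) = (bra u u \<oplus>\<^bsub>F\<^esub> bra v u) \<oplus>\<^bsub>F\<^esub> (bra u v \<oplus>\<^bsub>F\<^esub> bra v v)"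
    using assms by (simp add: bra_add_l bra_add_r)
  then have "bra v u \<oplus>\<^bsub>F\<^esub> bra u v = \<zero>\<^bsub>F\<^esub>"
    using assms by (simp add: bra_self)
  then show ?thesis using assms
    by (intro FF.minus_equality[symmetric]) simp_all
qed

lemma bra_ahom: "u \<in> carrier F \<Longrightarrow> bra u \<in> ahom F F"
  by (rule ahomI) (auto simp: bra_add_r)

lemma bra_smult_l:
  assumes "s \<in> carrier R" "u \<in> carrier F" "v \<in> carrier F"
  shows "bra (s \<odot>\<^bsub>F\<^esub> u) v = s \<odot>\<^bsub>F\<^esub> bra u v \<ominus>\<^bsub>F\<^esub> th v s \<odot>\<^bsub>F\<^esub> u"
  using assms bra_anti[of v "s \<odot>\<^bsub>F\<^esub> u"] bra_anti[of u v]
  by (simp add: bra_smult_r FF.minus_add FF.smult_r_minus FF.minus_minus a_minus_def)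

lemma bra_jacobi':
  assumes "u \<in> carrier F" "v \<in> carrier F" "w \<in> carrier F"
  shows "bra u (bra v w) \<ominus>\<^bsub>F\<^esub> bra v (bra u w) = bra (bra u v) w"
proof -
  have "bra v (bra w u) = \<ominus>\<^bsub>F\<^esub> bra v (bra u w)"
    using assms bra_anti[of u w] ahom_minus[OF FF.M.abelian_group_axioms FF.M.abelian_group_axioms bra_ahom[OF assms(2)], of "bra u w"]
    by simp
  moreover have "bra w (bra u v) = \<ominus>\<^bsub>F\<^esub> bra (bra u v) w"
    using assms bra_anti[of "bra u v" w] by simp
  ultimately have "bra u (bra v w) \<oplus>\<^bsub>F\<^esub> (\<ominus>\<^bsub>F\<^esub> bra v (bra u w)) \<oplus>\<^bsub>F\<^esub> (\<ominus>\<^bsub>F\<^esub> bra (bra u v) w) = \<zero>\<^bsub>F\<^esub>"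
    using bra_jacobi[OF assms] by simp
  then show ?thesis using assms
    by (simp add: FF.M.diff_eq_iff FF.minus_add a_minus_def)
      (metis FF.M.a_closed FF.M.a_inv_closed FF.M.add.inv_equality FF.M.minus_minus bra_closed)
qed

section \<open>The underlying module of the current algebroid\<close>

sublocale T: tensor "diffop_ring J d" R F "right_action J d \<iota>"
proof (intro tensor.intro tensor_axioms.intro ring_diffop_ring FF.M.abelian_group_axioms)
  show "right_action J d \<iota> s r \<in> carrier (diffop_ring J d)" if "s \<in> carrier (diffop_ring J d)" "r \<in> carrier R" for s r
    using that by (simp add: right_action_def mult_diffop_ring)
  show "s \<otimes>\<^bsub>diffop_ring J d\<^esub> right_action J d \<iota> t r = right_action J d \<iota> (s \<otimes>\<^bsub>diffop_ring J d\<^esub> t) r"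
    if "s \<in> carrier (diffop_ring J d)" "t \<in> carrier (diffop_ring J d)" "r \<in> carrier R" for s t r
  proof -
    interpret S: ring "diffop_ring J d" by (rule ring_diffop_ring)
    show ?thesis using that S.m_assoc[of s t "cpoly J (\<iota> r)"] by (simp add: right_action_def)
  qed
qed simp

text \<open>The restriction to J; together with the operator \<open>DE\<close> it carries the whole
  module, and \<open>current_smult\<close> translates the given action.\<close>

definition M0 :: "('j, ((nat \<Rightarrow> 'j) \<times> 'f \<Rightarrow>\<^sub>0 int) set) module" where
  "M0 = over_A J (current_module R F J d \<iota>)"

definition DE :: "((nat \<Rightarrow> 'j) \<times> 'f \<Rightarrow>\<^sub>0 int) set \<Rightarrow> ((nat \<Rightarrow> 'j) \<times> 'f \<Rightarrow>\<^sub>0 int) set" where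
  "DE = del J (current_module R F J d \<iota>)"

definition ten :: "(nat \<Rightarrow> 'j) \<Rightarrow> 'f \<Rightarrow> ((nat \<Rightarrow> 'j) \<times> 'f \<Rightarrow>\<^sub>0 int) set" where
  "ten = tensor_elem (diffop_ring J d) (right_action J d \<iota>) R F"

abbreviation "emb u \<equiv> ten (cpoly J \<one>\<^bsub>J\<^esub>) u"

lemma diffop_module_E: "diffop_module J d (current_module R F J d \<iota>)"
  unfolding current_module_def
  by (intro diffop_module.intro diff_ring_axioms T.left_module_T)

sublocale EM: diff_module J d M0 DE
  unfolding M0_def DE_def by (rule diffop_module.diff_module_E[OF diffop_module_E])

lemma carrier_M0: "carrier M0 = carrier T.T" and add_M0: "add M0 = add T.T"
  by (simp_all add: M0_def current_module_def)

lemma current_smult: "P \<in> carrier (pmod J) \<Longrightarrow> x \<in> carrier M0 \<Longrightarrow> P \<odot>\<^bsub>current_module R F J d \<iota>\<^esub> x = act J M0 DE P x"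
  using diffop_module.smult_eq_act[OF diffop_module_E, of P x] by (simp add: M0_def DE_def)

lemma ten_closed [simp]: "P \<in> carrier (pmod J) \<Longrightarrow> u \<in> carrier F \<Longrightarrow> ten P u \<in> carrier M0"
  by (simp add: carrier_M0 ten_def)

lemma act_ten:
  assumes "P \<in> carrier (pmod J)" "Q \<in> carrier (pmod J)" "u \<in> carrier F"
  shows "act J M0 DE P (ten Q u) = ten (opmul J d P Q) u"
  using assms current_smult[OF assms(1) ten_closed[OF assms(2,3)]] T.smult_elem[of P Q u]
  by (simp add: current_module_def ten_def mult_diffop_ring)

lemma ten_emb: "P \<in> carrier (pmod J) \<Longrightarrow> u \<in> carrier F \<Longrightarrow> ten P u = act J M0 DE P (emb u)"
  by (simp add: act_ten opmul_one)

lemma ten_bal: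
  "P \<in> carrier (pmod J) \<Longrightarrow> r \<in> carrier R \<Longrightarrow> u \<in> carrier F \<Longrightarrow> ten (opmul J d P (cpoly J (\<iota> r))) u = ten P (r \<odot>\<^bsub>F\<^esub> u)"
  using T.ten_balanced[of P r u] by (simp add: right_action_def mult_diffop_ring ten_def)

text \<open>The balancing relation moves \<iota>(r) from the operator to the element of F.\<close>

lemma smult_emb: "r \<in> carrier R \<Longrightarrow> u \<in> carrier F \<Longrightarrow> \<iota> r \<odot>\<^bsub>M0\<^esub> emb u = emb (r \<odot>\<^bsub>F\<^esub> u)"
  using ten_bal[of "cpoly J \<one>\<^bsub>J\<^esub>" r u] act_ten[of "cpoly J (\<iota> r)" "cpoly J \<one>\<^bsub>J\<^esub>" u]
  by (simp add: opmul_one opmul_one_l)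

lemma ten_add_r: "P \<in> carrier (pmod J) \<Longrightarrow> u \<in> carrier F \<Longrightarrow> v \<in> carrier F \<Longrightarrow> ten P (u \<oplus>\<^bsub>F\<^esub> v) = ten P u \<oplus>\<^bsub>M0\<^esub> ten P v"
  using T.ten_add_r[of P u v] by (simp add: ten_def add_M0)

lemma emb_ahom: "(\<lambda>u. emb u) \<in> ahom F M0"
  by (rule ahomI) (auto simp: ten_add_r)

lemmas emb_minus = ahom_minus[OF FF.M.abelian_group_axioms EM.abelian_group_axioms emb_ahom]
lemmas emb_zero = ahom_zero[OF FF.M.abelian_group_axioms EM.abelian_group_axioms emb_ahom]
lemmas emb_diff = ahom_diff[OF FF.M.abelian_group_axioms EM.abelian_group_axioms emb_ahom]

lemma M0_induct [consumes 1, case_names ten add]: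
  assumes "x \<in> carrier M0" "\<And>P u. P \<in> carrier (pmod J) \<Longrightarrow> u \<in> carrier F \<Longrightarrow> Q (ten P u)"
    and "\<And>x y. x \<in> carrier M0 \<Longrightarrow> y \<in> carrier M0 \<Longrightarrow> Q x \<Longrightarrow> Q y \<Longrightarrow> Q (x \<oplus>\<^bsub>M0\<^esub> y)"
  shows "Q x"
  using assms unfolding carrier_M0 add_M0 ten_def
  by (induction x rule: T.T_induct) auto

text \<open>A pure tensor is an operator applied to an element of F, and operators are built from
  scalars, \<partial> and sums.\<close>

lemma M0_span:
  assumes x: "x \<in> carrier M0" and g: "\<And>u. u \<in> carrier F \<Longrightarrow> Q (emb u)"
    and a: "\<And>x y. x \<in> carrier M0 \<Longrightarrow> y \<in> carrier M0 \<Longrightarrow> Q x \<Longrightarrow> Q y \<Longrightarrow> Q (x \<oplus>\<^bsub>M0\<^esub> y)"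
    and D: "\<And>x. x \<in> carrier M0 \<Longrightarrow> Q x \<Longrightarrow> Q (DE x)"
    and s: "\<And>a x. a \<in> carrier J \<Longrightarrow> x \<in> carrier M0 \<Longrightarrow> Q x \<Longrightarrow> Q (a \<odot>\<^bsub>M0\<^esub> x)"
  shows "Q x"
  using x
proof (induction x rule: M0_induct)
  case (ten P u)
  have "Q (act J M0 DE P x)" if "x \<in> carrier M0" "Q x" for x
    using ten(1) that
    by (induction P arbitrary: x rule: pmod_induct)
      (simp_all add: s D a EM.act_lshift EM.act_add_l)
  then show ?case using ten g by (simp add: ten_emb[of P u])
qed (rule a)

lemma M0_universal:
  assumes "abelian_group H" "\<And>u. u \<in> carrier F \<Longrightarrow> (\<lambda>P. b P u) \<in> ahom (pmod J) H"
    "\<And>P. P \<in> carrier (pmod J) \<Longrightarrow> b P \<in> ahom F H"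
    "\<And>P r u. P \<in> carrier (pmod J) \<Longrightarrow> r \<in> carrier R \<Longrightarrow> u \<in> carrier F \<Longrightarrow> b (opmul J d P (cpoly J (\<iota> r))) u = b P (r \<odot>\<^bsub>F\<^esub> u)"
  shows "\<exists>h. h \<in> ahom M0 H \<and> (\<forall>P\<in>carrier (pmod J). \<forall>u\<in>carrier F. h (ten P u) = b P u)"
proof -
  have 1: "(\<lambda>P. b P u) \<in> ahom (diffop_ring J d) H" if "u \<in> carrier F" for u
    using assms(2)[OF that] by (simp add: hom_def)
  have 2: "b P \<in> ahom F H" if "P \<in> carrier (diffop_ring J d)" for P
    using assms(3) that by simp
  have 3: "b (right_action J d \<iota> P r) u = b P (r \<odot>\<^bsub>F\<^esub> u)"
    if "P \<in> carrier (diffop_ring J d)" "r \<in> carrier R" "u \<in> carrier F" for P r u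
    using assms(4) that by (simp add: right_action_def mult_diffop_ring)
  obtain h where h: "h \<in> ahom T.T H" "\<And>P u. P \<in> carrier (diffop_ring J d) \<Longrightarrow> u \<in> carrier F \<Longrightarrow> h (T.ten P u) = b P u"
    by (rule T.T_universal[of H b, OF assms(1) 1 2 3]) auto
  have "h \<in> ahom M0 H" using h(1) by (simp add: hom_def carrier_M0 add_M0)
  then show ?thesis using h(2) by (auto simp: ten_def)
qed

abbreviation "\<phi> u \<equiv> der_lift K R J d \<iota> (th u)"
abbreviation "act1J \<equiv> act1 J d (selfm J)"

lemma \<phi>_cder: "u \<in> carrier F \<Longrightarrow> cder J d (\<phi> u)"
  by (rule der_lift(2)[OF th_Der])

lemma \<phi>_CDer: "u \<in> carrier F \<Longrightarrow> \<phi> u \<in> CDer K J d"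
  by (rule der_lift(1)[OF th_Der])

lemma \<phi>_\<iota>: "u \<in> carrier F \<Longrightarrow> r \<in> carrier R \<Longrightarrow> \<phi> u (\<iota> r) = cpoly J (\<iota> (th u r))"
  by (rule der_lift(3)[OF th_Der])

lemma \<phi>_ahom: "u \<in> carrier F \<Longrightarrow> \<phi> u \<in> ahom J (pmod J)"
  using \<phi>_cder by (simp add: cder_def)

lemma \<phi>_closed [simp]: "u \<in> carrier F \<Longrightarrow> a \<in> carrier J \<Longrightarrow> \<phi> u a \<in> carrier (pmod J)"
  by (rule ahom_closed[OF \<phi>_ahom])

interpretation S: diff_module J d "selfm J" d by (rule diff_module_self)

lemma act1J_closed [simp]: "P \<in> carrier (pmod J) \<Longrightarrow> f \<in> carrier (pmod J) \<Longrightarrow> act1J P f \<in> carrier (pmod J)"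
  using S.act1_closed[of P f] by simp

lemma act1J_add_l: "P \<in> carrier (pmod J) \<Longrightarrow> Q \<in> carrier (pmod J) \<Longrightarrow> f \<in> carrier (pmod J) \<Longrightarrow>
   act1J (P \<oplus>\<^bsub>pmod J\<^esub> Q) f = act1J P f \<oplus>\<^bsub>pmod J\<^esub> act1J Q f"
  using S.act1_add_l[of P Q f] by simp

lemma act1J_add_r: "P \<in> carrier (pmod J) \<Longrightarrow> f \<in> carrier (pmod J) \<Longrightarrow> g \<in> carrier (pmod J) \<Longrightarrow>
   act1J P (f \<oplus>\<^bsub>pmod J\<^esub> g) = act1J P f \<oplus>\<^bsub>pmod J\<^esub> act1J P g"
  using S.act1_add_r[of P f g] by simp

lemma act1J_opmul: "P \<in> carrier (pmod J) \<Longrightarrow> Q \<in> carrier (pmod J) \<Longrightarrow> f \<in> carrier (pmod J) \<Longrightarrow>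
   act1J (opmul J d P Q) f = act1J P (act1J Q f)"
  using S.act1_opmul[of P Q f] by simp

lemma act1J_cpoly: "a \<in> carrier J \<Longrightarrow> f \<in> carrier (pmod J) \<Longrightarrow> act1J (cpoly J a) f = conv J d (selfm J) (cpoly J a) f"
  using S.act1_cpoly[of a f] by simp

lemma act1J_one: "f \<in> carrier (pmod J) \<Longrightarrow> act1J (cpoly J \<one>\<^bsub>J\<^esub>) f = f"
  using S.star_one[of f] by (simp add: act1J_cpoly)

lemma act1J_smult:
  assumes "P \<in> carrier (pmod J)" "f \<in> carrier (pmod J)" "c \<in> carrier J"
  shows "act1J P (c \<odot>\<^bsub>pmod (selfm J)\<^esub> f) = c \<odot>\<^bsub>pmod (selfm J)\<^esub> act1J P f"
  using S.act1_act2[of P "cpoly J c" f] S.act2_cpoly[of c f] S.act2_cpoly[of c "act1J P f"] assms by simp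

lemma \<phi>_add:
  assumes "u \<in> carrier F" "v \<in> carrier F" "a \<in> carrier J"
  shows "\<phi> (u \<oplus>\<^bsub>F\<^esub> v) a = \<phi> u a \<oplus>\<^bsub>pmod J\<^esub> \<phi> v a"
  by (rule cder_unique[OF \<phi>_cder cder_add[OF \<phi>_cder \<phi>_cder] _ assms(3)])
    (use assms in \<open>auto simp: \<phi>_\<iota> th_add \<iota>_add cpoly_add\<close>)

text \<open>Both sides are conformal derivations, so it suffices to compare them on R. This is the
  balancing condition for the anchor.\<close>

lemma \<phi>_smult:
  assumes "r \<in> carrier R" "u \<in> carrier F" "a \<in> carrier J"
  shows "\<phi> (r \<odot>\<^bsub>F\<^esub> u) a = act1J (cpoly J (\<iota> r)) (\<phi> u a)"
proof -
  have s: "conv J d (selfm J) (cpoly J (\<iota> r)) (cpoly J b) = cpoly J (\<iota> r \<otimes>\<^bsub>J\<^esub> b)" if "b \<in> carrier J" for b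
    using S.star_cpoly[of "\<iota> r" b] assms that by simp
  have "\<phi> (r \<odot>\<^bsub>F\<^esub> u) a = conv J d (selfm J) (cpoly J (\<iota> r)) (\<phi> u a)"
    by (rule cder_unique[OF \<phi>_cder cder_star[OF \<phi>_cder] _ assms(3)])
      (use assms s in \<open>auto simp: \<phi>_\<iota> th_smult \<iota>_mult\<close>)
  then show ?thesis using assms by (simp add: act1J_cpoly)
qed

subsection \<open>The anchor\<close>

text \<open>For each fixed a the universal property gives a map in x, determined on the carrier
  only; hence the choice.\<close>

definition anch :: "((nat \<Rightarrow> 'j) \<times> 'f \<Rightarrow>\<^sub>0 int) set \<Rightarrow> 'j \<Rightarrow> nat \<Rightarrow> 'j" where
  "anch x a = (SOME h. h \<in> ahom M0 (pmod J) \<and>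
     (\<forall>P\<in>carrier (pmod J). \<forall>u\<in>carrier F. h (ten P u) = act1J P (\<phi> u a))) x"

lemma anch_ex:
  assumes a: "a \<in> carrier J"
  shows "(\<lambda>x. anch x a) \<in> ahom M0 (pmod J) \<and> (\<forall>P\<in>carrier (pmod J). \<forall>u\<in>carrier F. anch (ten P u) a = act1J P (\<phi> u a))"
proof -
  have "\<exists>h. h \<in> ahom M0 (pmod J) \<and> (\<forall>P\<in>carrier (pmod J). \<forall>u\<in>carrier F. h (ten P u) = act1J P (\<phi> u a))"
    by (rule M0_universal)
      (use a in \<open>auto intro!: ahomI P.abelian_group_axioms simp: act1J_add_l act1J_add_r act1J_opmul \<phi>_smult \<phi>_add\<close>)
  from someI_ex[OF this] show ?thesis unfolding anch_def by simp
qed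

lemma anch_ahom_l: "a \<in> carrier J \<Longrightarrow> (\<lambda>x. anch x a) \<in> ahom M0 (pmod J)"
  using anch_ex by blast

lemma anch_ten: "a \<in> carrier J \<Longrightarrow> P \<in> carrier (pmod J) \<Longrightarrow> u \<in> carrier F \<Longrightarrow> anch (ten P u) a = act1J P (\<phi> u a)"
  using anch_ex by blast

lemmas anch_closed [simp] = ahom_closed[OF anch_ahom_l]
lemmas anch_add_l = ahom_add[OF anch_ahom_l]

lemma anch_emb: "a \<in> carrier J \<Longrightarrow> u \<in> carrier F \<Longrightarrow> anch (emb u) a = \<phi> u a"
  by (simp add: anch_ten act1J_one)

text \<open>In the variable a nothing is known from the construction; the derivation property is
  checked on pure tensors, where the value is an operator applied to a lift.\<close>

lemma anch_cder: "x \<in> carrier M0 \<Longrightarrow> cder J d (anch x)"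
proof (induction x rule: M0_induct)
  case (ten P u)
  show ?case by (rule cder_cong[OF cder_act1[OF ten(1) \<phi>_cder[OF ten(2)]]]) (use ten anch_ten in auto)
next
  case (add x y)
  show ?case by (rule cder_cong[OF cder_add[OF add(3,4)]]) (use add anch_add_l in auto)
qed

lemma anch_ahom: "x \<in> carrier M0 \<Longrightarrow> anch x \<in> ahom J (pmod J)"
  using anch_cder by (simp add: cder_def)

lemma anch_CDer: "x \<in> carrier M0 \<Longrightarrow> anch x \<in> CDer K J d"
proof -
  interpret O: diff_module J d "pmod (selfm J)" "ldel J d" by (rule diff_module_opmul)
  assume x: "x \<in> carrier M0"
  have "anch x (c \<odot>\<^bsub>J\<^esub> a) = (c \<odot>\<^bsub>J\<^esub> \<one>\<^bsub>J\<^esub>) \<odot>\<^bsub>pmod (selfm J)\<^esub> anch x a" if "c \<in> carrier K" "a \<in> carrier J" for c a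
    using x
  proof (induction x rule: M0_induct)
    case (ten P u)
    then show ?case using that \<phi>_CDer[of u] unfolding CDer_iff by (simp add: anch_ten act1J_smult)
  next
    case (add x y)
    then show ?case using that O.V.smult_r_distr[of "c \<odot>\<^bsub>J\<^esub> \<one>\<^bsub>J\<^esub>" "anch x a" "anch y a"] by (simp add: anch_add_l)
  qed
  then show ?thesis using anch_cder[OF x] by (simp add: CDer_iff)
qed

lemma anch_act:
  assumes "x \<in> carrier M0" "P \<in> carrier (pmod J)" "a \<in> carrier J"
  shows "anch (act J M0 DE P x) a = act1J P (anch x a)"
  using assms(1)
proof (induction x rule: M0_induct)
  case (ten Q u)
  then show ?case using assms by (simp add: act_ten anch_ten act1J_opmul)
next
  case (add x y)
  then show ?case using assms by (simp add: EM.act_add_r anch_add_l act1J_add_r)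
qed

subsection \<open>The bracket\<close>

abbreviation "a1 \<equiv> act1 J d M0"
abbreviation "a2 \<equiv> act2 J M0 DE"
abbreviation "da \<equiv> dact J M0 DE"
abbreviation "fl \<equiv> flip M0 DE"

lemma da_\<phi>_add: "u \<in> carrier F \<Longrightarrow> v \<in> carrier F \<Longrightarrow> P \<in> carrier (pmod J) \<Longrightarrow> x \<in> carrier M0 \<Longrightarrow>
    da (\<phi> (u \<oplus>\<^bsub>F\<^esub> v)) P x = da (\<phi> u) P x \<oplus>\<^bsub>pmod M0\<^esub> da (\<phi> v) P x"
  by (subst EM.dact_cong[of P _ "\<lambda>a. \<phi> u a \<oplus>\<^bsub>pmod J\<^esub> \<phi> v a"]) (simp_all add: \<phi>_add EM.dact_add_phi)

lemma da_\<phi>_smult: "u \<in> carrier F \<Longrightarrow> r \<in> carrier R \<Longrightarrow> P \<in> carrier (pmod J) \<Longrightarrow> x \<in> carrier M0 \<Longrightarrow>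
    da (\<phi> (r \<odot>\<^bsub>F\<^esub> u)) P x = a1 (cpoly J (\<iota> r)) (da (\<phi> u) P x)"
  by (subst EM.dact_cong[of P _ "\<lambda>a. act1J (cpoly J (\<iota> r)) (\<phi> u a)"])
    (simp_all add: \<phi>_smult EM.act1_dact_comp \<phi>_ahom)

lemma da_anch_add: "x \<in> carrier M0 \<Longrightarrow> y \<in> carrier M0 \<Longrightarrow> P \<in> carrier (pmod J) \<Longrightarrow> z \<in> carrier M0 \<Longrightarrow>
    da (anch (x \<oplus>\<^bsub>M0\<^esub> y)) P z = da (anch x) P z \<oplus>\<^bsub>pmod M0\<^esub> da (anch y) P z"
  by (subst EM.dact_cong[of P _ "\<lambda>a. anch x a \<oplus>\<^bsub>pmod J\<^esub> anch y a"]) (simp_all add: anch_add_l EM.dact_add_phi)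

lemma da_anch_act: "x \<in> carrier M0 \<Longrightarrow> P \<in> carrier (pmod J) \<Longrightarrow> Q \<in> carrier (pmod J) \<Longrightarrow> z \<in> carrier M0 \<Longrightarrow>
    da (anch (act J M0 DE Q x)) P z = a1 Q (da (anch x) P z)"
  by (subst EM.dact_cong[of P _ "\<lambda>a. act1J Q (anch x a)"]) (simp_all add: anch_act EM.act1_dact_comp anch_ahom)

lemma da_anch_emb: "u \<in> carrier F \<Longrightarrow> P \<in> carrier (pmod J) \<Longrightarrow> da (anch (emb u)) P z = da (\<phi> u) P z"
  by (rule EM.dact_cong) (auto simp: anch_emb)

lemma da_anch_ten: "u \<in> carrier F \<Longrightarrow> P \<in> carrier (pmod J) \<Longrightarrow> Q \<in> carrier (pmod J) \<Longrightarrow> z \<in> carrier M0 \<Longrightarrow>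
    da (anch (ten Q u)) P z = a1 Q (da (\<phi> u) P z)"
  by (simp add: ten_emb[of Q u] da_anch_act da_anch_emb)

lemma da_closed [simp]:
  "u \<in> carrier F \<Longrightarrow> P \<in> carrier (pmod J) \<Longrightarrow> z \<in> carrier M0 \<Longrightarrow> da (\<phi> u) P z \<in> carrier (pmod M0)"
  "x \<in> carrier M0 \<Longrightarrow> P \<in> carrier (pmod J) \<Longrightarrow> z \<in> carrier M0 \<Longrightarrow> da (anch x) P z \<in> carrier (pmod M0)"
  by (rule EM.dact_closed[OF \<phi>_ahom] EM.dact_closed[OF anch_ahom]; assumption)+

text \<open>Condition (i) applied to v in F, where the bracket with u is constant: the operator acts
  on [u,v], plus its commutator with the lift of \<open>th u\<close>.\<close>

definition adu :: "'f \<Rightarrow> ((nat \<Rightarrow> 'j) \<times> 'f \<Rightarrow>\<^sub>0 int) set \<Rightarrow> nat \<Rightarrow> ((nat \<Rightarrow> 'j) \<times> 'f \<Rightarrow>\<^sub>0 int) set" where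
  "adu u = (SOME h. h \<in> ahom M0 (pmod M0) \<and>
     (\<forall>Q\<in>carrier (pmod J). \<forall>v\<in>carrier F. h (ten Q v) =
        a2 Q (cpoly M0 (emb (bra u v))) \<oplus>\<^bsub>pmod M0\<^esub> da (\<phi> u) Q (emb v)))"

text \<open>Balancing: for Q composed with \<iota>(r) the commutator rule produces the extra term th
  u r times v, which is the one in the Leibniz rule for [u, r v].\<close>

lemma adu_ex:
  assumes u: "u \<in> carrier F"
  shows "adu u \<in> ahom M0 (pmod M0) \<and> (\<forall>Q\<in>carrier (pmod J). \<forall>v\<in>carrier F. adu u (ten Q v) =
        a2 Q (cpoly M0 (emb (bra u v))) \<oplus>\<^bsub>pmod M0\<^esub> da (\<phi> u) Q (emb v))"
proof -
  let ?b = "\<lambda>Q v. a2 Q (cpoly M0 (emb (bra u v))) \<oplus>\<^bsub>pmod M0\<^esub> da (\<phi> u) Q (emb v)"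
  have "\<exists>h. h \<in> ahom M0 (pmod M0) \<and> (\<forall>Q\<in>carrier (pmod J). \<forall>v\<in>carrier F. h (ten Q v) = ?b Q v)"
  proof (rule M0_universal)
    show "(\<lambda>P. ?b P v) \<in> ahom (pmod J) (pmod M0)" if "v \<in> carrier F" for v
      by (rule ahomI) (use u that in \<open>simp_all add: EM.act2_add_l EM.dact_add_l[OF \<phi>_ahom] EM.P.a_ac\<close>)
    show "?b P \<in> ahom F (pmod M0)" if "P \<in> carrier (pmod J)" for P
      by (rule ahomI) (use u that in \<open>simp_all add: bra_add_r ten_add_r EM.cpoly_add EM.act2_add_r EM.dact_add_r[OF \<phi>_ahom] EM.P.a_ac\<close>)
    fix P r v assume *: "P \<in> carrier (pmod J)" "r \<in> carrier R" "v \<in> carrier F"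
    have 1: "a2 (cpoly J (\<iota> r)) (cpoly M0 (emb (bra u v))) = cpoly M0 (emb (r \<odot>\<^bsub>F\<^esub> bra u v))"
    proof -
      have "a \<odot>\<^bsub>pmod M0\<^esub> cpoly M0 x = cpoly M0 (a \<odot>\<^bsub>M0\<^esub> x)" if "a \<in> carrier J" for a x
        by (rule ext) (use that in \<open>simp add: coeff cpoly_apply\<close>)
      then show ?thesis using * u by (simp add: EM.act2_cpoly smult_emb)
    qed
    have 2: "da (\<phi> u) (cpoly J (\<iota> r)) (emb v) = cpoly M0 (emb (th u r \<odot>\<^bsub>F\<^esub> v))"
      using * u by (simp add: EM.dact_cpoly[OF \<phi>_ahom] \<phi>_\<iota> EM.pairm_cpoly smult_emb)
    show "?b (opmul J d P (cpoly J (\<iota> r))) v = ?b P (r \<odot>\<^bsub>F\<^esub> v)"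
      using * u
      by (simp add: EM.act2_opmul EM.dact_opmul[OF \<phi>_cder] 1 2 smult_emb bra_smult_r ten_add_r EM.cpoly_add EM.act2_add_r EM.P.a_ac)
  qed (rule EM.P.abelian_group_axioms)
  from someI_ex[OF this] show ?thesis unfolding adu_def .
qed

lemma adu_ahom: "u \<in> carrier F \<Longrightarrow> adu u \<in> ahom M0 (pmod M0)"
  using adu_ex by blast

lemma adu_ten: "u \<in> carrier F \<Longrightarrow> Q \<in> carrier (pmod J) \<Longrightarrow> v \<in> carrier F \<Longrightarrow>
   adu u (ten Q v) = a2 Q (cpoly M0 (emb (bra u v))) \<oplus>\<^bsub>pmod M0\<^esub> da (\<phi> u) Q (emb v)"
  using adu_ex by blast

lemmas adu_closed [simp] = ahom_closed[OF adu_ahom]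
lemmas adu_add_r = ahom_add[OF adu_ahom]

lemma adu_act:
  assumes "y \<in> carrier M0" "u \<in> carrier F" "Q \<in> carrier (pmod J)"
  shows "adu u (act J M0 DE Q y) = a2 Q (adu u y) \<oplus>\<^bsub>pmod M0\<^esub> da (\<phi> u) Q y"
  using assms(1)
proof (induction y rule: M0_induct)
  case (ten P v)
  then show ?case using assms
    by (simp add: act_ten adu_ten EM.act2_opmul EM.dact_opmul[OF \<phi>_cder] EM.act2_add_r opmul_one EM.P.a_ac)
next
  case (add x y)
  then show ?case using assms
    by (simp add: EM.act_add_r adu_add_r EM.act2_add_r EM.dact_add_r[OF \<phi>_ahom] EM.P.a_ac)
qed

lemma adu_add_l:
  assumes "y \<in> carrier M0" "u \<in> carrier F" "v \<in> carrier F"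
  shows "adu (u \<oplus>\<^bsub>F\<^esub> v) y = adu u y \<oplus>\<^bsub>pmod M0\<^esub> adu v y"
  using assms(1)
proof (induction y rule: M0_induct)
  case (ten P w)
  then show ?case using assms
    by (simp add: adu_ten bra_add_l ten_add_r EM.cpoly_add EM.act2_add_r da_\<phi>_add EM.P.a_ac)
next
  case (add x y)
  then show ?case using assms by (simp add: adu_add_r EM.P.a_ac)
qed

text \<open>The Leibniz rule of F in the first argument; its correction term enters through the
  substitution -\<lambda>-\<partial>. It prepares the balancing condition in the first
  argument.\<close>

lemma adu_smult_l:
  assumes "y \<in> carrier M0" "u \<in> carrier F" "r \<in> carrier R"
  shows "adu (r \<odot>\<^bsub>F\<^esub> u) y = a1 (cpoly J (\<iota> r)) (adu u y) \<ominus>\<^bsub>pmod M0\<^esub> fl (pairm M0 (anch y (\<iota> r)) (emb u))"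
  using assms(1)
proof (induction y rule: M0_induct)
  case (ten P w)
  have 1: "a1 (cpoly J (\<iota> r)) (cpoly M0 (emb (bra u w))) = cpoly M0 (emb (r \<odot>\<^bsub>F\<^esub> bra u w))"
    using assms ten by (simp add: EM.act1_cpoly EM.star_cpoly smult_emb)
  have "fl (pairm M0 (anch (ten P w) (\<iota> r)) (emb u)) = a2 P (fl (pairm M0 (\<phi> w (\<iota> r)) (emb u)))"
    using assms ten by (simp add: anch_ten EM.act1_pairm EM.flip_act1)
  also have "\<dots> = a2 P (cpoly M0 (emb (th w r \<odot>\<^bsub>F\<^esub> u)))"
    using assms ten by (simp add: \<phi>_\<iota> EM.pairm_cpoly smult_emb)
  finally have 2: "fl (pairm M0 (anch (ten P w) (\<iota> r)) (emb u)) = a2 P (cpoly M0 (emb (th w r \<odot>\<^bsub>F\<^esub> u)))" .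
  have 3: "a1 (cpoly J (\<iota> r)) (a2 P (cpoly M0 (emb (bra u w)))) = a2 P (cpoly M0 (emb (r \<odot>\<^bsub>F\<^esub> bra u w)))"
    using assms ten by (simp add: EM.act1_act2[symmetric] 1)
  show ?case unfolding 2 using assms ten
    by (simp add: adu_ten bra_smult_l ten_add_r emb_minus EM.cpoly_add EM.cpoly_minus da_\<phi>_smult EM.act1_add_r 3 a_minus_def
        EM.act2_add_r EM.act2_minus EM.P.a_ac)
next
  case (add x y)
  then show ?case using assms
    by (simp add: adu_add_r anch_add_l EM.pairm_add_l EM.flip_add EM.act1_add_r a_minus_def EM.P.minus_add EM.P.a_ac)
qed

text \<open>The total formula with b = 1, for the operator P applied to u in F.\<close>

definition cbr :: "((nat \<Rightarrow> 'j) \<times> 'f \<Rightarrow>\<^sub>0 int) set \<Rightarrow> ((nat \<Rightarrow> 'j) \<times> 'f \<Rightarrow>\<^sub>0 int) set \<Rightarrow> nat \<Rightarrow> ((nat \<Rightarrow> 'j) \<times> 'f \<Rightarrow>\<^sub>0 int) set" where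
  "cbr x y = (SOME h. h \<in> ahom M0 (pmod M0) \<and>
     (\<forall>P\<in>carrier (pmod J). \<forall>u\<in>carrier F. h (ten P u) =
        a1 P (adu u y) \<ominus>\<^bsub>pmod M0\<^esub> fl (da (anch y) P (emb u)))) x"

lemma cbr_ex:
  assumes y: "y \<in> carrier M0"
  shows "(\<lambda>x. cbr x y) \<in> ahom M0 (pmod M0) \<and> (\<forall>P\<in>carrier (pmod J). \<forall>u\<in>carrier F. cbr (ten P u) y =
        a1 P (adu u y) \<ominus>\<^bsub>pmod M0\<^esub> fl (da (anch y) P (emb u)))"
proof -
  let ?b = "\<lambda>P u. a1 P (adu u y) \<ominus>\<^bsub>pmod M0\<^esub> fl (da (anch y) P (emb u))"
  have "\<exists>h. h \<in> ahom M0 (pmod M0) \<and> (\<forall>P\<in>carrier (pmod J). \<forall>u\<in>carrier F. h (ten P u) = ?b P u)"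
  proof (rule M0_universal)
    show "(\<lambda>P. ?b P u) \<in> ahom (pmod J) (pmod M0)" if "u \<in> carrier F" for u
      by (rule ahomI) (use y that in \<open>simp_all add: EM.act1_add_l EM.dact_add_l[OF anch_ahom] EM.flip_add a_minus_def EM.P.minus_add EM.P.a_ac\<close>)
    show "?b P \<in> ahom F (pmod M0)" if "P \<in> carrier (pmod J)" for P
      by (rule ahomI) (use y that in \<open>simp_all add: adu_add_l ten_add_r EM.act1_add_r EM.dact_add_r[OF anch_ahom] EM.flip_add a_minus_def EM.P.minus_add EM.P.a_ac\<close>)
    fix P r u assume *: "P \<in> carrier (pmod J)" "r \<in> carrier R" "u \<in> carrier F"
    \<comment> \<open>The second summand is the correction term of \<open>adu_smult_l\<close>, with
      P acting on it.\<close>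
    have 1: "fl (da (anch y) (opmul J d P (cpoly J (\<iota> r))) (emb u)) =
        fl (da (anch y) P (emb (r \<odot>\<^bsub>F\<^esub> u))) \<oplus>\<^bsub>pmod M0\<^esub> a1 P (fl (pairm M0 (anch y (\<iota> r)) (emb u)))"
      using * y by (simp add: EM.dact_opmul[OF anch_cder] EM.dact_cpoly[OF anch_ahom] smult_emb EM.flip_add EM.flip_act2)
    show "?b (opmul J d P (cpoly J (\<iota> r))) u = ?b P (r \<odot>\<^bsub>F\<^esub> u)"
      unfolding 1 using * y
      by (simp add: EM.act1_opmul adu_smult_l a_minus_def EM.act1_add_r EM.act1_minus EM.P.minus_add EM.P.a_ac)
  qed (rule EM.P.abelian_group_axioms)
  from someI_ex[OF this] show ?thesis unfolding cbr_def by simp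
qed

lemma cbr_ahom_l: "y \<in> carrier M0 \<Longrightarrow> (\<lambda>x. cbr x y) \<in> ahom M0 (pmod M0)"
  using cbr_ex by blast

lemma cbr_ten: "y \<in> carrier M0 \<Longrightarrow> P \<in> carrier (pmod J) \<Longrightarrow> u \<in> carrier F \<Longrightarrow>
   cbr (ten P u) y = a1 P (adu u y) \<ominus>\<^bsub>pmod M0\<^esub> fl (da (anch y) P (emb u))"
  using cbr_ex by blast

lemmas cbr_closed [simp] = ahom_closed[OF cbr_ahom_l]
lemmas cbr_add_l = ahom_add[OF cbr_ahom_l]

lemma cbr_add_r:
  assumes "x \<in> carrier M0" "y \<in> carrier M0" "z \<in> carrier M0"
  shows "cbr x (y \<oplus>\<^bsub>M0\<^esub> z) = cbr x y \<oplus>\<^bsub>pmod M0\<^esub> cbr x z"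
  using assms(1)
proof (induction x rule: M0_induct)
  case (ten P u)
  then show ?case using assms
    by (simp add: cbr_ten adu_add_r da_anch_add EM.act1_add_r EM.flip_add a_minus_def EM.P.minus_add EM.P.a_ac)
next
  case (add x y)
  then show ?case using assms by (simp add: cbr_add_l EM.P.a_ac)
qed

lemma cbr_ahom_r: "x \<in> carrier M0 \<Longrightarrow> cbr x \<in> ahom M0 (pmod M0)"
  by (rule ahomI) (auto simp: cbr_add_r)

text \<open>The actions \<open>a1\<close> and \<open>a2\<close> commute, and the operator Q, which
  acts on the anchor of its argument through \<open>a1\<close>, comes out of the flipped term as
  \<open>a2\<close>. So condition (i) survives the extension in x.\<close>

lemma cbr_act_r:
  assumes "x \<in> carrier M0" "y \<in> carrier M0" "Q \<in> carrier (pmod J)"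
  shows "cbr x (act J M0 DE Q y) = a2 Q (cbr x y) \<oplus>\<^bsub>pmod M0\<^esub> da (anch x) Q y"
  using assms(1)
proof (induction x rule: M0_induct)
  case (ten P u)
  then show ?case using assms
    by (simp add: cbr_ten adu_act da_anch_act EM.act1_add_r EM.flip_act1 EM.act1_act2[symmetric] a_minus_def
       EM.act2_add_r EM.act2_minus da_anch_ten EM.P.a_ac)
next
  case (add x x')
  then show ?case using assms by (simp add: cbr_add_l EM.act2_add_r da_anch_add EM.P.a_ac)
qed

text \<open>On pure tensors the substitution interchanges \<open>a1\<close> and \<open>a2\<close>
  and hence the two commutator terms, and it fixes the constant [u,v], whose antisymmetry supplies
  the sign.\<close>

lemma cbr_skew:
  assumes "x \<in> carrier M0" "y \<in> carrier M0"
  shows "cbr y x = \<ominus>\<^bsub>pmod M0\<^esub> fl (cbr x y)"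
  using assms(1)
proof (induction x rule: M0_induct)
  case (ten P u)
  show ?case using assms(2)
  proof (induction y rule: M0_induct)
    case (ten Q v)
    let ?W = "cpoly M0 (emb (bra u v))"
    have W: "cpoly M0 (emb (bra v u)) = \<ominus>\<^bsub>pmod M0\<^esub> ?W"
      using ten \<open>u \<in> carrier F\<close> bra_anti[of u v] by (simp add: emb_minus EM.cpoly_minus)
    note [simp] = \<open>P \<in> carrier (pmod J)\<close> \<open>u \<in> carrier F\<close> ten
    have 1: "cbr (ten P u) (ten Q v) = a1 P (a2 Q ?W) \<oplus>\<^bsub>pmod M0\<^esub> a1 P (da (\<phi> u) Q (emb v)) \<ominus>\<^bsub>pmod M0\<^esub> a2 Q (fl (da (\<phi> v) P (emb u)))"
      by (simp add: cbr_ten adu_ten EM.act1_add_r da_anch_ten EM.flip_act1)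
    have 2: "cbr (ten Q v) (ten P u) = \<ominus>\<^bsub>pmod M0\<^esub> a1 Q (a2 P ?W) \<oplus>\<^bsub>pmod M0\<^esub> a1 Q (da (\<phi> v) P (emb u)) \<ominus>\<^bsub>pmod M0\<^esub> a2 P (fl (da (\<phi> u) Q (emb v)))"
      by (simp add: cbr_ten adu_ten EM.act1_add_r da_anch_ten EM.flip_act1 W EM.act1_minus EM.act2_minus)
    have 3: "fl (a1 P (a2 Q ?W)) = a1 Q (a2 P ?W)"
      by (simp add: EM.flip_act1 EM.flip_act2 EM.act1_act2)
    show ?case unfolding 1 2
      by (simp add: EM.flip_add a_minus_def EM.flip_minus 3 EM.flip_act1 EM.flip_act2 EM.P.minus_add EM.P.minus_minus EM.P.a_ac)
  next
    case (add y z)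
    then show ?case using ten by (simp add: cbr_add_l cbr_add_r EM.flip_add EM.P.minus_add)
  qed
next
  case (add x x')
  then show ?case using assms(2) by (simp add: cbr_add_l cbr_add_r EM.flip_add EM.P.minus_add)
qed

text \<open>The rule for operators in the second argument, used for b directly and for a through
  skew-symmetry, where \<open>a2\<close> turns into \<open>a1\<close>.\<close>

lemma total_formula:
  assumes "x \<in> carrier M0" "y \<in> carrier M0" "P \<in> carrier (pmod J)" "Q \<in> carrier (pmod J)"
  shows "cbr (act J M0 DE P x) (act J M0 DE Q y) =
     a2 Q (a1 P (cbr x y)) \<oplus>\<^bsub>pmod M0\<^esub> a1 P (da (anch x) Q y) \<ominus>\<^bsub>pmod M0\<^esub> a2 Q (fl (da (anch y) P x))"
proof -
  have "cbr (act J M0 DE P x) y = \<ominus>\<^bsub>pmod M0\<^esub> fl (a2 P (cbr y x) \<oplus>\<^bsub>pmod M0\<^esub> da (anch y) P x)"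
    using assms cbr_skew[of y "act J M0 DE P x"] by (simp add: cbr_act_r)
  also have "\<dots> = a1 P (cbr x y) \<ominus>\<^bsub>pmod M0\<^esub> fl (da (anch y) P x)"
    using assms cbr_skew[of y x] by (simp add: EM.flip_add EM.flip_act2 EM.P.minus_add a_minus_def EM.act1_minus)
  finally have 1: "cbr (act J M0 DE P x) y = a1 P (cbr x y) \<ominus>\<^bsub>pmod M0\<^esub> fl (da (anch y) P x)" .
  have "cbr (act J M0 DE P x) (act J M0 DE Q y) = a2 Q (cbr (act J M0 DE P x) y) \<oplus>\<^bsub>pmod M0\<^esub> a1 P (da (anch x) Q y)"
    using assms by (simp add: cbr_act_r da_anch_act)
  then show ?thesis unfolding 1 using assms
    by (simp add: a_minus_def EM.act2_add_r EM.act2_minus EM.P.a_ac)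
qed

lemma cbr_emb: "u \<in> carrier F \<Longrightarrow> v \<in> carrier F \<Longrightarrow> cbr (emb u) (emb v) = cpoly M0 (emb (bra u v))"
proof -
  assume uv: "u \<in> carrier F" "v \<in> carrier F"
  have z: "pairm M0 \<zero>\<^bsub>pmod J\<^esub> x = \<zero>\<^bsub>pmod M0\<^esub>" if "x \<in> carrier M0" for x
    by (rule ahom_zero[OF P.abelian_group_axioms EM.P.abelian_group_axioms EM.pairm_ahom_l[OF that]])
  have "a1 (cpoly J \<one>\<^bsub>J\<^esub>) p = p" "a2 (cpoly J \<one>\<^bsub>J\<^esub>) p = p" if "p \<in> carrier (pmod M0)" for p
    using that module.smult_one[OF EM.module_pmod that] by (simp_all add: EM.act1_cpoly EM.star_one EM.act2_cpoly)
  moreover have "da (anch (emb v)) (cpoly J \<one>\<^bsub>J\<^esub>) (emb u) = \<zero>\<^bsub>pmod M0\<^esub>" "da (\<phi> u) (cpoly J \<one>\<^bsub>J\<^esub>) (emb v) = \<zero>\<^bsub>pmod M0\<^esub>"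
    using uv by (simp_all add: EM.dact_cpoly[OF anch_ahom] EM.dact_cpoly[OF \<phi>_ahom] cder_one[OF anch_cder] cder_one[OF \<phi>_cder] z)
  ultimately show ?thesis using uv by (simp add: cbr_ten adu_ten a_minus_def EM.P.r_neg EM.P.r_zero EM.P.a_inv_zero)
qed

lemma pre_algebroid: "pre_algebroid J d M0 DE cbr anch"
proof (intro pre_algebroid.intro anchored_bracket.intro EM.diff_module_axioms lambda_bracket.intro EM.del_group_axioms
    lambda_bracket_axioms.intro anchored_bracket_axioms.intro pre_algebroid_axioms.intro cbr_ahom_l cbr_ahom_r anch_cder anch_ahom_l)
  fix x y assume xy: "x \<in> carrier M0" "y \<in> carrier M0"
  show "cbr y x = \<ominus>\<^bsub>pmod M0\<^esub> fl (cbr x y)" using xy by (rule cbr_skew)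
  \<comment> \<open>The commutator with \<partial> involves only the value of the derivation at the
    coefficient 1 of \<partial>.\<close>
  have one: "da (anch x) (del_op J) y = \<zero>\<^bsub>pmod M0\<^esub>"
  proof -
    have "da (anch x) (del_op J) y = pairm M0 (anch x \<one>\<^bsub>J\<^esub>) (DE y)"
      using xy by (simp add: EM.del_op_eq EM.dact_lshift[OF anch_ahom] EM.dact_cpoly[OF anch_ahom])
    also have "\<dots> = da (anch x) (cpoly J \<one>\<^bsub>J\<^esub>) (DE y)"
      using xy by (simp add: EM.dact_cpoly[OF anch_ahom])
    also have "\<dots> = \<zero>\<^bsub>pmod M0\<^esub>"
    proof -
      have m1: "a2 (cpoly J \<one>\<^bsub>J\<^esub>) p = p" if "p \<in> carrier (pmod M0)" for p
        using that module.smult_one[OF EM.module_pmod that] by (simp add: EM.act2_cpoly)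
      \<comment> \<open>The operator 1 acts trivially, so the rule for operators forces its
        commutator term to be zero.\<close>
      have "cbr x (DE y) = cbr x (DE y) \<oplus>\<^bsub>pmod M0\<^esub> da (anch x) (cpoly J \<one>\<^bsub>J\<^esub>) (DE y)"
        using cbr_act_r[of x "DE y" "cpoly J \<one>\<^bsub>J\<^esub>"] xy by (simp add: m1)
      then show ?thesis using xy EM.P.add.l_cancel_one'[of "cbr x (DE y)" "da (anch x) (cpoly J \<one>\<^bsub>J\<^esub>) (DE y)"] by simp
    qed
    finally show ?thesis .
  qed
  have "del_op J \<in> carrier (pmod J)" by (simp add: EM.del_op_eq)
  moreover have "a2 (del_op J) p = ldel M0 DE p" if "p \<in> carrier (pmod M0)" for p
    using that module.smult_one[OF EM.module_pmod] by (simp add: EM.del_op_eq EM.act2_lshift EM.act2_cpoly)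
  ultimately show "cbr x (DE y) = ldel M0 DE (cbr x y)"
    using cbr_act_r[of x y "del_op J"] xy one by (simp add: EM.act_del_op EM.P.r_zero)
  fix a assume a: "a \<in> carrier J"
  show "cbr x (a \<odot>\<^bsub>M0\<^esub> y) = a \<odot>\<^bsub>pmod M0\<^esub> cbr x y \<oplus>\<^bsub>pmod M0\<^esub> pairm M0 (anch x a) y"
    using cbr_act_r[of x y "cpoly J a"] xy a by (simp add: EM.act2_cpoly EM.dact_cpoly[OF anch_ahom])
next
  fix x a assume *: "x \<in> carrier M0" "a \<in> carrier J"
  have "act1J (del_op J) f = \<ominus>\<^bsub>pmod J\<^esub> lshift J f" if "f \<in> carrier (pmod J)" for f
  proof -
    have "act1J (del_op J) f = act1J (cpoly J \<one>\<^bsub>J\<^esub>) (del1 (selfm J) f)"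
      using S.act1_lshift[of "cpoly J \<one>\<^bsub>J\<^esub>" f] that by (simp add: EM.del_op_eq)
    then show ?thesis using that by (simp add: act1J_one del1_def)
  qed
  moreover have "del_op J \<in> carrier (pmod J)" by (simp add: EM.del_op_eq)
  ultimately show "anch (DE x) a = \<ominus>\<^bsub>pmod J\<^esub> lshift J (anch x a)"
    using anch_act[of x "del_op J" a] * by (simp add: EM.act_del_op)
  fix b assume b: "b \<in> carrier J"
  show "anch (b \<odot>\<^bsub>M0\<^esub> x) a = conv J d (selfm J) (cpoly J b) (anch x a)"
    using anch_act[of x "cpoly J b" a] * b by (simp add: act1J_cpoly)
qed

end

context current
begin

interpretation PA: pre_algebroid J d M0 DE cbr anch by (rule pre_algebroid)

subsection \<open>The Jacobi identity and compatibility with the anchor\<close>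

text \<open>The brackets involved do not depend on \<lambda> and \<mu>, so only the coefficient m =
  n = 0 carries content: the Jacobi identity of F.\<close>

lemma jac_emb:
  assumes "u \<in> carrier F" "v \<in> carrier F" "w \<in> carrier F"
  shows "jac M0 cbr (emb u) (emb v) (emb w)"
proof -
  have *: "emb (bra u (bra v w)) \<ominus>\<^bsub>M0\<^esub> emb (bra v (bra u w)) = emb (bra (bra u v) w)"
    using assms by (simp flip: emb_diff bra_jacobi')
  show ?thesis
    unfolding PA.jac_iff
  proof (intro allI)
    fix m n
    show "cbr (emb u) (cbr (emb v) (emb w) n) m \<ominus>\<^bsub>M0\<^esub> cbr (emb v) (cbr (emb u) (emb w) m) n
       = PA.j3 (cbr (emb u) (emb v)) (emb w) m n"
      using assms *
      by (cases "m = 0"; cases "n = 0")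
        (simp_all add: cbr_emb PA.j3_cpoly cpoly_apply PA.br_zero_r coeff a_minus_def EM.a_inv_zero)
  qed
qed

text \<open>On \<iota>(R) this is the homomorphism property of the original anchor; closure under
  sums, products and \<partial> carries it to the jet algebra.\<close>

lemma anchor_hom_emb:
  assumes uv: "u \<in> carrier F" "v \<in> carrier F" and b: "b \<in> carrier J"
  shows "anchor_hom J cbr anch (emb u) (emb v) b"
  using b
proof (induction b rule: jet_induct)
  case (base r)
  have *: "\<iota> (th u (th v r)) \<ominus>\<^bsub>J\<^esub> \<iota> (th v (th u r)) = \<iota> (th (bra u v) r)"
    using uv base by (simp add: th_bra \<iota>_diff)
  have z\<phi>: "\<phi> w \<zero>\<^bsub>J\<^esub> = \<zero>\<^bsub>pmod J\<^esub>" if "w \<in> carrier F" for w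
    using PA.\<theta>_zero_r[of "emb w"] that by (simp add: anch_emb)
  have z': "anch \<zero>\<^bsub>M0\<^esub> a = \<zero>\<^bsub>pmod J\<^esub>" if "a \<in> carrier J" for a
    by (rule PA.\<theta>_zero_l[OF that])
  have u0: "umap J (\<lambda>i. \<zero>\<^bsub>pmod J\<^esub>) m n = \<zero>\<^bsub>J\<^esub>" for m n
    by (simp add: umap_def coeff)
  have "umap J (\<lambda>i. anch (cbr (emb u) (emb v) i) (\<iota> r)) m n =
     (if m = 0 \<and> n = 0 then \<iota> (th (bra u v) r) else \<zero>\<^bsub>J\<^esub>)" for m n
    using uv base by (subst umap_rec) (auto simp: cbr_emb cpoly_apply z' u0 anch_emb \<phi>_\<iota> coeff)
  moreover have "anch (emb u) (anch (emb v) (\<iota> r) n) m \<ominus>\<^bsub>J\<^esub> anch (emb v) (anch (emb u) (\<iota> r) m) n =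
     (if m = 0 \<and> n = 0 then \<iota> (th (bra u v) r) else \<zero>\<^bsub>J\<^esub>)" for m n
    using uv base *
    by (cases "m = 0"; cases "n = 0")
      (simp_all add: anch_emb \<phi>_\<iota> cpoly_apply z\<phi> coeff a_minus_def)
  ultimately show ?case by (simp add: anchor_hom_def)
next
  case (add a b)
  then show ?case using uv by (intro PA.anchor_hom_add) auto
next
  case (mult a b)
  then show ?case using uv by (intro PA.anchor_hom_mult) auto
next
  case (d a)
  then show ?case using uv by (intro PA.anchor_hom_d) auto
qed

lemma emb_span:
  assumes "x \<in> carrier M0" "\<And>g. g \<in> emb ` carrier F \<Longrightarrow> Q g"
    and "\<And>x y. x \<in> carrier M0 \<Longrightarrow> y \<in> carrier M0 \<Longrightarrow> Q x \<Longrightarrow> Q y \<Longrightarrow> Q (x \<oplus>\<^bsub>M0\<^esub> y)"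
    and "\<And>x. x \<in> carrier M0 \<Longrightarrow> Q x \<Longrightarrow> Q (DE x)"
    and "\<And>a x. a \<in> carrier J \<Longrightarrow> x \<in> carrier M0 \<Longrightarrow> Q x \<Longrightarrow> Q (a \<odot>\<^bsub>M0\<^esub> x)"
  shows "Q x"
  by (rule M0_span[where Q = Q, OF assms(1) _ assms(3-5)]) (simp_all add: assms(2))

lemma emb_image: "emb ` carrier F \<subseteq> carrier M0"
  by auto

lemma jacobi:
  assumes "u \<in> carrier M0" "v \<in> carrier M0" "w \<in> carrier M0"
  shows "jac M0 cbr u v w"
proof (rule PA.jac_span[OF emb_image])
  fix Q x assume "x \<in> carrier M0" "\<And>g. g \<in> emb ` carrier F \<Longrightarrow> Q g"
    and "\<And>x y. x \<in> carrier M0 \<Longrightarrow> y \<in> carrier M0 \<Longrightarrow> Q x \<Longrightarrow> Q y \<Longrightarrow> Q (x \<oplus>\<^bsub>M0\<^esub> y)"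
    and "\<And>x. x \<in> carrier M0 \<Longrightarrow> Q x \<Longrightarrow> Q (DE x)"
    and "\<And>a x. a \<in> carrier J \<Longrightarrow> x \<in> carrier M0 \<Longrightarrow> Q x \<Longrightarrow> Q (a \<odot>\<^bsub>M0\<^esub> x)"
  then show "Q x" by (rule emb_span[where Q = Q])
qed (use assms jac_emb anchor_hom_emb in auto)

lemma anchor_bracket:
  assumes "u \<in> carrier M0" "v \<in> carrier M0" "a \<in> carrier J"
  shows "anchor_hom J cbr anch u v a"
proof (rule PA.anchor_hom_span[OF emb_image])
  fix Q x assume "x \<in> carrier M0" "\<And>g. g \<in> emb ` carrier F \<Longrightarrow> Q g"
    and "\<And>x y. x \<in> carrier M0 \<Longrightarrow> y \<in> carrier M0 \<Longrightarrow> Q x \<Longrightarrow> Q y \<Longrightarrow> Q (x \<oplus>\<^bsub>M0\<^esub> y)"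
    and "\<And>x. x \<in> carrier M0 \<Longrightarrow> Q x \<Longrightarrow> Q (DE x)"
    and "\<And>a x. a \<in> carrier J \<Longrightarrow> x \<in> carrier M0 \<Longrightarrow> Q x \<Longrightarrow> Q (a \<odot>\<^bsub>M0\<^esub> x)"
  then show "Q x" by (rule emb_span[where Q = Q])
qed (use assms anchor_hom_emb in auto)

subsection \<open>The current Lie conformal algebroid in terms of the definitions\<close>

abbreviation "E \<equiv> current_module R F J d \<iota>"

lemma E_simps [simp]:
  "carrier E = carrier M0" "zero E = zero M0" "add E = add M0"
  "finsum E = finsum M0" "a_inv E = a_inv M0" "a_minus E = a_minus M0" "supp E = supp M0" "cpoly E = cpoly M0"
  "polysum E = polysum M0" "subst_xy E = subst_xy M0"
  by (simp_all add: M0_def)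

lemma over_E [simp]: "over_A J E = M0" "smult E (del_op J) = DE"
  by (simp_all add: M0_def DE_def)

lemma current_emb_eq: "current_emb R F J d \<iota> u = emb u"
  by (simp add: current_emb_def ten_def)

lemma ten_eq_smult: "P \<in> carrier (pmod J) \<Longrightarrow> u \<in> carrier F \<Longrightarrow> ten P u = P \<odot>\<^bsub>E\<^esub> emb u"
  by (simp add: current_smult ten_emb[of P u])

lemma anch_module_hom: "cder_module_hom K J d E anch"
  unfolding cder_module_hom_def
  by (auto simp: anch_CDer anch_add_l coeff current_smult anch_act cder_smult_eq)

lemma current_anchor: "is_current_anchor K R F th J d \<iota> anch"
  unfolding is_current_anchor_def by (simp add: anch_module_hom current_emb_eq anch_emb)

lemma current_anchor_unique:
  assumes \<theta>: "is_current_anchor K R F th J d \<iota> \<theta>" and x: "x \<in> carrier E" and a: "a \<in> carrier J"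
  shows "\<theta> x a = anch x a"
proof -
  have 1: "\<theta> (P \<odot>\<^bsub>E\<^esub> y) a = cder_smult J d P (\<theta> y) a" if "P \<in> carrier (pmod J)" "y \<in> carrier M0" for P y
    using \<theta> that a by (simp add: is_current_anchor_def cder_module_hom_def)
  have 2: "\<theta> (y \<oplus>\<^bsub>M0\<^esub> z) a n = \<theta> y a n \<oplus>\<^bsub>J\<^esub> \<theta> z a n" if "y \<in> carrier M0" "z \<in> carrier M0" for y z n
    using \<theta> that a by (simp add: is_current_anchor_def cder_module_hom_def)
  have 3: "\<theta> (emb u) a = \<phi> u a" if "u \<in> carrier F" for u
    using \<theta> that a by (simp add: is_current_anchor_def current_emb_eq)
  from x have "x \<in> carrier M0" by simp
  then show ?thesis
  proof (induction x rule: M0_induct)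
    case (ten P u)
    then have "\<theta> (ten P u) a = cder_smult J d P (\<theta> (emb u)) a" by (simp add: ten_eq_smult[of P u] 1)
    also have "\<dots> = act1J P (\<theta> (emb u) a)" using ten a by (intro cder_smult_eq) (simp_all add: 3)
    finally show ?case using ten a by (simp add: 3 anch_ten)
  next
    case (add y z)
    then show ?case using a by (intro ext) (simp add: 2 anch_add_l coeff)
  qed
qed

abbreviation "\<kappa> c \<equiv> c \<odot>\<^bsub>J\<^esub> \<one>\<^bsub>J\<^esub>"

text \<open>By linearity the value is c times the value at 1, which is zero. From this the bracket,
  built from additive maps, is seen to be bilinear over the ground field.\<close>

lemma anch_const: "c \<in> carrier K \<Longrightarrow> x \<in> carrier M0 \<Longrightarrow> anch x (\<kappa> c) = \<zero>\<^bsub>pmod J\<^esub>"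
  using anch_CDer[of x] cder_one[OF anch_cder[of x]]
  by (auto simp: CDer_iff coeff intro!: ext)

lemma cbr_const_r:
  assumes "c \<in> carrier K" "x \<in> carrier M0" "y \<in> carrier M0"
  shows "cbr x (\<kappa> c \<odot>\<^bsub>M0\<^esub> y) = \<kappa> c \<odot>\<^bsub>pmod M0\<^esub> cbr x y"
proof -
  have "pairm M0 \<zero>\<^bsub>pmod J\<^esub> y = \<zero>\<^bsub>pmod M0\<^esub>"
    by (rule ahom_zero[OF P.abelian_group_axioms EM.P.abelian_group_axioms EM.pairm_ahom_l[OF assms(3)]])
  moreover have "\<kappa> c \<odot>\<^bsub>pmod M0\<^esub> cbr x y \<in> carrier (pmod M0)"
    using assms EM.act2_closed[of "cpoly J (\<kappa> c)" "cbr x y"] by (simp add: EM.act2_cpoly)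
  ultimately show ?thesis using assms by (simp add: PA.br_smult_r anch_const EM.P.r_zero)
qed

text \<open>Constants commute with \<partial>, hence with the substitution in the skew-symmetry
  rule.\<close>

lemma cbr_const_l:
  assumes "c \<in> carrier K" "x \<in> carrier M0" "y \<in> carrier M0"
  shows "cbr (\<kappa> c \<odot>\<^bsub>M0\<^esub> x) y = \<kappa> c \<odot>\<^bsub>pmod M0\<^esub> cbr x y"
proof -
  let ?f = "\<lambda>z. \<kappa> c \<odot>\<^bsub>M0\<^esub> z"
  have f: "?f \<in> ahom M0 M0"
    by (rule ahomI) (use assms in \<open>simp_all add: EM.V.smult_r_distr\<close>)
  have p: "\<kappa> c \<odot>\<^bsub>pmod M0\<^esub> q = pmap ?f q" for q by (rule ext) (simp add: coeff)
  note fp = pmap_ahom[OF EM.abelian_group_axioms EM.abelian_group_axioms f]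
  have fl: "fl (pmap ?f q) = pmap ?f (fl q)" if "q \<in> carrier (pmod M0)" for q
    by (rule flip_hom[OF EM.del_group_axioms EM.del_group_axioms f])
      (use assms that in \<open>simp_all add: EM.D_smult\<close>)
  have "cbr (?f x) y = \<ominus>\<^bsub>pmod M0\<^esub> pmap ?f (fl (cbr y x))"
    using assms cbr_skew[of y "?f x"] by (simp add: cbr_const_r p fl)
  also have "\<dots> = pmap ?f (cbr x y)"
    using assms cbr_skew[of y x] ahom_minus[OF EM.P.abelian_group_axioms EM.P.abelian_group_axioms fp, of "fl (cbr y x)"] by simp
  finally show ?thesis by (simp add: p)
qed

lemma cbr_bilinear: "bilinear_lambda_bracket K (over_K J M0) cbr"
  unfolding bilinear_lambda_bracket_def
  by (auto simp: up_eq[of M0] cbr_add_l cbr_add_r cbr_const_l cbr_const_r coeff)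

lemma total_term1_eq:
  assumes "P \<in> carrier (pmod J)" "Q \<in> carrier (pmod J)" "w \<in> carrier (pmod M0)"
  shows "total_term1 J d E P Q w = a2 Q (a1 P w)"
proof -
  have "total_term1 J d E P Q w = a2 Q (conv J d M0 (adjoint_symbol J d P) w)"
    unfolding total_term1_def E_simps over_E by (rule EM.term1_eq) (use assms in \<open>simp_all add: adjoint_symbol_eq\<close>)
  then show ?thesis using assms by (simp add: adjoint_symbol_eq EM.conv_flip)
qed

lemma total_term2_eq:
  assumes "P \<in> carrier (pmod J)" "Q \<in> carrier (pmod J)" "\<psi> \<in> ahom J (pmod J)" "v \<in> carrier M0"
  shows "total_term2 J d E P Q \<psi> v = a1 P (da \<psi> Q v)"
proof -
  have "total_term2 J d E P Q \<psi> v = conv J d M0 (adjoint_symbol J d P) (da \<psi> Q v)"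
    unfolding total_term2_def E_simps over_E by (rule EM.term2_eq) (use assms in \<open>simp_all add: adjoint_symbol_eq\<close>)
  then show ?thesis using assms by (simp add: adjoint_symbol_eq EM.conv_flip EM.dact_closed)
qed

lemma total_term3_eq:
  assumes "P \<in> carrier (pmod J)" "Q \<in> carrier (pmod J)" "\<psi> \<in> ahom J (pmod J)" "u \<in> carrier M0"
  shows "total_term3 J d E P Q (cder_adjoint J d \<psi>) u = a2 Q (fl (da \<psi> P u))"
  unfolding total_term3_def E_simps over_E
  by (rule EM.term3_eq) (use assms in \<open>simp_all add: cder_adjoint_eq ahom_closed[of \<psi> J "pmod J"]\<close>)

lemma total_formula_eq:
  assumes "x \<in> carrier M0" "y \<in> carrier M0" "P \<in> carrier (pmod J)" "Q \<in> carrier (pmod J)" "w \<in> carrier (pmod M0)"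
  shows "total_term1 J d E P Q w k \<oplus>\<^bsub>M0\<^esub> total_term2 J d E P Q (anch x) y k \<ominus>\<^bsub>M0\<^esub>
           total_term3 J d E P Q (cder_adjoint J d (anch y)) x k =
     (a2 Q (a1 P w) \<oplus>\<^bsub>pmod M0\<^esub> a1 P (da (anch x) Q y) \<ominus>\<^bsub>pmod M0\<^esub> a2 Q (fl (da (anch y) P x))) k"
  using assms by (simp add: total_term1_eq total_term2_eq total_term3_eq anch_ahom coeff)

lemma current_bracket: "is_current_bracket K R F bra J d \<iota> anch cbr"
  unfolding is_current_bracket_def Let_def
  by (auto simp: cbr_bilinear current_emb_eq cbr_emb total_formula_eq current_smult total_formula)

text \<open>Pure tensors are operators applied to elements of F, so the total formula reduces their
  bracket to the prescribed one; biadditivity does the rest.\<close>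

lemma current_bracket_unique:
  assumes br: "is_current_bracket K R F bra J d \<iota> anch br" and x: "x \<in> carrier E" and y: "y \<in> carrier E"
  shows "br x y = cbr x y"
proof -
  have 1: "br (y \<oplus>\<^bsub>M0\<^esub> z) w n = br y w n \<oplus>\<^bsub>M0\<^esub> br z w n" "br w (y \<oplus>\<^bsub>M0\<^esub> z) n = br w y n \<oplus>\<^bsub>M0\<^esub> br w z n"
    if "y \<in> carrier M0" "z \<in> carrier M0" "w \<in> carrier M0" for y z w n
    using br that by (simp_all add: is_current_bracket_def Let_def bilinear_lambda_bracket_def)
  have 2: "br (emb u) (emb v) = cpoly M0 (emb (bra u v))" if "u \<in> carrier F" "v \<in> carrier F" for u v
    using br that by (simp add: is_current_bracket_def Let_def current_emb_eq)
  have 3: "br (P \<odot>\<^bsub>E\<^esub> y) (Q \<odot>\<^bsub>E\<^esub> z) k = total_term1 J d E P Q (br y z) k \<oplus>\<^bsub>M0\<^esub> total_term2 J d E P Q (anch y) z k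
          \<ominus>\<^bsub>M0\<^esub> total_term3 J d E P Q (cder_adjoint J d (anch z)) y k"
    if "P \<in> carrier (pmod J)" "Q \<in> carrier (pmod J)" "y \<in> carrier M0" "z \<in> carrier M0" for P Q y z k
    using br that by (simp add: is_current_bracket_def Let_def)
  from x y have "x \<in> carrier M0" "y \<in> carrier M0" by simp_all
  then show ?thesis
  proof (induction x rule: M0_induct)
    case (ten P u)
    note PU = ten(1,2)
    from ten(3) show ?case
    proof (induction y rule: M0_induct)
      case (ten Q v)
      have "br (P \<odot>\<^bsub>E\<^esub> emb u) (Q \<odot>\<^bsub>E\<^esub> emb v) k = cbr (P \<odot>\<^bsub>E\<^esub> emb u) (Q \<odot>\<^bsub>E\<^esub> emb v) k" for k
        using PU ten by (simp add: 3 2 cbr_emb[symmetric] total_formula_eq) (simp add: current_smult total_formula)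
      then show ?case using PU ten by (intro ext) (simp add: ten_eq_smult[of P u] ten_eq_smult[of Q v])
    next
      case (add y z)
      then show ?case using PU by (intro ext) (simp add: 1 cbr_add_r coeff)
    qed
  next
    case (add x z)
    then show ?case by (intro ext) (simp add: 1 cbr_add_l coeff)
  qed
qed

lemma current_lca: "lie_conformal_algebra K (over_K J M0) DE cbr"
  unfolding lie_conformal_algebra_def
proof (intro conjI ballI allI)
  show "module K (over_K J M0)"
    by (rule module_over_K[OF JJ.algebra_axioms EM.V.module_axioms])
  show "bilinear_lambda_bracket K (over_K J M0) cbr" by (rule cbr_bilinear)
  show "DE (c \<odot>\<^bsub>over_K J M0\<^esub> x) = c \<odot>\<^bsub>over_K J M0\<^esub> DE x" if "c \<in> carrier K" "x \<in> carrier (over_K J M0)" for c x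
    using that by (simp add: EM.D_smult)
  fix x y n assume xy: "x \<in> carrier (over_K J M0)" "y \<in> carrier (over_K J M0)"
  show "DE (x \<oplus>\<^bsub>over_K J M0\<^esub> y) = DE x \<oplus>\<^bsub>over_K J M0\<^esub> DE y"
    using xy by (simp add: EM.D_add)
  show "cbr (DE x) y n = (if n = 0 then \<zero>\<^bsub>over_K J M0\<^esub> else \<ominus>\<^bsub>over_K J M0\<^esub> cbr x y (n - 1))"
    using xy by (cases n) (simp_all add: PA.br_D_l coeff EM.a_inv_zero)
  show "cbr x (DE y) n = DE (cbr x y n) \<oplus>\<^bsub>over_K J M0\<^esub> (if n = 0 then \<zero>\<^bsub>over_K J M0\<^esub> else cbr x y (n - 1))"
    using xy by (simp add: PA.br_D_r ldel_def) (simp add: coeff lshift_def EM.a_comm)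
  show "cbr y x n = \<ominus>\<^bsub>over_K J M0\<^esub> polysum (over_K J M0) (supp (over_K J M0) (cbr x y)) (\<lambda>n. subst_xy (over_K J M0) ((- lam - xv) ^ n)
                       (\<lambda>q r. cpoly (over_K J M0) ((DE ^^ q) (cbr x y n)))) n"
    using xy cbr_skew[of x y] by (simp add: EM.flip_eq_polysum) (simp add: coeff)
next
  fix u v w m n assume "u \<in> carrier (over_K J M0)" "v \<in> carrier (over_K J M0)" "w \<in> carrier (over_K J M0)"
  then show "cbr u (cbr v w n) m \<ominus>\<^bsub>over_K J M0\<^esub> cbr v (cbr u w m) n =
        (\<Oplus>\<^bsub>over_K J M0\<^esub>i\<in>{..m}. add_pow (over_K J M0) ((m + n - i) choose n) (cbr (cbr u v i) w (m + n - i)))"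
    using jacobi[of u v w] by (simp add: jac_def umap_def)
qed simp

lemma current_lcad: "lie_conformal_algebroid K J d E cbr anch"
  unfolding lie_conformal_algebroid_def over_E
proof (intro conjI ballI allI)
  show "left_module (diffop_ring J d) E" unfolding current_module_def by (rule T.left_module_T)
  fix u v assume "u \<in> carrier E" "v \<in> carrier E"
  then have uv: "u \<in> carrier M0" "v \<in> carrier M0" by simp_all
  fix P k assume "P \<in> carrier (diffop_ring J d)"
  then have P: "P \<in> carrier (pmod J)" by simp
  have "cbr u (P \<odot>\<^bsub>E\<^esub> v) = a2 P (cbr u v) \<oplus>\<^bsub>pmod M0\<^esub> da (anch u) P v"
    using uv P by (simp add: current_smult cbr_act_r)
  then show "cbr u (P \<odot>\<^bsub>E\<^esub> v) k =
          polysum E (supp J P) (\<lambda>i. subst_xy E ((lam + xv) ^ i) (\<lambda>q r k. P i \<odot>\<^bsub>M0\<^esub> (DE ^^ q) (cbr u v k))) k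
          \<oplus>\<^bsub>E\<^esub> polysum E (supp J P) (\<lambda>i. subst_xy E (xv ^ i) (\<lambda>q r k. anch u (P i) k \<odot>\<^bsub>M0\<^esub> (DE ^^ q) v)) k"
    unfolding E_simps using uv P
    by (simp only: EM.act2_eq_polysum[OF P cbr_closed[OF uv(2,1)]] EM.dact_eq_polysum[OF P uv(2) anch_ahom[OF uv(1)]] pmod_apply)
next
  fix u v a m n assume "u \<in> carrier E" "v \<in> carrier E" and a: "a \<in> carrier J"
  then have uv: "u \<in> carrier M0" "v \<in> carrier M0" by simp_all
  let ?Y = "\<lambda>m n. anch u (anch v a n) m \<ominus>\<^bsub>J\<^esub> anch v (anch u a m) n"
  let ?X = "\<lambda>i. anch (cbr u v i) a"
  \<comment> \<open>The compatibility in terms of \<lambda>+\<mu>; inverting that substitution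
    yields the stated form with \<mu>-\<lambda>.\<close>
  have "?Y = umap J ?X" using anchor_bracket[OF uv a] by (intro ext) (simp add: anchor_hom_def)
  then have "vmap J ?Y m n = ?X m n" using uv a by (simp add: vmap_umap)
  then show "anch (cbr u v m) a n =
        (\<Oplus>\<^bsub>J\<^esub>s\<in>{..m}. add_pow J ((- 1) ^ s * int ((n + s) choose n))
           (anch u (anch v a (n + s)) (m - s) \<ominus>\<^bsub>J\<^esub> anch v (anch u a (m - s)) (n + s)))"
    by (simp add: vmap_def)
qed (use diff_alg anch_module_hom current_lca in simp_all)

end

section \<open>The quotient Lie algebroid\<close>

text \<open>Every element of the target is an image, and all operations are computed on preimages,
  so each axiom is inherited from the source.\<close>

lemma lie_algebroid_image:
  assumes LA: "lie_algebroid K R F bra th"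
    and R': "carrier R' = f ` carrier R" "\<zero>\<^bsub>R'\<^esub> = f \<zero>\<^bsub>R\<^esub>" "\<one>\<^bsub>R'\<^esub> = f \<one>\<^bsub>R\<^esub>"
      "\<And>r s. r \<in> carrier R \<Longrightarrow> s \<in> carrier R \<Longrightarrow> f r \<oplus>\<^bsub>R'\<^esub> f s = f (r \<oplus>\<^bsub>R\<^esub> s)"
      "\<And>r s. r \<in> carrier R \<Longrightarrow> s \<in> carrier R \<Longrightarrow> f r \<otimes>\<^bsub>R'\<^esub> f s = f (r \<otimes>\<^bsub>R\<^esub> s)"
      "\<And>c r. c \<in> carrier K \<Longrightarrow> r \<in> carrier R \<Longrightarrow> c \<odot>\<^bsub>R'\<^esub> f r = f (c \<odot>\<^bsub>R\<^esub> r)"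
    and F': "carrier F' = g ` carrier F" "\<zero>\<^bsub>F'\<^esub> = g \<zero>\<^bsub>F\<^esub>"
      "\<And>u v. u \<in> carrier F \<Longrightarrow> v \<in> carrier F \<Longrightarrow> g u \<oplus>\<^bsub>F'\<^esub> g v = g (u \<oplus>\<^bsub>F\<^esub> v)"
      "\<And>r u. r \<in> carrier R \<Longrightarrow> u \<in> carrier F \<Longrightarrow> f r \<odot>\<^bsub>F'\<^esub> g u = g (r \<odot>\<^bsub>F\<^esub> u)"
    and bra': "\<And>u v. u \<in> carrier F \<Longrightarrow> v \<in> carrier F \<Longrightarrow> bra' (g u) (g v) = g (bra u v)"
    and th': "\<And>u r. u \<in> carrier F \<Longrightarrow> r \<in> carrier R \<Longrightarrow> th' (g u) (f r) = f (th u r)"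
  shows "lie_algebroid K R' F' bra' th'"
proof -
  note eqs [simp] = R' F' bra' th'
  interpret R: algebra K R using LA by (simp add: lie_algebroid_def)
  interpret F: module R F using LA by (simp add: lie_algebroid_def)
  have L: "lie_algebra K (over_K R F) bra" using LA by (simp add: lie_algebroid_def)
  note lie = L[unfolded lie_algebra_def, simplified]
  have [simp]: "bra u v \<in> carrier F" if "u \<in> carrier F" "v \<in> carrier F" for u v
    using lie that by simp
  have th: "th u \<in> Der K R" if "u \<in> carrier F" for u
    using LA that by (simp add: lie_algebroid_def)
  have [simp]: "th u r \<in> carrier R" if "u \<in> carrier F" "r \<in> carrier R" for u r
    using th[OF that(1)] that(2) by (auto simp: Der_def)
  have aR: "abelian_group R'"
  proof (rule abelian_groupI)
    fix x assume "x \<in> carrier R'"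
    then obtain r where "r \<in> carrier R" "x = f r" by auto
    then show "\<exists>y\<in>carrier R'. y \<oplus>\<^bsub>R'\<^esub> x = \<zero>\<^bsub>R'\<^esub>"
      by (intro bexI[of _ "f (\<ominus>\<^bsub>R\<^esub> r)"]) (auto simp: R.l_neg)
  qed (auto simp: R.a_ac)
  have aF: "abelian_group F'"
  proof (rule abelian_groupI)
    fix x assume "x \<in> carrier F'"
    then obtain u where "u \<in> carrier F" "x = g u" by auto
    then show "\<exists>y\<in>carrier F'. y \<oplus>\<^bsub>F'\<^esub> x = \<zero>\<^bsub>F'\<^esub>"
      by (intro bexI[of _ "g (\<ominus>\<^bsub>F\<^esub> u)"]) (auto simp: F.M.l_neg)
  qed (auto simp: F.M.a_ac)
  have cR: "cring R'"
  proof (rule cringI[OF aR])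
    show "comm_monoid R'"
      by (rule comm_monoidI) (auto simp: R.m_ac)
  qed (auto simp: R.l_distr)
  have alg: "algebra K R'"
    by (rule algebraI[OF R.R.is_cring cR])
      (auto simp: R.smult_l_distr R.smult_r_distr R.smult_assoc1 R.smult_assoc2)
  have mod: "module R' F'"
    by (rule moduleI[OF cR aF]) (auto simp: F.smult_l_distr F.smult_r_distr F.smult_assoc1)
  have fh: "f \<in> ahom R R'" by (rule ahomI) auto
  have diff: "f r \<ominus>\<^bsub>R'\<^esub> f s = f (r \<ominus>\<^bsub>R\<^esub> s)" if "r \<in> carrier R" "s \<in> carrier R" for r s
    by (rule ahom_diff[OF R.M.abelian_group_axioms aR fh that, symmetric])
  have "lie_algebra K (over_K R' F') bra'"
    unfolding lie_algebra_def using module_over_K[OF alg mod] lie by auto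
  moreover have "th' x \<in> Der K R'" if "x \<in> carrier F'" for x
    using that th by (auto simp: Der_def)
  ultimately show ?thesis
    using alg mod LA unfolding lie_algebroid_def by (auto simp: diff)
qed

text \<open>The map \<open>s\<close> is a section of sets; it shows that every fibre over H has an
  element.\<close>

locale split_surjection = G: abelian_group G + H: abelian_group H
  for G :: "('a, 'm) ring_scheme" and H :: "('b, 'n) ring_scheme" +
  fixes e :: "'a \<Rightarrow> 'b" and s :: "'b \<Rightarrow> 'a"
  assumes e: "e \<in> ahom G H" and s [simp]: "y \<in> carrier H \<Longrightarrow> s y \<in> carrier G"
    and e_s [simp]: "y \<in> carrier H \<Longrightarrow> e (s y) = y"
begin

lemmas e_closed [simp] = ahom_closed[OF e]
lemmas e_add = ahom_add[OF e]
lemmas e_minus = ahom_minus[OF G.abelian_group_axioms H.abelian_group_axioms e]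

definition fibre :: "'b \<Rightarrow> 'a set" where
  "fibre y = {x \<in> carrier G. e x = y}"

lemma coset_kernel:
  assumes "x \<in> carrier G"
  shows "fibre \<zero>\<^bsub>H\<^esub> +>\<^bsub>G\<^esub> x = fibre (e x)"
proof
  show "fibre \<zero>\<^bsub>H\<^esub> +>\<^bsub>G\<^esub> x \<subseteq> fibre (e x)"
    using assms by (auto simp: a_r_coset_def' fibre_def e_add)
  show "fibre (e x) \<subseteq> fibre \<zero>\<^bsub>H\<^esub> +>\<^bsub>G\<^esub> x"
  proof
    fix z assume "z \<in> fibre (e x)"
    then have "z \<ominus>\<^bsub>G\<^esub> x \<in> fibre \<zero>\<^bsub>H\<^esub>" "z = (z \<ominus>\<^bsub>G\<^esub> x) \<oplus>\<^bsub>G\<^esub> x"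
      using assms by (auto simp: fibre_def a_minus_def e_add e_minus H.r_neg G.a_assoc G.l_neg)
    then show "z \<in> fibre \<zero>\<^bsub>H\<^esub> +>\<^bsub>G\<^esub> x" unfolding a_r_coset_def' by blast
  qed
qed

lemma rcosets_kernel: "a_rcosets\<^bsub>G\<^esub> fibre \<zero>\<^bsub>H\<^esub> = fibre ` carrier H"
proof -
  have "a_rcosets\<^bsub>G\<^esub> fibre \<zero>\<^bsub>H\<^esub> = (\<lambda>x. fibre (e x)) ` carrier G"
    unfolding A_RCOSETS_def' using coset_kernel by auto
  also have "\<dots> = fibre ` carrier H"
  proof -
    have "y \<in> e ` carrier G" if "y \<in> carrier H" for y
      using that by (intro image_eqI[of y e "s y"]) simp_all
    then have "e ` carrier G = carrier H" by auto
    then show ?thesis by (simp flip: image_image[of fibre e])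
  qed
  finally show ?thesis .
qed

lemma fibre_add:
  assumes "y \<in> carrier H" "z \<in> carrier H"
  shows "fibre y <+>\<^bsub>G\<^esub> fibre z = fibre (y \<oplus>\<^bsub>H\<^esub> z)"
proof
  show "fibre y <+>\<^bsub>G\<^esub> fibre z \<subseteq> fibre (y \<oplus>\<^bsub>H\<^esub> z)"
    by (auto simp: set_add_def' fibre_def e_add)
  show "fibre (y \<oplus>\<^bsub>H\<^esub> z) \<subseteq> fibre y <+>\<^bsub>G\<^esub> fibre z"
  proof
    fix x assume x: "x \<in> fibre (y \<oplus>\<^bsub>H\<^esub> z)"
    then have "s y \<in> fibre y" "\<ominus>\<^bsub>G\<^esub> s y \<oplus>\<^bsub>G\<^esub> x \<in> fibre z" "x = s y \<oplus>\<^bsub>G\<^esub> (\<ominus>\<^bsub>G\<^esub> s y \<oplus>\<^bsub>G\<^esub> x)"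
      using assms by (auto simp: fibre_def e_add e_minus H.r_neg1 H.r_neg2 G.r_neg1 G.r_neg2)
    then show "x \<in> fibre y <+>\<^bsub>G\<^esub> fibre z" unfolding set_add_def' by blast
  qed
qed

lemma inj_fibre: "inj_on fibre (carrier H)"
proof (rule inj_onI)
  fix y z assume y: "y \<in> carrier H" and eq: "fibre y = fibre z"
  have "s y \<in> fibre y" using y by (simp add: fibre_def)
  then have "s y \<in> fibre z" by (simp only: eq)
  then show "y = z" using y by (simp add: fibre_def)
qed

text \<open>Evaluates the operations on cosets: the union over all representatives of a set
  independent of the representative.\<close>

lemma UN_fibre:
  assumes "y \<in> carrier H" "\<And>x. x \<in> fibre y \<Longrightarrow> B x = C"
  shows "(\<Union>x\<in>fibre y. B x) = C"
proof -
  have "s y \<in> fibre y" using assms(1) by (simp add: fibre_def)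
  then show ?thesis using assms(2) by auto
qed

end

text \<open>\<open>ret\<close> is the identity on \<open>R\<close> and kills \<open>\<partial>\<close>, and \<open>eps\<close> maps \<open>a(\<partial>) \<otimes> u\<close> to \<open>ret(a\<^sub>0) u\<close>. Their kernels
  are the two submodules that are divided out, so that the cosets are their fibres.\<close>

context current
begin

section \<open>Reduction modulo \<partial> at \<lambda> = 0\<close>

definition ret :: "'j \<Rightarrow> 'r" where
  "ret = (SOME h. h \<in> ahom J R \<and> (\<forall>a\<in>carrier J. \<forall>b\<in>carrier J. h (a \<otimes>\<^bsub>J\<^esub> b) = h a \<otimes>\<^bsub>R\<^esub> h b) \<and>
     (\<forall>r\<in>carrier R. h (\<iota> r) = r) \<and> (\<forall>a\<in>carrier J. h (d a) = \<zero>\<^bsub>R\<^esub>))"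

lemma ret: "ret \<in> ahom J R \<and> (\<forall>a\<in>carrier J. \<forall>b\<in>carrier J. ret (a \<otimes>\<^bsub>J\<^esub> b) = ret a \<otimes>\<^bsub>R\<^esub> ret b) \<and>
     (\<forall>r\<in>carrier R. ret (\<iota> r) = r) \<and> (\<forall>a\<in>carrier J. ret (d a) = \<zero>\<^bsub>R\<^esub>)"
proof (rule obtain_retraction)
  fix h assume "h \<in> ahom J R" "\<And>a b. a \<in> carrier J \<Longrightarrow> b \<in> carrier J \<Longrightarrow> h (a \<otimes>\<^bsub>J\<^esub> b) = h a \<otimes>\<^bsub>R\<^esub> h b"
    "\<And>r. r \<in> carrier R \<Longrightarrow> h (\<iota> r) = r" "\<And>a. a \<in> carrier J \<Longrightarrow> h (d a) = \<zero>\<^bsub>R\<^esub>"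
  then have "\<exists>h. h \<in> ahom J R \<and> (\<forall>a\<in>carrier J. \<forall>b\<in>carrier J. h (a \<otimes>\<^bsub>J\<^esub> b) = h a \<otimes>\<^bsub>R\<^esub> h b) \<and>
     (\<forall>r\<in>carrier R. h (\<iota> r) = r) \<and> (\<forall>a\<in>carrier J. h (d a) = \<zero>\<^bsub>R\<^esub>)" by blast
  from someI_ex[OF this] show ?thesis unfolding ret_def .
qed

lemma ret_ahom: "ret \<in> ahom J R"
  and ret_mult [simp]: "a \<in> carrier J \<Longrightarrow> b \<in> carrier J \<Longrightarrow> ret (a \<otimes>\<^bsub>J\<^esub> b) = ret a \<otimes>\<^bsub>R\<^esub> ret b"
  and ret_\<iota> [simp]: "r \<in> carrier R \<Longrightarrow> ret (\<iota> r) = r"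
  and ret_d [simp]: "a \<in> carrier J \<Longrightarrow> ret (d a) = \<zero>\<^bsub>R\<^esub>"
  using ret by auto

lemmas ret_closed [simp] = ahom_closed[OF ret_ahom]
lemmas ret_add [simp] = ahom_add[OF ret_ahom]
lemmas ret_zero [simp] = ahom_zero[OF abelian_group_axioms RR.M.abelian_group_axioms ret_ahom]
lemmas ret_minus = ahom_minus[OF abelian_group_axioms RR.M.abelian_group_axioms ret_ahom]

lemma ret_ldel: "f \<in> carrier (pmod J) \<Longrightarrow> ret (ldel J d f 0) = \<zero>\<^bsub>R\<^esub>"
  by (simp add: ldel_def coeff)

text \<open>A factor \<partial> at the end of P acts on Q as \<lambda>+\<partial>, whose constant
  coefficient is a derivative and is killed. The special case of a function on the right is the
  balancing condition for \<open>eps\<close>.\<close>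

lemma ret_opmul:
  assumes "P \<in> carrier (pmod J)" "Q \<in> carrier (pmod J)"
  shows "ret (opmul J d P Q 0) = ret (P 0) \<otimes>\<^bsub>R\<^esub> ret (Q 0)"
  using assms
proof (induction P arbitrary: Q rule: pmod_induct)
  case (const a)
  then show ?case by (simp add: opmul_cpoly) (simp add: coeff)
next
  case (shift P)
  then show ?case by (simp add: opmul_lshift ret_ldel)
next
  case (add P P')
  then show ?case by (simp add: opmul_add_l) (simp add: coeff RR.l_distr)
qed

interpretation S: diff_module J d "selfm J" d by (rule diff_module_self)

lemma ret_conv:
  assumes "f \<in> carrier (pmod J)" "g \<in> carrier (pmod J)"
  shows "ret (conv J d (selfm J) g f 0) = ret (g 0) \<otimes>\<^bsub>R\<^esub> ret (f 0)"
  using assms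
proof (induction f arbitrary: g rule: pmod_induct)
  case (const a)
  then show ?case using S.conv_cpoly[of g a] by (simp add: pairm_def)
next
  case (shift f)
  then show ?case using S.conv_lshift[of g f] by (simp add: ret_ldel)
next
  case (add f f')
  then show ?case using S.conv_add_r[of g f f'] S.conv_closed[of g f] S.conv_closed[of g f']
    by simp (simp add: coeff RR.r_distr)
qed

lemma ret_act1:
  assumes "P \<in> carrier (pmod J)" "f \<in> carrier (pmod J)"
  shows "ret (act1J P f 0) = ret (P 0) \<otimes>\<^bsub>R\<^esub> ret (f 0)"
  using assms
proof (induction P arbitrary: f rule: pmod_induct)
  case (const a)
  then show ?case by (simp add: act1J_cpoly ret_conv)
next
  case (shift P)
  have "del1 (selfm J) f \<in> carrier (pmod J)" "ret (del1 (selfm J) f 0) = \<zero>\<^bsub>R\<^esub>"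
    using shift(3) by (simp_all add: del1_def) (simp add: coeff a_inv_zero)
  then show ?case using shift S.act1_lshift[of P f] by simp
next
  case (add P P')
  then show ?case by (simp add: act1J_add_l) (simp add: coeff RR.l_distr)
qed

lemma th_add_r: "u \<in> carrier F \<Longrightarrow> r \<in> carrier R \<Longrightarrow> s \<in> carrier R \<Longrightarrow> th u (r \<oplus>\<^bsub>R\<^esub> s) = th u r \<oplus>\<^bsub>R\<^esub> th u s"
  and th_mult: "u \<in> carrier F \<Longrightarrow> r \<in> carrier R \<Longrightarrow> s \<in> carrier R \<Longrightarrow>
    th u (r \<otimes>\<^bsub>R\<^esub> s) = th u r \<otimes>\<^bsub>R\<^esub> s \<oplus>\<^bsub>R\<^esub> r \<otimes>\<^bsub>R\<^esub> th u s"
  using th_Der[of u] by (simp_all add: Der_def)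

lemma th_zero: "u \<in> carrier F \<Longrightarrow> th u \<zero>\<^bsub>R\<^esub> = \<zero>\<^bsub>R\<^esub>"
  by (rule ahom_zero[OF RR.M.abelian_group_axioms RR.M.abelian_group_axioms]) (auto intro: ahomI simp: th_add_r)

text \<open>Both sides are derivations over the retraction, agree on R and vanish on
  derivatives.\<close>

lemma ret_\<phi>:
  assumes u: "u \<in> carrier F" and a: "a \<in> carrier J"
  shows "ret (\<phi> u a 0) = th u (ret a)"
  using a
proof (induction a rule: jet_induct)
  case (base r)
  then show ?case using u by (simp add: \<phi>_\<iota>)
next
  case (add a b)
  then show ?case using u by (simp add: ahom_add[OF \<phi>_ahom[OF u]] coeff th_add_r)
next
  case (mult a b)
  have "\<phi> u (a \<otimes>\<^bsub>J\<^esub> b) = b \<odot>\<^bsub>pmod (selfm J)\<^esub> \<phi> u a \<oplus>\<^bsub>pmod J\<^esub> a \<odot>\<^bsub>pmod (selfm J)\<^esub> \<phi> u b"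
    using \<phi>_cder[OF u] mult unfolding cder_def by blast
  then show ?case using u mult by (simp add: coeff th_mult RR.m_comm)
next
  case (d a)
  then show ?case using u \<phi>_cder[OF u] by (simp add: cder_def ret_ldel th_zero)
qed

definition eps :: "((nat \<Rightarrow> 'j) \<times> 'f \<Rightarrow>\<^sub>0 int) set \<Rightarrow> 'f" where
  "eps = (SOME h. h \<in> ahom M0 F \<and> (\<forall>P\<in>carrier (pmod J). \<forall>u\<in>carrier F. h (ten P u) = ret (P 0) \<odot>\<^bsub>F\<^esub> u))"

lemma eps: "eps \<in> ahom M0 F \<and> (\<forall>P\<in>carrier (pmod J). \<forall>u\<in>carrier F. eps (ten P u) = ret (P 0) \<odot>\<^bsub>F\<^esub> u)"
proof -
  have "\<exists>h. h \<in> ahom M0 F \<and> (\<forall>P\<in>carrier (pmod J). \<forall>u\<in>carrier F. h (ten P u) = ret (P 0) \<odot>\<^bsub>F\<^esub> u)"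
    by (rule M0_universal)
      (auto intro!: ahomI FF.M.abelian_group_axioms simp: coeff FF.smult_l_distr FF.smult_r_distr ret_opmul FF.smult_assoc1)
  from someI_ex[OF this] show ?thesis unfolding eps_def .
qed

lemma eps_ahom: "eps \<in> ahom M0 F"
  and eps_ten: "P \<in> carrier (pmod J) \<Longrightarrow> u \<in> carrier F \<Longrightarrow> eps (ten P u) = ret (P 0) \<odot>\<^bsub>F\<^esub> u"
  using eps by auto

lemmas eps_closed [simp] = ahom_closed[OF eps_ahom]
lemmas eps_add [simp] = ahom_add[OF eps_ahom]
lemmas eps_zero [simp] = ahom_zero[OF EM.abelian_group_axioms FF.M.abelian_group_axioms eps_ahom]
lemmas eps_minus = ahom_minus[OF EM.abelian_group_axioms FF.M.abelian_group_axioms eps_ahom]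

lemma ret_one: "ret \<one>\<^bsub>J\<^esub> = \<one>\<^bsub>R\<^esub>"
  using ret_\<iota>[of "\<one>\<^bsub>R\<^esub>"] by (simp add: \<iota>_one)

lemma eps_emb [simp]: "u \<in> carrier F \<Longrightarrow> eps (emb u) = u"
  by (simp add: eps_ten ret_one)

lemma eps_act:
  assumes "x \<in> carrier M0" "P \<in> carrier (pmod J)"
  shows "eps (act J M0 DE P x) = ret (P 0) \<odot>\<^bsub>F\<^esub> eps x"
  using assms(1)
proof (induction x rule: M0_induct)
  case (ten Q u)
  then show ?case using assms by (simp add: act_ten eps_ten ret_opmul FF.smult_assoc1)
next
  case (add x y)
  then show ?case using assms by (simp add: EM.act_add_r FF.smult_r_distr)
qed

lemma eps_smult [simp]: "a \<in> carrier J \<Longrightarrow> x \<in> carrier M0 \<Longrightarrow> eps (a \<odot>\<^bsub>M0\<^esub> x) = ret a \<odot>\<^bsub>F\<^esub> eps x"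
  using eps_act[of x "cpoly J a"] by simp

lemma eps_DE [simp]: "x \<in> carrier M0 \<Longrightarrow> eps (DE x) = \<zero>\<^bsub>F\<^esub>"
  using eps_act[of x "del_op J"] by (simp add: EM.act_del_op) (simp add: EM.del_op_eq)

lemma eps_ldel: "p \<in> carrier (pmod M0) \<Longrightarrow> eps (ldel M0 DE p 0) = \<zero>\<^bsub>F\<^esub>"
  by (simp add: ldel_def coeff)

lemma ret_anch:
  assumes x: "x \<in> carrier M0" and a: "a \<in> carrier J"
  shows "ret (anch x a 0) = th (eps x) (ret a)"
  using x
proof (induction x rule: M0_induct)
  case (ten P u)
  then show ?case using a by (simp add: anch_ten ret_act1 eps_ten ret_\<phi> th_smult)
next
  case (add x y)
  then show ?case using a by (simp add: anch_add_l coeff th_add)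
qed

lemma eps_act2:
  assumes "Q \<in> carrier (pmod J)" "p \<in> carrier (pmod M0)"
  shows "eps (a2 Q p 0) = ret (Q 0) \<odot>\<^bsub>F\<^esub> eps (p 0)"
  using assms
proof (induction Q arbitrary: p rule: pmod_induct)
  case (const a)
  then show ?case by (simp add: EM.act2_cpoly coeff)
next
  case (shift P)
  then show ?case by (simp add: EM.act2_lshift eps_ldel)
next
  case (add P P')
  then show ?case by (simp add: EM.act2_add_l) (simp add: coeff FF.smult_l_distr)
qed

text \<open>Modulo \<partial> and at \<lambda> = 0 every positive power of -\<lambda>-\<partial>
  vanishes.\<close>

lemma eps_flip: "p \<in> carrier (pmod M0) \<Longrightarrow> eps (fl p 0) = eps (p 0)"
proof (induction p rule: EM.pmod_induct)
  case (shift p)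
  then show ?case by (simp add: EM.flip_lshift coeff eps_minus eps_ldel FF.M.a_inv_zero)
next
  case (add p q)
  then show ?case by (simp add: EM.flip_add) (simp add: coeff)
qed simp

lemma eps_da:
  assumes "x \<in> carrier M0" "Q \<in> carrier (pmod J)" "y \<in> carrier M0"
  shows "eps (da (anch x) Q y 0) = th (eps x) (ret (Q 0)) \<odot>\<^bsub>F\<^esub> eps y"
  using assms(2,3)
proof (induction Q arbitrary: y rule: pmod_induct)
  case (const a)
  then show ?case using assms(1) by (simp add: EM.dact_cpoly anch_ahom pairm_def ret_anch)
next
  case (shift P)
  then show ?case using assms(1) by (simp add: EM.dact_lshift anch_ahom th_zero)
next
  case (add P P')
  then show ?case using assms(1)
    by (simp add: EM.dact_add_l[OF anch_ahom]) (simp add: coeff th_add_r FF.smult_l_distr)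
qed

lemma eps_cbr_act:
  assumes "x \<in> carrier M0" "Q \<in> carrier (pmod J)" "y \<in> carrier M0"
  shows "eps (cbr x (act J M0 DE Q y) 0) = ret (Q 0) \<odot>\<^bsub>F\<^esub> eps (cbr x y 0) \<oplus>\<^bsub>F\<^esub> th (eps x) (ret (Q 0)) \<odot>\<^bsub>F\<^esub> eps y"
  using assms by (simp add: cbr_act_r coeff eps_act2 eps_da)

lemma eps_cbr_skew: "x \<in> carrier M0 \<Longrightarrow> y \<in> carrier M0 \<Longrightarrow> eps (cbr y x 0) = \<ominus>\<^bsub>F\<^esub> eps (cbr x y 0)"
  by (simp add: cbr_skew[of x y] coeff eps_minus eps_flip)

text \<open>Condition (i) at \<lambda> = 0 modulo \<partial> is the Leibniz rule of F.\<close>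

lemma eps_cbr_emb:
  assumes "u \<in> carrier F" "y \<in> carrier M0"
  shows "eps (cbr (emb u) y 0) = bra u (eps y)"
  using assms(2)
proof (induction y rule: M0_induct)
  case (ten Q v)
  then show ?case using assms(1) eps_cbr_act[of "emb u" Q "emb v"]
    by (simp add: ten_emb[of Q v] cbr_emb bra_smult_r eps_act)
next
  case (add y z)
  then show ?case using assms(1) by (simp add: cbr_add_r coeff bra_add_r)
qed

text \<open>Skew-symmetry reduces the first argument to the case already treated. The right side
  depends only on the images under \<open>eps\<close>, so the bracket of cosets is well
  defined.\<close>

lemma eps_cbr:
  assumes x: "x \<in> carrier M0" and y: "y \<in> carrier M0"
  shows "eps (cbr x y 0) = bra (eps x) (eps y)"
  using x
proof (induction x rule: M0_induct)
  case (ten P u)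
  have "eps (cbr y (ten P u) 0) = bra (eps y) (ret (P 0) \<odot>\<^bsub>F\<^esub> u)"
    using ten y eps_cbr_act[of y P "emb u"] eps_cbr_skew[of "emb u" y] eps_cbr_emb[of u y] bra_anti[of u "eps y"]
    by (simp add: ten_emb[of P u] bra_smult_r)
  then show ?case using ten y eps_cbr_skew[of y "ten P u"] bra_anti[of "eps y" "ret (P 0) \<odot>\<^bsub>F\<^esub> u"]
    by (simp add: eps_ten)
next
  case (add x z)
  then show ?case using y by (simp add: cbr_add_l coeff bra_add_l)
qed

section \<open>The kernels and the quotient\<close>

lemma abelian_group_E: "abelian_group E"
  using diffop_module_E by (simp add: diffop_module_def left_module_def)

sublocale QA: split_surjection J R ret \<iota>
  by unfold_locales (simp_all add: ret_ahom)

sublocale QE: split_surjection E F eps "\<lambda>u. emb u"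
proof -
  interpret EE: abelian_group E by (rule abelian_group_E)
  have "eps \<in> ahom E F" using eps_ahom by (simp add: hom_def)
  then show "split_surjection E F eps (\<lambda>u. emb u)" by unfold_locales simp_all
qed

text \<open>The kernel of the retraction is an ideal containing all derivatives. Conversely every a
  differs from \<iota>(ret a) by an element of the ideal, by induction over the jet algebra.\<close>

lemma ideal_AdA_eq: "ideal_AdA J d = QA.fibre \<zero>\<^bsub>R\<^esub>"
proof
  have "ideal (QA.fibre \<zero>\<^bsub>R\<^esub>) J"
  proof (rule idealI[OF ring_axioms])
    show "subgroup (QA.fibre \<zero>\<^bsub>R\<^esub>) (add_monoid J)"
      by (rule subgroup.intro) (auto simp: QA.fibre_def ret_minus RR.M.a_inv_zero simp flip: a_inv_def)
  qed (auto simp: QA.fibre_def)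
  then show "ideal_AdA J d \<subseteq> QA.fibre \<zero>\<^bsub>R\<^esub>"
    unfolding ideal_AdA_def by (rule genideal_minimal) (auto simp: QA.fibre_def)
  interpret I: ideal "ideal_AdA J d" J
    unfolding ideal_AdA_def by (rule genideal_ideal) auto
  have dI: "d a \<in> ideal_AdA J d" if "a \<in> carrier J" for a
  proof -
    have "d ` carrier J \<subseteq> carrier J" by auto
    from genideal_self[OF this] show ?thesis unfolding ideal_AdA_def using that by blast
  qed
  have "a \<ominus>\<^bsub>J\<^esub> \<iota> (ret a) \<in> ideal_AdA J d" if "a \<in> carrier J" for a
    using that
  proof (induction a rule: jet_induct)
    case (base r)
    then show ?case by (simp add: a_minus_def r_neg)
  next
    case (add a b)
    then show ?case using I.a_closed[OF add(3,4)] by (simp add: \<iota>_add diff_add_diff)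
  next
    case (mult a b)
    \<comment> \<open>From ab - a'b' = a(b-b') + b'(a-a'), where primes denote the images under
      \<iota> after the retraction.\<close>
    have "a \<otimes>\<^bsub>J\<^esub> b \<ominus>\<^bsub>J\<^esub> \<iota> (ret (a \<otimes>\<^bsub>J\<^esub> b)) = a \<otimes>\<^bsub>J\<^esub> (b \<ominus>\<^bsub>J\<^esub> \<iota> (ret b)) \<oplus>\<^bsub>J\<^esub> \<iota> (ret b) \<otimes>\<^bsub>J\<^esub> (a \<ominus>\<^bsub>J\<^esub> \<iota> (ret a))"
      using mult by (simp add: \<iota>_mult a_minus_def r_distr r_minus m_comm a_assoc r_neg1)
    then show ?case using mult I.I_l_closed I.a_closed by simp
  next
    case (d a)
    then show ?case using dI by (simp add: a_minus_def a_inv_zero)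
  qed
  note * = this
  show "QA.fibre \<zero>\<^bsub>R\<^esub> \<subseteq> ideal_AdA J d"
  proof
    fix a assume "a \<in> QA.fibre \<zero>\<^bsub>R\<^esub>"
    then show "a \<in> ideal_AdA J d" using *[of a] by (simp add: QA.fibre_def a_minus_def a_inv_zero)
  qed
qed

text \<open>For the harder inclusion, a submodule H containing all \<partial> x also absorbs
  multiples by elements of the kernel of the retraction, so y and its projection to F agree modulo
  H.\<close>

lemma submodule_AdE_eq: "submodule_AdE J E = QE.fibre \<zero>\<^bsub>F\<^esub>"
proof
  have "submodule (QE.fibre \<zero>\<^bsub>F\<^esub>) J M0"
    by (rule EM.V.submoduleI) (auto simp: QE.fibre_def eps_minus FF.M.a_inv_zero)
  moreover have "DE ` carrier M0 \<subseteq> QE.fibre \<zero>\<^bsub>F\<^esub>" by (auto simp: QE.fibre_def)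
  ultimately show "submodule_AdE J E \<subseteq> QE.fibre \<zero>\<^bsub>F\<^esub>"
    unfolding submodule_AdE_def by auto
  have "x \<in> H" if x: "x \<in> carrier M0" "eps x = \<zero>\<^bsub>F\<^esub>" and H: "submodule H J M0" and D: "DE ` carrier M0 \<subseteq> H" for x H
  proof -
    note H_add = EM.V.submoduleE(5)[OF H] and H_smult = EM.V.submoduleE(4)[OF H] and H_minus = EM.V.submoduleE(3)[OF H]
    have H0: "\<zero>\<^bsub>M0\<^esub> \<in> H" using subgroup.one_closed[OF submodule.axioms(1)[OF H]] by simp
    \<comment> \<open>The scalars that carry the whole module into H. They form an ideal, and it
      contains the derivatives because (\<partial> a) x = \<partial>(a x) - a \<partial> x.\<close>
    let ?I = "{c \<in> carrier J. \<forall>x\<in>carrier M0. c \<odot>\<^bsub>M0\<^esub> x \<in> H}"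
    have "ideal ?I J"
    proof (rule idealI[OF ring_axioms])
      show "subgroup ?I (add_monoid J)"
        by (rule subgroup.intro)
          (auto simp: EM.V.smult_l_distr EM.V.smult_l_minus H_add H_minus H0 simp flip: a_inv_def)
    qed (auto simp: EM.V.smult_assoc1 H_smult)
    moreover have "d ` carrier J \<subseteq> ?I"
    proof clarsimp
      fix a x assume ax: "a \<in> carrier J" "x \<in> carrier M0"
      have "d a \<odot>\<^bsub>M0\<^esub> x = DE (a \<odot>\<^bsub>M0\<^esub> x) \<oplus>\<^bsub>M0\<^esub> (\<ominus>\<^bsub>M0\<^esub> (a \<odot>\<^bsub>M0\<^esub> DE x))"
        using ax by (simp add: EM.D_smult EM.a_assoc EM.r_neg)
      moreover have "DE (a \<odot>\<^bsub>M0\<^esub> x) \<in> H" "DE x \<in> H" using D ax by auto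
      ultimately show "d a \<odot>\<^bsub>M0\<^esub> x \<in> H" using ax by (simp add: H_add H_smult H_minus)
    qed
    ultimately have "ideal_AdA J d \<subseteq> ?I"
      unfolding ideal_AdA_def by (rule genideal_minimal)
    then have sm: "c \<odot>\<^bsub>M0\<^esub> y \<in> H" if "c \<in> carrier J" "ret c = \<zero>\<^bsub>R\<^esub>" "y \<in> carrier M0" for c y
      using that by (auto simp: ideal_AdA_eq QA.fibre_def)
    have "y \<ominus>\<^bsub>M0\<^esub> emb (eps y) \<in> H" if "y \<in> carrier M0" for y
      using that
    proof (induction y rule: M0_span[consumes 1, case_names emb add DE smult])
      case (emb u)
      then show ?case by (simp add: a_minus_def EM.r_neg H0)
    next
      case (add y z)
      then show ?case using H_add[OF add(3,4)] by (simp add: ten_add_r EM.diff_add_diff)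
    next
      case (DE y)
      then show ?case using D by (auto simp: emb_zero EM.a_inv_zero a_minus_def)
    next
      case (smult a y)
      have "a \<odot>\<^bsub>M0\<^esub> y \<ominus>\<^bsub>M0\<^esub> emb (eps (a \<odot>\<^bsub>M0\<^esub> y)) =
          a \<odot>\<^bsub>M0\<^esub> (y \<ominus>\<^bsub>M0\<^esub> emb (eps y)) \<oplus>\<^bsub>M0\<^esub> (a \<ominus>\<^bsub>J\<^esub> \<iota> (ret a)) \<odot>\<^bsub>M0\<^esub> emb (eps y)"
        using smult by (simp add: a_minus_def smult_emb EM.V.smult_l_distr EM.V.smult_r_distr EM.V.smult_l_minus
            EM.V.smult_r_minus EM.a_assoc EM.r_neg1)
      moreover have "(a \<ominus>\<^bsub>J\<^esub> \<iota> (ret a)) \<odot>\<^bsub>M0\<^esub> emb (eps y) \<in> H"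
        using smult by (intro sm) (simp_all add: a_minus_def ret_minus RR.M.r_neg)
      ultimately show ?case using smult by (simp add: H_add H_smult)
    qed
    from this[OF x(1)] show ?thesis using x by (simp add: emb_zero EM.a_inv_zero a_minus_def)
  qed
  then show "QE.fibre \<zero>\<^bsub>F\<^esub> \<subseteq> submodule_AdE J E"
    unfolding submodule_AdE_def by (auto simp: QE.fibre_def)
qed

text \<open>Cosets are fibres of the retractions, and these are compatible with every operation, so
  all unions over representatives are single fibres; the isomorphism takes an element to the fibre
  over it.\<close>

lemma current_quotient:
  defines "f \<equiv> \<lambda>r. ideal_AdA J d +>\<^bsub>J\<^esub> \<iota> r" and "g \<equiv> \<lambda>u. submodule_AdE J E +>\<^bsub>E\<^esub> emb u"
  shows "lie_algebroid K (quot_A J d) (quot_E J E) (quot_bracket J E cbr) (quot_anchor J d anch)" (is ?A)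
    and "lie_algebroid_iso K R F bra th
       (quot_A J d) (quot_E J E) (quot_bracket J E cbr) (quot_anchor J d anch) f g" (is ?I)
proof -
  have cA: "ideal_AdA J d +>\<^bsub>J\<^esub> a = QA.fibre (ret a)" if "a \<in> carrier J" for a
    using that by (simp add: ideal_AdA_eq QA.coset_kernel)
  have cE: "submodule_AdE J E +>\<^bsub>E\<^esub> x = QE.fibre (eps x)" if "x \<in> carrier M0" for x
    using that by (simp add: submodule_AdE_eq QE.coset_kernel)
  have f [simp]: "f r = QA.fibre r" if "r \<in> carrier R" for r
    using that by (simp add: f_def cA)
  have g [simp]: "g u = QE.fibre u" if "u \<in> carrier F" for u
    using that by (simp add: g_def cE)
  have A: "carrier (quot_A J d) = QA.fibre ` carrier R" "\<zero>\<^bsub>quot_A J d\<^esub> = QA.fibre \<zero>\<^bsub>R\<^esub>"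
    "\<one>\<^bsub>quot_A J d\<^esub> = QA.fibre \<one>\<^bsub>R\<^esub>" "X \<oplus>\<^bsub>quot_A J d\<^esub> Y = X <+>\<^bsub>J\<^esub> Y"
    "X \<otimes>\<^bsub>quot_A J d\<^esub> Y = (\<Union>a\<in>X. \<Union>b\<in>Y. ideal_AdA J d +>\<^bsub>J\<^esub> (a \<otimes>\<^bsub>J\<^esub> b))"
    "c \<odot>\<^bsub>quot_A J d\<^esub> X = (\<Union>a\<in>X. ideal_AdA J d +>\<^bsub>J\<^esub> (c \<odot>\<^bsub>J\<^esub> a))" for X Y c
    by (simp_all add: quot_A_def Let_def FactRing_def rcoset_mult_def QA.rcosets_kernel[folded ideal_AdA_eq] cA ret_one)
      (simp add: ideal_AdA_eq)
  have E: "carrier (quot_E J E) = QE.fibre ` carrier F" "\<zero>\<^bsub>quot_E J E\<^esub> = QE.fibre \<zero>\<^bsub>F\<^esub>"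
    "U \<oplus>\<^bsub>quot_E J E\<^esub> V = U <+>\<^bsub>E\<^esub> V"
    "X \<odot>\<^bsub>quot_E J E\<^esub> U = (\<Union>a\<in>X. \<Union>u\<in>U. submodule_AdE J E +>\<^bsub>E\<^esub> (a \<odot>\<^bsub>M0\<^esub> u))" for X U V
    by (simp_all add: quot_E_def Let_def QE.rcosets_kernel[folded submodule_AdE_eq])
      (simp add: submodule_AdE_eq)
  have fA: "a \<in> QA.fibre r \<longleftrightarrow> a \<in> carrier J \<and> ret a = r" for a r by (simp add: QA.fibre_def)
  have fE: "x \<in> QE.fibre u \<longleftrightarrow> x \<in> carrier M0 \<and> eps x = u" for x u by (simp add: QE.fibre_def)
  have ret_smult: "ret (c \<odot>\<^bsub>J\<^esub> a) = c \<odot>\<^bsub>R\<^esub> ret a" if "c \<in> carrier K" "a \<in> carrier J" for c a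
  proof -
    have "ret (c \<odot>\<^bsub>J\<^esub> a) = ret (\<iota> (c \<odot>\<^bsub>R\<^esub> \<one>\<^bsub>R\<^esub>)) \<otimes>\<^bsub>R\<^esub> ret a"
      using that smult_eq_mult[of c a] by (simp add: \<iota>_smult \<iota>_one flip: ret_mult)
    then show ?thesis using that by (simp add: RR.smult_assoc2)
  qed
  have mult: "QA.fibre r \<otimes>\<^bsub>quot_A J d\<^esub> QA.fibre s = QA.fibre (r \<otimes>\<^bsub>R\<^esub> s)" if "r \<in> carrier R" "s \<in> carrier R" for r s
    unfolding A by (intro QA.UN_fibre that) (simp add: fA cA)
  have add: "QA.fibre r \<oplus>\<^bsub>quot_A J d\<^esub> QA.fibre s = QA.fibre (r \<oplus>\<^bsub>R\<^esub> s)" if "r \<in> carrier R" "s \<in> carrier R" for r s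
    using that by (simp add: A QA.fibre_add)
  have smultA: "c \<odot>\<^bsub>quot_A J d\<^esub> QA.fibre r = QA.fibre (c \<odot>\<^bsub>R\<^esub> r)" if "c \<in> carrier K" "r \<in> carrier R" for c r
    unfolding A by (intro QA.UN_fibre that) (use that in \<open>simp add: fA cA ret_smult\<close>)
  have addE: "QE.fibre u \<oplus>\<^bsub>quot_E J E\<^esub> QE.fibre v = QE.fibre (u \<oplus>\<^bsub>F\<^esub> v)" if "u \<in> carrier F" "v \<in> carrier F" for u v
    using that by (simp add: E QE.fibre_add)
  have smultE: "QA.fibre r \<odot>\<^bsub>quot_E J E\<^esub> QE.fibre u = QE.fibre (r \<odot>\<^bsub>F\<^esub> u)" if "r \<in> carrier R" "u \<in> carrier F" for r u
    unfolding E by (intro QA.UN_fibre QE.UN_fibre that) (simp add: fA fE cE)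
  have bracket: "quot_bracket J E cbr (QE.fibre u) (QE.fibre v) = QE.fibre (bra u v)" if "u \<in> carrier F" "v \<in> carrier F" for u v
    unfolding quot_bracket_def by (intro QE.UN_fibre that) (simp add: fE cE eps_cbr)
  have anchor: "quot_anchor J d anch (QE.fibre u) (QA.fibre r) = QA.fibre (th u r)" if "u \<in> carrier F" "r \<in> carrier R" for u r
    unfolding quot_anchor_def by (intro QA.UN_fibre QE.UN_fibre that) (simp add: fA fE cA ret_anch)
  show ?A
    by (rule lie_algebroid_image[OF LA, where f = QA.fibre and g = QE.fibre])
      (simp_all add: A(1-3) E(1,2) mult add smultA addE smultE bracket anchor)
  have fimg: "f ` carrier R = QA.fibre ` carrier R" and gimg: "g ` carrier F = QE.fibre ` carrier F" by simp_all
  have "inj_on f (carrier R)" "inj_on g (carrier F)"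
    using QA.inj_fibre QE.inj_fibre by (simp_all add: inj_on_def)
  then have "bij_betw f (carrier R) (carrier (quot_A J d))" "bij_betw g (carrier F) (carrier (quot_E J E))"
    by (simp_all add: bij_betw_def fimg gimg A(1) E(1))
  then show ?I
    unfolding lie_algebroid_iso_def
    by (simp add: algebra_hom_def ring_hom_def A(1,3) mult add smultA addE smultE bracket anchor)
qed

end

theorem proposition2p12:
  fixes K :: "'k ring"
    and R :: "('k, 'r) module"
    and F :: "('r, 'f) module"
    and bra :: "'f \<Rightarrow> 'f \<Rightarrow> 'f"
    and th :: "'f \<Rightarrow> 'r \<Rightarrow> 'r"
    and J :: "('k, 'j) module"
    and d :: "'j \<Rightarrow> 'j"
    and \<iota> :: "'r \<Rightarrow> 'j"
  assumes "field K" and "char_zero K"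
    and "algebra K R" and "finitely_generated_algebra K R"
    and "lie_algebroid K R F bra th"
    and "jet_algebra K R J d \<iota>"
  shows
    "(\<forall>D\<in>Der K R. \<exists>!\<phi>. extends_der K R J d \<iota> D \<phi>) \<and>
     (let E = current_module R F J d \<iota>; emb = current_emb R F J d \<iota> in
      \<exists>\<theta> br.
        is_current_anchor K R F th J d \<iota> \<theta> \<and>
        (\<forall>\<theta>'. is_current_anchor K R F th J d \<iota> \<theta>' \<longrightarrow>
           (\<forall>u\<in>carrier E. \<forall>a\<in>carrier J. \<theta>' u a = \<theta> u a)) \<and>
        is_current_bracket K R F bra J d \<iota> \<theta> br \<and>
        (\<forall>br'. is_current_bracket K R F bra J d \<iota> \<theta> br' \<longrightarrow>
           (\<forall>u\<in>carrier E. \<forall>v\<in>carrier E. br' u v = br u v)) \<and>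
        lie_conformal_algebroid K J d E br \<theta> \<and>
        lie_algebroid K (quot_A J d) (quot_E J E) (quot_bracket J E br) (quot_anchor J d \<theta>) \<and>
        lie_algebroid_iso K
          R F bra th
          (quot_A J d) (quot_E J E) (quot_bracket J E br) (quot_anchor J d \<theta>)
          (\<lambda>r. ideal_AdA J d +>\<^bsub>J\<^esub> \<iota> r) (\<lambda>u. submodule_AdE J E +>\<^bsub>E\<^esub> emb u))"
proof -
  interpret current K R J d \<iota> F bra th
    by (intro current.intro jet_setup.intro current_axioms.intro assms)
  show ?thesis
    unfolding Let_def current_emb_eq
    using extends_der_unique_exists current_anchor current_anchor_unique current_bracket current_bracket_unique
      current_lcad current_quotient by blast
qed

end
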